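(* Let $\mathcal{C}$ be an ordinary regular category and let $\mathcal{C}_{oex/reg}$ denote the exact completion of $\mathcal{C}$ as an ordinary regular category. Then there are equivalences of $\mathsf{Pos}$-categories $$\mathsf{Ord}(\mathcal{C}_{oex/reg})\simeq\mathsf{Ord}(\mathcal{C})_{ex/reg}\simeq\mathcal{C}_{ex/reg},$$ where in the last term $\mathcal{C}$ is regarded as a regular $\mathsf{Pos}$-category with discretely ordered hom-sets.
   Context: "Ordinary" means non-enriched. For an ordinary regular category $\mathcal{C}$, its ordinary exact completion $\mathcal{C}_{oex/reg}$ is the (Barr-)exact category equipped with a regular functor $\mathcal{C}\to\mathcal{C}_{oex/reg}$ through which every regular functor from $\mathcal{C}$ to an exact category factors, uniquely up to isomorphism, by a regular functor. For a finitely complete ordinary category $\mathcal{C}$, $\mathsf{Ord}(\mathcal{C})$ is the $\mathsf{Pos}$-category of internal posets: objects are pairs $(X,\leq_X)$ with $\leq_X\rightarrowtail X\times X$ an internal partial order in $\mathcal{C}$; morphisms $(X,\leq_X)\to(Y,\leq_Y)$ are morphisms $f\colon X\to Y$ of $\mathcal{C}$ such that the restriction of $f\times f$ to $\leq_X$ factors through $\leq_Y\rightarrowtail Y\times Y$; for parallel $f,f'\colon(X,\le_X)\to(Y,\le_Y)$, $f\leq f'$ iff $\langle f,f'\rangle\colon X\to Y\times Y$ factors through $\leq_Y$. If $\mathcal{C}$ is regular in the ordinary sense, then $\mathsf{Ord}(\mathcal{C})$ and $\mathcal{C}$ (with discrete hom-posets) are regular in the enriched sense below. For a regular $\mathsf{Pos}$-category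 $\mathcal{E}$, $\mathcal{E}_{ex/reg}$ denotes its $\mathsf{Pos}$-enriched exact completion, defined as follows. Categories are enriched over the cartesian closed category $\mathsf{Pos}$ of posets and monotone maps (hom-sets are posets, composition is monotone). Limits are weighted ($\mathsf{Pos}$-enriched); in particular the projections of products and pullbacks are jointly order-monomorphic, where a family $(p_i)$ with common domain is jointly order-monomorphic if $p_iu\le p_iv$ for all $i$ implies $u\le v$. A morphism $m\colon X\to Y$ is an $\mathsf{ff}$-morphism if $mf\le mg$ implies $f\le g$. A morphism $e\colon A\to B$ of $\mathcal{E}$ is an $\mathsf{so}$-morphism if for every $\mathsf{ff}$-morphism $m\colon X\to Y$ the canonical square from $\mathcal{E}(B,X)$ to $\mathcal{E}(A,X)$, $\mathcal{E}(B,Y)$ over $\mathcal{E}(A,Y)$ is a pullback in $\mathsf{Pos}$. A category is regular if it has all finite weighted limits, every morphism factors as an $\mathsf{so}$-morphism followed by an $\mathsf{ff}$-morphism, and $\mathsf{so}$-morphisms are stable under pullback. A relation $R\colon X\looparrowright Y$ in a regular $\mathsf{Pos}$-category is a subobject of $X\times Y$ represented by an $\mathsf{ff}$-morphism $\langle r_0,r_1\rangle\colon R\rightarrowtail X\times Y$; relations are ordered by inclusion. Write $(x,y)\in_A R$ if $\langle x,y\rangle\colon A\to X\times Y$ factors through $\langle r_0,r_1\rangle$. The composite $SR\colon X\looparrowright Z$ of $R\colon X\looparrowright Y$ and $S\colon Y\looparrowright Z$ is the $\mathsf{ff}$-part of the $(\mathsf{so},\mathsf{ff})$-factorization of $\langle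 r_0t_0,s_1t_1\rangle$, where $(T,t_0,t_1)$ is the pullback of $r_1$ and $s_0$. $R$ is weakening-closed if $x'\le x$, $(x,y)\in_A R$, $y\le y'$ imply $(x',y')\in_A R$. A congruence on $X$ is a weakening-closed relation $E\colon X\looparrowright X$ that is reflexive and transitive. $Q_w(\mathcal{E})$ is the locally posetal bicategory with objects the pairs $(X,E)$, $E$ a congruence on $X\in\mathcal{E}$; morphisms $(X,E)\to(Y,F)$ the relations $\Phi\colon X\looparrowright Y$ in $\mathcal{E}$ with $F\Phi E=\Phi$, ordered by inclusion; composition that of relations; identity on $(X,E)$ the relation $E$. $\mathcal{E}_{ex/reg}$ has the same objects; its morphisms $(X,E)\to(Y,F)$ are the morphisms $R_*$ of $Q_w(\mathcal{E})$ having a right adjoint, i.e. for which there is $R^*\colon(Y,F)\to(X,E)$ in $Q_w(\mathcal{E})$ with $R^*R_*\supseteq E$ and $R_*R^*\subseteq F$; the order is $R_*\le S_*:\iff R_*\supseteq S_*$. *)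

theory Defs
  imports "HOL-Library.Infinite_Typeclass"
begin

section \<open>Categories and \<open>Pos\<close>-categories\<close>

record ('o, 'm) cat =
  Ob :: "'o set"
  Ar :: "'m set"
  src :: "'m \<Rightarrow> 'o"
  tgt :: "'m \<Rightarrow> 'o"
  idt :: "'o \<Rightarrow> 'm"
  cmp :: "'m \<Rightarrow> 'm \<Rightarrow> 'm"  (infixr \<open>\<cdot>\<index>\<close> 70)

record ('o, 'm) pcat = "('o, 'm) cat" +
  leq :: "'m \<Rightarrow> 'm \<Rightarrow> bool"  (infix \<open>\<preceq>\<index>\<close> 50)

text \<open>Composition is in function order: \<open>g \<cdot> f\<close> is first \<open>f\<close>, then \<open>g\<close>.\<close>

definition hom :: "('o, 'm, 'z) cat_scheme \<Rightarrow> 'o \<Rightarrow> 'o \<Rightarrow> 'm set" where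
  "hom C X Y = {f \<in> Ar C. src C f = X \<and> tgt C f = Y}"

locale category =
  fixes C :: "('o, 'm, 'z) cat_scheme" (structure)
  assumes src_Ob: "f \<in> Ar C \<Longrightarrow> src C f \<in> Ob C"
    and tgt_Ob: "f \<in> Ar C \<Longrightarrow> tgt C f \<in> Ob C"
    and idt_hom: "X \<in> Ob C \<Longrightarrow> idt C X \<in> hom C X X"
    and cmp_hom: "f \<in> hom C X Y \<Longrightarrow> g \<in> hom C Y Z \<Longrightarrow> g \<cdot> f \<in> hom C X Z"
    and idt_left: "f \<in> hom C X Y \<Longrightarrow> idt C Y \<cdot> f = f"
    and idt_right: "f \<in> hom C X Y \<Longrightarrow> f \<cdot> idt C X = f"
    and assoc: "f \<in> hom C W X \<Longrightarrow> g \<in> hom C X Y \<Longrightarrow> h \<in> hom C Y Z \<Longrightarrow>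
      (h \<cdot> g) \<cdot> f = h \<cdot> (g \<cdot> f)"

locale pos_category = category E for E :: "('o, 'm, 'z) pcat_scheme" (structure) +
  assumes leq_parallel: "f \<preceq> g \<Longrightarrow> \<exists>X Y. f \<in> hom E X Y \<and> g \<in> hom E X Y"
    and leq_refl: "f \<in> Ar E \<Longrightarrow> f \<preceq> f"
    and leq_trans: "f \<preceq> g \<Longrightarrow> g \<preceq> h \<Longrightarrow> f \<preceq> h"
    and leq_antisym: "f \<preceq> g \<Longrightarrow> g \<preceq> f \<Longrightarrow> f = g"
    and cmp_mono: "f \<in> hom E X Y \<Longrightarrow> g \<in> hom E Y Z \<Longrightarrow> f \<preceq> f' \<Longrightarrow> g \<preceq> g' \<Longrightarrow>
      g \<cdot> f \<preceq> g' \<cdot> f'"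

definition disc :: "('o, 'm) cat \<Rightarrow> ('o, 'm) pcat" where
  "disc C = \<lparr>Ob = Ob C, Ar = Ar C, src = src C, tgt = tgt C, idt = idt C, cmp = cmp C,
     leq = (\<lambda>f g. f \<in> Ar C \<and> f = g)\<rparr>"

definition iso :: "('o, 'm, 'z) cat_scheme \<Rightarrow> 'm \<Rightarrow> bool" where
  "iso C f \<longleftrightarrow> f \<in> Ar C \<and> (\<exists>g \<in> hom C (tgt C f) (src C f).
     g \<cdot>\<^bsub>C\<^esub> f = idt C (src C f) \<and> f \<cdot>\<^bsub>C\<^esub> g = idt C (tgt C f))"


section \<open>Functors and equivalences\<close>

record ('o1, 'm1, 'o2, 'm2) ftor =
  fob :: "'o1 \<Rightarrow> 'o2"
  far :: "'m1 \<Rightarrow> 'm2"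

definition is_functor ::
  "('o1, 'm1, 'z1) cat_scheme \<Rightarrow> ('o2, 'm2, 'z2) cat_scheme \<Rightarrow> ('o1, 'm1, 'o2, 'm2) ftor \<Rightarrow> bool" where
  "is_functor A B F \<longleftrightarrow> category A \<and> category B \<and>
     (\<forall>X \<in> Ob A. fob F X \<in> Ob B) \<and>
     (\<forall>X Y. \<forall>f \<in> hom A X Y. far F f \<in> hom B (fob F X) (fob F Y)) \<and>
     (\<forall>X \<in> Ob A. far F (idt A X) = idt B (fob F X)) \<and>
     (\<forall>X Y Z. \<forall>f \<in> hom A X Y. \<forall>g \<in> hom A Y Z. far F (g \<cdot>\<^bsub>A\<^esub> f) = far F g \<cdot>\<^bsub>B\<^esub> far F f)"

definition id_ftor :: "('o, 'm, 'o, 'm) ftor" where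
  "id_ftor = \<lparr>fob = (\<lambda>X. X), far = (\<lambda>f. f)\<rparr>"

definition comp_ftor ::
  "('o2, 'm2, 'o3, 'm3) ftor \<Rightarrow> ('o1, 'm1, 'o2, 'm2) ftor \<Rightarrow> ('o1, 'm1, 'o3, 'm3) ftor" where
  "comp_ftor G F = \<lparr>fob = (\<lambda>X. fob G (fob F X)), far = (\<lambda>f. far G (far F f))\<rparr>"

definition nat_iso ::
  "('o1, 'm1, 'z1) cat_scheme \<Rightarrow> ('o2, 'm2, 'z2) cat_scheme \<Rightarrow>
     ('o1, 'm1, 'o2, 'm2) ftor \<Rightarrow> ('o1, 'm1, 'o2, 'm2) ftor \<Rightarrow> bool" where
  "nat_iso A B F G \<longleftrightarrow> (\<exists>\<eta>.
     (\<forall>X \<in> Ob A. \<eta> X \<in> hom B (fob F X) (fob G X) \<and> iso B (\<eta> X)) \<and>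
     (\<forall>X Y. \<forall>f \<in> hom A X Y. far G f \<cdot>\<^bsub>B\<^esub> \<eta> X = \<eta> Y \<cdot>\<^bsub>B\<^esub> far F f))"

definition pos_functor ::
  "('o1, 'm1) pcat \<Rightarrow> ('o2, 'm2) pcat \<Rightarrow> ('o1, 'm1, 'o2, 'm2) ftor \<Rightarrow> bool" where
  "pos_functor A B F \<longleftrightarrow> pos_category A \<and> pos_category B \<and> is_functor A B F \<and>
     (\<forall>f g. f \<preceq>\<^bsub>A\<^esub> g \<longrightarrow> far F f \<preceq>\<^bsub>B\<^esub> far F g)"

text \<open>Naturality in the \<open>Pos\<close>-enriched sense is ordinary naturality, since the underlying-set
  functor of \<open>Pos\<close> is faithful.\<close>

definition pos_equivalent :: "('o1, 'm1) pcat \<Rightarrow> ('o2, 'm2) pcat \<Rightarrow> bool" where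
  "pos_equivalent A B \<longleftrightarrow> (\<exists>F G. pos_functor A B F \<and> pos_functor B A G \<and>
     nat_iso A A (comp_ftor G F) id_ftor \<and> nat_iso B B (comp_ftor F G) id_ftor)"


section \<open>Limits and epimorphisms\<close>

definition is_terminal :: "('o, 'm, 'z) cat_scheme \<Rightarrow> 'o \<Rightarrow> bool" where
  "is_terminal C T \<longleftrightarrow> T \<in> Ob C \<and> (\<forall>X \<in> Ob C. \<exists>!f. f \<in> hom C X T)"

text \<open>In \<open>is_product C X Y p0 p1\<close> and \<open>is_pullback C f g p0 p1\<close> the limit object is the
  common source of the projections.\<close>

definition is_product :: "('o, 'm, 'z) cat_scheme \<Rightarrow> 'o \<Rightarrow> 'o \<Rightarrow> 'm \<Rightarrow> 'm \<Rightarrow> bool" where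
  "is_product C X Y p0 p1 \<longleftrightarrow> (\<exists>P. p0 \<in> hom C P X \<and> p1 \<in> hom C P Y \<and>
     (\<forall>A. \<forall>x \<in> hom C A X. \<forall>y \<in> hom C A Y.
        \<exists>!u. u \<in> hom C A P \<and> p0 \<cdot>\<^bsub>C\<^esub> u = x \<and> p1 \<cdot>\<^bsub>C\<^esub> u = y))"

definition is_equalizer :: "('o, 'm, 'z) cat_scheme \<Rightarrow> 'm \<Rightarrow> 'm \<Rightarrow> 'm \<Rightarrow> bool" where
  "is_equalizer C f g k \<longleftrightarrow> (\<exists>X Y K. f \<in> hom C X Y \<and> g \<in> hom C X Y \<and> k \<in> hom C K X \<and>
     f \<cdot>\<^bsub>C\<^esub> k = g \<cdot>\<^bsub>C\<^esub> k \<and>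
     (\<forall>A. \<forall>x \<in> hom C A X. f \<cdot>\<^bsub>C\<^esub> x = g \<cdot>\<^bsub>C\<^esub> x \<longrightarrow> (\<exists>!u. u \<in> hom C A K \<and> k \<cdot>\<^bsub>C\<^esub> u = x)))"

definition is_coequalizer :: "('o, 'm, 'z) cat_scheme \<Rightarrow> 'm \<Rightarrow> 'm \<Rightarrow> 'm \<Rightarrow> bool" where
  "is_coequalizer C f g e \<longleftrightarrow> (\<exists>X Y Q. f \<in> hom C X Y \<and> g \<in> hom C X Y \<and> e \<in> hom C Y Q \<and>
     e \<cdot>\<^bsub>C\<^esub> f = e \<cdot>\<^bsub>C\<^esub> g \<and>
     (\<forall>A. \<forall>x \<in> hom C Y A. x \<cdot>\<^bsub>C\<^esub> f = x \<cdot>\<^bsub>C\<^esub> g \<longrightarrow> (\<exists>!u. u \<in> hom C Q A \<and> u \<cdot>\<^bsub>C\<^esub> e = x)))"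

definition is_pullback :: "('o, 'm, 'z) cat_scheme \<Rightarrow> 'm \<Rightarrow> 'm \<Rightarrow> 'm \<Rightarrow> 'm \<Rightarrow> bool" where
  "is_pullback C f g p0 p1 \<longleftrightarrow> (\<exists>X Y Z P. f \<in> hom C X Z \<and> g \<in> hom C Y Z \<and>
     p0 \<in> hom C P X \<and> p1 \<in> hom C P Y \<and> f \<cdot>\<^bsub>C\<^esub> p0 = g \<cdot>\<^bsub>C\<^esub> p1 \<and>
     (\<forall>A. \<forall>x \<in> hom C A X. \<forall>y \<in> hom C A Y. f \<cdot>\<^bsub>C\<^esub> x = g \<cdot>\<^bsub>C\<^esub> y \<longrightarrow>
        (\<exists>!u. u \<in> hom C A P \<and> p0 \<cdot>\<^bsub>C\<^esub> u = x \<and> p1 \<cdot>\<^bsub>C\<^esub> u = y)))"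

definition regular_epi :: "('o, 'm, 'z) cat_scheme \<Rightarrow> 'm \<Rightarrow> bool" where
  "regular_epi C e \<longleftrightarrow> (\<exists>f g. is_coequalizer C f g e)"

text \<open>The \<open>Pos\<close>-enriched product and pullback: the projections are in addition jointly
  order-monomorphic.\<close>

definition jointly_order_mono :: "('o, 'm) pcat \<Rightarrow> 'm \<Rightarrow> 'm \<Rightarrow> bool" where
  "jointly_order_mono E p0 p1 \<longleftrightarrow> (\<exists>P. p0 \<in> Ar E \<and> p1 \<in> Ar E \<and> src E p0 = P \<and> src E p1 = P \<and>
     (\<forall>A. \<forall>u \<in> hom E A P. \<forall>v \<in> hom E A P.
        p0 \<cdot>\<^bsub>E\<^esub> u \<preceq>\<^bsub>E\<^esub> p0 \<cdot>\<^bsub>E\<^esub> v \<and> p1 \<cdot>\<^bsub>E\<^esub> u \<preceq>\<^bsub>E\<^esub> p1 \<cdot>\<^bsub>E\<^esub> v \<longrightarrow> u \<preceq>\<^bsub>E\<^esub> v))"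

definition pos_product :: "('o, 'm) pcat \<Rightarrow> 'o \<Rightarrow> 'o \<Rightarrow> 'm \<Rightarrow> 'm \<Rightarrow> bool" where
  "pos_product E X Y p0 p1 \<longleftrightarrow> is_product E X Y p0 p1 \<and> jointly_order_mono E p0 p1"

definition pos_pullback :: "('o, 'm) pcat \<Rightarrow> 'm \<Rightarrow> 'm \<Rightarrow> 'm \<Rightarrow> 'm \<Rightarrow> bool" where
  "pos_pullback E f g p0 p1 \<longleftrightarrow> is_pullback E f g p0 p1 \<and> jointly_order_mono E p0 p1"

definition ff_mor :: "('o, 'm) pcat \<Rightarrow> 'm \<Rightarrow> bool" where
  "ff_mor E m \<longleftrightarrow> m \<in> Ar E \<and>
     (\<forall>A. \<forall>f \<in> hom E A (src E m). \<forall>g \<in> hom E A (src E m).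
        m \<cdot>\<^bsub>E\<^esub> f \<preceq>\<^bsub>E\<^esub> m \<cdot>\<^bsub>E\<^esub> g \<longrightarrow> f \<preceq>\<^bsub>E\<^esub> g)"

text \<open>That the square of hom-posets is a pullback in \<open>Pos\<close> means: \<open>w \<mapsto> (w \<cdot> e, m \<cdot> w)\<close> is a
  bijection onto the fibre product (first conjunct) which also reflects the order (second).\<close>

definition so_mor :: "('o, 'm) pcat \<Rightarrow> 'm \<Rightarrow> bool" where
  "so_mor E e \<longleftrightarrow> e \<in> Ar E \<and> (\<forall>m. ff_mor E m \<longrightarrow>
     (let A = src E e; B = tgt E e; X = src E m; Y = tgt E m in
       (\<forall>u \<in> hom E A X. \<forall>v \<in> hom E B Y. m \<cdot>\<^bsub>E\<^esub> u = v \<cdot>\<^bsub>E\<^esub> e \<longrightarrow>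
          (\<exists>!w. w \<in> hom E B X \<and> w \<cdot>\<^bsub>E\<^esub> e = u \<and> m \<cdot>\<^bsub>E\<^esub> w = v)) \<and>
       (\<forall>w \<in> hom E B X. \<forall>w' \<in> hom E B X.
          w \<cdot>\<^bsub>E\<^esub> e \<preceq>\<^bsub>E\<^esub> w' \<cdot>\<^bsub>E\<^esub> e \<and> m \<cdot>\<^bsub>E\<^esub> w \<preceq>\<^bsub>E\<^esub> m \<cdot>\<^bsub>E\<^esub> w' \<longrightarrow> w \<preceq>\<^bsub>E\<^esub> w')))"


section \<open>Relations\<close>

text \<open>\<open>rel_span E X Y r0 r1\<close>: the arrow \<open>\<langle>r0, r1\<rangle>\<close> into \<open>X \<times> Y\<close> is an \<open>ff\<close>-morphism. A relation is
  a subobject of \<open>X \<times> Y\<close>, that is, the isomorphism class of such a span; it is encoded as the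
  set of all spans representing it.\<close>

definition rel_span :: "('o, 'm) pcat \<Rightarrow> 'o \<Rightarrow> 'o \<Rightarrow> 'm \<Rightarrow> 'm \<Rightarrow> bool" where
  "rel_span E X Y r0 r1 \<longleftrightarrow> (\<exists>p0 p1 m. pos_product E X Y p0 p1 \<and>
     ff_mor E m \<and> tgt E m = src E p0 \<and> r0 = p0 \<cdot>\<^bsub>E\<^esub> m \<and> r1 = p1 \<cdot>\<^bsub>E\<^esub> m)"

type_synonym 'm rel = "('m \<times> 'm) set"

definition rels :: "('o, 'm) pcat \<Rightarrow> 'o \<Rightarrow> 'o \<Rightarrow> 'm rel set" where
  "rels E X Y = {{(r0 \<cdot>\<^bsub>E\<^esub> i, r1 \<cdot>\<^bsub>E\<^esub> i) |i. iso E i \<and> tgt E i = src E r0} |r0 r1.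
     rel_span E X Y r0 r1}"

text \<open>\<open>rel_mem E R x y\<close> is \<open>(x, y) \<in>\<^sub>A R\<close>, where \<open>A\<close> is the common source of \<open>x\<close> and \<open>y\<close>.\<close>

definition rel_mem :: "('o, 'm, 'z) cat_scheme \<Rightarrow> 'm rel \<Rightarrow> 'm \<Rightarrow> 'm \<Rightarrow> bool" where
  "rel_mem E R x y \<longleftrightarrow> (\<exists>(r0, r1) \<in> R. \<exists>h \<in> Ar E. tgt E h = src E r0 \<and>
     x = r0 \<cdot>\<^bsub>E\<^esub> h \<and> y = r1 \<cdot>\<^bsub>E\<^esub> h)"

definition rel_incl :: "('o, 'm, 'z) cat_scheme \<Rightarrow> 'm rel \<Rightarrow> 'm rel \<Rightarrow> bool" where
  "rel_incl E R S \<longleftrightarrow> (\<forall>(r0, r1) \<in> R. rel_mem E S r0 r1)"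

text \<open>\<open>rel_comp E S R\<close> is \<open>SR\<close>. It collects the spans \<open>(q0, q1)\<close> for which \<open>\<langle>q0, q1\<rangle>\<close> is the
  \<open>ff\<close>-part of an \<open>(so, ff)\<close>-factorization of \<open>\<langle>r0 \<cdot> t0, s1 \<cdot> t1\<rangle>\<close>; such factorizations are unique
  up to isomorphism, so that this is again a single isomorphism class.\<close>

definition rel_comp :: "('o, 'm) pcat \<Rightarrow> 'm rel \<Rightarrow> 'm rel \<Rightarrow> 'm rel" where
  "rel_comp E S R = {(q0, q1). \<exists>(r0, r1) \<in> R. \<exists>(s0, s1) \<in> S. \<exists>t0 t1 e.
     pos_pullback E r1 s0 t0 t1 \<and> rel_span E (tgt E r0) (tgt E s1) q0 q1 \<and>
     so_mor E e \<and> tgt E e = src E q0 \<and>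
     r0 \<cdot>\<^bsub>E\<^esub> t0 = q0 \<cdot>\<^bsub>E\<^esub> e \<and> s1 \<cdot>\<^bsub>E\<^esub> t1 = q1 \<cdot>\<^bsub>E\<^esub> e}"

definition rel_refl :: "('o, 'm, 'z) cat_scheme \<Rightarrow> 'o \<Rightarrow> 'm rel \<Rightarrow> bool" where
  "rel_refl E X R \<longleftrightarrow> (\<forall>A. \<forall>x \<in> hom E A X. rel_mem E R x x)"

definition rel_trans :: "('o, 'm, 'z) cat_scheme \<Rightarrow> 'm rel \<Rightarrow> bool" where
  "rel_trans E R \<longleftrightarrow> (\<forall>x y z. rel_mem E R x y \<and> rel_mem E R y z \<longrightarrow> rel_mem E R x z)"

definition rel_sym :: "('o, 'm, 'z) cat_scheme \<Rightarrow> 'm rel \<Rightarrow> bool" where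
  "rel_sym E R \<longleftrightarrow> (\<forall>x y. rel_mem E R x y \<longrightarrow> rel_mem E R y x)"

definition rel_antisym :: "('o, 'm, 'z) cat_scheme \<Rightarrow> 'm rel \<Rightarrow> bool" where
  "rel_antisym E R \<longleftrightarrow> (\<forall>x y. rel_mem E R x y \<and> rel_mem E R y x \<longrightarrow> x = y)"

definition weakening_closed :: "('o, 'm) pcat \<Rightarrow> 'm rel \<Rightarrow> bool" where
  "weakening_closed E R \<longleftrightarrow> (\<forall>x' x y y'. x' \<preceq>\<^bsub>E\<^esub> x \<and> rel_mem E R x y \<and> y \<preceq>\<^bsub>E\<^esub> y' \<longrightarrow>
     rel_mem E R x' y')"


section \<open>Ordinary regular and exact categories\<close>

definition finitely_complete :: "('o, 'm, 'z) cat_scheme \<Rightarrow> bool" where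
  "finitely_complete C \<longleftrightarrow> (\<exists>T. is_terminal C T) \<and>
     (\<forall>X \<in> Ob C. \<forall>Y \<in> Ob C. \<exists>p0 p1. is_product C X Y p0 p1) \<and>
     (\<forall>X Y. \<forall>f \<in> hom C X Y. \<forall>g \<in> hom C X Y. \<exists>k. is_equalizer C f g k)"

definition regular_category :: "('o, 'm) cat \<Rightarrow> bool" where
  "regular_category C \<longleftrightarrow> category C \<and> finitely_complete C \<and>
     (\<forall>f p0 p1. is_pullback C f f p0 p1 \<longrightarrow> (\<exists>e. is_coequalizer C p0 p1 e)) \<and>
     (\<forall>e g p0 p1. regular_epi C e \<and> is_pullback C e g p0 p1 \<longrightarrow> regular_epi C p1)"

text \<open>In \<open>disc C\<close> the \<open>ff\<close>-morphisms are the monomorphisms of \<open>C\<close>, and \<open>Pos\<close>-products are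
  ordinary products; thus \<open>rels (disc C) X Y\<close> consists of the ordinary subobjects of \<open>X \<times> Y\<close>.\<close>

definition equivalence_rel :: "('o, 'm) cat \<Rightarrow> 'o \<Rightarrow> 'm rel \<Rightarrow> bool" where
  "equivalence_rel C X R \<longleftrightarrow> R \<in> rels (disc C) X X \<and> rel_refl C X R \<and> rel_sym C R \<and> rel_trans C R"

definition exact_category :: "('o, 'm) cat \<Rightarrow> bool" where
  "exact_category C \<longleftrightarrow> regular_category C \<and>
     (\<forall>X \<in> Ob C. \<forall>R. equivalence_rel C X R \<longrightarrow>
        (\<exists>f. \<exists>(r0, r1) \<in> R. is_pullback C f f r0 r1))"

definition regular_functor ::
  "('o1, 'm1) cat \<Rightarrow> ('o2, 'm2) cat \<Rightarrow> ('o1, 'm1, 'o2, 'm2) ftor \<Rightarrow> bool" where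
  "regular_functor A B F \<longleftrightarrow> is_functor A B F \<and>
     (\<forall>T. is_terminal A T \<longrightarrow> is_terminal B (fob F T)) \<and>
     (\<forall>X Y p0 p1. is_product A X Y p0 p1 \<longrightarrow>
        is_product B (fob F X) (fob F Y) (far F p0) (far F p1)) \<and>
     (\<forall>f g k. is_equalizer A f g k \<longrightarrow> is_equalizer B (far F f) (far F g) (far F k)) \<and>
     (\<forall>e. regular_epi A e \<longrightarrow> regular_epi B (far F e))"

text \<open>The universal property quantifies over all small exact categories. The infinite type \<open>'u\<close>
  serves as the universe: \<open>C\<close>, its completion \<open>D\<close> and the categories against which \<open>D\<close> is tested
  have their objects and arrows in \<open>'u\<close>. Infinity of \<open>'u\<close> gives \<open>'u \<times> 'u \<cong> 'u\<close>, so an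
  exact completion of \<open>C\<close> exists in the same universe; with finite types the test categories
  could be too few to determine \<open>D\<close>.\<close>

definition exact_completion ::
  "('u :: infinite, 'u) cat \<Rightarrow> ('u, 'u) cat \<Rightarrow> ('u, 'u, 'u, 'u) ftor \<Rightarrow> bool" where
  "exact_completion C D I \<longleftrightarrow> exact_category D \<and> regular_functor C D I \<and>
     (\<forall>(E :: ('u, 'u) cat) F. exact_category E \<and> regular_functor C E F \<longrightarrow>
        (\<exists>G. regular_functor D E G \<and> nat_iso C E (comp_ftor G I) F) \<and>
        (\<forall>G G'. regular_functor D E G \<and> nat_iso C E (comp_ftor G I) F \<and>
           regular_functor D E G' \<and> nat_iso C E (comp_ftor G' I) F \<longrightarrow> nat_iso D E G G'))"


section \<open>Internal posets\<close>

definition internal_poset :: "('o, 'm) cat \<Rightarrow> 'o \<times> 'm rel \<Rightarrow> bool" where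
  "internal_poset C = (\<lambda>(X, R). X \<in> Ob C \<and> R \<in> rels (disc C) X X \<and>
     rel_refl C X R \<and> rel_trans C R \<and> rel_antisym C R)"

text \<open>Arrows of the categories below carry their source and target. For monotonicity,
  \<open>(f \<cdot> r0, f \<cdot> r1)\<close> is the restriction of \<open>f \<times> f\<close> to the relation represented by \<open>(r0, r1)\<close>.\<close>

definition Ord_arrows :: "('o, 'm) cat \<Rightarrow> (('o \<times> 'm rel) \<times> ('o \<times> 'm rel) \<times> 'm) set" where
  "Ord_arrows C = {((X, R), (Y, S), f) |X R Y S f.
     internal_poset C (X, R) \<and> internal_poset C (Y, S) \<and> f \<in> hom C X Y \<and>
     (\<forall>(r0, r1) \<in> R. rel_mem C S (f \<cdot>\<^bsub>C\<^esub> r0) (f \<cdot>\<^bsub>C\<^esub> r1))}"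

definition Ord :: "('o, 'm) cat \<Rightarrow>
    ('o \<times> 'm rel, ('o \<times> 'm rel) \<times> ('o \<times> 'm rel) \<times> 'm) pcat" where
  "Ord C = \<lparr>
     Ob = {XR. internal_poset C XR},
     Ar = Ord_arrows C,
     src = (\<lambda>(XR, YS, f). XR),
     tgt = (\<lambda>(XR, YS, f). YS),
     idt = (\<lambda>XR. (XR, XR, idt C (fst XR))),
     cmp = (\<lambda>(YS', ZT, g) (XR, YS, f). (XR, ZT, g \<cdot>\<^bsub>C\<^esub> f)),
     leq = (\<lambda>(XR, YS, f) (XR', YS', f').
       (XR, YS, f) \<in> Ord_arrows C \<and> (XR', YS', f') \<in> Ord_arrows C \<and>
       XR = XR' \<and> YS = YS' \<and> rel_mem C (snd YS) f f')\<rparr>"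


section \<open>The enriched exact completion\<close>

definition congruence :: "('o, 'm) pcat \<Rightarrow> 'o \<times> 'm rel \<Rightarrow> bool" where
  "congruence E = (\<lambda>(X, R). X \<in> Ob E \<and> R \<in> rels E X X \<and>
     weakening_closed E R \<and> rel_refl E X R \<and> rel_trans E R)"

definition Qw_arrows :: "('o, 'm) pcat \<Rightarrow> (('o \<times> 'm rel) \<times> ('o \<times> 'm rel) \<times> 'm rel) set" where
  "Qw_arrows E = {((X, R), (Y, S), \<Phi>) |X R Y S \<Phi>.
     congruence E (X, R) \<and> congruence E (Y, S) \<and> \<Phi> \<in> rels E X Y \<and>
     rel_comp E S (rel_comp E \<Phi> R) = \<Phi>}"

definition Qw :: "('o, 'm) pcat \<Rightarrow>
    ('o \<times> 'm rel, ('o \<times> 'm rel) \<times> ('o \<times> 'm rel) \<times> 'm rel) pcat" where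
  "Qw E = \<lparr>
     Ob = {XR. congruence E XR},
     Ar = Qw_arrows E,
     src = (\<lambda>(XR, YS, \<Phi>). XR),
     tgt = (\<lambda>(XR, YS, \<Phi>). YS),
     idt = (\<lambda>XR. (XR, XR, snd XR)),
     cmp = (\<lambda>(YS', ZT, \<Psi>) (XR, YS, \<Phi>). (XR, ZT, rel_comp E \<Psi> \<Phi>)),
     leq = (\<lambda>(XR, YS, \<Phi>) (XR', YS', \<Phi>').
       (XR, YS, \<Phi>) \<in> Qw_arrows E \<and> (XR', YS', \<Phi>') \<in> Qw_arrows E \<and>
       XR = XR' \<and> YS = YS' \<and> rel_incl E \<Phi> \<Phi>')\<rparr>"

definition has_right_adjoint :: "('o, 'm) pcat \<Rightarrow> 'm \<Rightarrow> bool" where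
  "has_right_adjoint Q f \<longleftrightarrow> f \<in> Ar Q \<and> (\<exists>g \<in> hom Q (tgt Q f) (src Q f).
     idt Q (src Q f) \<preceq>\<^bsub>Q\<^esub> g \<cdot>\<^bsub>Q\<^esub> f \<and> f \<cdot>\<^bsub>Q\<^esub> g \<preceq>\<^bsub>Q\<^esub> idt Q (tgt Q f))"

text \<open>\<open>ex_reg E\<close> has its intended meaning for regular \<open>E\<close>. Note the reversal of the order.\<close>

definition ex_reg :: "('o, 'm) pcat \<Rightarrow>
    ('o \<times> 'm rel, ('o \<times> 'm rel) \<times> ('o \<times> 'm rel) \<times> 'm rel) pcat" where
  "ex_reg E = (Qw E)\<lparr>
     Ar := {f. has_right_adjoint (Qw E) f},
     leq := (\<lambda>f g. has_right_adjoint (Qw E) f \<and> has_right_adjoint (Qw E) g \<and> g \<preceq>\<^bsub>Qw E\<^esub> f)\<rparr>"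

end

theory Submission
  imports Defs
begin

text \<open>
  \<open>C_{oex/reg}\<close> is realised by the category \<open>K\<close> of equivalence relations in \<open>C\<close> and functional
  relations between them. A regular functor from \<open>C\<close> to an exact category extends along \<open>J: C \<rightarrow> K\<close>,
  because entailments between relations that hold in \<open>C\<close> are preserved by regular functors. By the
  universal property any other completion \<open>I: C \<rightarrow> D\<close> is then, like \<open>J\<close>, full and faithful, reflects
  regular epimorphisms, and every object of \<open>D\<close> is covered by an object of \<open>C\<close>. Pulling the order of
  an internal poset of \<open>D\<close> back along such a cover gives a congruence (an internal preorder) in \<open>C\<close>,
  and every congruence arises in this way since \<open>D\<close> is exact; monotone maps correspond to left adjoint
  modules between the congruences. This is the equivalence of \<open>Ord D\<close> with \<open>ex_reg (disc C)\<close>.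
  For \<open>ex_reg (Ord C)\<close>, a weakening-closed relation between internal posets is determined by its
  underlying relation in \<open>C\<close>, so passing to underlying relations is an equivalence onto \<open>ex_reg (disc C)\<close>.
\<close>

text \<open>Arguments run on generalised elements: an arrow with source \<open>A\<close> is an
  element at stage \<open>A\<close>. Two facts make this as good as working in sets. A relation is
  an isomorphism class of spans, so relations with the same elements are equal
  (\<open>rels_eqI\<close>); and membership may be checked after a cover of the stage
  (\<open>mem_local\<close>), so existential statements, which hold only after a cover, can still be
  eliminated. The obstacle is that the completion is known only through a universal property, from
  which nothing about its objects or arrows can be read off. The hand-made \<open>K\<close> supplies
  this information. The universal property yields \<open>G\<close> from \<open>D\<close> to
  \<open>K\<close>; the extension \<open>H\<close> leads back, and uniqueness gives an isomorphism
  of \<open>H G\<close> with the identity. To know that \<open>H\<close> is regular, limits in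
  \<open>K\<close> are first restated as entailments between relations of \<open>C\<close>, the only
  data that a regular functor visibly preserves. Congruences in \<open>C\<close> are the common
  middle term: those on internal posets reduce to them because elements of \<open>C\<close> are
  exactly the arrows out of discrete posets.\<close>

no_notation (ASCII) comp (infixl \<open>o\<close> 55)
notation cmp (\<open>_ o\<index> _\<close> [71, 70] 70)

section \<open>Categories\<close>

lemma hom_iff: "f : hom C X Y \<longleftrightarrow> f : Ar C & src C f = X & tgt C f = Y"
 by (auto simp: hom_def)

context category begin

lemma Ar_cmp [simp]: "f : Ar C ==> g : Ar C ==> tgt C f = src C g ==> g o f : Ar C"
 and src_cmp [simp]: "f : Ar C ==> g : Ar C ==> tgt C f = src C g ==> src C (g o f) = src C f"
 and tgt_cmp [simp]: "f : Ar C ==> g : Ar C ==> tgt C f = src C g ==> tgt C (g o f) = tgt C g"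
 using cmp_hom[of f "src C f" "src C g" g "tgt C g"] by (auto simp: hom_iff)

lemma cmp_assoc [simp]: "f : Ar C ==> g : Ar C ==> h : Ar C ==> tgt C f = src C g ==>
  tgt C g = src C h ==> (h o g) o f = h o (g o f)"
 using assoc[of f "src C f" "src C g" g "src C h" h "tgt C h"] by (auto simp: hom_iff)

lemma idt_Ar [simp]: "X : Ob C ==> idt C X : Ar C"
 and src_idt [simp]: "X : Ob C ==> src C (idt C X) = X"
 and tgt_idt [simp]: "X : Ob C ==> tgt C (idt C X) = X"
 using idt_hom by (auto simp: hom_iff)

lemma idt_cmp [simp]: "f : Ar C ==> tgt C f = Y ==> idt C Y o f = f"
 and cmp_idt [simp]: "f : Ar C ==> src C f = X ==> f o idt C X = f"
 using idt_left[of f] idt_right[of f] by (auto simp: hom_iff)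

lemma src_in_Ob [simp]: "f : Ar C ==> src C f : Ob C"
 and tgt_in_Ob [simp]: "f : Ar C ==> tgt C f : Ob C"
 by (rule src_Ob, simp) (rule tgt_Ob, simp)

lemma hom_Ob: "f : hom C X Y ==> X : Ob C & Y : Ob C"
 by (auto simp: hom_iff)

lemma cmp_reassoc: "g o f = k o h ==> f : Ar C ==> g : Ar C ==> k : Ar C ==> h : Ar C ==> x : Ar C ==>
  tgt C f = src C g ==> tgt C h = src C k ==> tgt C x = src C f ==> src C h = src C f ==>
  g o (f o x) = k o (h o x)"
 by (metis cmp_assoc)

lemma isoI: "f : hom C X Y ==> g : hom C Y X ==> g o f = idt C X ==> f o g = idt C Y ==> iso C f"
 by (auto simp: iso_def hom_iff)

lemma isoE:
 assumes "iso C f" "f : hom C X Y"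
 obtains g where "g : hom C Y X" "g o f = idt C X" "f o g = idt C Y" "iso C g"
proof -
 obtain g where g: "g : hom C Y X" "g o f = idt C X" "f o g = idt C Y"
  using assms by (auto simp: iso_def hom_iff)
 from that[OF g isoI[OF g(1) assms(2) g(3,2)]] show thesis .
qed

lemma iso_Ar: "iso C f ==> f : Ar C"
 by (simp add: iso_def)

lemma iso_idt: "X : Ob C ==> iso C (idt C X)"
 by (rule isoI[of _ X X "idt C X"]) (auto simp: hom_iff)

lemma iso_cmp:
 assumes "iso C f" "iso C g" "f : hom C X Y" "g : hom C Y Z"
 shows "iso C (g o f)"
proof -
 obtain f' where f': "f' : hom C Y X" "f' o f = idt C X" "f o f' = idt C Y"
  using isoE[OF assms(1,3)] by metis
 obtain g' where g': "g' : hom C Z Y" "g' o g = idt C Y" "g o g' = idt C Z"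
  using isoE[OF assms(2,4)] by metis
 have "(f' o g') o (g o f) = f' o ((g' o g) o f)" "(g o f) o (f' o g') = g o ((f o f') o g')"
  using assms(3,4) f'(1) g'(1) by (simp_all add: hom_iff)
 then show ?thesis
  using assms(3,4) f' g' by (intro isoI[of _ X Z "f' o g'"]) (simp_all add: hom_iff)
qed

end

section \<open>Monomorphisms; universal properties as existence plus cancellation\<close>

definition mono_ar :: "('o, 'm, 'z) cat_scheme => 'm => bool" where
 "mono_ar C m \<longleftrightarrow> m : Ar C & (ALL A. ALL u:hom C A (src C m). ALL v:hom C A (src C m).
   m o\<^bsub>C\<^esub> u = m o\<^bsub>C\<^esub> v --> u = v)"

text \<open>Every \<open>u\<close> in \<open>S\<close> lies over an admissible target, so uniqueness
  of lifts, taken over all targets together, is injectivity of \<open>F\<close> on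
  \<open>S\<close>.\<close>

lemma ex1_split:
 assumes "ALL u:S. F u : T & P (F u)"
 shows "(ALL x:T. P x --> (EX! u. u : S & F u = x)) \<longleftrightarrow>
  (ALL x:T. P x --> (EX u:S. F u = x)) & (ALL u:S. ALL v:S. F u = F v --> u = v)" (is "?l \<longleftrightarrow> ?r")
proof
 assume l: ?l
 have "u = v" if "u : S" "v : S" "F u = F v" for u v
  using ex1E[OF l[rule_format, of "F v"]] assms that by metis
 then show ?r using l by blast
next
 assume r: ?r
 show ?l
 proof (intro ballI impI)
  fix x assume "x : T" "P x"
  then obtain u where u: "u : S" "F u = x" using r by blast
  show "EX! u. u : S & F u = x" by (rule ex1I[of _ u]) (use u r in blast)+
 qed
qed

context category begin

text \<open>\<open>Q\<close> is the cone condition: trivial for products, commutativity of the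
  square for pullbacks.\<close>

lemma ex1_pair:
 assumes "p0 : hom C P X" "p1 : hom C P Y" "!!A u. u : hom C A P ==> Q (p0 o u) (p1 o u)"
 shows "(ALL A. ALL x:hom C A X. ALL y:hom C A Y. Q x y --> (EX! u. u : hom C A P & p0 o u = x & p1 o u = y)) \<longleftrightarrow>
  (ALL A. ALL x:hom C A X. ALL y:hom C A Y. Q x y --> (EX u:hom C A P. p0 o u = x & p1 o u = y)) &
  (ALL A. ALL u:hom C A P. ALL v:hom C A P. p0 o u = p0 o v --> p1 o u = p1 o v --> u = v)"
proof -
 have "(ALL x:hom C A X. ALL y:hom C A Y. Q x y --> (EX! u. u : hom C A P & p0 o u = x & p1 o u = y)) \<longleftrightarrow>
  (ALL x:hom C A X. ALL y:hom C A Y. Q x y --> (EX u:hom C A P. p0 o u = x & p1 o u = y)) &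
  (ALL u:hom C A P. ALL v:hom C A P. p0 o u = p0 o v --> p1 o u = p1 o v --> u = v)" for A
  using ex1_split[of "hom C A P" "%u. (p0 o u, p1 o u)" "hom C A X \<times> hom C A Y" "case_prod Q"]
   assms(3) cmp_hom[OF _ assms(1)] cmp_hom[OF _ assms(2)] by (simp add: imp_conjL)
 then show ?thesis by blast
qed

lemma is_product_iff: "is_product C X Y p0 p1 \<longleftrightarrow> (EX P. p0 : hom C P X & p1 : hom C P Y &
  (ALL A. ALL x:hom C A X. ALL y:hom C A Y. EX u:hom C A P. p0 o u = x & p1 o u = y) &
  (ALL A. ALL u:hom C A P. ALL v:hom C A P. p0 o u = p0 o v --> p1 o u = p1 o v --> u = v))"
 unfolding is_product_def using ex1_pair[where Q = "%_ _. True"]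
 by (intro ex_cong1 conj_cong refl) simp

lemma cone_stable: "f : hom C X Z ==> g : hom C Y Z ==> p0 : hom C P X ==> p1 : hom C P Y ==> f o p0 = g o p1 ==>
  u : hom C A P ==> f o (p0 o u) = g o (p1 o u)"
 using assoc[of u A P p0 X f Z] assoc[of u A P p1 Y g Z] by simp

lemma is_pullback_iff: "is_pullback C f g p0 p1 \<longleftrightarrow> (EX X Y Z P. f : hom C X Z & g : hom C Y Z &
  p0 : hom C P X & p1 : hom C P Y & f o p0 = g o p1 &
  (ALL A. ALL x:hom C A X. ALL y:hom C A Y. f o x = g o y --> (EX u:hom C A P. p0 o u = x & p1 o u = y)) &
  (ALL A. ALL u:hom C A P. ALL v:hom C A P. p0 o u = p0 o v --> p1 o u = p1 o v --> u = v))"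
 unfolding is_pullback_def
 by (intro ex_cong1 conj_cong refl ex1_pair) (assumption | rule cone_stable)+

lemma is_equalizer_iff: "is_equalizer C f g k \<longleftrightarrow> (EX X Y K. f : hom C X Y & g : hom C X Y & k : hom C K X &
  f o k = g o k & (ALL A. ALL x:hom C A X. f o x = g o x --> (EX u:hom C A K. k o u = x)) &
  (ALL A. ALL u:hom C A K. ALL v:hom C A K. k o u = k o v --> u = v))"
proof -
 have "(ALL x:hom C A X. f o x = g o x --> (EX! u. u : hom C A K & k o u = x)) \<longleftrightarrow>
  (ALL x:hom C A X. f o x = g o x --> (EX u:hom C A K. k o u = x)) &
  (ALL u:hom C A K. ALL v:hom C A K. k o u = k o v --> u = v)"
  if "f : hom C X Y" "g : hom C X Y" "k : hom C K X" "f o k = g o k" for A X Y K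
  by (rule ex1_split) (use cmp_hom[OF _ that(3)] assoc[OF _ that(3,1)] assoc[OF _ that(3,2)] that(4) in auto)
 then show ?thesis unfolding is_equalizer_def
  by (intro ex_cong1 conj_cong refl) (simp add: all_conj_distrib)
qed

lemma is_coequalizer_iff: "is_coequalizer C f g e \<longleftrightarrow> (EX X Y Q. f : hom C X Y & g : hom C X Y & e : hom C Y Q &
  e o f = e o g & (ALL A. ALL x:hom C Y A. x o f = x o g --> (EX u:hom C Q A. u o e = x)) &
  (ALL A. ALL u:hom C Q A. ALL v:hom C Q A. u o e = v o e --> u = v))"
proof -
 have "(ALL x:hom C Y A. x o f = x o g --> (EX! u. u : hom C Q A & u o e = x)) \<longleftrightarrow>
  (ALL x:hom C Y A. x o f = x o g --> (EX u:hom C Q A. u o e = x)) &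
  (ALL u:hom C Q A. ALL v:hom C Q A. u o e = v o e --> u = v)"
  if "f : hom C X Y" "g : hom C X Y" "e : hom C Y Q" "e o f = e o g" for A X Y Q
  by (rule ex1_split) (use cmp_hom[OF that(3)] assoc[OF that(1,3)] assoc[OF that(2,3)] that(4) in auto)
 then show ?thesis unfolding is_coequalizer_def
  by (intro ex_cong1 conj_cong refl) (simp add: all_conj_distrib)
qed

end

section \<open>Regular epimorphisms in an arbitrary category\<close>

lemma (in category) regular_epi_Ar: "regular_epi C e ==> e : Ar C"
 by (auto simp: regular_epi_def is_coequalizer_def hom_iff)

lemma (in category) regular_epi_cancel:
 assumes "regular_epi C e" "e : hom C X Y" "u : hom C Y A" "v : hom C Y A" "u o e = v o e"
 shows "u = v"
 using assms unfolding regular_epi_def is_coequalizer_iff by (auto simp: hom_iff)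

text \<open>The hypothesis covers all pairs identified by \<open>e\<close>, in particular the
  unknown pair of which \<open>e\<close> is a coequalizer.\<close>

lemma (in category) regular_epi_desc:
 assumes "regular_epi C e" "e : hom C X Y" "x : hom C X A"
  and "!!B u v. u : hom C B X ==> v : hom C B X ==> e o u = e o v ==> x o u = x o v"
 obtains w where "w : hom C Y A" "w o e = x"
proof -
 obtain f g B Y' Q where *: "f : hom C B Y'" "g : hom C B Y'" "e : hom C Y' Q" "e o f = e o g"
  "ALL A. ALL x:hom C Y' A. x o f = x o g --> (EX u:hom C Q A. u o e = x)"
  using assms(1) unfolding regular_epi_def is_coequalizer_iff by blast
 then have "Y' = X" "Q = Y" using assms(2) by (auto simp: hom_iff)
 then show thesis using * assms(3) assms(4)[of f B g] that by blast
qed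

text \<open>An isomorphism is a coequalizer of the identity of its source with itself.\<close>

lemma (in category) regular_epi_iso:
 assumes "iso C i" shows "regular_epi C i"
proof -
 obtain X Y where i: "i : hom C X Y" using iso_Ar[OF assms] by (auto simp: hom_iff)
 obtain j where j: "j : hom C Y X" "j o i = idt C X" "i o j = idt C Y" using isoE[OF assms i] by metis
 have 1: "EX u:hom C Y A. u o i = x" if "x : hom C X A" for A x
 proof
  show "x o j : hom C Y A" using that j by (auto simp: hom_iff)
  show "(x o j) o i = x" using that j i by (auto simp: hom_iff)
 qed
 have 2: "u = v" if "u : hom C Y A" "v : hom C Y A" "u o i = v o i" for A u v
 proof -
  have "(u o i) o j = (v o i) o j" by (simp add: that)
  then show ?thesis using that(1,2) i j by (simp add: hom_iff)
 qed
 have X: "X : Ob C" using i by (auto simp: hom_iff)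
 show ?thesis unfolding regular_epi_def is_coequalizer_iff
  by (rule exI[of _ "idt C X"], rule exI[of _ "idt C X"], rule exI[of _ X], rule exI[of _ X], rule exI[of _ Y])
   (use 1 2 i X in \<open>auto simp: idt_hom\<close>)
qed

lemma (in category) regular_epi_cmp_iso:
 assumes e: "regular_epi C e" "e : hom C X Y" and i: "iso C i" "i : hom C Y Z"
 shows "regular_epi C (i o e)"
proof -
 obtain f g B where *: "f : hom C B X" "g : hom C B X" "e o f = e o g"
  "!!A x. x : hom C X A ==> x o f = x o g ==> EX u:hom C Y A. u o e = x"
  using e unfolding regular_epi_def is_coequalizer_iff by (auto simp: hom_iff)
 obtain j where j: "j : hom C Z Y" "j o i = idt C Y" "i o j = idt C Z" using isoE[OF i] by metis
 have 1: "(i o e) o f = (i o e) o g" using e i * by (simp add: hom_iff)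
 have 2: "EX u:hom C Z A. u o (i o e) = x" if x: "x : hom C X A" "x o f = x o g" for A x
 proof -
  obtain u where u: "u : hom C Y A" "u o e = x" using *(4)[OF x] by blast
  have "(u o j) o (i o e) = u o ((j o i) o e)" using u(1) j(1) i(2) e(2) by (simp add: hom_iff)
  then have "(u o j) o (i o e) = x" using u j e by (simp add: hom_iff)
  then show ?thesis using u j by (intro bexI[of _ "u o j"]) (auto simp: hom_iff)
 qed
 have 3: "u = v" if uv: "u : hom C Z A" "v : hom C Z A" "u o (i o e) = v o (i o e)" for A u v
 proof -
  have "(u o i) o e = (v o i) o e" using uv e i by (simp add: hom_iff)
  then have "u o i = v o i"
   using regular_epi_cancel[OF e, of "u o i" A "v o i"] uv i by (simp add: hom_iff)
  then show ?thesis using regular_epi_cancel[OF regular_epi_iso[OF i(1)] i(2)] uv by blast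
 qed
 show ?thesis unfolding regular_epi_def is_coequalizer_iff
  by (rule exI[of _ f], rule exI[of _ g], rule exI[of _ B], rule exI[of _ X], rule exI[of _ Z])
   (use 1 2 3 * e i in \<open>auto simp: hom_iff\<close>)
qed

section \<open>Regular categories\<close>

locale regular =
 fixes C :: "('o, 'm) cat" (structure)
 assumes regular: "regular_category C"

sublocale regular \<subseteq> category C
 using regular by (simp add: regular_category_def)

context regular begin

lemma terminal_ex: "EX T. is_terminal C T"
 using regular by (simp add: regular_category_def finitely_complete_def)

lemma product_ex: 
 assumes "X : Ob C" "Y : Ob C"
 obtains P p0 p1 where "p0 : hom C P X" "p1 : hom C P Y" "is_product C X Y p0 p1"
  "!!A x y. x : hom C A X ==> y : hom C A Y ==> EX u:hom C A P. p0 o u = x & p1 o u = y"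
  "!!A u v. u : hom C A P ==> v : hom C A P ==> p0 o u = p0 o v ==> p1 o u = p1 o v ==> u = v"
proof -
 obtain p0 p1 where p: "is_product C X Y p0 p1"
  using regular assms unfolding regular_category_def finitely_complete_def by blast
 then obtain P where "p0 : hom C P X & p1 : hom C P Y &
  (ALL A. ALL x:hom C A X. ALL y:hom C A Y. EX u:hom C A P. p0 o u = x & p1 o u = y) &
  (ALL A. ALL u:hom C A P. ALL v:hom C A P. p0 o u = p0 o v --> p1 o u = p1 o v --> u = v)"
  unfolding is_product_iff by blast
 then show thesis using p by (intro that[of p0 P p1]) auto
qed

lemma equalizer_ex: 
 assumes "f : hom C X Y" "g : hom C X Y"
 obtains K k where "k : hom C K X" "is_equalizer C f g k" "f o k = g o k"
  "!!A x. x : hom C A X ==> f o x = g o x ==> EX u:hom C A K. k o u = x"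
  "!!A u v. u : hom C A K ==> v : hom C A K ==> k o u = k o v ==> u = v"
proof -
 obtain k where k: "is_equalizer C f g k"
  using regular assms unfolding regular_category_def finitely_complete_def by blast
 then obtain X' Y' K where *: "f : hom C X' Y'" "k : hom C K X' & f o k = g o k &
  (ALL A. ALL x:hom C A X'. f o x = g o x --> (EX u:hom C A K. k o u = x)) &
  (ALL A. ALL u:hom C A K. ALL v:hom C A K. k o u = k o v --> u = v)"
  unfolding is_equalizer_iff by blast
 then have "X' = X" using assms by (auto simp: hom_iff)
 then show thesis using k * by (intro that[of k K]) auto
qed

text \<open>The standard construction: the equalizer of the two composites out of the
  product.\<close>

lemma pullback_ex: 
 assumes f: "f : hom C X Z" and g: "g : hom C Y Z"
 obtains P p0 p1 where "p0 : hom C P X" "p1 : hom C P Y" "is_pullback C f g p0 p1" "f o p0 = g o p1"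
  "!!A x y. x : hom C A X ==> y : hom C A Y ==> f o x = g o y ==>
    EX u:hom C A P. p0 o u = x & p1 o u = y"
  "!!A u v. u : hom C A P ==> v : hom C A P ==> p0 o u = p0 o v ==> p1 o u = p1 o v ==> u = v"
proof -
 have "X : Ob C" "Y : Ob C" using hom_Ob f g by blast+
 then obtain Q q0 q1 where q: "q0 : hom C Q X" "q1 : hom C Q Y"
  and q2: "!!A x y. x : hom C A X ==> y : hom C A Y ==> EX u:hom C A Q. q0 o u = x & q1 o u = y"
  and q3: "!!A u v. u : hom C A Q ==> v : hom C A Q ==> q0 o u = q0 o v ==> q1 o u = q1 o v ==> u = v"
  by (rule product_ex) blast
 have fg: "f o q0 : hom C Q Z" "g o q1 : hom C Q Z" using q f g by (auto simp: hom_iff)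
 obtain P k where k: "k : hom C P Q" "(f o q0) o k = (g o q1) o k"
  and k2: "!!A x. x : hom C A Q ==> (f o q0) o x = (g o q1) o x ==> EX u:hom C A P. k o u = x"
  and k3: "!!A u v. u : hom C A P ==> v : hom C A P ==> k o u = k o v ==> u = v"
  by (rule equalizer_ex[OF fg]) blast
 have p: "q0 o k : hom C P X" "q1 o k : hom C P Y" "f o (q0 o k) = g o (q1 o k)"
  using q k f g by (auto simp: hom_iff)
 have e: "EX u:hom C A P. (q0 o k) o u = x & (q1 o k) o u = y"
  if xy: "x : hom C A X" "y : hom C A Y" "f o x = g o y" for A x y
 proof -
  obtain v where v: "v : hom C A Q" "q0 o v = x" "q1 o v = y" using q2 xy by blast
  then have "(f o q0) o v = (g o q1) o v" using q f g xy(3) by (simp add: hom_iff)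
  then obtain u where "u : hom C A P" "k o u = v" using k2 v by blast
  then show ?thesis using v q k by (intro bexI[of _ u]) (auto simp: hom_iff)
 qed
 have m: "u = v" if uv: "u : hom C A P" "v : hom C A P" "(q0 o k) o u = (q0 o k) o v" "(q1 o k) o u = (q1 o k) o v" for A u v
  using k3[OF uv(1,2)] q3[of "k o u" A "k o v"] uv q k by (simp add: hom_iff)
 have "is_pullback C f g (q0 o k) (q1 o k)"
  unfolding is_pullback_iff
  by (intro exI conjI ballI allI impI; (rule f g p e m; assumption)?)
 then show thesis by (rule that[OF p(1,2) _ p(3) e m])
qed

text \<open>Stability under pullback in the form in which it is used throughout: an element of the
  codomain of a cover lifts once its own stage is covered.\<close>

lemma cover_lift:
 assumes "regular_epi C e" "e : hom C X Y" "y : hom C A Y"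
 obtains A' a x where "a : hom C A' A" "regular_epi C a" "x : hom C A' X" "e o x = y o a"
proof -
 obtain P p0 p1 where p: "p0 : hom C P X" "p1 : hom C P A" "is_pullback C e y p0 p1" "e o p0 = y o p1"
  by (rule pullback_ex[OF assms(2,3)]) blast
 then have "regular_epi C p1" using regular assms(1) unfolding regular_category_def by blast
 then show thesis using p that by blast
qed

text \<open>\<open>e\<close> is the coequalizer of the kernel pair of \<open>f\<close>. Two elements
  of \<open>Q\<close> with equal images under \<open>m\<close> are lifted along \<open>e\<close>,
  one cover after the other; the lifts form an element of the kernel pair, so \<open>e\<close>
  identifies them.\<close>

lemma factorization:
 assumes f: "f : hom C X Y"
 obtains Q e m where "e : hom C X Q" "regular_epi C e" "m : hom C Q Y" "mono_ar C m" "f = m o e"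
proof -
 obtain P p0 p1 where p: "p0 : hom C P X" "p1 : hom C P X" "is_pullback C f f p0 p1" "f o p0 = f o p1"
  and pu: "!!A x y. x : hom C A X ==> y : hom C A X ==> f o x = f o y ==>
    EX u:hom C A P. p0 o u = x & p1 o u = y"
  by (rule pullback_ex[OF f f]) blast
 obtain e where e: "is_coequalizer C p0 p1 e"
  using p(3) regular unfolding regular_category_def by blast
 have re: "regular_epi C e" unfolding regular_epi_def using e by blast
 obtain Q where Q: "e : hom C X Q" "e o p0 = e o p1"
   "!!A x. x : hom C X A ==> x o p0 = x o p1 ==> EX u:hom C Q A. u o e = x"
  using e p(1) unfolding is_coequalizer_iff by (auto simp: hom_iff)
 obtain m where m: "m : hom C Q Y" "m o e = f" using Q(3)[OF f p(4)] by blast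
 have "u = v" if uv: "u : hom C B Q" "v : hom C B Q" "m o u = m o v" for B u v
 proof -
  obtain B1 b1 x where x: "b1 : hom C B1 B" "regular_epi C b1" "x : hom C B1 X" "e o x = u o b1"
   by (rule cover_lift[OF re Q(1) uv(1)])
  have vb: "v o b1 : hom C B1 Q" using uv x by (auto simp: hom_iff)
  obtain B2 b2 y where y: "b2 : hom C B2 B1" "regular_epi C b2" "y : hom C B2 X" "e o y = (v o b1) o b2"
   by (rule cover_lift[OF re Q(1) vb])
  have "f o (x o b2) = m o ((e o x) o b2)"
   using x(1,3) y(1,3) Q(1) m(1) by (simp add: m(2)[symmetric] hom_iff)
  also have "\<dots> = (m o u) o (b1 o b2)"
   using x(1) y(1) uv(1) m(1) unfolding x(4) by (simp add: hom_iff)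
  also have "\<dots> = m o ((v o b1) o b2)"
   using x(1) y(1) uv(1,2) m(1) unfolding uv(3) by (simp add: hom_iff)
  also have "\<dots> = f o y" 
   using x(1,3) y(1,3) Q(1) m(1) by (simp add: m(2)[symmetric] y(4)[symmetric] hom_iff)
  finally have "f o (x o b2) = f o y" .
  moreover have "x o b2 : hom C B2 X" using x y by (auto simp: hom_iff)
  ultimately obtain w where w: "w : hom C B2 P" "p0 o w = x o b2" "p1 o w = y" using pu[of "x o b2" B2 y] y(3) by blast
  have "e o (p0 o w) = e o (p1 o w)" using Q p w by (intro cmp_reassoc) (auto simp: hom_iff)
  moreover have "e o (p0 o w) = (e o x) o b2" using x(1,3) y(1) Q(1) by (simp add: w(2) hom_iff)
  ultimately have "(u o b1) o b2 = (v o b1) o b2" by (simp only: x(4) w(3) y(4))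
  then have "u o b1 = v o b1"
   using regular_epi_cancel[OF y(2,1), of "u o b1" Q "v o b1"] uv x by (simp add: hom_iff)
  then show "u = v" using regular_epi_cancel[OF x(2,1)] uv by blast
 qed
 then have "mono_ar C m" using m(1) by (auto simp: mono_ar_def hom_iff)
 then show thesis using that[OF Q(1) re m(1)] m(2) by blast
qed

end

lemma (in category) mono_ar_cancel:
 "mono_ar C m ==> m : hom C X Y ==> u : hom C A X ==> v : hom C A X ==> m o u = m o v ==> u = v"
 by (auto simp: mono_ar_def hom_iff)

text \<open>As \<open>m\<close> is a monomorphism, \<open>u\<close> identifies whatever
  \<open>e\<close> identifies and hence descends along \<open>e\<close>.\<close>

lemma (in category) regular_epi_mono_orth:
 assumes e: "regular_epi C e" "e : hom C A B" and m: "mono_ar C m" "m : hom C X Y"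
  and u: "u : hom C A X" and v: "v : hom C B Y" and eq: "m o u = v o e"
 obtains w where "w : hom C B X" "w o e = u" "m o w = v"
proof -
 have "u o s = u o t" if st: "s : hom C D A" "t : hom C D A" "e o s = e o t" for D s t
 proof -
  have "m o (u o s) = v o (e o s)" "m o (u o t) = v o (e o t)"
   using st(1,2) e m u v by (auto intro!: cmp_reassoc[OF eq] simp: hom_iff)
  then show ?thesis using mono_ar_cancel[OF m, of "u o s" D "u o t"] st u by (simp add: hom_iff)
 qed
 then obtain w where w: "w : hom C B X" "w o e = u" using regular_epi_desc[OF e u] by blast
 have "(m o w) o e = v o e" using w m e eq by (simp add: hom_iff)
 then have "m o w = v" using regular_epi_cancel[OF e, of "m o w" Y v] w m v by (simp add: hom_iff)
 then show thesis using w that by blast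
qed

lemma (in category) mono_section_iso:
 assumes "mono_ar C m" "m : hom C X Y" "s : hom C Y X" "m o s = idt C Y"
 shows "iso C m"
proof (rule isoI[OF assms(2,3) _ assms(4)])
 have "m o (s o m) = (m o s) o m" using assms(2,3) by (simp add: hom_iff)
 then have "m o (s o m) = m o idt C X" using assms(2) unfolding assms(4) by (simp add: hom_iff)
 then show "s o m = idt C X"
  using mono_ar_cancel[OF assms(1,2), of "s o m" X "idt C X"] assms hom_Ob by (auto simp: hom_iff)
qed

lemma (in category) mono_regular_epi_iso:
 assumes "mono_ar C m" "regular_epi C m"
 shows "iso C m"
proof -
 obtain X Y where m: "m : hom C X Y" using assms(1) by (auto simp: mono_ar_def hom_iff)
 have i: "idt C X : hom C X X" "idt C Y : hom C Y Y" "m o idt C X = idt C Y o m"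
  using m by (auto simp: hom_iff)
 obtain w where "w : hom C Y X" "m o w = idt C Y"
  by (rule regular_epi_mono_orth[OF assms(2) m assms(1) m i])
 then show ?thesis using mono_section_iso assms m by blast
qed

context regular begin

text \<open>Orthogonality of \<open>g o f\<close> against the mono part of \<open>g\<close> splits
  that mono part, which is therefore invertible.\<close>

lemma regular_epi_right:
 assumes gf: "regular_epi C (g o f)" and f: "f : hom C X Y" and g: "g : hom C Y Z"
 shows "regular_epi C g"
proof -
 obtain Q e m where m: "e : hom C Y Q" "regular_epi C e" "m : hom C Q Z" "mono_ar C m" "g = m o e"
  by (rule factorization[OF g])
 have gf': "g o f : hom C X Z" using f g by (simp add: hom_iff)
 have i: "e o f : hom C X Q" "idt C Z : hom C Z Z" "m o (e o f) = idt C Z o (g o f)"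
  using m f g by (auto simp: hom_iff)
 obtain w where "w : hom C Z Q" "m o w = idt C Z"
  by (rule regular_epi_mono_orth[OF gf gf' m(4,3) i])
 then have "iso C m" using mono_section_iso m by blast
 then show ?thesis using regular_epi_cmp_iso m by simp
qed

text \<open>The mono part \<open>m\<close> of the composite is played off first against
  \<open>e\<close> and then against \<open>d\<close>; the second fill-in is a section of
  \<open>m\<close>.\<close>

lemma regular_epi_cmp:
 assumes e: "regular_epi C e" "e : hom C X Y" and d: "regular_epi C d" "d : hom C Y Z"
 shows "regular_epi C (d o e)"
proof -
 have de: "d o e : hom C X Z" using e d by (simp add: hom_iff)
 obtain Q q m where m: "q : hom C X Q" "regular_epi C q" "m : hom C Q Z" "mono_ar C m" "d o e = m o q"
  by (rule factorization[OF de])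
 obtain w where w: "w : hom C Y Q" "m o w = d"
  using regular_epi_mono_orth[OF e m(4,3,1) d(2)] m(5) by metis
 have i: "idt C Z : hom C Z Z" "m o w = idt C Z o d" using w(2) d by (auto simp: hom_iff)
 obtain s where "s : hom C Z Q" "m o s = idt C Z"
  by (rule regular_epi_mono_orth[OF d m(4,3) w(1) i])
 then have "iso C m" using mono_section_iso m by blast
 then show ?thesis using regular_epi_cmp_iso m by simp
qed

end

section \<open>Relations in regular \<open>Pos\<close>-categories\<close>

text \<open>The \<open>ff\<close>-morphisms into a product, described by their components so that no
  product has to be chosen (\<open>rel_span_iff\<close>).\<close>

definition jointly_ff :: "('o, 'm) pcat => 'o => 'o => 'o => 'm => 'm => bool" where
 "jointly_ff E T X Y r0 r1 \<longleftrightarrow> r0 : hom E T X & r1 : hom E T Y &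
   (ALL A. ALL u:hom E A T. ALL v:hom E A T. r0 o\<^bsub>E\<^esub> u \<preceq>\<^bsub>E\<^esub> r0 o\<^bsub>E\<^esub> v --> r1 o\<^bsub>E\<^esub> u \<preceq>\<^bsub>E\<^esub> r1 o\<^bsub>E\<^esub> v --> u \<preceq>\<^bsub>E\<^esub> v)"

definition span_class :: "('o, 'm, 'z) cat_scheme => 'm => 'm => 'm rel" where
 "span_class E r0 r1 = {(r0 o\<^bsub>E\<^esub> i, r1 o\<^bsub>E\<^esub> i) |i. iso E i & tgt E i = src E r0}"

lemma (in category) span_class_self:
 assumes "r0 : hom C T X" "r1 : hom C T Y"
 shows "(r0, r1) : span_class C r0 r1"
 unfolding span_class_def
 by (rule CollectI, rule exI[of _ "idt C T"]) (use assms in \<open>auto simp: hom_iff intro: iso_idt\<close>)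

text \<open>Membership may be tested on one representative: the others differ from it by an
  isomorphism, which \<open>h\<close> absorbs.\<close>

lemma (in category) rel_mem_span_class:
 assumes "r0 : hom C T X" "r1 : hom C T Y"
 shows "rel_mem C (span_class C r0 r1) x y \<longleftrightarrow> (EX A. EX h:hom C A T. x = r0 o h & y = r1 o h)"
proof
 assume "rel_mem C (span_class C r0 r1) x y"
 then obtain i h where "iso C i" "tgt C i = src C r0" "h : Ar C" "tgt C h = src C (r0 o i)"
   "x = (r0 o i) o h" "y = (r1 o i) o h"
  by (auto simp: rel_mem_def span_class_def)
 then show "EX A. EX h:hom C A T. x = r0 o h & y = r1 o h"
  using assms by (intro exI[of _ "src C h"] bexI[of _ "i o h"]) (auto simp: hom_iff iso_Ar)
next
 assume "EX A. EX h:hom C A T. x = r0 o h & y = r1 o h"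
 then obtain A h where h: "h : hom C A T" "x = r0 o h" "y = r1 o h" by blast
 have "(r0, r1) : span_class C r0 r1" by (rule span_class_self[OF assms])
 then show "rel_mem C (span_class C r0 r1) x y"
  unfolding rel_mem_def by (rule bexI[rotated]) (use h assms in \<open>auto simp: hom_iff\<close>)
qed

lemma (in category) span_class_iso:
 assumes r: "r0 : hom C T X" "r1 : hom C T Y" and i: "iso C i" "i : hom C S T"
 shows "span_class C (r0 o i) (r1 o i) = span_class C r0 r1"
proof -
 obtain j where j: "j : hom C T S" "j o i = idt C S" "i o j = idt C T" "iso C j"
  by (rule isoE[OF i]; blast)
 show ?thesis
 proof (rule set_eqI, rule iffI)
  fix p assume "p : span_class C (r0 o i) (r1 o i)"
  then obtain k where k: "iso C k" "tgt C k = src C (r0 o i)" "p = ((r0 o i) o k, (r1 o i) o k)"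
   by (auto simp: span_class_def)
  have "k : hom C (src C k) S" using k(1,2) r i by (simp add: hom_iff iso_Ar)
  then have "iso C (i o k)" "tgt C (i o k) = src C r0" "p = (r0 o (i o k), r1 o (i o k))"
   using iso_cmp[OF k(1) i(1) _ i(2)] r i k by (auto simp: hom_iff)
  then show "p : span_class C r0 r1" by (auto simp: span_class_def)
 next
  fix p assume "p : span_class C r0 r1"
  then obtain k where k: "iso C k" "tgt C k = src C r0" "p = (r0 o k, r1 o k)"
   by (auto simp: span_class_def)
  have kh: "k : hom C (src C k) T" using k(1,2) r by (simp add: hom_iff iso_Ar)
  have "i o (j o k) = (i o j) o k" using i j(1) kh by (simp add: hom_iff)
  then have e: "i o (j o k) = k" using kh by (simp add: j(3) hom_iff)
  have "iso C (j o k)" by (rule iso_cmp[OF k(1) j(4) kh j(1)])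
  moreover have "tgt C (j o k) = src C (r0 o i)" using r i j(1) kh by (simp add: hom_iff)
  moreover have "p = ((r0 o i) o (j o k), (r1 o i) o (j o k))" 
   using r i(2) j(1) kh k(3) e by (simp add: hom_iff)
  ultimately show "p : span_class C (r0 o i) (r1 o i)" by (auto simp: span_class_def)
 qed
qed

text \<open>\<open>ff_mor\<close> and the notions built on it are defined for records without extension fields.\<close>

locale pcategory = pos_category E for E :: "('o, 'm) pcat" (structure)
begin

lemma cmp_mono_left: "g : hom E Y Z ==> f : hom E X Y ==> f \<preceq> f' ==> g o f \<preceq> g o f'"
 using cmp_mono[of f X Y g Z f' g] leq_refl[of g] by (simp add: hom_iff)

lemma cmp_mono_right: "g : hom E Y Z ==> f : hom E X Y ==> g \<preceq> g' ==> g o f \<preceq> g' o f"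
 using cmp_mono[of f X Y g Z f g'] leq_refl[of f] by (simp add: hom_iff)

lemma ff_mor_cancel: "ff_mor E m ==> m : hom E X Y ==> f : hom E A X ==> g : hom E A X ==>
  m o f \<preceq> m o g ==> f \<preceq> g"
 by (auto simp: ff_mor_def hom_iff)

lemma so_mor_lift:
 assumes e: "so_mor E e" "e : hom E A B" and m: "ff_mor E m" "m : hom E X Y"
  and "u : hom E A X" "v : hom E B Y" "m o u = v o e"
 obtains w where "w : hom E B X" "w o e = u" "m o w = v"
proof -
 have "src E e = A" "tgt E e = B" "src E m = X" "tgt E m = Y" using e m by (auto simp: hom_iff)
 then have "EX w. w : hom E B X & w o e = u & m o w = v"
  using e(1) m(1) assms(5-7) unfolding so_mor_def Let_def by blast
 then show thesis using that by blast
qed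

lemma so_mor_leq:
 assumes e: "so_mor E e" "e : hom E A B" and m: "ff_mor E m" "m : hom E X Y"
  and "w : hom E B X" "w' : hom E B X" "w o e \<preceq> w' o e" "m o w \<preceq> m o w'"
 shows "w \<preceq> w'"
proof -
 have "src E e = A" "tgt E e = B" "src E m = X" "tgt E m = Y" using e m by (auto simp: hom_iff)
 then show ?thesis
  using e(1) m(1) assms(5-8) unfolding so_mor_def Let_def by blast
qed

text \<open>Uniqueness of the fill-in comes from the order clause, used in both directions, and
  antisymmetry.\<close>

lemma so_morI:
 assumes e: "e : hom E A B"
  and 1: "!!m X Y u v. ff_mor E m ==> m : hom E X Y ==> u : hom E A X ==> v : hom E B Y ==> m o u = v o e ==>
    EX w:hom E B X. w o e = u & m o w = v"
  and 2: "!!m X Y w w'. ff_mor E m ==> m : hom E X Y ==> w : hom E B X ==> w' : hom E B X ==>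
    w o e \<preceq> w' o e ==> m o w \<preceq> m o w' ==> w \<preceq> w'"
 shows "so_mor E e"
proof -
 have eA: "e : Ar E" "src E e = A" "tgt E e = B" using e by (auto simp: hom_iff)
 have "EX! w. w : hom E B (src E m) & w o e = u & m o w = v"
  if m: "ff_mor E m" and uv: "u : hom E A (src E m)" "v : hom E B (tgt E m)" "m o u = v o e" for m u v
 proof -
  have mh: "m : hom E (src E m) (tgt E m)" using m by (auto simp: ff_mor_def hom_iff)
  obtain w where w: "w : hom E B (src E m)" "w o e = u" "m o w = v" using 1[OF m mh uv] by blast
  have "w' = w" if w': "w' : hom E B (src E m)" "w' o e = u" "m o w' = v" for w'
  proof (rule leq_antisym)
   have "u \<preceq> u" "v \<preceq> v" using uv leq_refl by (auto simp: hom_iff)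
   then show "w' \<preceq> w" "w \<preceq> w'" using 2[OF m mh w'(1) w(1)] 2[OF m mh w(1) w'(1)] w w' by auto
  qed
  then show ?thesis using w by blast
 qed
 then show ?thesis unfolding so_mor_def Let_def eA(2,3)
  using eA(1) 2 by (auto simp: ff_mor_def hom_iff)
qed

lemma so_mor_iso:
 assumes "iso E i" shows "so_mor E i"
proof -
 obtain A B where i: "i : hom E A B" using iso_Ar[OF assms] by (auto simp: hom_iff)
 obtain j where j: "j : hom E B A" "j o i = idt E A" "i o j = idt E B" by (rule isoE[OF assms i]; blast)
 show ?thesis
 proof (rule so_morI[OF i])
  fix m X Y u v assume *: "ff_mor E m" "m : hom E X Y" "u : hom E A X" "v : hom E B Y" "m o u = v o i"
  have "(u o j) o i = u" using *(3) i j by (simp add: hom_iff)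
  moreover have "m o (u o j) = v o (i o j)"
   using *(2-4) i j(1) by (intro cmp_reassoc[OF *(5)]) (auto simp: hom_iff)
  then have "m o (u o j) = v" using *(4) j by (simp add: hom_iff)
  moreover have "u o j : hom E B X" using *(3) j by (simp add: hom_iff)
  ultimately show "EX w:hom E B X. w o i = u & m o w = v" by blast
 next
  fix m X Y w w' assume *: "w : hom E B X" "w' : hom E B X" "w o i \<preceq> w' o i"
  have "(w o i) o j \<preceq> (w' o i) o j" by (rule cmp_mono_right[OF _ j(1) *(3)]) (use *(1) i in \<open>simp add: hom_iff\<close>)
  then have "w o (i o j) \<preceq> w' o (i o j)" using *(1,2) i j(1) by (simp add: hom_iff)
  then show "w \<preceq> w'" using *(1,2) unfolding j(3) by (simp add: hom_iff)
 qed
qed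

lemma so_mor_cmp:
 assumes e: "so_mor E e" "e : hom E A B" and d: "so_mor E d" "d : hom E B D"
 shows "so_mor E (d o e)"
proof (rule so_morI)
 show "d o e : hom E A D" using e d by (simp add: hom_iff)
next
 fix m X Y u v assume *: "ff_mor E m" "m : hom E X Y" "u : hom E A X" "v : hom E D Y" "m o u = v o (d o e)"
 then have 1: "m o u = (v o d) o e" "v o d : hom E B Y" using e d by (auto simp: hom_iff)
 obtain w where w: "w : hom E B X" "w o e = u" "m o w = v o d"
  by (rule so_mor_lift[OF e *(1,2,3) 1(2,1)])
 obtain x where x: "x : hom E D X" "x o d = w" "m o x = v"
  by (rule so_mor_lift[OF d *(1,2) w(1) *(4) w(3)])
 have "x o (d o e) = (x o d) o e" using x(1) d e by (simp add: hom_iff)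
 then show "EX w:hom E D X. w o (d o e) = u & m o w = v" using x w by auto
next
 fix m X Y w w' assume *: "ff_mor E m" "m : hom E X Y" "w : hom E D X" "w' : hom E D X"
  "w o (d o e) \<preceq> w' o (d o e)" "m o w \<preceq> m o w'"
 have h: "w o d : hom E B X" "w' o d : hom E B X" using * d by (auto simp: hom_iff)
 have "(w o d) o e \<preceq> (w' o d) o e" using * d e by (simp add: hom_iff)
 moreover have "(m o w) o d \<preceq> (m o w') o d" using * d by (intro cmp_mono_right) (auto simp: hom_iff)
 then have "m o (w o d) \<preceq> m o (w' o d)" using * d by (simp add: hom_iff)
 ultimately have "w o d \<preceq> w' o d" by (rule so_mor_leq[OF e *(1,2) h])
 then show "w \<preceq> w'" by (rule so_mor_leq[OF d *(1-4) _ *(6)])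
qed

lemma jointly_ff_cancel:
 assumes "jointly_ff E T X Y r0 r1" "u : hom E A T" "v : hom E A T" "r0 o u = r0 o v" "r1 o u = r1 o v"
 shows "u = v"
proof (rule leq_antisym)
 have "r0 o v \<preceq> r0 o v" "r1 o v \<preceq> r1 o v" using assms by (auto intro!: leq_refl simp: jointly_ff_def hom_iff)
 then show "u \<preceq> v" "v \<preceq> u" using assms by (auto simp: jointly_ff_def)
qed

lemma jointly_ff_iso:
 assumes r: "jointly_ff E T X Y r0 r1" and i: "iso E i" "i : hom E S T"
 shows "jointly_ff E S X Y (r0 o i) (r1 o i)"
proof -
 have rh: "r0 : hom E T X" "r1 : hom E T Y" using r by (auto simp: jointly_ff_def)
 obtain j where j: "j : hom E T S" "j o i = idt E S" by (rule isoE[OF i]; blast)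
 have "u \<preceq> v" if uv: "u : hom E A S" "v : hom E A S" "(r0 o i) o u \<preceq> (r0 o i) o v" "(r1 o i) o u \<preceq> (r1 o i) o v" for A u v
 proof -
  have 1: "i o u : hom E A T" "i o v : hom E A T" using i uv by (auto simp: hom_iff)
  have "r0 o (i o u) \<preceq> r0 o (i o v)" "r1 o (i o u) \<preceq> r1 o (i o v)"
   using rh i uv by (auto simp: hom_iff)
  then have "i o u \<preceq> i o v" using r 1 unfolding jointly_ff_def by blast
  then have "j o (i o u) \<preceq> j o (i o v)" by (rule cmp_mono_left[OF j(1) 1(1)])
  moreover have "j o (i o u) = (j o i) o u" "j o (i o v) = (j o i) o v" using i uv(1,2) j(1) by (auto simp: hom_iff)
  ultimately show ?thesis using uv(1,2) by (simp add: j(2) hom_iff)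
 qed
 then show ?thesis using rh i unfolding jointly_ff_def by (auto simp: hom_iff)
qed

end

text \<open>Between congruences this elementwise closure is the equation
  \<open>F \<Phi> E = \<Phi>\<close> of the bicategory: one inclusion is the closure, the other is
  reflexivity (\<open>lax_module_iff\<close>).\<close>

definition lax_module :: "('o, 'm) pcat => 'o \<times> 'm rel => 'o \<times> 'm rel => 'm rel => bool" where
 "lax_module E p q \<Phi> \<longleftrightarrow> \<Phi> : rels E (fst p) (fst q) &
   (ALL x' x y y'. rel_mem E (snd p) x' x --> rel_mem E \<Phi> x y --> rel_mem E (snd q) y y' --> rel_mem E \<Phi> x' y')"

text \<open>Unit and counit of an adjunction, spelled out on elements. The intermediate element of
  the unit exists only after a cover, and the unit is stated on the diagonal alone.\<close>

definition adjoint_modules ::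
 "('o, 'm) pcat => ('m => bool) => 'o \<times> 'm rel => 'o \<times> 'm rel => 'm rel => 'm rel => bool" where
 "adjoint_modules E cv p q \<Phi> \<Psi> \<longleftrightarrow> lax_module E p q \<Phi> & lax_module E q p \<Psi> &
   (ALL A. ALL x:hom E A (fst p). EX B. EX a:hom E B A. EX y. cv a &
    rel_mem E \<Phi> (x o\<^bsub>E\<^esub> a) y & rel_mem E \<Psi> y (x o\<^bsub>E\<^esub> a)) &
   (ALL y x y'. rel_mem E \<Psi> y x --> rel_mem E \<Phi> x y' --> rel_mem E (snd q) y y')"

text \<open>The class of \<open>so\<close>-morphisms is a parameter, to be instantiated by an explicit description: regular
 epimorphisms in \<open>disc C\<close>, and underlying regular epimorphisms in \<open>Ord C\<close>.\<close>

locale posreg = pcategory E for E :: "('o, 'm) pcat" (structure) +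
 fixes cv :: "'m => bool"
 assumes cv_iff: "cv e \<longleftrightarrow> so_mor E e"
  and pos_product_ex: "X : Ob E ==> Y : Ob E ==> EX p0 p1. pos_product E X Y p0 p1"
  and pos_pullback_ex: "f : hom E X Z ==> g : hom E Y Z ==> EX p0 p1. pos_pullback E f g p0 p1"
  and span_factorization: "t0 : hom E T X ==> t1 : hom E T Y ==>
    EX Q q0 q1 e. jointly_ff E Q X Y q0 q1 & cv e & e : hom E T Q & t0 = q0 o e & t1 = q1 o e"
  and cv_stable: "pos_pullback E e g p0 p1 ==> cv e ==> cv p1"
begin

lemma cv_iso: "iso E i ==> cv i"
 and cv_cmp: "cv e ==> e : hom E A B ==> cv d ==> d : hom E B D ==> cv (d o e)"
 unfolding cv_iff by (rule so_mor_iso so_mor_cmp; assumption)+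

lemma cv_idt: "X : Ob E ==> cv (idt E X)"
 by (rule cv_iso) (rule iso_idt)

lemma pos_productE:
 assumes "pos_product E X Y p0 p1"
 obtains P where "p0 : hom E P X" "p1 : hom E P Y"
  "ALL A x y. x : hom E A X --> y : hom E A Y --> (EX u:hom E A P. p0 o u = x & p1 o u = y)"
  "ALL A u v. u : hom E A P --> v : hom E A P --> p0 o u \<preceq> p0 o v --> p1 o u \<preceq> p1 o v --> u \<preceq> v"
proof -
 obtain P where P: "p0 : hom E P X" "p1 : hom E P Y"
  "ALL A x y. x : hom E A X --> y : hom E A Y --> (EX u:hom E A P. p0 o u = x & p1 o u = y)"
  using assms unfolding pos_product_def is_product_iff by blast
 have "src E p0 = P" using P(1) by (simp add: hom_iff)
 then have "ALL A u v. u : hom E A P --> v : hom E A P --> p0 o u \<preceq> p0 o v --> p1 o u \<preceq> p1 o v --> u \<preceq> v"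
  using assms unfolding pos_product_def jointly_order_mono_def by blast
 then show thesis by (rule that[OF P])
qed

lemma jointly_ff_tuple:
 assumes r: "jointly_ff E T X Y r0 r1" and p: "p0 : hom E P X" "p1 : hom E P Y"
  and m: "m : hom E T P" "p0 o m = r0" "p1 o m = r1"
 shows "ff_mor E m"
proof -
 have "f \<preceq> g" if fg: "f : hom E A T" "g : hom E A T" "m o f \<preceq> m o g" for A f g
 proof -
  have mf: "m o f : hom E A P" using fg m by (simp add: hom_iff)
  have "p0 o (m o f) \<preceq> p0 o (m o g)" "p1 o (m o f) \<preceq> p1 o (m o g)"
   using fg(3) cmp_mono_left[OF _ mf] p by auto
  then have "(p0 o m) o f \<preceq> (p0 o m) o g" "(p1 o m) o f \<preceq> (p1 o m) o g"
   using fg(1,2) m(1) p by (auto simp: hom_iff)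
  then show ?thesis using r fg unfolding m(2,3) jointly_ff_def by blast
 qed
 then show ?thesis using m(1) unfolding ff_mor_def by (auto simp: hom_iff)
qed

lemma rel_span_iff: "rel_span E X Y r0 r1 \<longleftrightarrow> (EX T. jointly_ff E T X Y r0 r1)"
proof
 assume "rel_span E X Y r0 r1"
 then obtain p0 p1 m where p: "pos_product E X Y p0 p1" and m: "ff_mor E m" "tgt E m = src E p0"
   and r: "r0 = p0 o m" "r1 = p1 o m" by (auto simp: rel_span_def)
 obtain P where P: "p0 : hom E P X" "p1 : hom E P Y"
  and Pu: "ALL A x y. x : hom E A X --> y : hom E A Y --> (EX u:hom E A P. p0 o u = x & p1 o u = y)"
  and Pm: "ALL A u v. u : hom E A P --> v : hom E A P --> p0 o u \<preceq> p0 o v --> p1 o u \<preceq> p1 o v --> u \<preceq> v"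
  by (rule pos_productE[OF p])
 have mh: "m : hom E (src E m) P" using m P by (auto simp: ff_mor_def hom_iff)
 have "u \<preceq> v" if uv: "u : hom E A (src E m)" "v : hom E A (src E m)" "(p0 o m) o u \<preceq> (p0 o m) o v" "(p1 o m) o u \<preceq> (p1 o m) o v" for A u v
 proof (rule ff_mor_cancel[OF m(1) mh uv(1,2)], rule Pm[rule_format])
  show "m o u : hom E A P" "m o v : hom E A P" using uv mh by (auto simp: hom_iff)
  show "p0 o (m o u) \<preceq> p0 o (m o v)" "p1 o (m o u) \<preceq> p1 o (m o v)"
   using uv mh P(1,2) by (auto simp: hom_iff)
 qed
 then have "jointly_ff E (src E m) X Y r0 r1" unfolding jointly_ff_def r using P(1,2) mh by (auto simp: hom_iff)
 then show "EX T. jointly_ff E T X Y r0 r1" by blast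
next
 assume "EX T. jointly_ff E T X Y r0 r1"
 then obtain T where r: "jointly_ff E T X Y r0 r1" by blast
 then have rh: "r0 : hom E T X" "r1 : hom E T Y" by (auto simp: jointly_ff_def)
 then obtain p0 p1 where p: "pos_product E X Y p0 p1" using pos_product_ex hom_Ob by blast
 obtain P where P: "p0 : hom E P X" "p1 : hom E P Y"
  and Pu: "ALL A x y. x : hom E A X --> y : hom E A Y --> (EX u:hom E A P. p0 o u = x & p1 o u = y)"
  and Pm: "ALL A u v. u : hom E A P --> v : hom E A P --> p0 o u \<preceq> p0 o v --> p1 o u \<preceq> p1 o v --> u \<preceq> v"
  by (rule pos_productE[OF p])
 obtain m where m: "m : hom E T P" "p0 o m = r0" "p1 o m = r1" using Pu[rule_format, OF rh] by blast
 have "ff_mor E m" by (rule jointly_ff_tuple[OF r P(1,2) m])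
 moreover have "tgt E m = src E p0" using m(1) P(1) by (simp add: hom_iff)
 ultimately show "rel_span E X Y r0 r1" unfolding rel_span_def using p m(2,3) by blast
qed

lemma rels_iff: "R : rels E X Y \<longleftrightarrow> (EX T r0 r1. jointly_ff E T X Y r0 r1 & R = span_class E r0 r1)"
 unfolding rels_def rel_span_iff span_class_def by blast

lemma relsE:
 assumes "R : rels E X Y"
 obtains T r0 r1 where "jointly_ff E T X Y r0 r1" "r0 : hom E T X" "r1 : hom E T Y" "(r0, r1) : R"
  "R = span_class E r0 r1"
proof -
 obtain T r0 r1 where r: "jointly_ff E T X Y r0 r1" "R = span_class E r0 r1" using assms rels_iff by blast
 then have rh: "r0 : hom E T X" "r1 : hom E T Y" by (auto simp: jointly_ff_def)
 show thesis by (rule that[OF r(1) rh _ r(2)]) (simp add: r(2) span_class_self[OF rh])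
qed

lemma rels_span:
 assumes R: "R : rels E X Y" and ab: "(a, b) : R"
 obtains T where "jointly_ff E T X Y a b" "a : hom E T X" "b : hom E T Y" "R = span_class E a b"
proof -
 obtain T r0 r1 where r: "jointly_ff E T X Y r0 r1" "r0 : hom E T X" "r1 : hom E T Y" "R = span_class E r0 r1"
  by (rule relsE[OF R]; blast)
 then obtain i where i: "iso E i" "tgt E i = src E r0" "a = r0 o i" "b = r1 o i"
  using ab by (auto simp: span_class_def)
 have ih: "i : hom E (src E i) T" using i r by (auto simp: hom_iff iso_Ar)
 have 1: "jointly_ff E (src E i) X Y a b" "R = span_class E a b"
  unfolding i r using jointly_ff_iso[OF r(1) i(1) ih] span_class_iso[OF r(2,3) i(1) ih] by auto
 show thesis by (rule that[OF 1(1) _ _ 1(2)]) (use 1(1) in \<open>auto simp: jointly_ff_def\<close>)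
qed

lemma rels_spanI:
 "jointly_ff E T X Y r0 r1 ==> span_class E r0 r1 : rels E X Y"
 using rels_iff by blast

lemma mem_hom: "R : rels E X Y ==> rel_mem E R x y ==> EX A. x : hom E A X & y : hom E A Y"
 by (erule relsE) (auto simp: hom_iff rel_mem_span_class)

lemma mem_stable:
 assumes R: "R : rels E X Y" and m: "rel_mem E R x y" and a: "a : hom E B A" "x : hom E A X"
 shows "rel_mem E R (x o a) (y o a)"
proof -
 obtain T r0 r1 where r: "r0 : hom E T X" "r1 : hom E T Y" "R = span_class E r0 r1"
  by (rule relsE[OF R]; blast)
 note rm = rel_mem_span_class[OF r(1,2), folded r(3)]
 obtain D h where h: "h : hom E D T" "x = r0 o h" "y = r1 o h" using m rm by blast
 then have "D = A" using a r by (auto simp: hom_iff)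
 then show ?thesis unfolding rm using h a r(1,2) by (intro exI[of _ B] bexI[of _ "h o a"]) (auto simp: hom_iff)
qed

text \<open>The cover \<open>a\<close> is orthogonal to the \<open>ff\<close>-morphism into the
  product that represents \<open>R\<close>. This is how covers introduced by existential statements
  are discarded again.\<close>

lemma mem_local:
 assumes R: "R : rels E X Y" and a: "cv a" "a : hom E B A" and x: "x : hom E A X" and y: "y : hom E A Y"
  and m: "rel_mem E R (x o a) (y o a)"
 shows "rel_mem E R x y"
proof -
 obtain T r0 r1 where r: "jointly_ff E T X Y r0 r1" "r0 : hom E T X" "r1 : hom E T Y" "R = span_class E r0 r1"
  by (rule relsE[OF R]; blast)
 note rm = rel_mem_span_class[OF r(2,3), folded r(4)]
 obtain D h where h: "h : hom E D T" "x o a = r0 o h" "y o a = r1 o h" using m rm by blast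
 have "src E (r0 o h) = D" "src E (x o a) = B" using h(1) r a x by (auto simp: hom_iff)
 then have D: "D = B" using h(2) by simp
 obtain p0 p1 where p: "pos_product E X Y p0 p1" using pos_product_ex hom_Ob x y by blast
 obtain P where P: "p0 : hom E P X" "p1 : hom E P Y"
  "ALL A x y. x : hom E A X --> y : hom E A Y --> (EX u:hom E A P. p0 o u = x & p1 o u = y)"
  and Pm: "ALL A u v. u : hom E A P --> v : hom E A P --> p0 o u \<preceq> p0 o v --> p1 o u \<preceq> p1 o v --> u \<preceq> v"
  by (rule pos_productE[OF p])
 obtain n where n: "n : hom E T P" "p0 o n = r0" "p1 o n = r1" using P(3)[rule_format, OF r(2,3)] by blast
 obtain z where z: "z : hom E A P" "p0 o z = x" "p1 o z = y" using P(3)[rule_format, OF x y] by blast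
 have nf: "ff_mor E n" by (rule jointly_ff_tuple[OF r(1) P(1,2) n])
 have hh: "n o h : hom E B P" "z o a : hom E B P" using n z h a D by (auto simp: hom_iff)
 have "p0 o (n o h) = (p0 o n) o h" "p1 o (n o h) = (p1 o n) o h"
   "p0 o (z o a) = (p0 o z) o a" "p1 o (z o a) = (p1 o z) o a"
  using n(1) z(1) h(1) a(2) P(1,2) by (auto simp: hom_iff)
 then have eq: "p0 o (n o h) = p0 o (z o a)" "p1 o (n o h) = p1 o (z o a)"
  by (auto simp: n z h)
 have "p0 o (n o h) \<preceq> p0 o (n o h)" "p1 o (n o h) \<preceq> p1 o (n o h)"
  using P(1,2) hh by (auto intro!: leq_refl simp: hom_iff)
 then have "n o h = z o a"
  by (intro leq_antisym Pm[rule_format, OF hh] Pm[rule_format, OF hh(2,1)]) (simp_all only: eq)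
 then obtain w where w: "w : hom E A T" "n o w = z"
  using so_mor_lift[OF a(1)[unfolded cv_iff] a(2) nf n(1) _ z(1)] h(1) D by blast
 have "x = p0 o (n o w)" "y = p1 o (n o w)" using z w by auto
 moreover have "p0 o (n o w) = (p0 o n) o w" "p1 o (n o w) = (p1 o n) o w"
  using P(1,2) n(1) w(1) by (auto simp: hom_iff)
 ultimately show ?thesis unfolding rm using w(1) n by auto
qed

text \<open>The hypotheses, applied to the generic elements \<open>(r0, r1)\<close> and
  \<open>(s0, s1)\<close>, give mutually inverse arrows between the two spans, and isomorphic spans
  have the same class.\<close>

lemma rels_eqI:
 assumes R: "R : rels E X Y" and S: "S : rels E X Y"
  and RS: "!!x y. rel_mem E R x y ==> rel_mem E S x y" and SR: "!!x y. rel_mem E S x y ==> rel_mem E R x y"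
 shows "R = S"
proof -
 obtain T r0 r1 where r: "jointly_ff E T X Y r0 r1" "r0 : hom E T X" "r1 : hom E T Y" "R = span_class E r0 r1"
  by (rule relsE[OF R]; blast)
 note rm = rel_mem_span_class[OF r(2,3), folded r(4)]
 obtain U s0 s1 where s: "jointly_ff E U X Y s0 s1" "s0 : hom E U X" "s1 : hom E U Y" "S = span_class E s0 s1"
  by (rule relsE[OF S]; blast)
 note sm = rel_mem_span_class[OF s(2,3), folded s(4)]
 have self: "r = r o idt E T" if "r : hom E T Z" for r T Z using that by (simp add: hom_iff)
 have id: "idt E T : hom E T T" "idt E U : hom E U U" using hom_Ob r s by (auto intro!: idt_hom)
 have "rel_mem E R r0 r1" "rel_mem E S s0 s1" using self r s id unfolding rm sm by blast+
 then have "rel_mem E S r0 r1" "rel_mem E R s0 s1" using RS SR by blast+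
 then obtain h k A B where hk: "h : hom E A U" "r0 = s0 o h" "r1 = s1 o h" "k : hom E B T" "s0 = r0 o k" "s1 = r1 o k"
  unfolding rm sm by blast
 have "src E (s0 o h) = A" "src E (r0 o k) = B" using hk(1,4) r s by (auto simp: hom_iff)
 then have "src E r0 = A" "src E s0 = B" by (simp_all only: hk(2,5)[symmetric])
 then have AB: "A = T" "B = U" using r s by (auto simp: hom_iff)
 have hkh: "h o k : hom E U U" "k o h : hom E T T" using hk(1,4) AB by (auto simp: hom_iff)
 have "s0 o (h o k) = (s0 o h) o k" "s1 o (h o k) = (s1 o h) o k" "r0 o (k o h) = (r0 o k) o h" "r1 o (k o h) = (r1 o k) o h"
  using hk(1,4) r(2,3) s(2,3) AB by (auto simp: hom_iff)
 then have "s0 o (h o k) = s0" "s1 o (h o k) = s1" "r0 o (k o h) = r0" "r1 o (k o h) = r1"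
  by (simp_all only: hk(2,3,5,6)[symmetric])
 then have "s0 o (h o k) = s0 o idt E U" "s1 o (h o k) = s1 o idt E U"
  "r0 o (k o h) = r0 o idt E T" "r1 o (k o h) = r1 o idt E T"
  using r(2,3) s(2,3) by (auto simp: hom_iff)
 then have "h o k = idt E U" "k o h = idt E T"
  using jointly_ff_cancel[OF s(1) hkh(1) id(2)] jointly_ff_cancel[OF r(1) hkh(2) id(1)] by auto
 then have "iso E h" using isoI[of h T U k] hk(1,4) AB by auto
 then have "span_class E (s0 o h) (s1 o h) = span_class E s0 s1"
  using span_class_iso[OF s(2,3), of h T] hk(1) AB by auto
 then show "R = S" by (simp only: r(4) s(4) hk(2,3)[symmetric])
qed

lemma rel_incl_iff:
 assumes R: "R : rels E X Y" and S: "S : rels E X Y"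
 shows "rel_incl E R S \<longleftrightarrow> (ALL x y. rel_mem E R x y --> rel_mem E S x y)"
proof
 assume i: "rel_incl E R S"
 show "ALL x y. rel_mem E R x y --> rel_mem E S x y"
 proof (intro allI impI)
  fix x y assume m: "rel_mem E R x y"
  obtain T r0 r1 where r: "r0 : hom E T X" "r1 : hom E T Y" "(r0, r1) : R" "R = span_class E r0 r1"
   by (rule relsE[OF R]; blast)
  have "rel_mem E S r0 r1" using i r(3) by (auto simp: rel_incl_def)
  then show "rel_mem E S x y" using mem_stable[OF S _ _ r(1)] m
   unfolding rel_mem_span_class[OF r(1,2), folded r(4)] by blast
 qed
next
 assume *: "ALL x y. rel_mem E R x y --> rel_mem E S x y"
 have "rel_mem E R a b" if ab: "(a, b) : R" for a b
 proof -
  obtain T where t: "a : hom E T X" "b : hom E T Y" "R = span_class E a b" by (rule rels_span[OF R ab]; blast)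
  then show ?thesis unfolding t(3) rel_mem_span_class[OF t(1,2)]
   by (intro exI[of _ T] bexI[of _ "idt E T"]) (auto simp: hom_iff)
 qed
 then show "rel_incl E R S" using * by (auto simp: rel_incl_def)
qed

lemma pos_pullbackE:
 assumes "pos_pullback E f g p0 p1" "f : hom E X Z" "g : hom E Y Z"
 obtains P where "p0 : hom E P X" "p1 : hom E P Y" "f o p0 = g o p1"
  "ALL A x y. x : hom E A X --> y : hom E A Y --> f o x = g o y --> (EX u:hom E A P. p0 o u = x & p1 o u = y)"
proof -
 obtain P X' Y' Z' where P: "f : hom E X' Z'" "g : hom E Y' Z'" "p0 : hom E P X'" "p1 : hom E P Y'" "f o p0 = g o p1"
  "ALL A x y. x : hom E A X' --> y : hom E A Y' --> f o x = g o y --> (EX u:hom E A P. p0 o u = x & p1 o u = y)"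
  using assms(1) unfolding pos_pullback_def is_pullback_iff by blast
 then have XY: "X' = X" "Y' = Y" using assms(2,3) by (auto simp: hom_iff)
 show thesis by (rule that[OF P(3-6)[unfolded XY]])
qed

lemma cv_lift:
 assumes e: "cv e" "e : hom E X Y" and y: "y : hom E A Y"
 obtains B a x where "a : hom E B A" "cv a" "x : hom E B X" "e o x = y o a"
proof -
 obtain p0 p1 where p: "pos_pullback E e y p0 p1" using pos_pullback_ex[OF e(2) y] by blast
 obtain P where "p0 : hom E P X" "p1 : hom E P A" "e o p0 = y o p1"
  "ALL D x z. x : hom E D X --> z : hom E D A --> e o x = y o z --> (EX u:hom E D P. p0 o u = x & p1 o u = z)"
  by (rule pos_pullbackE[OF p e(2) y])
 then show thesis using cv_stable[OF p e(1)] that by blast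
qed

text \<open>Composition is internal existential quantification. From left to right, \<open>h\<close>
  is lifted along the \<open>so\<close>-part \<open>e\<close> to the pullback; from right to left,
  the factorization obtained after the cover descends by \<open>mem_local\<close>.\<close>

lemma rel_comp_span:
 assumes R: "R : rels E X Y" and S: "S : rels E Y Z" and q: "(q0, q1) : rel_comp E S R"
 obtains Q where "jointly_ff E Q X Z q0 q1" "q0 : hom E Q X" "q1 : hom E Q Z"
  "ALL x z. (EX A. EX h:hom E A Q. x = q0 o h & z = q1 o h) \<longleftrightarrow>
   (EX A B a y. x : hom E A X & z : hom E A Z & a : hom E B A & cv a & rel_mem E R (x o a) y & rel_mem E S y (z o a))"
proof -
 obtain r0 r1 s0 s1 t0 t1 e where rs: "(r0, r1) : R" "(s0, s1) : S" and t: "pos_pullback E r1 s0 t0 t1"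
  and rsp: "rel_span E (tgt E r0) (tgt E s1) q0 q1" and e: "so_mor E e" "tgt E e = src E q0"
  and eq: "r0 o t0 = q0 o e" "s1 o t1 = q1 o e"
  using q by (auto simp: rel_comp_def)
 obtain T where r: "r0 : hom E T X" "r1 : hom E T Y" "R = span_class E r0 r1"
  by (rule rels_span[OF R rs(1)]; blast)
 obtain U where s: "s0 : hom E U Y" "s1 : hom E U Z" "S = span_class E s0 s1"
  by (rule rels_span[OF S rs(2)]; blast)
 obtain P where P: "t0 : hom E P T" "t1 : hom E P U" "r1 o t0 = s0 o t1"
  "ALL A x y. x : hom E A T --> y : hom E A U --> r1 o x = s0 o y --> (EX u:hom E A P. t0 o u = x & t1 o u = y)"
  by (rule pos_pullbackE[OF t r(2) s(1)])
 obtain Q where Q: "jointly_ff E Q X Z q0 q1" using rsp r s unfolding rel_span_iff by (auto simp: hom_iff)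
 then have qh: "q0 : hom E Q X" "q1 : hom E Q Z" by (auto simp: jointly_ff_def)
 have Rm: "rel_mem E R x y \<longleftrightarrow> (EX A. EX h:hom E A T. x = r0 o h & y = r1 o h)" for x y
  unfolding r(3) by (rule rel_mem_span_class[OF r(1,2)])
 have Sm: "rel_mem E S x y \<longleftrightarrow> (EX A. EX h:hom E A U. x = s0 o h & y = s1 o h)" for x y
  unfolding s(3) by (rule rel_mem_span_class[OF s(1,2)])
 have "src E (r0 o t0) = P" "src E (q0 o e) = src E e"
  using r P qh e by (auto simp: hom_iff so_mor_def)
 then have eh: "e : hom E P Q" using eq(1) e qh by (auto simp: hom_iff so_mor_def)
 have QR: "span_class E q0 q1 : rels E X Z" using rels_spanI[OF Q] .
 show thesis
 proof (rule that[OF Q qh], intro allI, rule iffI)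
  fix x z assume "EX A. EX h:hom E A Q. x = q0 o h & z = q1 o h"
  then obtain A h where h: "h : hom E A Q" "x = q0 o h" "z = q1 o h" by blast
  obtain B a k where a: "a : hom E B A" "cv a" "k : hom E B P" "e o k = h o a"
   by (rule cv_lift[OF e(1)[folded cv_iff] eh h(1)])
  have "x o a = q0 o (e o k)" "z o a = q1 o (e o k)" unfolding a(4) h(2,3) using qh h(1) a(1) by (auto simp: hom_iff)
  moreover have "q0 o (e o k) = r0 o (t0 o k)" "q1 o (e o k) = s1 o (t1 o k)"
   using qh eh a(3) r s P(1,2) by (auto intro!: cmp_reassoc eq[symmetric] simp: hom_iff)
  moreover have "r1 o (t0 o k) = s0 o (t1 o k)"
   using a(3) r s P(1,2) by (auto intro!: cmp_reassoc P(3) simp: hom_iff)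
  moreover have "t0 o k : hom E B T" "t1 o k : hom E B U" using P a by (auto simp: hom_iff)
  ultimately have "rel_mem E R (x o a) (r1 o (t0 o k))" "rel_mem E S (r1 o (t0 o k)) (z o a)"
   unfolding Rm Sm by (rule_tac exI[of _ B], force)+
  moreover have "x : hom E A X" "z : hom E A Z" using h qh by (auto simp: hom_iff)
  ultimately show "EX A B a y. x : hom E A X & z : hom E A Z & a : hom E B A & cv a & rel_mem E R (x o a) y & rel_mem E S y (z o a)"
   using a(1,2) by blast
 next
  fix x z
  assume "EX A B a y. x : hom E A X & z : hom E A Z & a : hom E B A & cv a & rel_mem E R (x o a) y & rel_mem E S y (z o a)"
  then obtain A B a y where xz: "x : hom E A X" "z : hom E A Z" and a: "a : hom E B A" "cv a"
   and m: "rel_mem E R (x o a) y" "rel_mem E S y (z o a)" by blast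
  obtain F h G k where h: "h : hom E F T" "x o a = r0 o h" "y = r1 o h" and k: "k : hom E G U" "y = s0 o k" "z o a = s1 o k"
   using m unfolding Rm Sm by blast
  have "src E (r1 o h) = F" "src E (s0 o k) = G" using h(1) k(1) r s by (auto simp: hom_iff)
  then have "F = G" using h(3) k(2) by simp
  then obtain u where u: "u : hom E F P" "t0 o u = h" "t1 o u = k" using P(4)[rule_format, OF h(1), of k] h(3) k(1,2) by auto
  have "x o a = q0 o (e o u)" "z o a = q1 o (e o u)"
   unfolding h(2) k(3) u(2,3)[symmetric] using qh eh u(1) r s P(1,2) by (auto intro!: cmp_reassoc eq simp: hom_iff)
  moreover have "e o u : hom E F Q" using u(1) eh by (simp add: hom_iff)
  ultimately have "rel_mem E (span_class E q0 q1) (x o a) (z o a)"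
   unfolding rel_mem_span_class[OF qh] by blast
  then have "rel_mem E (span_class E q0 q1) x z" by (rule mem_local[OF QR a(2,1) xz])
  then show "EX A. EX h:hom E A Q. x = q0 o h & z = q1 o h" unfolding rel_mem_span_class[OF qh] .
 qed
qed

text \<open>The set \<open>rel_comp E S R\<close> is a single isomorphism class: by
  \<open>rel_comp_span\<close> its spans all have the same elements, whatever representatives,
  pullback and factorization produced them.\<close>

lemma rel_comp_aux:
 assumes R: "R : rels E X Y" and S: "S : rels E Y Z"
 obtains q0 q1 where "(q0, q1) : rel_comp E S R" "rel_comp E S R = span_class E q0 q1"
proof -
 obtain T r0 r1 where r: "r0 : hom E T X" "r1 : hom E T Y" "(r0, r1) : R" by (rule relsE[OF R]; blast)
 obtain U s0 s1 where s: "s0 : hom E U Y" "s1 : hom E U Z" "(s0, s1) : S" by (rule relsE[OF S]; blast)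
 obtain t0 t1 where t: "pos_pullback E r1 s0 t0 t1" using pos_pullback_ex[OF r(2) s(1)] by blast
 obtain P where P: "t0 : hom E P T" "t1 : hom E P U" "r1 o t0 = s0 o t1"
  "ALL A x y. x : hom E A T --> y : hom E A U --> r1 o x = s0 o y --> (EX u:hom E A P. t0 o u = x & t1 o u = y)"
  by (rule pos_pullbackE[OF t r(2) s(1)])
 have 1: "r0 o t0 : hom E P X" "s1 o t1 : hom E P Z" using r s P by (auto simp: hom_iff)
 obtain Q q0 q1 e where q: "jointly_ff E Q X Z q0 q1" "cv e" "e : hom E P Q" "r0 o t0 = q0 o e" "s1 o t1 = q1 o e"
  using span_factorization[OF 1] by blast
 have qh: "q0 : hom E Q X" "q1 : hom E Q Z" using q(1) by (auto simp: jointly_ff_def)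
 have tg: "tgt E r0 = X" "tgt E s1 = Z" using r s by (auto simp: hom_iff)
 have mem: "(q0', q1') : rel_comp E S R" if "rel_span E X Z q0' q1'" "cv e'" "tgt E e' = src E q0'"
   "r0 o t0 = q0' o e'" "s1 o t1 = q1' o e'" for q0' q1' e'
  unfolding rel_comp_def using r(3) s(3) t that tg cv_iff by blast
 have self: "(q0, q1) : rel_comp E S R"
  by (rule mem[of _ _ e]) (use q qh rel_span_iff in \<open>auto simp: hom_iff\<close>)
 have "span_class E q0 q1 \<subseteq> rel_comp E S R"
 proof (clarsimp simp: span_class_def)
  fix i assume i: "iso E i" "tgt E i = src E q0"
  have ih: "i : hom E (src E i) Q" using i qh by (auto simp: hom_iff iso_Ar)
  obtain j where j: "j : hom E Q (src E i)" "i o j = idt E Q" "iso E j" by (rule isoE[OF i(1) ih]; blast)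
  have *: "i o (j o e) = (i o j) o e" using ih j(1) q(3) by (simp add: hom_iff)
  show "(q0 o i, q1 o i) : rel_comp E S R"
  proof (rule mem[of _ _ "j o e"])
   show "rel_span E X Z (q0 o i) (q1 o i)" unfolding rel_span_iff using jointly_ff_iso[OF q(1) i(1) ih] by blast
   show "cv (j o e)" by (rule cv_cmp[OF q(2,3) cv_iso[OF j(3)] j(1)])
   show "tgt E (j o e) = src E (q0 o i)" using q(3) j(1) qh ih by (simp add: hom_iff)
   show "r0 o t0 = (q0 o i) o (j o e)" "s1 o t1 = (q1 o i) o (j o e)"
    unfolding q(4,5) using qh ih j(1) q(3) * j(2) by (auto simp: hom_iff)
  qed
 qed
 moreover have "rel_comp E S R \<subseteq> span_class E q0 q1"
 proof (rule subrelI)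
  fix a b assume ab: "(a, b) : rel_comp E S R"
  obtain Q' where Q': "jointly_ff E Q' X Z a b" "a : hom E Q' X" "b : hom E Q' Z" and
   m': "ALL x z. (EX A. EX h:hom E A Q'. x = a o h & z = b o h) \<longleftrightarrow>
   (EX A B a y. x : hom E A X & z : hom E A Z & a : hom E B A & cv a & rel_mem E R (x o a) y & rel_mem E S y (z o a))"
   by (rule rel_comp_span[OF R S ab])
  obtain Q'' where Q'': "jointly_ff E Q'' X Z q0 q1" "q0 : hom E Q'' X" "q1 : hom E Q'' Z" and
   m'': "ALL x z. (EX A. EX h:hom E A Q''. x = q0 o h & z = q1 o h) \<longleftrightarrow>
   (EX A B a y. x : hom E A X & z : hom E A Z & a : hom E B A & cv a & rel_mem E R (x o a) y & rel_mem E S y (z o a))"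
   by (rule rel_comp_span[OF R S self])
  have "rel_mem E (span_class E a b) x z \<longleftrightarrow> rel_mem E (span_class E q0 q1) x z" for x z
   unfolding rel_mem_span_class[OF Q'(2,3)] rel_mem_span_class[OF Q''(2,3)]
   by (rule trans[OF m'[rule_format] m''[rule_format, symmetric]])
  then have "span_class E a b = span_class E q0 q1"
   by (intro rels_eqI[OF rels_spanI[OF Q'(1)] rels_spanI[OF Q''(1)]]) blast+
  then show "(a, b) : span_class E q0 q1" using span_class_self[OF Q'(2,3)] by simp
 qed
 ultimately show thesis using that[OF self] by blast
qed

lemma rel_comp_rels:
 assumes R: "R : rels E X Y" and S: "S : rels E Y Z"
 shows "rel_comp E S R : rels E X Z"
proof -
 obtain q0 q1 where q: "(q0, q1) : rel_comp E S R" "rel_comp E S R = span_class E q0 q1"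
  by (rule rel_comp_aux[OF R S])
 obtain Q where Q: "jointly_ff E Q X Z q0 q1" "q0 : hom E Q X" "q1 : hom E Q Z"
  "ALL x z. (EX A. EX h:hom E A Q. x = q0 o h & z = q1 o h) \<longleftrightarrow>
   (EX A B a y. x : hom E A X & z : hom E A Z & a : hom E B A & cv a & rel_mem E R (x o a) y & rel_mem E S y (z o a))"
  by (rule rel_comp_span[OF R S q(1)])
 show ?thesis unfolding q(2) by (rule rels_spanI[OF Q(1)])
qed

lemma rel_mem_comp:
 assumes R: "R : rels E X Y" and S: "S : rels E Y Z"
 shows "rel_mem E (rel_comp E S R) x z \<longleftrightarrow> (EX A B a y. x : hom E A X & z : hom E A Z & a : hom E B A & cv a &
  rel_mem E R (x o a) y & rel_mem E S y (z o a))"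
proof -
 obtain q0 q1 where q: "(q0, q1) : rel_comp E S R" "rel_comp E S R = span_class E q0 q1"
  by (rule rel_comp_aux[OF R S])
 obtain Q where Q: "jointly_ff E Q X Z q0 q1" "q0 : hom E Q X" "q1 : hom E Q Z"
  "ALL x z. (EX A. EX h:hom E A Q. x = q0 o h & z = q1 o h) \<longleftrightarrow>
   (EX A B a y. x : hom E A X & z : hom E A Z & a : hom E B A & cv a & rel_mem E R (x o a) y & rel_mem E S y (z o a))"
  by (rule rel_comp_span[OF R S q(1)])
 show ?thesis unfolding q(2) rel_mem_span_class[OF Q(2,3)] by (rule Q(4)[rule_format])
qed

end

section \<open>Modules between congruences and the \<open>Pos\<close>-category of left
  adjoints\<close>

context posreg begin

lemma mem_compI:
 assumes R: "R : rels E X Y" and S: "S : rels E Y Z" and m: "rel_mem E R x y" "rel_mem E S y z"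
 shows "rel_mem E (rel_comp E S R) x z"
proof -
 obtain A where A: "x : hom E A X" "y : hom E A Y" using mem_hom[OF R m(1)] by blast
 obtain B where B: "y : hom E B Y" "z : hom E B Z" using mem_hom[OF S m(2)] by blast
 have B': "B = A" using A B by (simp add: hom_iff)
 have "x o idt E A = x" "z o idt E A = z" "A : Ob E" using A B B' by (auto simp: hom_iff)
 then show ?thesis unfolding rel_mem_comp[OF R S]
  by (intro exI[of _ A] exI[of _ "idt E A"] exI[of _ y] conjI)
   (simp_all add: A(1) B(2)[unfolded B'] m cv_idt idt_hom)
qed

lemma mem_compE:
 assumes R: "R : rels E X Y" and S: "S : rels E Y Z" and m: "rel_mem E (rel_comp E S R) x z"
 obtains A B a y where "x : hom E A X" "z : hom E A Z" "a : hom E B A" "cv a"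
  "y : hom E B Y" "rel_mem E R (x o a) y" "rel_mem E S y (z o a)"
proof -
 obtain A B a y where *: "x : hom E A X" "z : hom E A Z" "a : hom E B A" "cv a"
   "rel_mem E R (x o a) y" "rel_mem E S y (z o a)"
  using m unfolding rel_mem_comp[OF R S] by blast
 obtain D where "x o a : hom E D X" "y : hom E D Y" using mem_hom[OF R *(5)] by blast
 then have "y : hom E B Y" using *(1,3) by (simp add: hom_iff)
 then show thesis by (rule that[OF *(1-4) _ *(5,6)])
qed

text \<open>The cover hidden in the composite is removed by locality of \<open>T\<close>; an
  inclusion out of a composite thus becomes a plain entailment.\<close>

lemma rel_comp_leI:
 assumes R: "R : rels E X Y" and S: "S : rels E Y Z" and T: "T : rels E X Z"
  and RST: "!!x y z. rel_mem E R x y ==> rel_mem E S y z ==> rel_mem E T x z"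
  and m: "rel_mem E (rel_comp E S R) x z"
 shows "rel_mem E T x z"
proof -
 obtain A B a y where *: "x : hom E A X" "z : hom E A Z" "a : hom E B A" "cv a"
   "rel_mem E R (x o a) y" "rel_mem E S y (z o a)"
  by (rule mem_compE[OF R S m])
 show ?thesis by (rule mem_local[OF T *(4,3,1,2)]) (rule RST[OF *(5,6)])
qed

lemma rel_comp_assoc:
 assumes R: "R : rels E X Y" and S: "S : rels E Y Z" and T: "T : rels E Z W"
 shows "rel_comp E T (rel_comp E S R) = rel_comp E (rel_comp E T S) R"
proof -
 note c = rel_comp_rels[OF R S] rel_comp_rels[OF S T]
 note d = rel_comp_rels[OF c(1) T] rel_comp_rels[OF R c(2)]
 show ?thesis
 proof (rule rels_eqI[OF d])
  fix x w assume "rel_mem E (rel_comp E T (rel_comp E S R)) x w"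
  then show "rel_mem E (rel_comp E (rel_comp E T S) R) x w"
  proof (rule rel_comp_leI[OF c(1) T d(2), rotated])
   fix x z w assume m: "rel_mem E (rel_comp E S R) x z" and t: "rel_mem E T z w"
   obtain A B a y where *: "x : hom E A X" "z : hom E A Z" "a : hom E B A" "cv a"
     "y : hom E B Y" "rel_mem E R (x o a) y" "rel_mem E S y (z o a)"
    by (rule mem_compE[OF R S m])
   have "w : hom E A W" using mem_hom[OF T t] *(2) by (auto simp: hom_iff)
   moreover have "rel_mem E T (z o a) (w o a)" by (rule mem_stable[OF T t *(3,2)])
   ultimately show "rel_mem E (rel_comp E (rel_comp E T S) R) x w"
    using mem_local[OF d(2) *(4,3,1)] mem_compI[OF R c(2) *(6) mem_compI[OF S T *(7)]] by blast
  qed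
 next
  fix x w assume "rel_mem E (rel_comp E (rel_comp E T S) R) x w"
  then show "rel_mem E (rel_comp E T (rel_comp E S R)) x w"
  proof (rule rel_comp_leI[OF R c(2) d(1), rotated])
   fix x y w assume r: "rel_mem E R x y" and m: "rel_mem E (rel_comp E T S) y w"
   obtain A B a z where *: "y : hom E A Y" "w : hom E A W" "a : hom E B A" "cv a"
     "z : hom E B Z" "rel_mem E S (y o a) z" "rel_mem E T z (w o a)"
    by (rule mem_compE[OF S T m])
   have x: "x : hom E A X" using mem_hom[OF R r] *(1) by (auto simp: hom_iff)
   moreover have "rel_mem E R (x o a) (y o a)" by (rule mem_stable[OF R r *(3) x])
   ultimately show "rel_mem E (rel_comp E T (rel_comp E S R)) x w"
    using mem_local[OF d(1) *(4,3) x *(2)] mem_compI[OF c(1) T mem_compI[OF R S _ *(6)] *(7)] by blast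
  qed
 qed
qed

lemma congruenceD:
 assumes "congruence E p"
 shows "fst p : Ob E" "snd p : rels E (fst p) (fst p)"
  "!!A x. x : hom E A (fst p) ==> rel_mem E (snd p) x x"
  "!!x y z. rel_mem E (snd p) x y ==> rel_mem E (snd p) y z ==> rel_mem E (snd p) x z"
  "!!x' x y y'. x' \<preceq> x ==> rel_mem E (snd p) x y ==> y \<preceq> y' ==> rel_mem E (snd p) x' y'"
proof -
 have *: "fst p : Ob E" "snd p : rels E (fst p) (fst p)" "weakening_closed E (snd p)"
   "rel_refl E (fst p) (snd p)" "rel_trans E (snd p)"
  using assms unfolding congruence_def case_prod_unfold by blast+
 show "fst p : Ob E" "snd p : rels E (fst p) (fst p)" by fact+
 show "!!A x. x : hom E A (fst p) ==> rel_mem E (snd p) x x" using *(4) unfolding rel_refl_def by blast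
 show "!!x y z. rel_mem E (snd p) x y ==> rel_mem E (snd p) y z ==> rel_mem E (snd p) x z"
  using *(5) unfolding rel_trans_def by blast
 show "!!x' x y y'. x' \<preceq> x ==> rel_mem E (snd p) x y ==> y \<preceq> y' ==> rel_mem E (snd p) x' y'"
  using *(3) unfolding weakening_closed_def by blast
qed

lemma lax_moduleD:
 assumes "lax_module E p q \<Phi>"
 shows "\<Phi> : rels E (fst p) (fst q)"
  "rel_mem E (snd p) x' x ==> rel_mem E \<Phi> x y ==> rel_mem E (snd q) y y' ==> rel_mem E \<Phi> x' y'"
 using assms unfolding lax_module_def by blast+

lemma lax_module_left:
 assumes "congruence E q" "lax_module E p q \<Phi>" "rel_mem E (snd p) x' x" "rel_mem E \<Phi> x y"
 shows "rel_mem E \<Phi> x' y"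
proof -
 obtain A where "y : hom E A (fst q)" using mem_hom[OF lax_moduleD(1)[OF assms(2)] assms(4)] by blast
 then show ?thesis by (rule lax_moduleD(2)[OF assms(2-4) congruenceD(3)[OF assms(1)]])
qed

lemma lax_module_right:
 assumes "congruence E p" "lax_module E p q \<Phi>" "rel_mem E \<Phi> x y" "rel_mem E (snd q) y y'"
 shows "rel_mem E \<Phi> x y'"
proof -
 obtain A where "x : hom E A (fst p)" using mem_hom[OF lax_moduleD(1)[OF assms(2)] assms(3)] by blast
 then show ?thesis by (rule lax_moduleD(2)[OF assms(2) congruenceD(3)[OF assms(1)] assms(3,4)])
qed

lemma lax_moduleI:
 assumes p: "congruence E p" and q: "congruence E q" and \<Phi>: "\<Phi> : rels E (fst p) (fst q)"
  and 1: "!!x' x y. rel_mem E (snd p) x' x ==> rel_mem E \<Phi> x y ==> rel_mem E \<Phi> x' y"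
  and 2: "!!x y y'. rel_mem E \<Phi> x y ==> rel_mem E (snd q) y y' ==> rel_mem E \<Phi> x y'"
 shows "lax_module E p q \<Phi>"
 unfolding lax_module_def using \<Phi> 1 2 by blast

lemma lax_module_iff:
 assumes p: "congruence E p" and q: "congruence E q"
 shows "lax_module E p q \<Phi> \<longleftrightarrow> \<Phi> : rels E (fst p) (fst q) & rel_comp E (snd q) (rel_comp E \<Phi> (snd p)) = \<Phi>"
proof
 assume m: "lax_module E p q \<Phi>"
 note \<Phi> = lax_moduleD(1)[OF m] and R = congruenceD(2)[OF p] and S = congruenceD(2)[OF q]
 note c = rel_comp_rels[OF R \<Phi>]
 have "rel_comp E (snd q) (rel_comp E \<Phi> (snd p)) = \<Phi>"
 proof (rule rels_eqI[OF rel_comp_rels[OF c S] \<Phi>])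
  fix x y assume "rel_mem E (rel_comp E (snd q) (rel_comp E \<Phi> (snd p))) x y"
  then show "rel_mem E \<Phi> x y"
  proof (rule rel_comp_leI[OF c S \<Phi>, rotated])
   fix x y z assume "rel_mem E (rel_comp E \<Phi> (snd p)) x y" and s: "rel_mem E (snd q) y z"
   then have "rel_mem E \<Phi> x y"
    by (rule_tac rel_comp_leI[OF R \<Phi> \<Phi> lax_module_left[OF q m]])
   then show "rel_mem E \<Phi> x z" using lax_module_right[OF p m] s by blast
  qed
 next
  fix x y assume *: "rel_mem E \<Phi> x y"
  then obtain A where "x : hom E A (fst p)" "y : hom E A (fst q)" using mem_hom[OF \<Phi>] by blast
  then show "rel_mem E (rel_comp E (snd q) (rel_comp E \<Phi> (snd p))) x y"
   using mem_compI[OF c S mem_compI[OF R \<Phi>]] * congruenceD(3)[OF p] congruenceD(3)[OF q] by blast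
 qed
 then show "\<Phi> : rels E (fst p) (fst q) & rel_comp E (snd q) (rel_comp E \<Phi> (snd p)) = \<Phi>" using \<Phi> by simp
next
 assume *: "\<Phi> : rels E (fst p) (fst q) & rel_comp E (snd q) (rel_comp E \<Phi> (snd p)) = \<Phi>"
 note \<Phi> = conjunct1[OF *] and R = congruenceD(2)[OF p] and S = congruenceD(2)[OF q]
 have "rel_mem E \<Phi> x' y'" if "rel_mem E (snd p) x' x" "rel_mem E \<Phi> x y" "rel_mem E (snd q) y y'" for x' x y y'
  using mem_compI[OF rel_comp_rels[OF R \<Phi>] S mem_compI[OF R \<Phi> that(1,2)] that(3)] * by simp
 then show "lax_module E p q \<Phi>" unfolding lax_module_def using \<Phi> by blast
qed

lemma Qw_arrows_iff: "(p, q, \<Phi>) : Qw_arrows E \<longleftrightarrow> congruence E p & congruence E q & lax_module E p q \<Phi>"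
proof -
 have "(p, q, \<Phi>) : Qw_arrows E \<longleftrightarrow> congruence E p & congruence E q &
   \<Phi> : rels E (fst p) (fst q) & rel_comp E (snd q) (rel_comp E \<Phi> (snd p)) = \<Phi>"
  unfolding Qw_arrows_def by (cases p; cases q) auto
 then show ?thesis using lax_module_iff by blast
qed

lemma lax_module_comp:
 assumes p: "congruence E p" and q: "congruence E q" and r: "congruence E r"
  and \<Phi>: "lax_module E p q \<Phi>" and \<Psi>: "lax_module E q r \<Psi>"
 shows "lax_module E p r (rel_comp E \<Psi> \<Phi>)"
proof -
 note f = lax_moduleD(1)[OF \<Phi>] and g = lax_moduleD(1)[OF \<Psi>]
 note c = rel_comp_rels[OF f g]
 show ?thesis
 proof (rule lax_moduleI[OF p r c])
  fix x' x z assume x: "rel_mem E (snd p) x' x" and m: "rel_mem E (rel_comp E \<Psi> \<Phi>) x z"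
  obtain A B a y where *: "x : hom E A (fst p)" "z : hom E A (fst r)" "a : hom E B A" "cv a"
    "rel_mem E \<Phi> (x o a) y" "rel_mem E \<Psi> y (z o a)" by (rule mem_compE[OF f g m])
  have x': "x' : hom E A (fst p)" using mem_hom[OF congruenceD(2)[OF p] x] *(1) by (auto simp: hom_iff)
  have "rel_mem E (snd p) (x' o a) (x o a)" by (rule mem_stable[OF congruenceD(2)[OF p] x *(3) x'])
  then have "rel_mem E (rel_comp E \<Psi> \<Phi>) (x' o a) (z o a)"
   using mem_compI[OF f g lax_module_left[OF q \<Phi> _ *(5)] *(6)] by blast
  then show "rel_mem E (rel_comp E \<Psi> \<Phi>) x' z" by (rule mem_local[OF c *(4,3) x' *(2)])
 next
  fix x z z' assume m: "rel_mem E (rel_comp E \<Psi> \<Phi>) x z" and z: "rel_mem E (snd r) z z'"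
  obtain A B a y where *: "x : hom E A (fst p)" "z : hom E A (fst r)" "a : hom E B A" "cv a"
    "rel_mem E \<Phi> (x o a) y" "rel_mem E \<Psi> y (z o a)" by (rule mem_compE[OF f g m])
  have z': "z' : hom E A (fst r)" using mem_hom[OF congruenceD(2)[OF r] z] *(2) by (auto simp: hom_iff)
  have "rel_mem E (snd r) (z o a) (z' o a)" by (rule mem_stable[OF congruenceD(2)[OF r] z *(3,2)])
  then have "rel_mem E (rel_comp E \<Psi> \<Phi>) (x o a) (z' o a)"
   using mem_compI[OF f g *(5) lax_module_right[OF q \<Psi> *(6)]] by blast
  then show "rel_mem E (rel_comp E \<Psi> \<Phi>) x z'" by (rule mem_local[OF c *(4,3,1) z'])
 qed
qed

lemma lax_module_id: "congruence E p ==> lax_module E p p (snd p)"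
 using congruenceD by (intro lax_moduleI) blast+

lemma lax_module_comp_id:
 assumes p: "congruence E p" and q: "congruence E q" and m: "lax_module E p q \<Phi>"
 shows "rel_comp E \<Phi> (snd p) = \<Phi>" "rel_comp E (snd q) \<Phi> = \<Phi>"
proof -
 note f = lax_moduleD(1)[OF m] and R = congruenceD(2)[OF p] and S = congruenceD(2)[OF q]
 show "rel_comp E \<Phi> (snd p) = \<Phi>"
 proof (rule rels_eqI[OF rel_comp_rels[OF R f] f])
  fix x y assume "rel_mem E (rel_comp E \<Phi> (snd p)) x y"
  then show "rel_mem E \<Phi> x y" by (rule rel_comp_leI[OF R f f, rotated]) (rule lax_module_left[OF q m])
 next
  fix x y assume *: "rel_mem E \<Phi> x y"
  then obtain A where "x : hom E A (fst p)" using mem_hom[OF f] by blast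
  then show "rel_mem E (rel_comp E \<Phi> (snd p)) x y" by (rule mem_compI[OF R f congruenceD(3)[OF p] *])
 qed
 show "rel_comp E (snd q) \<Phi> = \<Phi>"
 proof (rule rels_eqI[OF rel_comp_rels[OF f S] f])
  fix x y assume "rel_mem E (rel_comp E (snd q) \<Phi>) x y"
  then show "rel_mem E \<Phi> x y" by (rule rel_comp_leI[OF f S f, rotated]) (rule lax_module_right[OF p m])
 next
  fix x y assume *: "rel_mem E \<Phi> x y"
  then obtain A where "y : hom E A (fst q)" using mem_hom[OF f] by blast
  then show "rel_mem E (rel_comp E (snd q) \<Phi>) x y" by (rule mem_compI[OF f S * congruenceD(3)[OF q]])
 qed
qed

definition left_adjoint :: "'o \<times> 'm rel => 'o \<times> 'm rel => 'm rel => bool" where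
 "left_adjoint p q \<Phi> \<longleftrightarrow> congruence E p & congruence E q & (EX \<Psi>. adjoint_modules E cv p q \<Phi> \<Psi>)"

lemma Qw_simps: "Ob (Qw E) = Collect (congruence E)" "Ar (Qw E) = Qw_arrows E"
  "src (Qw E) (p, q, \<Phi>) = p" "tgt (Qw E) (p, q, \<Phi>) = q" "idt (Qw E) p = (p, p, snd p)"
  "cmp (Qw E) (q', r, \<Psi>) (p, q, \<Phi>) = (p, r, rel_comp E \<Psi> \<Phi>)"
  "leq (Qw E) (p, q, \<Phi>) (p', q', \<Phi>') \<longleftrightarrow> (p, q, \<Phi>) : Qw_arrows E & (p', q', \<Phi>') : Qw_arrows E & p = p' & q = q' & rel_incl E \<Phi> \<Phi>'"
 by (auto simp: Qw_def)

lemma has_right_adjoint_iff: "has_right_adjoint (Qw E) (p, q, \<Phi>) \<longleftrightarrow> left_adjoint p q \<Phi>"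
proof -
 have "adjoint_modules E cv p q \<Phi> \<Psi> \<longleftrightarrow>
   (p, p, snd p) \<preceq>\<^bsub>Qw E\<^esub> (p, p, rel_comp E \<Psi> \<Phi>) & (q, q, rel_comp E \<Phi> \<Psi>) \<preceq>\<^bsub>Qw E\<^esub> (q, q, snd q)"
  if p: "congruence E p" and q: "congruence E q" and \<Phi>: "lax_module E p q \<Phi>" and \<Psi>: "lax_module E q p \<Psi>" for \<Psi>
 proof -
  note f = lax_moduleD(1)[OF \<Phi>] and g = lax_moduleD(1)[OF \<Psi>]
  note R = congruenceD(2)[OF p] and S = congruenceD(2)[OF q]
  have 1: "(p, p, snd p) \<preceq>\<^bsub>Qw E\<^esub> (p, p, rel_comp E \<Psi> \<Phi>) \<longleftrightarrow> (ALL x y. rel_mem E (snd p) x y --> rel_mem E (rel_comp E \<Psi> \<Phi>) x y)"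
   using p lax_module_id[OF p] lax_module_comp[OF p q p \<Phi> \<Psi>] rel_incl_iff[OF R rel_comp_rels[OF f g]]
   by (simp add: Qw_simps Qw_arrows_iff)
  have 2: "(q, q, rel_comp E \<Phi> \<Psi>) \<preceq>\<^bsub>Qw E\<^esub> (q, q, snd q) \<longleftrightarrow> (ALL x y. rel_mem E (rel_comp E \<Phi> \<Psi>) x y --> rel_mem E (snd q) x y)"
   using q lax_module_id[OF q] lax_module_comp[OF q p q \<Psi> \<Phi>] rel_incl_iff[OF rel_comp_rels[OF g f] S]
   by (simp add: Qw_simps Qw_arrows_iff)
  have 3: "(ALL x y. rel_mem E (rel_comp E \<Phi> \<Psi>) x y --> rel_mem E (snd q) x y) \<longleftrightarrow>
    (ALL y x y'. rel_mem E \<Psi> y x --> rel_mem E \<Phi> x y' --> rel_mem E (snd q) y y')"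
   using mem_compI[OF g f] rel_comp_leI[OF g f S] by blast
  \<comment> \<open>The unit on the diagonal is enough: for \<open>x\<close> related to
    \<open>y\<close>, the right action on \<open>\<Psi>\<close> turns the witness for
    \<open>(x, x)\<close> into one for \<open>(x, y)\<close>.\<close>
  have 4: "(ALL x y. rel_mem E (snd p) x y --> rel_mem E (rel_comp E \<Psi> \<Phi>) x y) \<longleftrightarrow>
    (ALL A. ALL x:hom E A (fst p). EX B. EX a:hom E B A. EX y. cv a & rel_mem E \<Phi> (x o a) y & rel_mem E \<Psi> y (x o a))" (is "?l \<longleftrightarrow> ?r")
  proof
   assume l: ?l
   show ?r
   proof (intro allI ballI)
    fix A x assume x: "x : hom E A (fst p)"
    then have m: "rel_mem E (rel_comp E \<Psi> \<Phi>) x x" using l congruenceD(3)[OF p x] by blast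
    obtain A' B a y where *: "x : hom E A' (fst p)" "x : hom E A' (fst p)" "a : hom E B A'" "cv a"
     "rel_mem E \<Phi> (x o a) y" "rel_mem E \<Psi> y (x o a)" by (rule mem_compE[OF f g m])
    then have "A' = A" using x by (auto simp: hom_iff)
    then show "EX B. EX a:hom E B A. EX y. cv a & rel_mem E \<Phi> (x o a) y & rel_mem E \<Psi> y (x o a)" using * by blast
   qed
  next
   assume r: ?r
   show ?l
   proof (intro allI impI)
    fix x y assume m: "rel_mem E (snd p) x y"
    then obtain A where A: "x : hom E A (fst p)" "y : hom E A (fst p)" using mem_hom[OF R] by blast
    then obtain B a z where a: "a : hom E B A" "cv a" "rel_mem E \<Phi> (x o a) z" "rel_mem E \<Psi> z (x o a)" using r by blast
    have "rel_mem E (snd p) (x o a) (y o a)" by (rule mem_stable[OF R m a(1) A(1)])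
    then have "rel_mem E \<Psi> z (y o a)" using lax_module_right[OF q \<Psi> a(4)] by blast
    then have "rel_mem E (rel_comp E \<Psi> \<Phi>) (x o a) (y o a)" by (rule mem_compI[OF f g a(3)])
    then show "rel_mem E (rel_comp E \<Psi> \<Phi>) x y" by (rule mem_local[OF rel_comp_rels[OF f g] a(2,1) A])
   qed
  qed
  show ?thesis unfolding adjoint_modules_def 1 2 3 4 using \<Phi> \<Psi> by blast
 qed
 note * = this
 have "has_right_adjoint (Qw E) (p, q, \<Phi>) \<longleftrightarrow> congruence E p & congruence E q & lax_module E p q \<Phi> &
   (EX \<Psi>. lax_module E q p \<Psi> & (p, p, snd p) \<preceq>\<^bsub>Qw E\<^esub> (p, p, rel_comp E \<Psi> \<Phi>) & (q, q, rel_comp E \<Phi> \<Psi>) \<preceq>\<^bsub>Qw E\<^esub> (q, q, snd q))"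
  (is "_ = ?r")
 proof
  assume "has_right_adjoint (Qw E) (p, q, \<Phi>)"
  then obtain g where g: "(p, q, \<Phi>) : Qw_arrows E" "g : hom (Qw E) q p"
   "(p, p, snd p) \<preceq>\<^bsub>Qw E\<^esub> g o\<^bsub>Qw E\<^esub> (p, q, \<Phi>)" "(p, q, \<Phi>) o\<^bsub>Qw E\<^esub> g \<preceq>\<^bsub>Qw E\<^esub> (q, q, snd q)"
   unfolding has_right_adjoint_def Qw_simps by blast
  then obtain \<Psi> where "g = (q, p, \<Psi>)" "(q, p, \<Psi>) : Qw_arrows E" by (cases g) (auto simp: hom_iff Qw_simps)
  then show ?r using g by (auto simp: Qw_arrows_iff Qw_simps(6))
 next
  assume ?r
  then obtain \<Psi> where "(p, q, \<Phi>) : Qw_arrows E" "(q, p, \<Psi>) : hom (Qw E) q p"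
    "(p, p, snd p) \<preceq>\<^bsub>Qw E\<^esub> (q, p, \<Psi>) o\<^bsub>Qw E\<^esub> (p, q, \<Phi>)" "(p, q, \<Phi>) o\<^bsub>Qw E\<^esub> (q, p, \<Psi>) \<preceq>\<^bsub>Qw E\<^esub> (q, q, snd q)"
   by (auto simp: hom_iff Qw_arrows_iff Qw_simps(1-6))
  then show "has_right_adjoint (Qw E) (p, q, \<Phi>)" unfolding has_right_adjoint_def Qw_simps(1-5) by blast
 qed
 also have "\<dots> \<longleftrightarrow> left_adjoint p q \<Phi>"
  unfolding left_adjoint_def using * unfolding adjoint_modules_def[of E cv p q \<Phi>] by blast
 finally show ?thesis .
qed

lemma left_adjointD:
 assumes "left_adjoint p q \<Phi>"
 shows "congruence E p" "congruence E q" "lax_module E p q \<Phi>" "\<Phi> : rels E (fst p) (fst q)"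
 using assms lax_moduleD(1) unfolding left_adjoint_def adjoint_modules_def by blast+

lemma ex_reg_simps: "Ob (ex_reg E) = Collect (congruence E)"
  "(p, q, \<Phi>) : Ar (ex_reg E) \<longleftrightarrow> left_adjoint p q \<Phi>"
  "src (ex_reg E) (p, q, \<Phi>) = p" "tgt (ex_reg E) (p, q, \<Phi>) = q" "idt (ex_reg E) p = (p, p, snd p)"
  "cmp (ex_reg E) (q', r, \<Psi>) (p, q, \<Phi>) = (p, r, rel_comp E \<Psi> \<Phi>)"
 by (auto simp: ex_reg_def has_right_adjoint_iff Qw_simps)

lemma ex_reg_leq: "(p, q, \<Phi>) \<preceq>\<^bsub>ex_reg E\<^esub> (p', q', \<Phi>') \<longleftrightarrow> left_adjoint p q \<Phi> & left_adjoint p' q' \<Phi>' & p = p' & q = q' &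
   (ALL x y. rel_mem E \<Phi>' x y --> rel_mem E \<Phi> x y)"
proof -
 have "(p, q, \<Phi>) \<preceq>\<^bsub>ex_reg E\<^esub> (p', q', \<Phi>') \<longleftrightarrow> left_adjoint p q \<Phi> & left_adjoint p' q' \<Phi>' & p = p' & q = q' &
   rel_incl E \<Phi>' \<Phi>"
  by (auto simp: ex_reg_def has_right_adjoint_iff Qw_simps Qw_arrows_iff dest: left_adjointD(1-3))
 also have "\<dots> \<longleftrightarrow> left_adjoint p q \<Phi> & left_adjoint p' q' \<Phi>' & p = p' & q = q' & (ALL x y. rel_mem E \<Phi>' x y --> rel_mem E \<Phi> x y)"
  by (auto simp: rel_incl_iff[OF left_adjointD(4) left_adjointD(4)])
 finally show ?thesis .
qed

lemma hom_ex_reg: "f : hom (ex_reg E) p q \<longleftrightarrow> (EX \<Phi>. f = (p, q, \<Phi>) & left_adjoint p q \<Phi>)"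
 by (cases f) (auto simp: hom_iff ex_reg_simps)

lemma left_adjoint_id: 
 assumes p: "congruence E p" shows "left_adjoint p p (snd p)"
proof -
 have "EX B. EX a:hom E B A. EX y. cv a & rel_mem E (snd p) (x o a) y & rel_mem E (snd p) y (x o a)"
  if x: "x : hom E A (fst p)" for A x
 proof -
  have "A : Ob E" "x o idt E A = x" using x by (auto simp: hom_iff)
  then show ?thesis using congruenceD(3)[OF p x] cv_idt idt_hom
   by (intro exI[of _ A] bexI[of _ "idt E A"] exI[of _ x]) auto
 qed
 then have "adjoint_modules E cv p p (snd p) (snd p)"
  unfolding adjoint_modules_def using lax_module_id[OF p] congruenceD(4)[OF p] by blast
 then show ?thesis unfolding left_adjoint_def using p by blast
qed

lemma left_adjoint_comp:
 assumes f: "left_adjoint p q \<Phi>" and g: "left_adjoint q r \<Psi>"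
 shows "left_adjoint p r (rel_comp E \<Psi> \<Phi>)"
proof -
 note c = left_adjointD(1,2)[OF f] left_adjointD(2)[OF g]
 obtain \<Phi>' where \<Phi>': "adjoint_modules E cv p q \<Phi> \<Phi>'" using f unfolding left_adjoint_def by blast
 obtain \<Psi>' where \<Psi>': "adjoint_modules E cv q r \<Psi> \<Psi>'" using g unfolding left_adjoint_def by blast
 have m: "lax_module E p q \<Phi>" "lax_module E q p \<Phi>'" "lax_module E q r \<Psi>" "lax_module E r q \<Psi>'"
  using \<Phi>' \<Psi>' unfolding adjoint_modules_def by blast+
 note R = m[THEN lax_moduleD(1)]
 have \<Phi>2: "rel_mem E (snd q) y y'" if "rel_mem E \<Phi>' y x" "rel_mem E \<Phi> x y'" for y x y'
  using \<Phi>' that unfolding adjoint_modules_def by blast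
 have \<Psi>2: "rel_mem E (snd r) z z'" if "rel_mem E \<Psi>' z y" "rel_mem E \<Psi> y z'" for z y z'
  using \<Psi>' that unfolding adjoint_modules_def by blast
 have "EX B. EX a:hom E B A. EX z. cv a & rel_mem E (rel_comp E \<Psi> \<Phi>) (x o a) z & rel_mem E (rel_comp E \<Phi>' \<Psi>') z (x o a)"
  if x: "x : hom E A (fst p)" for A x
 proof -
  obtain B a y where a: "a : hom E B A" "cv a" "rel_mem E \<Phi> (x o a) y" "rel_mem E \<Phi>' y (x o a)"
   using \<Phi>' x unfolding adjoint_modules_def by blast
  have xa: "x o a : hom E B (fst p)" using x a by (simp add: hom_iff)
  then have y: "y : hom E B (fst q)" using mem_hom[OF R(1) a(3)] by (auto simp: hom_iff)
  then obtain B' b z where b: "b : hom E B' B" "cv b" "rel_mem E \<Psi> (y o b) z" "rel_mem E \<Psi>' z (y o b)"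
   using \<Psi>' unfolding adjoint_modules_def by blast
  have e: "(x o a) o b = x o (a o b)" using x a b by (simp add: hom_iff)
  have "rel_mem E \<Phi> (x o (a o b)) (y o b)" "rel_mem E \<Phi>' (y o b) (x o (a o b))"
   using mem_stable[OF R(1) a(3) b(1) xa] mem_stable[OF R(2) a(4) b(1) y] e by auto
  then have "rel_mem E (rel_comp E \<Psi> \<Phi>) (x o (a o b)) z" "rel_mem E (rel_comp E \<Phi>' \<Psi>') z (x o (a o b))"
   using mem_compI[OF R(1) R(3) _ b(3)] mem_compI[OF R(4) R(2) b(4)] by auto
  moreover have "cv (a o b)" using cv_cmp[OF b(2,1) a(2,1)] .
  moreover have "a o b : hom E B' A" using a b by (simp add: hom_iff)
  ultimately show ?thesis by blast
 qed
 moreover have "rel_mem E (snd r) z z'"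
  if z: "rel_mem E (rel_comp E \<Phi>' \<Psi>') z x" "rel_mem E (rel_comp E \<Psi> \<Phi>) x z'" for z x z'
 proof -
  have S: "snd r : rels E (fst r) (fst r)" by (rule congruenceD(2)[OF c(3)])
  \<comment> \<open>Associativity brings \<open>\<Phi>\<close> next to \<open>\<Phi>'\<close>. Their
    counit lands in the congruence of \<open>q\<close>, which \<open>\<Psi>'\<close> absorbs; what
    remains is the counit of \<open>\<Psi>\<close>.\<close>
  have "rel_mem E (rel_comp E \<Psi> (rel_comp E \<Phi> (rel_comp E \<Phi>' \<Psi>'))) z z'"
   unfolding rel_comp_assoc[OF rel_comp_rels[OF R(4,2)] R(1,3)]
   by (rule mem_compI[OF rel_comp_rels[OF R(4,2)] rel_comp_rels[OF R(1,3)] z])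
  then have "rel_mem E (rel_comp E \<Psi> (rel_comp E (rel_comp E \<Phi> \<Phi>') \<Psi>')) z z'"
   unfolding rel_comp_assoc[OF R(4,2,1)] .
  then show ?thesis
  proof (rule rel_comp_leI[OF rel_comp_rels[OF R(4) rel_comp_rels[OF R(2,1)]] R(3) S, rotated])
   fix w y z assume 1: "rel_mem E (rel_comp E (rel_comp E \<Phi> \<Phi>') \<Psi>') w y" and 2: "rel_mem E \<Psi> y z"
   have "rel_mem E \<Psi>' w y"
    using 1
   proof (rule rel_comp_leI[OF R(4) rel_comp_rels[OF R(2,1)] R(4), rotated])
    fix w y y' assume w: "rel_mem E \<Psi>' w y" and y: "rel_mem E (rel_comp E \<Phi> \<Phi>') y y'"
    have "rel_mem E (snd q) y y'"
     by (rule rel_comp_leI[OF R(2,1) congruenceD(2)[OF c(2)] \<Phi>2 y])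
    then show "rel_mem E \<Psi>' w y'" using lax_module_right[OF c(3) m(4) w] by blast
   qed
   then show "rel_mem E (snd r) w z" using 2 by (rule \<Psi>2)
  qed
 qed
 ultimately have "adjoint_modules E cv p r (rel_comp E \<Psi> \<Phi>) (rel_comp E \<Phi>' \<Psi>')"
  unfolding adjoint_modules_def using lax_module_comp[OF c(1,2,3) m(1,3)] lax_module_comp[OF c(3,2,1) m(4,2)] by blast
 then show ?thesis unfolding left_adjoint_def using c by blast
qed

lemma pos_category_ex_reg: "pos_category (ex_reg E)"
proof (unfold_locales, goal_cases)
 case (1 f) then show ?case using left_adjointD by (cases f) (auto simp: ex_reg_simps)
next
 case (2 f) then show ?case using left_adjointD by (cases f) (auto simp: ex_reg_simps)
next
 case (3 X) then show ?case by (auto simp: hom_ex_reg ex_reg_simps left_adjoint_id)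
next
 case (4 f X Y g Z) then show ?case by (auto simp: hom_ex_reg ex_reg_simps left_adjoint_comp)
next
 case (5 f X Y)
 then obtain \<Phi> where f: "f = (X, Y, \<Phi>)" "left_adjoint X Y \<Phi>" unfolding hom_ex_reg by blast
 show ?case unfolding f(1) ex_reg_simps lax_module_comp_id(2)[OF left_adjointD(1-3)[OF f(2)]] ..
next
 case (6 f X Y)
 then obtain \<Phi> where f: "f = (X, Y, \<Phi>)" "left_adjoint X Y \<Phi>" unfolding hom_ex_reg by blast
 show ?case unfolding f(1) ex_reg_simps lax_module_comp_id(1)[OF left_adjointD(1-3)[OF f(2)]] ..
next
 case (7 f W X g Y h Z)
 then obtain \<Phi> \<Psi> \<Theta> where f: "f = (W, X, \<Phi>)" "left_adjoint W X \<Phi>" "g = (X, Y, \<Psi>)" "left_adjoint X Y \<Psi>"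
   "h = (Y, Z, \<Theta>)" "left_adjoint Y Z \<Theta>" unfolding hom_ex_reg by blast
 show ?case unfolding f(1,3,5) ex_reg_simps
   rel_comp_assoc[OF left_adjointD(4)[OF f(2)] left_adjointD(4)[OF f(4)] left_adjointD(4)[OF f(6)]] ..
next
 case (8 f g) then show ?case by (cases f; cases g) (auto simp: hom_ex_reg ex_reg_leq)
next
 case (9 f) then show ?case by (cases f) (auto simp: ex_reg_simps ex_reg_leq)
next
 case (10 f g h) then show ?case by (cases f; cases g; cases h) (auto simp: ex_reg_leq)
next
 case (11 f g)
 obtain p q \<Phi> p' q' \<Psi> where fg: "f = (p, q, \<Phi>)" "g = (p', q', \<Psi>)" by (cases f; cases g) blast
 have "left_adjoint p q \<Phi>" "left_adjoint p q \<Psi>" "p' = p" "q' = q" "ALL x y. rel_mem E \<Phi> x y \<longleftrightarrow> rel_mem E \<Psi> x y"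
  using 11 unfolding fg ex_reg_leq by auto
 then show ?case unfolding fg using rels_eqI[OF left_adjointD(4) left_adjointD(4), of p q \<Phi> \<Psi>] by blast
next
 case (12 f X Y g Z f' g')
 obtain \<Phi> \<Psi> where f: "f = (X, Y, \<Phi>)" "left_adjoint X Y \<Phi>" and g: "g = (Y, Z, \<Psi>)" "left_adjoint Y Z \<Psi>"
  using 12(1,2) by (auto simp: hom_ex_reg)
 obtain \<Phi>' where f': "f' = (X, Y, \<Phi>')" "left_adjoint X Y \<Phi>'" "ALL x y. rel_mem E \<Phi>' x y --> rel_mem E \<Phi> x y"
  using 12(3) by (cases f') (auto simp: f ex_reg_leq)
 obtain \<Psi>' where g': "g' = (Y, Z, \<Psi>')" "left_adjoint Y Z \<Psi>'" "ALL x y. rel_mem E \<Psi>' x y --> rel_mem E \<Psi> x y"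
  using 12(4) by (cases g') (auto simp: g ex_reg_leq)
 note R = left_adjointD(4)[OF f(2)] left_adjointD(4)[OF g(2)] left_adjointD(4)[OF f'(2)] left_adjointD(4)[OF g'(2)]
 have "rel_mem E (rel_comp E \<Psi> \<Phi>) x z" if "rel_mem E (rel_comp E \<Psi>' \<Phi>') x z" for x z
 proof (rule rel_comp_leI[OF R(3,4) rel_comp_rels[OF R(1,2)] _ that])
  fix x y z assume "rel_mem E \<Phi>' x y" "rel_mem E \<Psi>' y z"
  then show "rel_mem E (rel_comp E \<Psi> \<Phi>) x z" using f'(3) g'(3) by (intro mem_compI[OF R(1,2)]) blast+
 qed
 then show ?case using left_adjoint_comp[OF f(2) g(2)] left_adjoint_comp[OF f'(2) g'(2)]
  by (auto simp: f(1) g(1) f'(1) g'(1) ex_reg_simps ex_reg_leq)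
qed

end

section \<open>Relations in ordinary regular categories\<close>

lemma disc_simps [simp]: "Ob (disc C) = Ob C" "Ar (disc C) = Ar C" "src (disc C) = src C" "tgt (disc C) = tgt C"
 "idt (disc C) = idt C" "cmp (disc C) = cmp C" "leq (disc C) f g \<longleftrightarrow> f : Ar C & f = g"
 by (simp_all add: disc_def)

lemma disc_defs [simp]: "hom (disc C) = hom C" "iso (disc C) = iso C" "rel_mem (disc C) = rel_mem C"
 "is_product (disc C) = is_product C" "is_pullback (disc C) = is_pullback C" "span_class (disc C) = span_class C"
 by (intro ext, simp add: hom_def iso_def rel_mem_def is_product_def is_pullback_def span_class_def)+

lemma category_disc [simp]: "category (disc C) \<longleftrightarrow> category C"
 by (simp add: category_def)

lemma (in category) pos_category_disc:
 fixes D :: "('x, 'y) cat" assumes "category D" shows "pos_category (disc D)"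
proof -
 interpret D: category D by fact
 show ?thesis
 proof (intro pos_category.intro)
  show "category (disc D)" using assms by simp
  show "pos_category_axioms (disc D)" by unfold_locales (auto simp: hom_iff)
 qed
qed

lemma ff_mor_disc: "ff_mor (disc C) m \<longleftrightarrow> mono_ar C m" if "category C"
proof -
 interpret category C by fact
 show ?thesis by (auto simp: ff_mor_def mono_ar_def hom_iff)
qed

lemma jointly_ff_disc: "jointly_ff (disc C) T X Y r0 r1 \<longleftrightarrow> r0 : hom C T X & r1 : hom C T Y &
  (ALL A. ALL u:hom C A T. ALL v:hom C A T. r0 o\<^bsub>C\<^esub> u = r0 o\<^bsub>C\<^esub> v --> r1 o\<^bsub>C\<^esub> u = r1 o\<^bsub>C\<^esub> v --> u = v)" if "category C"
proof -
 interpret category C by fact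
 show ?thesis by (auto simp: jointly_ff_def hom_iff)
qed

lemma pos_product_disc: "pos_product (disc C) X Y p0 p1 \<longleftrightarrow> is_product C X Y p0 p1" if "category C"
proof -
 interpret category C by fact
 show ?thesis unfolding pos_product_def category.is_product_iff[OF that] jointly_order_mono_def
  by (auto simp: hom_iff category.is_product_iff[OF that])
qed

lemma pos_pullback_disc: "pos_pullback (disc C) f g p0 p1 \<longleftrightarrow> is_pullback C f g p0 p1" if "category C"
proof -
 interpret category C by fact
 have "jointly_order_mono (disc C) p0 p1" if "is_pullback C f g p0 p1"
  using that unfolding is_pullback_iff jointly_order_mono_def by (auto simp: hom_iff)
 then show ?thesis unfolding pos_pullback_def by auto
qed

context regular begin

text \<open>The \<open>ff\<close>-morphisms of \<open>disc C\<close> are the monomorphisms.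
  Orthogonality of \<open>e\<close> against its own mono part makes that part split, hence
  invertible; conversely regular epimorphisms are orthogonal to monomorphisms.\<close>

lemma so_mor_disc: "so_mor (disc C) e \<longleftrightarrow> regular_epi C e"
proof
 interpret D: pcategory "disc C" by (rule pcategory.intro, rule pos_category_disc, rule category_axioms)
 assume so: "so_mor (disc C) e"
 then obtain X Y where e: "e : hom C X Y" by (auto simp: so_mor_def hom_iff)
 obtain Q q m where m: "q : hom C X Q" "regular_epi C q" "m : hom C Q Y" "mono_ar C m" "e = m o q"
  by (rule factorization[OF e])
 have "m o q = idt C Y o e" using e m(5) by (simp add: hom_iff)
 moreover have "ff_mor (disc C) m" using m(4) by (simp add: ff_mor_disc[OF category_axioms])
 moreover have "idt C Y : hom C Y Y" using hom_Ob[OF e] idt_hom by blast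
 ultimately obtain w where "w : hom C Y Q" "m o w = idt C Y"
  using D.so_mor_lift[unfolded disc_defs disc_simps, OF so e _ m(3,1)] by blast
 then have "iso C m" using mono_section_iso m by blast
 then show "regular_epi C e" using regular_epi_cmp_iso m by simp
next
 interpret D: pcategory "disc C" by (rule pcategory.intro, rule pos_category_disc, rule category_axioms)
 assume re: "regular_epi C e"
 then obtain X Y where e: "e : hom C X Y" using regular_epi_Ar by (auto simp: hom_iff)
 show "so_mor (disc C) e"
 proof (rule D.so_morI, simp, rule e)
  fix m Z W u v assume "ff_mor (disc C) m" "m : hom (disc C) Z W" "u : hom (disc C) X Z" "v : hom (disc C) Y W"
    "m o\<^bsub>disc C\<^esub> u = v o\<^bsub>disc C\<^esub> e"
  then have *: "mono_ar C m" "m : hom C Z W" "u : hom C X Z" "v : hom C Y W" "m o u = v o e"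
   by (simp_all add: ff_mor_disc[OF category_axioms])
  obtain w where "w : hom C Y Z" "w o e = u" "m o w = v" by (rule regular_epi_mono_orth[OF re e *])
  then show "EX w:hom (disc C) Y Z. w o\<^bsub>disc C\<^esub> e = u & m o\<^bsub>disc C\<^esub> w = v" by auto
 next
  fix m Z W w w' assume "w : hom (disc C) Y Z" "w' : hom (disc C) Y Z" "w o\<^bsub>disc C\<^esub> e \<preceq>\<^bsub>disc C\<^esub> w' o\<^bsub>disc C\<^esub> e"
  then have "w = w'" "w : Ar C" using regular_epi_cancel[OF re e] by (auto simp: hom_iff)
  then show "w \<preceq>\<^bsub>disc C\<^esub> w'" by simp
 qed
qed

text \<open>The image factorization of the pairing of \<open>t0\<close> and \<open>t1\<close>, read
  off on components.\<close>

lemma span_image: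
 assumes t: "t0 : hom C T X" "t1 : hom C T Y"
 obtains Q q0 q1 e where "jointly_ff (disc C) Q X Y q0 q1" "regular_epi C e" "e : hom C T Q" "t0 = q0 o e" "t1 = q1 o e"
proof -
 have "X : Ob C" "Y : Ob C" using t hom_Ob by blast+
 then obtain P p0 p1 where p: "p0 : hom C P X" "p1 : hom C P Y"
  and pe: "!!A x y. x : hom C A X ==> y : hom C A Y ==> EX u:hom C A P. p0 o u = x & p1 o u = y"
  and pu: "!!A u v. u : hom C A P ==> v : hom C A P ==> p0 o u = p0 o v ==> p1 o u = p1 o v ==> u = v"
  by (rule product_ex) blast
 obtain t where t': "t : hom C T P" "p0 o t = t0" "p1 o t = t1" using pe[OF t] by blast
 obtain Q e m where m: "e : hom C T Q" "regular_epi C e" "m : hom C Q P" "mono_ar C m" "t = m o e"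
  by (rule factorization[OF t'(1)])
 have j: "u = v" if uv: "u : hom C A Q" "v : hom C A Q" "(p0 o m) o u = (p0 o m) o v" "(p1 o m) o u = (p1 o m) o v" for A u v
 proof (rule mono_ar_cancel[OF m(4,3) uv(1,2)], rule pu)
  show "m o u : hom C A P" "m o v : hom C A P" using uv m(3) by (auto simp: hom_iff)
  show "p0 o (m o u) = p0 o (m o v)" "p1 o (m o u) = p1 o (m o v)"
   using uv m(3) p by (auto simp: hom_iff)
 qed
 show thesis
 proof (rule that[OF _ m(2,1)])
  show "jointly_ff (disc C) Q X Y (p0 o m) (p1 o m)" unfolding jointly_ff_disc[OF category_axioms]
   using p m(3) j by (auto simp: hom_iff)
  show "t0 = (p0 o m) o e" "t1 = (p1 o m) o e"
   using p m(1,3) unfolding t'(2,3)[symmetric] m(5) by (auto simp: hom_iff)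
 qed
qed

lemma posreg_disc: "posreg (disc C) (regular_epi C)"
proof (intro posreg.intro posreg_axioms.intro pcategory.intro pos_category_disc category_axioms, goal_cases)
 case 1 show ?case by (simp add: so_mor_disc)
next
 case (2 X Y)
 obtain p0 p1 where "is_product C X Y p0 p1" by (rule product_ex[of X Y]) (use 2 in auto)
 then show ?case by (auto simp: pos_product_disc[OF category_axioms])
next
 case (3 f X Z g Y)
 obtain p0 p1 where "is_pullback C f g p0 p1" by (rule pullback_ex[of f X Z g Y]) (use 3 in auto)
 then show ?case by (auto simp: pos_pullback_disc[OF category_axioms])
next
 case (4 t0 T X t1 Y)
 then have t: "t0 : hom C T X" "t1 : hom C T Y" by auto
 show ?case by (rule span_image[OF t]) (simp, blast)
next
 case (5 e g p0 p1)
 then show ?case using regular unfolding regular_category_def pos_pullback_disc[OF category_axioms] by blast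
qed

end

text \<open>The rewrites let the lemmas of \<open>posreg\<close> speak of the hom-sets, composition
  and membership of \<open>C\<close> itself.\<close>

sublocale regular \<subseteq> rel: posreg "disc C" "regular_epi C"
 rewrites "hom (disc C) = hom C" and "Ob (disc C) = Ob C" and "Ar (disc C) = Ar C" and "src (disc C) = src C"
  and "tgt (disc C) = tgt C" and "idt (disc C) = idt C" and "cmp (disc C) = cmp C" and "rel_mem (disc C) = rel_mem C"
  and "span_class (disc C) = span_class C" and "iso (disc C) = iso C"
 by (rule posreg_disc) simp_all

section \<open>Images, inverse images, intersections and graphs of relations\<close>

context regular begin

abbreviation "Rel == rels (disc C)"

text \<open>Internal existential quantification over the apex of an arbitrary span. Inverse images,
  intersections and, later, quotient orders are built this way.\<close>

lemma span_relation:
 assumes t: "t0 : hom C T X" "t1 : hom C T Y"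
 obtains R where "R : Rel X Y"
  "ALL x y. rel_mem C R x y \<longleftrightarrow> (EX A B a h. x : hom C A X & y : hom C A Y & a : hom C B A & regular_epi C a &
    h : hom C B T & x o a = t0 o h & y o a = t1 o h)"
proof -
 obtain Q q0 q1 e where q: "jointly_ff (disc C) Q X Y q0 q1" and e: "regular_epi C e" "e : hom C T Q"
   and te: "t0 = q0 o e" "t1 = q1 o e"
  by (rule span_image[OF t])
 have qh: "q0 : hom C Q X" "q1 : hom C Q Y" using q by (auto simp: jointly_ff_def)
 have R: "span_class C q0 q1 : Rel X Y" by (rule rel.rels_spanI[OF q])
 note rm = rel_mem_span_class[OF qh]
 show thesis
 proof (rule that[OF R], intro allI, rule iffI)
  fix x y assume "rel_mem C (span_class C q0 q1) x y"
  then obtain A k where k: "k : hom C A Q" "x = q0 o k" "y = q1 o k" unfolding rm by blast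
  obtain B a h where a: "a : hom C B A" "regular_epi C a" "h : hom C B T" "e o h = k o a"
   by (rule cover_lift[OF e k(1)])
  have "x o a = q0 o (k o a)" "y o a = q1 o (k o a)" using k qh a(1) by (auto simp: hom_iff)
  moreover have "t0 o h = q0 o (e o h)" "t1 o h = q1 o (e o h)" using te e(2) qh a(3) by (auto simp: hom_iff)
  moreover have "x : hom C A X" "y : hom C A Y" using k qh by (auto simp: hom_iff)
  ultimately show "EX A B a h. x : hom C A X & y : hom C A Y & a : hom C B A & regular_epi C a &
    h : hom C B T & x o a = t0 o h & y o a = t1 o h"
   using a(1-3) by (intro exI[of _ A] exI[of _ B] exI[of _ a] exI[of _ h]) (simp add: a(4))
 next
  fix x y assume "EX A B a h. x : hom C A X & y : hom C A Y & a : hom C B A & regular_epi C a &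
    h : hom C B T & x o a = t0 o h & y o a = t1 o h"
  then obtain A B a h where *: "x : hom C A X" "y : hom C A Y" "a : hom C B A" "regular_epi C a"
    "h : hom C B T" "x o a = t0 o h" "y o a = t1 o h" by blast
  have "x o a = q0 o (e o h)" "y o a = q1 o (e o h)" "e o h : hom C B Q"
   using *(5) e(2) qh unfolding *(6,7) te by (auto simp: hom_iff)
  then have "rel_mem C (span_class C q0 q1) (x o a) (y o a)" unfolding rm by blast
  then show "rel_mem C (span_class C q0 q1) x y" by (rule rel.mem_local[OF R *(4,3,1,2)])
 qed
qed

text \<open>The span is pulled back along \<open>f\<close> on one leg and then along
  \<open>g\<close> on the other. The cover in the description of its image disappears by locality of
  \<open>R\<close>.\<close>

lemma rel_inv_image:
 assumes R: "R : Rel X Y" and f: "f : hom C X' X" and g: "g : hom C Y' Y"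
 obtains S where "S : Rel X' Y'"
  "ALL x y. rel_mem C S x y \<longleftrightarrow> (EX A. x : hom C A X' & y : hom C A Y') & rel_mem C R (f o x) (g o y)"
proof -
 obtain T r0 r1 where r: "r0 : hom C T X" "r1 : hom C T Y" "R = span_class C r0 r1"
  by (rule rel.relsE[OF R]; blast)
 note rm = rel_mem_span_class[OF r(1,2), folded r(3)]
 obtain P p t where p: "p : hom C P X'" "t : hom C P T" "f o p = r0 o t"
  and pe: "!!A x y. x : hom C A X' ==> y : hom C A T ==> f o x = r0 o y ==> EX u:hom C A P. p o u = x & t o u = y"
  by (rule pullback_ex[OF f r(1)]) blast
 have rt: "r1 o t : hom C P Y" using r p by (simp add: hom_iff)
 obtain Q s u where s: "s : hom C Q Y'" "u : hom C Q P" "g o s = (r1 o t) o u"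
  and se: "!!A x y. x : hom C A Y' ==> y : hom C A P ==> g o x = (r1 o t) o y ==> EX v:hom C A Q. s o v = x & u o v = y"
  by (rule pullback_ex[OF g rt]) blast
 have ps: "p o u : hom C Q X'" using p s by (simp add: hom_iff)
 obtain S where S: "S : Rel X' Y'"
   "ALL x y. rel_mem C S x y \<longleftrightarrow> (EX A B a h. x : hom C A X' & y : hom C A Y' & a : hom C B A & regular_epi C a &
    h : hom C B Q & x o a = (p o u) o h & y o a = s o h)"
  by (rule span_relation[OF ps s(1)])
 show thesis
 proof (rule that[OF S(1)], intro allI iffI)
  fix x y assume "rel_mem C S x y"
  then obtain A B a h where *: "x : hom C A X'" "y : hom C A Y'" "a : hom C B A" "regular_epi C a"
    "h : hom C B Q" "x o a = (p o u) o h" "y o a = s o h" using S(2) by blast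
  have "(f o x) o a = f o (x o a)" "(g o y) o a = g o (y o a)" using *(1-3) f g by (auto simp: hom_iff)
  moreover have "f o (x o a) = (f o p) o (u o h)" "g o (y o a) = (g o s) o h"
   unfolding *(6,7) using f g p(1) s(1,2) *(5) by (auto simp: hom_iff)
  moreover have "(f o p) o (u o h) = r0 o (t o (u o h))" "(g o s) o h = r1 o (t o (u o h))"
   unfolding p(3) s(3) using r(1,2) p(2) s(2) *(5) by (auto simp: hom_iff)
  moreover have "t o (u o h) : hom C B T" using p(2) s(2) *(5) by (auto simp: hom_iff)
  ultimately have "rel_mem C R ((f o x) o a) ((g o y) o a)" unfolding rm by auto
  moreover have "f o x : hom C A X" "g o y : hom C A Y" using *(1,2) f g by (auto simp: hom_iff)
  ultimately have "rel_mem C R (f o x) (g o y)" using rel.mem_local[OF R *(4,3)] by blast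
  then show "(EX A. x : hom C A X' & y : hom C A Y') & rel_mem C R (f o x) (g o y)" using * by blast
 next
  fix x y assume "(EX A. x : hom C A X' & y : hom C A Y') & rel_mem C R (f o x) (g o y)"
  then obtain A B k where *: "x : hom C A X'" "y : hom C A Y'" "k : hom C B T" "f o x = r0 o k" "g o y = r1 o k"
   unfolding rm by blast
  have "src C (f o x) = A" "src C (r0 o k) = B" using *(1,3) f r by (auto simp: hom_iff)
  then have B: "B = A" using *(4) by simp
  obtain m where m: "m : hom C A P" "p o m = x" "t o m = k" using pe[OF *(1) _ *(4)] *(3) B by blast
  have "g o y = (r1 o t) o m" unfolding *(5) m(3)[symmetric] using r p(2) m(1) by (simp add: hom_iff)
  then obtain n where n: "n : hom C A Q" "s o n = y" "u o n = m" using se[OF *(2) m(1)] by blast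
  have "(p o u) o n = p o (u o n)" using n(1) p(1) s(2) by (simp add: hom_iff)
  then have "(p o u) o n = x" by (simp only: n(3) m(2))
  moreover have "x o idt C A = x" "y o idt C A = y" using *(1,2) by (simp_all add: hom_iff)
  moreover have "A : Ob C" using hom_Ob[OF *(1)] by blast
  ultimately show "rel_mem C S x y" unfolding S(2)[rule_format] using *(1,2) n(1,2)
   by (intro exI[of _ A] exI[of _ "idt C A"] exI[of _ n]) (simp add: rel.cv_idt idt_hom)
 qed
qed

text \<open>\<open>V\<close> is \<open>S\<close> pulled back along both legs of the span of
  \<open>R\<close>. The equalizer of the legs of \<open>V\<close> cuts out its diagonal, that is,
  those elements of \<open>R\<close> that also lie in \<open>S\<close>.\<close>

lemma rel_inter:
 assumes R: "R : Rel X Y" and S: "S : Rel X Y"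
 obtains T where "T : Rel X Y" "ALL x y. rel_mem C T x y \<longleftrightarrow> rel_mem C R x y & rel_mem C S x y"
proof -
 obtain U r0 r1 where r: "r0 : hom C U X" "r1 : hom C U Y" "R = span_class C r0 r1"
  by (rule rel.relsE[OF R]; blast)
 note rm = rel_mem_span_class[OF r(1,2), folded r(3)]
 obtain V where V: "V : Rel U U" "ALL x y. rel_mem C V x y \<longleftrightarrow> (EX A. x : hom C A U & y : hom C A U) & rel_mem C S (r0 o x) (r1 o y)"
  by (rule rel_inv_image[OF S r(1,2)])
 obtain W v0 v1 where v: "v0 : hom C W U" "v1 : hom C W U" "V = span_class C v0 v1"
  by (rule rel.relsE[OF V(1)]; blast)
 note vm = rel_mem_span_class[OF v(1,2), folded v(3)]
 obtain K k where k: "k : hom C K W" "v0 o k = v1 o k"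
  and ke: "!!A x. x : hom C A W ==> v0 o x = v1 o x ==> EX u:hom C A K. k o u = x"
  by (rule equalizer_ex[OF v(1,2)]) blast
 have vk: "v0 o k : hom C K U" using v k by (simp add: hom_iff)
 then have t: "r0 o (v0 o k) : hom C K X" "r1 o (v0 o k) : hom C K Y" using r by (auto simp: hom_iff)
 obtain T where T: "T : Rel X Y"
   "ALL x y. rel_mem C T x y \<longleftrightarrow> (EX A B a h. x : hom C A X & y : hom C A Y & a : hom C B A & regular_epi C a &
    h : hom C B K & x o a = (r0 o (v0 o k)) o h & y o a = (r1 o (v0 o k)) o h)"
  by (rule span_relation[OF t])
 show thesis
 proof (rule that[OF T(1)], intro allI, rule iffI)
  fix x y assume "rel_mem C T x y"
  then obtain A B a h where *: "x : hom C A X" "y : hom C A Y" "a : hom C B A" "regular_epi C a"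
    "h : hom C B K" "x o a = (r0 o (v0 o k)) o h" "y o a = (r1 o (v0 o k)) o h" using T(2) by blast
  have vkh: "(v0 o k) o h : hom C B U" using vk *(5) by (simp add: hom_iff)
  have e: "x o a = r0 o ((v0 o k) o h)" "y o a = r1 o ((v0 o k) o h)" 
   unfolding *(6,7) using r(1,2) v k(1) *(5) by (auto simp: hom_iff)
  then have 1: "rel_mem C R (x o a) (y o a)" unfolding rm using vkh by blast
  have "k o h : hom C B W" "(v0 o k) o h = v0 o (k o h)" "(v1 o k) o h = v1 o (k o h)"
   using v(1,2) k(1) *(5) by (auto simp: hom_iff)
  then have "rel_mem C V ((v0 o k) o h) ((v0 o k) o h)" unfolding vm
   by (intro exI[of _ B] bexI[of _ "k o h"]) (simp_all add: k(2))
  then have 2: "rel_mem C S (x o a) (y o a)" unfolding e using V(2) by blast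
  show "rel_mem C R x y & rel_mem C S x y"
   using rel.mem_local[OF R *(4,3,1,2) 1] rel.mem_local[OF S *(4,3,1,2) 2] by blast
 next
  fix x y assume m: "rel_mem C R x y & rel_mem C S x y"
  then obtain A h where h: "h : hom C A U" "x = r0 o h" "y = r1 o h" unfolding rm by blast
  have xy: "x : hom C A X" "y : hom C A Y" using h r by (auto simp: hom_iff)
  have "rel_mem C V h h" using V(2) m h by blast
  then obtain B w where w: "w : hom C B W" "h = v0 o w" "h = v1 o w" unfolding vm by blast
  have "src C h = A" "src C (v0 o w) = B" using h(1) w(1) v(1) by (auto simp: hom_iff)
  then have B: "B = A" using w(2) by simp
  obtain u where u: "u : hom C A K" "k o u = w" using ke[OF w(1)] w(2,3) B by auto
  have "v0 o (k o u) = h" using u(2) w(2) by simp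
  then have "(r0 o (v0 o k)) o u = x" "(r1 o (v0 o k)) o u = y" using r(1,2) v(1) k(1) u(1) h(2,3) by (auto simp: hom_iff)
  moreover have "x o idt C A = x" "y o idt C A = y" "A : Ob C" using xy by (auto simp: hom_iff)
  ultimately show "rel_mem C T x y" unfolding T(2)[rule_format] using xy u(1)
   by (intro exI[of _ A] exI[of _ "idt C A"] exI[of _ u]) (simp add: rel.cv_idt idt_hom)
 qed
qed

text \<open>A relation is a set of pairs of arrows, so its set-theoretic converse already is the
  opposite relation.\<close>

lemma rel_converse:
 assumes R: "R : Rel X Y"
 shows "R\<inverse> : Rel Y X" "rel_mem C (R\<inverse>) y x \<longleftrightarrow> rel_mem C R x y"
proof -
 obtain T r0 r1 where r: "jointly_ff (disc C) T X Y r0 r1" "r0 : hom C T X" "r1 : hom C T Y" "R = span_class C r0 r1"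
  by (rule rel.relsE[OF R]; blast)
 have "src C r0 = src C r1" using r by (simp add: hom_iff)
 then have c: "R\<inverse> = span_class C r1 r0" unfolding r(4) by (auto simp: span_class_def)
 have "jointly_ff (disc C) T Y X r1 r0" using r(1) by (auto simp: jointly_ff_disc[OF category_axioms])
 then show "R\<inverse> : Rel Y X" unfolding c by (rule rel.rels_spanI)
 show "rel_mem C (R\<inverse>) y x \<longleftrightarrow> rel_mem C R x y"
  unfolding c rel_mem_span_class[OF r(3,2)] unfolding r(4) rel_mem_span_class[OF r(2,3)] by blast
qed

definition graph :: "'m => 'm rel" where
 "graph f = span_class C (idt C (src C f)) f"

lemma graph_rels:
 assumes f: "f : hom C X Y"
 shows "graph f : Rel X Y" "rel_mem C (graph f) x y \<longleftrightarrow> (EX A. x : hom C A X) & y = f o x"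
proof -
 have i: "src C f = X" "idt C X : hom C X X" using f idt_hom by (auto simp: hom_iff)
 have "jointly_ff (disc C) X X Y (idt C X) f" unfolding jointly_ff_disc[OF category_axioms]
  using f i by (auto simp: hom_iff)
 then show "graph f : Rel X Y" unfolding graph_def i by (rule rel.rels_spanI)
 have *: "(EX h:hom C A X. x = idt C X o h & y = f o h) \<longleftrightarrow> x : hom C A X & y = f o x" for A
 proof -
  have "idt C X o h = h" if "h : hom C A X" for h using that by (auto simp: hom_iff)
  then show ?thesis by auto
 qed
 show "rel_mem C (graph f) x y \<longleftrightarrow> (EX A. x : hom C A X) & y = f o x"
  unfolding graph_def i(1) rel_mem_span_class[OF i(2) f] * by blast
qed

lemma rel_top:
 assumes "X : Ob C" "Y : Ob C"
 obtains R where "R : Rel X Y" "ALL x y. rel_mem C R x y \<longleftrightarrow> (EX A. x : hom C A X & y : hom C A Y)"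
proof -
 obtain P p0 p1 where p: "p0 : hom C P X" "p1 : hom C P Y"
  and pe: "!!A x y. x : hom C A X ==> y : hom C A Y ==> EX u:hom C A P. p0 o u = x & p1 o u = y"
  and pu: "!!A u v. u : hom C A P ==> v : hom C A P ==> p0 o u = p0 o v ==> p1 o u = p1 o v ==> u = v"
  by (rule product_ex[OF assms]) blast
 have j: "jointly_ff (disc C) P X Y p0 p1" unfolding jointly_ff_disc[OF category_axioms] using p pu by blast
 show thesis
 proof (rule that[OF rel.rels_spanI[OF j]], unfold rel_mem_span_class[OF p], intro allI, rule iffI)
  fix x y assume "EX A. EX h:hom C A P. x = p0 o h & y = p1 o h"
  then show "EX A. x : hom C A X & y : hom C A Y" using p by (auto simp: hom_iff)
 next
  fix x y assume "EX A. x : hom C A X & y : hom C A Y"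
  then obtain A u where "u : hom C A P" "p0 o u = x" "p1 o u = y" using pe by blast
  then show "EX A. EX h:hom C A P. x = p0 o h & y = p1 o h" by auto
 qed
qed

end

section \<open>Functional relations between equivalence relations\<close>

context regular begin

abbreviation "mem == rel_mem C"
abbreviation "rcomp == rel_comp (disc C)"

text \<open>Weakening along a discrete order is vacuous; what is left of a congruence is an internal
  preorder.\<close>

lemma congruence_disc_iff:
 "congruence (disc C) p \<longleftrightarrow> fst p : Ob C & snd p : Rel (fst p) (fst p) & rel_refl C (fst p) (snd p) & rel_trans C (snd p)"
proof -
 have "weakening_closed (disc C) R" for R unfolding weakening_closed_def disc_simps disc_defs by blast
 moreover have "rel_refl (disc C) = rel_refl C" "rel_trans (disc C) = rel_trans C"
  by (intro ext, simp add: rel_refl_def rel_trans_def)+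
 ultimately show ?thesis unfolding congruence_def case_prod_unfold disc_simps by metis
qed

definition eqv :: "'o \<times> 'm rel => bool" where
 "eqv p \<longleftrightarrow> fst p : Ob C & equivalence_rel C (fst p) (snd p)"

lemma eqvD:
 assumes "eqv p"
 shows "fst p : Ob C" "snd p : Rel (fst p) (fst p)"
  "x : hom C A (fst p) ==> mem (snd p) x x"
  "mem (snd p) x y ==> mem (snd p) y x"
  "mem (snd p) x y ==> mem (snd p) y z ==> mem (snd p) x z"
  "congruence (disc C) p"
proof -
 have *: "fst p : Ob C" "snd p : Rel (fst p) (fst p)" "rel_refl C (fst p) (snd p)" "rel_sym C (snd p)" "rel_trans C (snd p)"
  using assms unfolding eqv_def equivalence_rel_def by blast+
 show "fst p : Ob C" "snd p : Rel (fst p) (fst p)" by fact+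
 show "x : hom C A (fst p) ==> mem (snd p) x x" using *(3) unfolding rel_refl_def by blast
 show "mem (snd p) x y ==> mem (snd p) y x" using *(4) unfolding rel_sym_def by blast
 show "mem (snd p) x y ==> mem (snd p) y z ==> mem (snd p) x z" using *(5) unfolding rel_trans_def by blast
 show "congruence (disc C) p" unfolding congruence_disc_iff using *(1,2,3,5) by (intro conjI)
qed

lemma eqvI:
 assumes "X : Ob C" "R : Rel X X" "!!A x. x : hom C A X ==> mem R x x" "!!x y. mem R x y ==> mem R y x"
  "!!x y z. mem R x y ==> mem R y z ==> mem R x z"
 shows "eqv (X, R)"
 unfolding eqv_def equivalence_rel_def rel_refl_def rel_sym_def rel_trans_def fst_conv snd_conv
 using assms by blast

lemma mem_hom2:
 assumes "R : Rel X Y" "mem R x y" shows "x : hom C A X ==> y : hom C A Y" "y : hom C A Y ==> x : hom C A X"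
 using rel.mem_hom[OF assms] by (auto simp: hom_iff)

text \<open>The arrows of the exact completion: \<open>fst p\<close> is the object and \<open>snd p\<close> the equivalence relation.\<close>

definition fn :: "'o \<times> 'm rel => 'o \<times> 'm rel => 'm rel => bool" where
 "fn p q \<Phi> \<longleftrightarrow> eqv p & eqv q & lax_module (disc C) p q \<Phi> &
   (ALL A. ALL x:hom C A (fst p). EX B. EX a:hom C B A. EX y. regular_epi C a & mem \<Phi> (x o a) y) &
   (ALL x y y'. mem \<Phi> x y --> mem \<Phi> x y' --> mem (snd q) y y')"

lemma fnD:
 assumes "fn p q \<Phi>"
 shows "eqv p" "eqv q" "lax_module (disc C) p q \<Phi>" "\<Phi> : Rel (fst p) (fst q)"
  "mem \<Phi> x y ==> mem \<Phi> x y' ==> mem (snd q) y y'"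
  "mem (snd p) x' x ==> mem \<Phi> x y ==> mem \<Phi> x' y"
  "mem (snd p) x x' ==> mem \<Phi> x y ==> mem \<Phi> x' y"
  "mem \<Phi> x y ==> mem (snd q) y y' ==> mem \<Phi> x y'"
  "mem \<Phi> x y ==> mem (snd q) y' y ==> mem \<Phi> x y'"
proof -
 show e: "eqv p" "eqv q" "lax_module (disc C) p q \<Phi>" using assms unfolding fn_def by blast+
 then show "\<Phi> : Rel (fst p) (fst q)" using rel.lax_moduleD(1) by blast
 show "mem \<Phi> x y ==> mem \<Phi> x y' ==> mem (snd q) y y'" using assms unfolding fn_def by blast
 note l = rel.lax_module_left[OF eqvD(6)[OF e(2)] e(3)] and r = rel.lax_module_right[OF eqvD(6)[OF e(1)] e(3)]
 show "mem (snd p) x' x ==> mem \<Phi> x y ==> mem \<Phi> x' y" by (rule l)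
 show "mem (snd p) x x' ==> mem \<Phi> x y ==> mem \<Phi> x' y" by (rule l, rule eqvD(4)[OF e(1)])
 show "mem \<Phi> x y ==> mem (snd q) y y' ==> mem \<Phi> x y'" by (rule r)
 show "mem \<Phi> x y ==> mem (snd q) y' y ==> mem \<Phi> x y'" by (rule r, assumption, rule eqvD(4)[OF e(2)])
qed

lemma fn_total:
 assumes f: "fn p q \<Phi>" and x: "x : hom C A (fst p)"
 obtains B a y where "a : hom C B A" "regular_epi C a" "y : hom C B (fst q)" "mem \<Phi> (x o a) y"
proof -
 obtain B a y where *: "a : hom C B A" "regular_epi C a" "mem \<Phi> (x o a) y"
  using f x unfolding fn_def by blast
 have "x o a : hom C B (fst p)" using x *(1) by (simp add: hom_iff)
 then have "y : hom C B (fst q)" by (rule mem_hom2(1)[OF fnD(4)[OF f] *(3)])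
 from that[OF *(1,2) this *(3)] show thesis .
qed

lemma fnI:
 assumes p: "eqv p" and q: "eqv q" and \<Phi>: "\<Phi> : Rel (fst p) (fst q)"
  and 1: "!!x' x y. mem (snd p) x' x ==> mem \<Phi> x y ==> mem \<Phi> x' y"
  and 2: "!!x y y'. mem \<Phi> x y ==> mem (snd q) y y' ==> mem \<Phi> x y'"
  and 3: "!!A x. x : hom C A (fst p) ==> EX B. EX a:hom C B A. EX y. regular_epi C a & mem \<Phi> (x o a) y"
  and 4: "!!x y y'. mem \<Phi> x y ==> mem \<Phi> x y' ==> mem (snd q) y y'"
 shows "fn p q \<Phi>"
proof -
 have "lax_module (disc C) p q \<Phi>" by (rule rel.lax_moduleI[OF eqvD(6)[OF p] eqvD(6)[OF q] \<Phi> 1 2])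
 then show ?thesis unfolding fn_def using p q by (intro conjI allI ballI impI) (assumption | rule 3 | erule (1) 4)+
qed

text \<open>The identity of the stage is the cover.\<close>

lemma cover_self: 
 assumes "x : hom C A X" and "P x" shows "EX B. EX a:hom C B A. regular_epi C a & P (x o a)"
proof -
 have "A : Ob C" using hom_Ob[OF assms(1)] by blast
 moreover have "x o idt C A = x" using assms(1) by (simp add: hom_iff)
 ultimately show ?thesis using assms(2) rel.cv_idt idt_hom by (intro exI[of _ A] bexI[of _ "idt C A"]) auto
qed

text \<open>One inclusion suffices, since a total relation contained in a single-valued one exhausts
  it.\<close>

lemma fn_eqI:
 assumes f: "fn p q \<Phi>" and g: "fn p q \<Psi>" and le: "!!x y. mem \<Phi> x y ==> mem \<Psi> x y"
 shows "\<Phi> = \<Psi>"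
proof (rule rel.rels_eqI[OF fnD(4)[OF f] fnD(4)[OF g] le])
 fix x y assume m: "mem \<Psi> x y"
 obtain A where x: "x : hom C A (fst p)" "y : hom C A (fst q)" using rel.mem_hom[OF fnD(4)[OF g] m] by blast
 obtain B a z where a: "a : hom C B A" "regular_epi C a" "z : hom C B (fst q)" "mem \<Phi> (x o a) z" by (rule fn_total[OF f x(1)])
 have "mem \<Psi> (x o a) (y o a)" by (rule rel.mem_stable[OF fnD(4)[OF g] m a(1) x(1)])
 then have "mem (snd q) z (y o a)" by (rule fnD(5)[OF g le[OF a(4)]])
 then have "mem \<Phi> (x o a) (y o a)" by (rule fnD(8)[OF f a(4)])
 then show "mem \<Phi> x y" by (rule rel.mem_local[OF fnD(4)[OF f] a(2,1) x])
qed

lemma fn_id: 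
 assumes p: "eqv p" shows "fn p p (snd p)"
proof (rule fnI[OF p p eqvD(2)[OF p]])
 show "!!x' x y. mem (snd p) x' x ==> mem (snd p) x y ==> mem (snd p) x' y" by (rule eqvD(5)[OF p])
 show "!!x y y'. mem (snd p) x y ==> mem (snd p) y y' ==> mem (snd p) x y'" by (rule eqvD(5)[OF p])
 fix A x assume x: "x : hom C A (fst p)"
 show "EX B. EX a:hom C B A. EX y. regular_epi C a & mem (snd p) (x o a) y"
  using cover_self[OF x, of "%x. mem (snd p) x x"] eqvD(3)[OF p x] by blast
next
 show "!!x y y'. mem (snd p) x y ==> mem (snd p) x y' ==> mem (snd p) y y'"
  by (rule eqvD(5)[OF p eqvD(4)[OF p]])
qed

lemma fn_comp:
 assumes f: "fn p q \<Phi>" and g: "fn q r \<Psi>"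
 shows "fn p r (rcomp \<Psi> \<Phi>)"
proof -
 note p = fnD(1)[OF f] and q = fnD(1)[OF g] and r = fnD(2)[OF g] and R = fnD(4)[OF f] and S = fnD(4)[OF g]
 have lm: "lax_module (disc C) p r (rcomp \<Psi> \<Phi>)"
  by (rule rel.lax_module_comp[OF eqvD(6)[OF p] eqvD(6)[OF q] eqvD(6)[OF r] fnD(3)[OF f] fnD(3)[OF g]])
 have t: "EX B. EX a:hom C B A. EX z. regular_epi C a & mem (rcomp \<Psi> \<Phi>) (x o a) z"
  if x: "x : hom C A (fst p)" for A x
 proof -
  obtain B a y where a: "a : hom C B A" "regular_epi C a" "y : hom C B (fst q)" "mem \<Phi> (x o a) y" by (rule fn_total[OF f x])
  obtain D b z where b: "b : hom C D B" "regular_epi C b" "z : hom C D (fst r)" "mem \<Psi> (y o b) z" by (rule fn_total[OF g a(3)])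
  have xa: "x o a : hom C B (fst p)" using x a by (simp add: hom_iff)
  have "mem (rcomp \<Psi> \<Phi>) ((x o a) o b) z" by (rule rel.mem_compI[OF R S rel.mem_stable[OF R a(4) b(1) xa] b(4)])
  moreover have "(x o a) o b = x o (a o b)" "a o b : hom C D A" using x a b by (auto simp: hom_iff)
  moreover have "regular_epi C (a o b)" by (rule regular_epi_cmp[OF b(2,1) a(2,1)])
  ultimately show ?thesis by auto
 qed
 have s: "mem (snd r) z z'" if m: "mem (rcomp \<Psi> \<Phi>) x z" "mem (rcomp \<Psi> \<Phi>) x z'" for x z z'
 proof -
  obtain A B a y where a: "x : hom C A (fst p)" "z : hom C A (fst r)" "a : hom C B A" "regular_epi C a"
   "y : hom C B (fst q)" "mem \<Phi> (x o a) y" "mem \<Psi> y (z o a)" by (rule rel.mem_compE[OF R S m(1)])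
  have z': "z' : hom C A (fst r)" by (rule mem_hom2(1)[OF rel.rel_comp_rels[OF R S] m(2) a(1)])
  \<comment> \<open>The second pair is first restricted to the stage \<open>B\<close> of the first
    witness, so that both intermediate elements end up on a common refinement.\<close>
  have "mem (rcomp \<Psi> \<Phi>) (x o a) (z' o a)" by (rule rel.mem_stable[OF rel.rel_comp_rels[OF R S] m(2) a(3,1)])
  then obtain A' D b y' where b: "x o a : hom C A' (fst p)" "z' o a : hom C A' (fst r)" "b : hom C D A'" "regular_epi C b"
   "y' : hom C D (fst q)" "mem \<Phi> ((x o a) o b) y'" "mem \<Psi> y' ((z' o a) o b)" by (rule rel.mem_compE[OF R S])
  have xa: "x o a : hom C B (fst p)" using a by (simp add: hom_iff)
  then have A': "A' = B" using b(1) by (simp add: hom_iff)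
  note b = b[unfolded A']
  have "mem \<Phi> ((x o a) o b) (y o b)" by (rule rel.mem_stable[OF R a(6) b(3) xa])
  then have "mem (snd q) (y o b) y'" by (rule fnD(5)[OF f _ b(6)])
  moreover have "mem \<Psi> (y o b) ((z o a) o b)" by (rule rel.mem_stable[OF S a(7) b(3) a(5)])
  ultimately have "mem \<Psi> y' ((z o a) o b)" by (rule fnD(7)[OF g])
  then have "mem (snd r) ((z o a) o b) ((z' o a) o b)" by (rule fnD(5)[OF g _ b(7)])
  then have "mem (snd r) (z o a) (z' o a)"
   by (rule rel.mem_local[OF eqvD(2)[OF r] b(4,3), rotated 2]) (use a z' in \<open>auto simp: hom_iff\<close>)
  then show ?thesis by (rule rel.mem_local[OF eqvD(2)[OF r] a(4,3,2) z'])
 qed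
 show ?thesis unfolding fn_def using p r lm by (intro conjI allI ballI impI) (assumption | rule t | erule (1) s)+
qed

lemma fn_comp_eqI:
 assumes f: "fn p q \<Phi>" and g: "fn q r \<Psi>" and h: "fn p r \<Theta>"
  and 1: "!!x y z. mem \<Phi> x y ==> mem \<Psi> y z ==> mem \<Theta> x z"
 shows "rcomp \<Psi> \<Phi> = \<Theta>"
 by (rule fn_eqI[OF fn_comp[OF f g] h]) (rule rel.rel_comp_leI[OF fnD(4)[OF f] fnD(4)[OF g] fnD(4)[OF h] 1])

lemma fn_compD:
 assumes "rcomp \<Psi> \<Phi> = \<Theta>" and f: "fn p q \<Phi>" and g: "fn q r \<Psi>" and "mem \<Phi> x y" "mem \<Psi> y z"
 shows "mem \<Theta> x z"
 using rel.mem_compI[OF fnD(4)[OF f] fnD(4)[OF g] assms(4,5)] assms(1) by simp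

text \<open>The intermediate element that witnesses the composite is equivalent to the given
  \<open>y\<close>, because \<open>\<Phi>\<close> is single-valued.\<close>

lemma fn_comp_factor:
 assumes e: "rcomp \<Psi> \<Phi> = \<Theta>" and f: "fn p q \<Phi>" and g: "fn q r \<Psi>" and m: "mem \<Phi> x y" "mem \<Theta> x z"
 shows "mem \<Psi> y z"
proof -
 obtain A B a y' where a: "x : hom C A (fst p)" "z : hom C A (fst r)" "a : hom C B A" "regular_epi C a"
   "y' : hom C B (fst q)" "mem \<Phi> (x o a) y'" "mem \<Psi> y' (z o a)"
  by (rule rel.mem_compE[OF fnD(4)[OF f] fnD(4)[OF g] m(2)[folded e]])
 have y: "y : hom C A (fst q)" by (rule mem_hom2(1)[OF fnD(4)[OF f] m(1) a(1)])
 have "mem \<Phi> (x o a) (y o a)" by (rule rel.mem_stable[OF fnD(4)[OF f] m(1) a(3,1)])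
 then have "mem (snd q) (y o a) y'" by (rule fnD(5)[OF f _ a(6)])
 then have "mem \<Psi> (y o a) (z o a)" by (rule fnD(6)[OF g _ a(7)])
 then show ?thesis by (rule rel.mem_local[OF fnD(4)[OF g] a(4,3) y a(2)])
qed

text \<open>The discrete equivalence relation on \<open>X\<close>, which represents \<open>X\<close> in the exact completion.\<close>

definition jo :: "'o => 'o \<times> 'm rel" where
 "jo X = (X, graph (idt C X))"

lemma fst_jo [simp]: "fst (jo X) = X"
 by (simp add: jo_def)

lemma mem_jo:
 assumes X: "X : Ob C" shows "mem (snd (jo X)) x y \<longleftrightarrow> (EX A. x : hom C A X) & x = y"
proof -
 have "idt C X o x = x" if "x : hom C A X" for A using that by (simp add: hom_iff)
 then show ?thesis unfolding jo_def snd_conv graph_rels(2)[OF idt_hom[OF X]] by auto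
qed

lemma eqv_jo: "X : Ob C ==> eqv (jo X)"
 unfolding jo_def
 by (rule eqvI) (auto simp: graph_rels(1) idt_hom mem_jo[unfolded jo_def snd_conv])

text \<open>An element \<open>x\<close> of \<open>fst p\<close> at stage \<open>A\<close>, regarded as an arrow from \<open>jo A\<close> to \<open>p\<close>.\<close>

definition pt :: "'o \<times> 'm rel => 'm => 'm rel" where
 "pt p x = rcomp (snd p) (graph x)"

lemma pt_rels: "eqv p ==> x : hom C A (fst p) ==> pt p x : Rel A (fst p)"
 unfolding pt_def by (rule rel.rel_comp_rels[OF graph_rels(1) eqvD(2)])

lemma mem_pt:
 assumes p: "eqv p" and x: "x : hom C A (fst p)"
 shows "mem (pt p x) b y \<longleftrightarrow> (EX B. b : hom C B A) & mem (snd p) (x o b) y"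
proof
 assume m: "mem (pt p x) b y"
 obtain B D a z where a: "b : hom C B A" "y : hom C B (fst p)" "a : hom C D B" "regular_epi C a"
  "mem (graph x) (b o a) z" "mem (snd p) z (y o a)"
  by (rule rel.mem_compE[OF graph_rels(1)[OF x] eqvD(2)[OF p] m[unfolded pt_def]])
 have "z = (x o b) o a" using a(1,3,5) x unfolding graph_rels(2)[OF x] by (simp add: hom_iff)
 moreover have "x o b : hom C B (fst p)" using x a by (simp add: hom_iff)
 ultimately have "mem (snd p) (x o b) y" using rel.mem_local[OF eqvD(2)[OF p] a(4,3) _ a(2)] a(6) by simp
 then show "(EX B. b : hom C B A) & mem (snd p) (x o b) y" using a by blast
next
 assume *: "(EX B. b : hom C B A) & mem (snd p) (x o b) y"
 then have "mem (graph x) b (x o b)" unfolding graph_rels(2)[OF x] by blast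
 then show "mem (pt p x) b y" unfolding pt_def using rel.mem_compI[OF graph_rels(1)[OF x] eqvD(2)[OF p]] * by blast
qed

lemma fn_pt:
 assumes p: "eqv p" and x: "x : hom C A (fst p)"
 shows "fn (jo A) p (pt p x)"
proof -
 have A: "A : Ob C" using hom_Ob[OF x] by blast
 show ?thesis
 proof (rule fnI[OF eqv_jo[OF A] p])
  show "pt p x : Rel (fst (jo A)) (fst p)" using pt_rels[OF p x] by simp
 next
  fix b' b y assume "mem (snd (jo A)) b' b" "mem (pt p x) b y"
  then show "mem (pt p x) b' y" unfolding mem_jo[OF A] by blast
 next
  fix b y y' assume "mem (pt p x) b y" "mem (snd p) y y'"
  then show "mem (pt p x) b y'" unfolding mem_pt[OF p x] using eqvD(5)[OF p] by blast
 next
  fix b y y' assume "mem (pt p x) b y" "mem (pt p x) b y'"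
  then show "mem (snd p) y y'" unfolding mem_pt[OF p x] using eqvD(4,5)[OF p] by blast
 next
  fix B b assume "b : hom C B (fst (jo A))"
  then have b: "b : hom C B A" by simp
  then have "x o b : hom C B (fst p)" using x by (simp add: hom_iff)
  then have "EX y. mem (pt p x) b y" unfolding mem_pt[OF p x] using b eqvD(3)[OF p] by blast
  then show "EX D. EX a:hom C D B. EX y. regular_epi C a & mem (pt p x) (b o a) y"
   using cover_self[OF b, of "%b. EX y. mem (pt p x) b y"] by blast
 qed
qed

lemma pt_self:
 assumes "eqv p" "x : hom C A (fst p)" shows "mem (pt p x) (idt C A) x"
proof -
 have "x o idt C A = x" "A : Ob C" using assms(2) hom_Ob[OF assms(2)] by (auto simp: hom_iff)
 then show ?thesis unfolding mem_pt[OF assms] using eqvD(3)[OF assms] idt_hom by auto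
qed

text \<open>Evaluation at the identity of the stage recovers \<open>x\<close> up to
  \<open>snd p\<close>.\<close>

lemma pt_eq_iff:
 assumes p: "eqv p" and x: "x : hom C A (fst p)" and y: "y : hom C A (fst p)"
 shows "pt p x = pt p y \<longleftrightarrow> mem (snd p) x y"
proof
 assume "pt p x = pt p y"
 then have "mem (pt p y) (idt C A) x" using pt_self[OF p x] by simp
 then show "mem (snd p) x y" by (rule fnD(5)[OF fn_pt[OF p y]]) (rule pt_self[OF p y])
next
 assume m: "mem (snd p) x y"
 show "pt p x = pt p y"
 proof (rule fn_eqI[OF fn_pt[OF p x] fn_pt[OF p y]])
  fix b z assume "mem (pt p x) b z"
  then obtain B where b: "b : hom C B A" "mem (snd p) (x o b) z" unfolding mem_pt[OF p x] by blast
  have "mem (snd p) (x o b) (y o b)" by (rule rel.mem_stable[OF eqvD(2)[OF p] m b(1) x])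
  then show "mem (pt p y) b z" unfolding mem_pt[OF p y] using b eqvD(4,5)[OF p] by blast
 qed
qed

text \<open>Applying \<open>\<Phi>\<close> to an element is composing with the arrow of that
  element. This dictionary allows universal properties in the completion to be tested on elements of
  \<open>C\<close>.\<close>

lemma pt_comp:
 assumes f: "fn p q \<Phi>" and m: "mem \<Phi> x y" and x: "x : hom C A (fst p)"
 shows "rcomp \<Phi> (pt p x) = pt q y"
proof -
 have y: "y : hom C A (fst q)" by (rule mem_hom2(1)[OF fnD(4)[OF f] m x])
 show ?thesis
 proof (rule fn_comp_eqI[OF fn_pt[OF fnD(1)[OF f] x] f fn_pt[OF fnD(2)[OF f] y]])
  fix b x' z assume 1: "mem (pt p x) b x'" and 2: "mem \<Phi> x' z"
  then obtain B where b: "b : hom C B A" "mem (snd p) (x o b) x'" unfolding mem_pt[OF fnD(1)[OF f] x] by blast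
  have "mem \<Phi> (x o b) z" by (rule fnD(6)[OF f b(2) 2])
  moreover have "mem \<Phi> (x o b) (y o b)" by (rule rel.mem_stable[OF fnD(4)[OF f] m b(1) x])
  ultimately have "mem (snd q) (y o b) z" by (rule fnD(5)[OF f, rotated])
  then show "mem (pt q y) b z" unfolding mem_pt[OF fnD(2)[OF f] y] using b by blast
 qed
qed

lemma pt_res:
 assumes p: "eqv p" and x: "x : hom C A (fst p)" and a: "a : hom C B A"
 shows "rcomp (pt p x) (pt (jo A) a) = pt p (x o a)"
proof (rule pt_comp[OF fn_pt[OF p x]])
 have "x o a : hom C B (fst p)" using x a by (simp add: hom_iff)
 then show "mem (pt p x) a (x o a)" unfolding mem_pt[OF p x] using a eqvD(3)[OF p] by blast
 show "a : hom C B (fst (jo A))" using a by simp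
qed

lemma pt_factor:
 assumes f: "fn p q \<Phi>" and x: "x : hom C A (fst p)" and y: "y : hom C A (fst q)" and e: "rcomp \<Phi> (pt p x) = pt q y"
 shows "mem \<Phi> x y"
 by (rule fn_comp_factor[OF e fn_pt[OF fnD(1)[OF f] x] f pt_self[OF fnD(1)[OF f] x] pt_self[OF fnD(2)[OF f] y]])

text \<open>A total relation has values only after a cover, so an arrow out of \<open>jo A\<close>
  is an element of \<open>p\<close> only locally.\<close>

lemma jo_arrow_local:
 assumes u: "fn (jo A) p U"
 obtains B a x where "a : hom C B A" "regular_epi C a" "x : hom C B (fst p)" "mem U a x"
  "rcomp U (pt (jo A) a) = pt p x"
proof -
 have A: "A : Ob C" using eqvD(1)[OF fnD(1)[OF u]] by simp
 have i: "idt C A : hom C A (fst (jo A))" using idt_hom[OF A] by simp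
 obtain B a x where a: "a : hom C B A" "regular_epi C a" "x : hom C B (fst p)" "mem U (idt C A o a) x"
  by (rule fn_total[OF u i])
 have "idt C A o a = a" using a by (simp add: hom_iff)
 then have m: "mem U a x" using a by simp
 show thesis by (rule that[OF a(1-3) m pt_comp[OF u m]]) (use a in simp)
qed

text \<open>The elementwise form of being a regular epimorphism of the completion; see
  \<open>surj_regular_epi\<close> and \<open>regular_epi_surj\<close>.\<close>

definition surj :: "'o \<times> 'm rel => 'm rel => bool" where
 "surj q \<Phi> \<longleftrightarrow> (ALL A. ALL y:hom C A (fst q). EX B. EX a:hom C B A. EX x. regular_epi C a & mem \<Phi> x (y o a))"

lemma surjE:
 assumes s: "surj q \<Phi>" and f: "\<Phi> : Rel X (fst q)" and y: "y : hom C A (fst q)"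
 obtains B a x where "a : hom C B A" "regular_epi C a" "x : hom C B X" "mem \<Phi> x (y o a)"
proof -
 obtain B a x where *: "a : hom C B A" "regular_epi C a" "mem \<Phi> x (y o a)"
  using s y unfolding surj_def by blast
 have "y o a : hom C B (fst q)" using y *(1) by (simp add: hom_iff)
 then have "x : hom C B X" by (rule mem_hom2(2)[OF f *(3)])
 from that[OF *(1,2) this *(3)] show thesis .
qed

end

section \<open>The exact completion\<close>

context regular begin

lemma lax_module_converse:
 assumes f: "fn p q \<Phi>" shows "lax_module (disc C) q p (\<Phi>\<inverse>)"
proof (rule rel.lax_moduleI[OF eqvD(6)[OF fnD(2)[OF f]] eqvD(6)[OF fnD(1)[OF f]] rel_converse(1)[OF fnD(4)[OF f]]])
 note c = rel_converse(2)[OF fnD(4)[OF f]]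
 show "mem (snd q) x' x ==> mem (\<Phi>\<inverse>) x y ==> mem (\<Phi>\<inverse>) x' y" for x' x y unfolding c by (rule fnD(9)[OF f])
 show "mem (\<Phi>\<inverse>) x y ==> mem (snd p) y y' ==> mem (\<Phi>\<inverse>) x y'" for x y y' unfolding c by (rule fnD(7)[OF f])
qed

text \<open>\<open>rcomp (M\<inverse>) \<Theta>\<close> relates \<open>a\<close> to \<open>u\<close>
  when \<open>\<Theta>\<close> at \<open>a\<close> and \<open>M\<close> at \<open>u\<close> have a
  common value, and single-valuedness of \<open>M\<close> makes any value of \<open>M\<close> at
  \<open>u\<close> serve.\<close>

lemma rcomp_converseD:
 assumes m: "fn s p M" and f: "fn t p \<Theta>" and h: "mem (rcomp (M\<inverse>) \<Theta>) a u" "mem M u v"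
 shows "mem \<Theta> a v"
proof -
 note M = fnD(4)[OF m] and T = fnD(4)[OF f]
 note c = rel_converse[OF M]
 obtain A B b x where a: "a : hom C A (fst t)" "u : hom C A (fst s)" "b : hom C B A" "regular_epi C b"
  "x : hom C B (fst p)" "mem \<Theta> (a o b) x" "mem (M\<inverse>) x (u o b)" by (rule rel.mem_compE[OF T c(1) h(1)])
 have "mem (snd p) x (v o b)" using fnD(5)[OF m _ rel.mem_stable[OF M h(2) a(3,2)]] a(7) c(2) by blast
 then have "mem \<Theta> (a o b) (v o b)" by (rule fnD(8)[OF f a(6)])
 then show ?thesis by (rule rel.mem_local[OF T a(4,3,1) mem_hom2(1)[OF M h(2) a(2)]])
qed

lemma fn_total2:
 assumes f: "fn s p M" and g: "fn s q N" and z: "z : hom C A (fst s)"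
 obtains B b x y where "b : hom C B A" "regular_epi C b" "z o b : hom C B (fst s)" "mem M (z o b) x" "mem N (z o b) y"
proof -
 obtain B b x where b: "b : hom C B A" "regular_epi C b" "x : hom C B (fst p)" "mem M (z o b) x" by (rule fn_total[OF f z])
 note zb = cmp_hom[OF b(1) z]
 obtain D d y where d: "d : hom C D B" "regular_epi C d" "y : hom C D (fst q)" "mem N ((z o b) o d) y" by (rule fn_total[OF g zb])
 note bd = cmp_hom[OF d(1) b(1)] and eq = assoc[OF d(1) b(1) z]
 show thesis by (rule that[OF bd regular_epi_cmp[OF d(2,1) b(2,1)] cmp_hom[OF bd z]])
  (use rel.mem_stable[OF fnD(4)[OF f] b(4) d(1) zb] d(4) eq in simp_all)
qed

text \<open>Joint monicity of two arrows out of \<open>s\<close>, up to the equivalence relation of \<open>s\<close>.\<close>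

definition jm :: "'o \<times> 'm rel => 'm rel => 'm rel => bool" where
 "jm s M N \<longleftrightarrow> (ALL z z' x y. mem M z x --> mem M z' x --> mem N z y --> mem N z' y --> mem (snd s) z z')"

text \<open>\<open>H\<close> relates \<open>a\<close> to those \<open>u\<close> whose values under
  \<open>M\<close> and \<open>N\<close> are the values of \<open>\<Theta>\<close> and
  \<open>\<Xi>\<close> at \<open>a\<close>. It is total by \<open>ex\<close> and single-valued by
  joint monicity. Products use it with two different legs, equalizers with the same leg
  twice.\<close>

lemma fn_pair:
 assumes m: "fn s p M" and n: "fn s q N" and j: "jm s M N" and f: "fn t p \<Theta>" and g: "fn t q \<Xi>"
  and ex: "!!A a x y. a : hom C A (fst t) ==> mem \<Theta> a x ==> mem \<Xi> a y ==>
    EX B. EX b:hom C B A. EX u. regular_epi C b & mem M u (x o b) & mem N u (y o b)"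
 obtains H where "fn t s H" "rcomp M H = \<Theta>" "rcomp N H = \<Xi>"
proof -
 note s = fnD(1)[OF m] and t = fnD(1)[OF f] and T = fnD(4)[OF f] and X = fnD(4)[OF g]
 note S = eqvD(2)[OF s] and c = rel_converse[OF fnD(4)[OF m]] and d = rel_converse[OF fnD(4)[OF n]]
 have l: "lax_module (disc C) t s (rcomp (M\<inverse>) \<Theta>)" "lax_module (disc C) t s (rcomp (N\<inverse>) \<Xi>)"
  by (rule rel.lax_module_comp[OF eqvD(6)[OF t] eqvD(6) eqvD(6)[OF s] fnD(3) lax_module_converse], (rule m n f g fnD(2)[OF f] fnD(2)[OF g])+)+
 obtain H where H: "H : Rel (fst t) (fst s)" "ALL a u. mem H a u \<longleftrightarrow> mem (rcomp (M\<inverse>) \<Theta>) a u & mem (rcomp (N\<inverse>) \<Xi>) a u"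
  by (rule rel_inter[OF rel.lax_moduleD(1)[OF l(1)] rel.lax_moduleD(1)[OF l(2)]])
 have H0: "mem \<Theta> a x" if "mem H a u" "mem M u x" for a u x using rcomp_converseD[OF m f _ that(2)] H(2) that(1) by blast
 have H1: "mem \<Xi> a x" if "mem H a u" "mem N u x" for a u x using rcomp_converseD[OF n g _ that(2)] H(2) that(1) by blast
 have h: "fn t s H"
 proof (rule fnI[OF t s H(1)])
  show "mem H a' u" if "mem (snd t) a' a" "mem H a u" for a' a u
   using rel.lax_module_left[OF eqvD(6)[OF s] l(1) that(1)] rel.lax_module_left[OF eqvD(6)[OF s] l(2) that(1)] that(2) H(2) by blast
  show "mem H a u'" if "mem H a u" "mem (snd s) u u'" for a u u'
   using rel.lax_module_right[OF eqvD(6)[OF t] l(1) _ that(2)] rel.lax_module_right[OF eqvD(6)[OF t] l(2) _ that(2)] that(1) H(2) by blast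
  show "EX B. EX b:hom C B A. EX u. regular_epi C b & mem H (a o b) u" if a: "a : hom C A (fst t)" for A a
  proof -
   obtain B b x y where b: "b : hom C B A" "regular_epi C b" "a o b : hom C B (fst t)" "mem \<Theta> (a o b) x" "mem \<Xi> (a o b) y"
    by (rule fn_total2[OF f g a])
   obtain D e u where e: "e : hom C D B" "regular_epi C e" "mem M u (x o e)" "mem N u (y o e)" using ex[OF b(3-5)] by blast
   have "mem (rcomp (M\<inverse>) \<Theta>) ((a o b) o e) u" "mem (rcomp (N\<inverse>) \<Xi>) ((a o b) o e) u"
    by (rule rel.mem_compI[OF T c(1) rel.mem_stable[OF T b(4) e(1) b(3)]] rel.mem_compI[OF X d(1) rel.mem_stable[OF X b(5) e(1) b(3)]],
     use c(2) d(2) e(3,4) in blast)+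
   then show ?thesis using H(2) assoc[OF e(1) b(1) a] cmp_hom[OF e(1) b(1)] regular_epi_cmp[OF e(2,1) b(2,1)] by auto
  qed
  show "mem (snd s) u u'" if h: "mem H a u" "mem H a u'" for a u u'
  proof -
   obtain A where A: "a : hom C A (fst t)" "u : hom C A (fst s)" using rel.mem_hom[OF H(1) h(1)] by blast
   note u' = mem_hom2(1)[OF H(1) h(2) A(1)]
   obtain B b x y where b: "b : hom C B A" "regular_epi C b" "u o b : hom C B (fst s)" "mem M (u o b) x" "mem N (u o b) y"
    by (rule fn_total2[OF m n A(2)])
   note ub = cmp_hom[OF b(1) u'] and ab = cmp_hom[OF b(1) A(1)]
   obtain D e x' y' where e: "e : hom C D B" "regular_epi C e" "(u' o b) o e : hom C D (fst s)" "mem M ((u' o b) o e) x'" "mem N ((u' o b) o e) y'"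
    by (rule fn_total2[OF m n ub])
   have h': "mem H ((a o b) o e) ((u o b) o e)" "mem H ((a o b) o e) ((u' o b) o e)"
    using rel.mem_stable[OF H(1) rel.mem_stable[OF H(1) h(1) b(1) A(1)] e(1) ab] rel.mem_stable[OF H(1) rel.mem_stable[OF H(1) h(2) b(1) A(1)] e(1) ab] by auto
   have 1: "mem M ((u o b) o e) (x o e)" "mem N ((u o b) o e) (y o e)"
    using rel.mem_stable[OF fnD(4)[OF m] b(4) e(1) b(3)] rel.mem_stable[OF fnD(4)[OF n] b(5) e(1) b(3)] by auto
   have "mem M ((u o b) o e) x'" by (rule fnD(8)[OF m 1(1) fnD(5)[OF f H0[OF h'(1) 1(1)] H0[OF h'(2) e(4)]]])
   moreover have "mem N ((u o b) o e) y'" by (rule fnD(8)[OF n 1(2) fnD(5)[OF g H1[OF h'(1) 1(2)] H1[OF h'(2) e(5)]]])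
   ultimately have "mem (snd s) ((u o b) o e) ((u' o b) o e)" using j e(4,5) unfolding jm_def by blast
   then show ?thesis by (rule rel.mem_local[OF S b(2,1) A(2) u' rel.mem_local[OF S e(2,1) b(3) ub]])
  qed
 qed
 show thesis by (rule that[OF h fn_comp_eqI[OF h m f H0] fn_comp_eqI[OF h n g H1]])
qed

lemma fn_joint_cancel:
 assumes m: "fn s p M" and n: "fn s q N" and j: "jm s M N" and f: "fn t s \<Gamma>" and g: "fn t s \<Delta>"
  and eq: "rcomp M \<Gamma> = rcomp M \<Delta>" "rcomp N \<Gamma> = rcomp N \<Delta>"
 shows "\<Gamma> = \<Delta>"
proof (rule fn_eqI[OF f g])
 note F = fnD(4)[OF f] and G = fnD(4)[OF g]
 fix a z assume az: "mem \<Gamma> a z"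
 obtain A where A: "a : hom C A (fst t)" "z : hom C A (fst s)" using rel.mem_hom[OF F az] by blast
 obtain B b z' where b: "b : hom C B A" "regular_epi C b" "z' : hom C B (fst s)" "mem \<Delta> (a o b) z'" by (rule fn_total[OF g A(1)])
 note ab = cmp_hom[OF b(1) A(1)] and zb = cmp_hom[OF b(1) A(2)]
 obtain D d x y where d: "d : hom C D B" "regular_epi C d" "(z o b) o d : hom C D (fst s)" "mem M ((z o b) o d) x" "mem N ((z o b) o d) y"
  by (rule fn_total2[OF m n zb])
 note 3 = rel.mem_stable[OF F rel.mem_stable[OF F az b(1) A(1)] d(1) ab] and 4 = rel.mem_stable[OF G b(4) d(1) ab]
 have "mem (snd s) ((z o b) o d) (z' o d)"
  using j d(4,5) fn_comp_factor[OF refl g m 4 fn_compD[OF eq(1) f m 3 d(4)]] fn_comp_factor[OF refl g n 4 fn_compD[OF eq(2) f n 3 d(5)]]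
  unfolding jm_def by blast
 then have "mem \<Delta> (a o b) (z o b)" by (rule fnD(9)[OF g b(4) rel.mem_local[OF eqvD(2)[OF fnD(1)[OF m]] d(2,1) zb b(3)]])
 then show "mem \<Delta> a z" by (rule rel.mem_local[OF G b(2,1) A])
qed

end

text \<open>The injections \<open>oc\<close> and \<open>ac\<close> encode objects and arrows of the completion in arbitrary types; this is
 needed because the universal property only tests against categories with both in \<open>'u\<close>.\<close>

locale excat = regular C for C :: "('o, 'm) cat" (structure) +
 fixes oc :: "'o \<times> 'm rel => 'p" and ac :: "('o \<times> 'm rel) \<times> ('o \<times> 'm rel) \<times> 'm rel => 'q"
 assumes oc_inj: "inj_on oc {p. eqv p}"
  and ac_inj: "inj_on ac {(p, q, \<Phi>). fn p q \<Phi>}"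
begin

abbreviation "dec == inv_into {(p, q, \<Phi>). fn p q \<Phi>} ac"

text \<open>Every operation decodes, computes with the underlying data and encodes the result;
  injectivity of the codes makes this faithful on genuine objects and arrows.\<close>

definition K :: "('p, 'q) cat" where
 "K = \<lparr>Ob = oc ` {p. eqv p}, Ar = ac ` {(p, q, \<Phi>). fn p q \<Phi>},
   src = (%f. oc (fst (dec f))), tgt = (%f. oc (fst (snd (dec f)))),
   idt = (%P. let p = inv_into {p. eqv p} oc P in ac (p, p, snd p)),
   cmp = (%g f. ac (fst (dec f), fst (snd (dec g)), rcomp (snd (snd (dec g))) (snd (snd (dec f)))))\<rparr>"

abbreviation cmpK (infixr "\<odot>" 70) where "cmpK == cmp K"

lemma dec_ac: "fn p q \<Phi> ==> dec (ac (p, q, \<Phi>)) = (p, q, \<Phi>)"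
 by (rule inv_into_f_f[OF ac_inj]) simp

lemma K_Ob: "Ob K = oc ` {p. eqv p}"
 by (simp add: K_def)

lemma oc_eq: "eqv p ==> eqv q ==> oc p = oc q \<longleftrightarrow> p = q"
 using oc_inj by (auto dest: inj_onD)

lemma ac_eq: "fn p q \<Phi> ==> fn p q \<Psi> ==> ac (p, q, \<Phi>) = ac (p, q, \<Psi>) \<longleftrightarrow> \<Phi> = \<Psi>"
 using inj_onD[OF ac_inj, of "(p, q, \<Phi>)" "(p, q, \<Psi>)"] by auto

lemma ac_hom: "fn p q \<Phi> ==> ac (p, q, \<Phi>) : hom K (oc p) (oc q)"
 unfolding hom_iff by (auto simp: K_def dec_ac)

lemma K_homE:
 assumes "f : hom K P Q"
 obtains p q \<Phi> where "P = oc p" "Q = oc q" "f = ac (p, q, \<Phi>)" "fn p q \<Phi>"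
proof -
 have "f : ac ` {(p, q, \<Phi>). fn p q \<Phi>}" using assms by (simp add: hom_iff K_def)
 then obtain p q \<Phi> where f: "f = ac (p, q, \<Phi>)" "fn p q \<Phi>" by auto
 have "P = oc p" "Q = oc q" using assms ac_hom[OF f(2)] unfolding f(1) hom_iff by auto
 then show thesis using that f by blast
qed

lemma K_homE2:
 assumes "f : hom K (oc p) (oc q)" "eqv p" "eqv q"
 obtains \<Phi> where "f = ac (p, q, \<Phi>)" "fn p q \<Phi>"
proof -
 obtain p' q' \<Phi> where f: "oc p = oc p'" "oc q = oc q'" "f = ac (p', q', \<Phi>)" "fn p' q' \<Phi>"
  by (rule K_homE[OF assms(1)])
 then have "p = p'" "q = q'" using oc_eq fnD(1,2)[OF f(4)] assms by auto
 then show thesis using that f by blast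
qed

lemma K_cmp: "fn p q \<Phi> ==> fn q r \<Psi> ==> ac (q, r, \<Psi>) \<odot> ac (p, q, \<Phi>) = ac (p, r, rcomp \<Psi> \<Phi>)"
 by (simp add: K_def dec_ac)

lemma K_idt: "eqv p ==> idt K (oc p) = ac (p, p, snd p)"
 by (simp add: K_def inv_into_f_f[OF oc_inj])

lemma K_hom_eqv: "f : hom K P Q ==> EX p q. P = oc p & Q = oc q & eqv p & eqv q"
 by (erule K_homE) (use fnD(1,2) in blast)

lemma category_K: "category K"
proof (unfold_locales, goal_cases)
 case (1 f)
 then have "f : hom K (src K f) (tgt K f)" by (simp add: hom_iff)
 then show ?case using K_hom_eqv unfolding K_Ob by blast
next
 case (2 f)
 then have "f : hom K (src K f) (tgt K f)" by (simp add: hom_iff)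
 then show ?case using K_hom_eqv unfolding K_Ob by blast
next
 case (3 X)
 then obtain p where "X = oc p" "eqv p" unfolding K_Ob by blast
 then show ?case using ac_hom[OF fn_id] K_idt by simp
next
 case (4 f X Y g Z)
 obtain p q \<Phi> where f: "X = oc p" "Y = oc q" "f = ac (p, q, \<Phi>)" "fn p q \<Phi>" by (rule K_homE[OF 4(1)])
 obtain q' r \<Psi> where g: "Y = oc q'" "Z = oc r" "g = ac (q', r, \<Psi>)" "fn q' r \<Psi>" by (rule K_homE[OF 4(2)])
 have "q' = q" using f g oc_eq fnD(1,2) by metis
 then show ?case using f g K_cmp ac_hom[OF fn_comp] by simp
next
 case (5 f X Y)
 obtain p q \<Phi> where f: "X = oc p" "Y = oc q" "f = ac (p, q, \<Phi>)" "fn p q \<Phi>" by (rule K_homE[OF 5])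
 note c = fnD(1,2)[OF f(4)]
 have "rcomp (snd q) \<Phi> = \<Phi>" by (rule rel.lax_module_comp_id(2)[OF eqvD(6)[OF c(1)] eqvD(6)[OF c(2)] fnD(3)[OF f(4)]])
 then show ?case using f K_cmp[OF f(4) fn_id[OF c(2)]] K_idt[OF c(2)] by simp
next
 case (6 f X Y)
 obtain p q \<Phi> where f: "X = oc p" "Y = oc q" "f = ac (p, q, \<Phi>)" "fn p q \<Phi>" by (rule K_homE[OF 6])
 note c = fnD(1,2)[OF f(4)]
 have "rcomp \<Phi> (snd p) = \<Phi>" by (rule rel.lax_module_comp_id(1)[OF eqvD(6)[OF c(1)] eqvD(6)[OF c(2)] fnD(3)[OF f(4)]])
 then show ?case using f K_cmp[OF fn_id[OF c(1)] f(4)] K_idt[OF c(1)] by simp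
next
 case (7 f W X g Y h Z)
 obtain p q \<Phi> where f: "W = oc p" "X = oc q" "f = ac (p, q, \<Phi>)" "fn p q \<Phi>" by (rule K_homE[OF 7(1)])
 have e: "eqv q" by (rule fnD(2)[OF f(4)])
 obtain q' r \<Psi> where g: "X = oc q'" "Y = oc r" "g = ac (q', r, \<Psi>)" "fn q' r \<Psi>" by (rule K_homE[OF 7(2)])
 have "q' = q" using f(2) g(1) oc_eq[OF e fnD(1)[OF g(4)]] by simp
 note g = g[unfolded this]
 obtain r' s \<Theta> where h: "Y = oc r'" "Z = oc s" "h = ac (r', s, \<Theta>)" "fn r' s \<Theta>" by (rule K_homE[OF 7(3)])
 have "r' = r" using g(2) h(1) oc_eq[OF fnD(2)[OF g(4)] fnD(1)[OF h(4)]] by simp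
 note h = h[unfolded this]
 show ?case unfolding f(3) g(3) h(3) K_cmp[OF g(4) h(4)] K_cmp[OF f(4) g(4)]
   K_cmp[OF f(4) fn_comp[OF g(4) h(4)]] K_cmp[OF fn_comp[OF f(4) g(4)] h(4)]
   rel.rel_comp_assoc[OF fnD(4)[OF f(4)] fnD(4)[OF g(4)] fnD(4)[OF h(4)]] ..
qed

lemma K_cmp_eq_iff:
 assumes f: "fn p q \<Phi>" and g: "fn q r \<Psi>" and h: "fn p r \<Theta>"
 shows "ac (q, r, \<Psi>) \<odot> ac (p, q, \<Phi>) = ac (p, r, \<Theta>) \<longleftrightarrow> rcomp \<Psi> \<Phi> = \<Theta>"
 unfolding K_cmp[OF f g] by (rule ac_eq[OF fn_comp[OF f g] h])

lemma K_cmp_eq_iff2: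
 assumes f: "fn p q \<Phi>" and g: "fn q r \<Psi>" and f': "fn p q' \<Phi>'" and g': "fn q' r \<Psi>'"
 shows "ac (q, r, \<Psi>) \<odot> ac (p, q, \<Phi>) = ac (q', r, \<Psi>') \<odot> ac (p, q', \<Phi>') \<longleftrightarrow> rcomp \<Psi> \<Phi> = rcomp \<Psi>' \<Phi>'"
 unfolding K_cmp[OF f g] K_cmp[OF f' g'] by (rule ac_eq[OF fn_comp[OF f g] fn_comp[OF f' g']])

subsection \<open>Finite limits\<close>

text \<open>Limits in \<open>K\<close> are recast as conditions on elements of \<open>C\<close>,
  that is, entailments between relations, because in this form they can be carried along a regular
  functor. The same holds for \<open>product_data\<close> and \<open>equalizer_data\<close>.\<close>

definition terminal_data :: "'o \<times> 'm rel => bool" where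
 "terminal_data t \<longleftrightarrow> eqv t &
   (ALL A:Ob C. EX B. EX a:hom C B A. EX z:hom C B (fst t). regular_epi C a) &
   (ALL A. ALL z:hom C A (fst t). ALL z':hom C A (fst t). mem (snd t) z z')"

lemma terminal_dataI:
 assumes t: "terminal_data t" shows "is_terminal K (oc t)"
proof -
 have e: "eqv t" and ex: "!!A. A : Ob C ==> EX B. EX a:hom C B A. EX z:hom C B (fst t). regular_epi C a"
  and un: "!!A z z'. z : hom C A (fst t) ==> z' : hom C A (fst t) ==> mem (snd t) z z'"
  using t unfolding terminal_data_def by blast+
 have "EX! f. f : hom K (oc p) (oc t)" if p: "eqv p" for p
 proof -
  obtain \<Phi> where \<Phi>: "\<Phi> : Rel (fst p) (fst t)" and m: "ALL x y. mem \<Phi> x y \<longleftrightarrow> (EX A. x : hom C A (fst p) & y : hom C A (fst t))"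
   by (rule rel_top[OF eqvD(1)[OF p] eqvD(1)[OF e]])
  have f: "fn p t \<Phi>"
  proof (rule fnI[OF p e \<Phi>])
   fix x' x y assume "mem (snd p) x' x" "mem \<Phi> x y"
   then show "mem \<Phi> x' y" using m mem_hom2(2)[OF eqvD(2)[OF p]] by blast
  next
   fix x y y' assume "mem \<Phi> x y" "mem (snd t) y y'"
   then show "mem \<Phi> x y'" using m mem_hom2(1)[OF eqvD(2)[OF e]] by blast
  next
   fix x y y' assume *: "mem \<Phi> x y" "mem \<Phi> x y'"
   obtain A where A: "x : hom C A (fst p)" "y : hom C A (fst t)" using m * by blast
   have "y' : hom C A (fst t)" by (rule mem_hom2(1)[OF \<Phi> *(2) A(1)])
   then show "mem (snd t) y y'" using un A by blast
  next
   fix A x assume x: "x : hom C A (fst p)"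
   then obtain B a z where *: "a : hom C B A" "z : hom C B (fst t)" "regular_epi C a" using ex hom_Ob by blast
   have "x o a : hom C B (fst p)" using x * by (simp add: hom_iff)
   then show "EX B. EX a:hom C B A. EX y. regular_epi C a & mem \<Phi> (x o a) y" using m * by blast
  qed
  have "g = ac (p, t, \<Phi>)" if g: "g : hom K (oc p) (oc t)" for g
  proof -
   obtain \<Psi> where \<Psi>: "g = ac (p, t, \<Psi>)" "fn p t \<Psi>" by (rule K_homE2[OF g p e])
   have "\<Psi> = \<Phi>" by (rule fn_eqI[OF \<Psi>(2) f]) (use m rel.mem_hom[OF fnD(4)[OF \<Psi>(2)]] in blast)
   then show ?thesis using \<Psi> by simp
  qed
  then show ?thesis using ac_hom[OF f] by blast
 qed
 then show ?thesis unfolding is_terminal_def K_Ob using e by blast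
qed

lemma terminal_dataD:
 assumes "is_terminal K P"
 obtains t where "P = oc t" "terminal_data t"
proof -
 obtain t where t: "P = oc t" "eqv t" using assms unfolding is_terminal_def K_Ob by blast
 have ex1: "EX! f. f : hom K (oc p) (oc t)" if "eqv p" for p
  using assms that unfolding t(1) is_terminal_def K_Ob by blast
 have "EX B. EX a:hom C B A. EX z:hom C B (fst t). regular_epi C a" if A: "A : Ob C" for A
 proof -
  obtain f where f: "f : hom K (oc (jo A)) (oc t)" using ex1[OF eqv_jo[OF A]] by blast
  obtain U where U: "fn (jo A) t U" by (rule K_homE2[OF f eqv_jo[OF A] t(2)])
  show ?thesis by (rule jo_arrow_local[OF U]) blast
 qed
 moreover have "mem (snd t) z z'" if z: "z : hom C A (fst t)" "z' : hom C A (fst t)" for A z z'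
 proof -
  have A: "A : Ob C" using hom_Ob[OF z(1)] by blast
  have "ac (jo A, t, pt t z) = ac (jo A, t, pt t z')"
   using ex1[OF eqv_jo[OF A]] ac_hom[OF fn_pt[OF t(2) z(1)]] ac_hom[OF fn_pt[OF t(2) z(2)]] by blast
  then show ?thesis unfolding ac_eq[OF fn_pt[OF t(2) z(1)] fn_pt[OF t(2) z(2)]] pt_eq_iff[OF t(2) z] .
 qed
 ultimately have "terminal_data t" unfolding terminal_data_def using t(2) by blast
 then show thesis using that t by blast
qed

text \<open>The arrow \<open>u\<close> becomes an element \<open>z\<close> only after a cover. One
  cover has to serve all legs \<open>M\<close> of a limit cone at once, hence the quantifier inside
  the conclusion.\<close>

lemma jo_lift:
 assumes u: "u : hom K (oc (jo A)) (oc s)" and A: "A : Ob C" and s: "eqv s"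
 obtains B a z where "a : hom C B A" "regular_epi C a" "z : hom C B (fst s)"
  "ALL p M x. fn s p M --> x : hom C A (fst p) --> ac (s, p, M) \<odot> u = ac (jo A, p, pt p x) --> mem M z (x o a)"
proof -
 obtain U where U: "u = ac (jo A, s, U)" "fn (jo A) s U" by (rule K_homE2[OF u eqv_jo[OF A] s])
 obtain B a z where a: "a : hom C B A" "regular_epi C a" "z : hom C B (fst s)" "mem U a z" "rcomp U (pt (jo A) a) = pt s z"
  by (rule jo_arrow_local[OF U(2)])
 have "mem M z (x o a)" if m: "fn s p M" and x: "x : hom C A (fst p)" and eq: "ac (s, p, M) \<odot> u = ac (jo A, p, pt p x)" for p M x
 proof -
  note p = fnD(2)[OF m]
  have c: "rcomp M U = pt p x" using eq unfolding U(1) K_cmp_eq_iff[OF U(2) m fn_pt[OF p x]] .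
  have "mem (pt p x) a (x o a)" unfolding mem_pt[OF p x] using a(1) eqvD(3)[OF p cmp_hom[OF a(1) x]] by blast
  then show ?thesis by (rule fn_comp_factor[OF c U(2) m a(4)])
 qed
 then show thesis using that[OF a(1-3)] by blast
qed

text \<open>Cancellation in \<open>K\<close> is applied to the arrows of the elements
  \<open>z\<close> and \<open>z'\<close>, which the dictionary of \<open>pt_comp\<close> makes agree
  under both legs.\<close>

lemma jmI:
 assumes m: "fn s p M" and n: "fn s q N"
  and un: "ALL A. ALL u:hom K A (oc s). ALL v:hom K A (oc s). ac (s, p, M) \<odot> u = ac (s, p, M) \<odot> v --> ac (s, q, N) \<odot> u = ac (s, q, N) \<odot> v --> u = v"
 shows "jm s M N"
 unfolding jm_def
proof (intro allI impI)
 fix z z' x y assume k: "mem M z x" "mem M z' x" "mem N z y" "mem N z' y"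
 obtain A where A: "z : hom C A (fst s)" "x : hom C A (fst p)" using rel.mem_hom[OF fnD(4)[OF m] k(1)] by blast
 note z' = mem_hom2(2)[OF fnD(4)[OF m] k(2) A(2)]
 note pz = fn_pt[OF fnD(1)[OF m] A(1)] and pz' = fn_pt[OF fnD(1)[OF m] z']
 have "ac (jo A, s, pt s z) = ac (jo A, s, pt s z')"
  using un ac_hom[OF pz] ac_hom[OF pz'] pt_comp[OF m k(1) A(1)] pt_comp[OF m k(2) z'] pt_comp[OF n k(3) A(1)] pt_comp[OF n k(4) z']
  by (simp add: K_cmp[OF pz m] K_cmp[OF pz' m] K_cmp[OF pz n] K_cmp[OF pz' n])
 then show "mem (snd s) z z'" unfolding ac_eq[OF pz pz'] pt_eq_iff[OF fnD(1)[OF m] A(1) z'] .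
qed

lemma K_joint_cancel:
 assumes m: "fn s p M" and n: "fn s q N" and j: "jm s M N" and u: "u : hom K D (oc s)" and v: "v : hom K D (oc s)"
  and eq: "ac (s, p, M) \<odot> u = ac (s, p, M) \<odot> v" "ac (s, q, N) \<odot> u = ac (s, q, N) \<odot> v"
 shows "u = v"
proof -
 obtain t where t: "D = oc t" "eqv t" using K_hom_eqv[OF u] by blast
 obtain \<Gamma> where \<Gamma>: "u = ac (t, s, \<Gamma>)" "fn t s \<Gamma>" by (rule K_homE2[OF u[unfolded t(1)] t(2) fnD(1)[OF m]])
 obtain \<Delta> where \<Delta>: "v = ac (t, s, \<Delta>)" "fn t s \<Delta>" by (rule K_homE2[OF v[unfolded t(1)] t(2) fnD(1)[OF m]])
 show ?thesis using fn_joint_cancel[OF m n j \<Gamma>(2) \<Delta>(2)] eq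
  unfolding \<Gamma>(1) \<Delta>(1) K_cmp_eq_iff2[OF \<Gamma>(2) m \<Delta>(2) m] K_cmp_eq_iff2[OF \<Gamma>(2) n \<Delta>(2) n] by blast
qed

definition product_data :: "'o \<times> 'm rel => 'o \<times> 'm rel => 'o \<times> 'm rel => 'm rel => 'm rel => bool" where
 "product_data p q r \<Pi>0 \<Pi>1 \<longleftrightarrow> fn r p \<Pi>0 & fn r q \<Pi>1 &
   (ALL A. ALL x:hom C A (fst p). ALL y:hom C A (fst q). EX B. EX a:hom C B A. EX z. regular_epi C a &
    mem \<Pi>0 z (x o a) & mem \<Pi>1 z (y o a)) & jm r \<Pi>0 \<Pi>1"

lemma product_dataI:
 assumes d: "product_data p q r \<Pi>0 \<Pi>1"
 shows "is_product K (oc p) (oc q) (ac (r, p, \<Pi>0)) (ac (r, q, \<Pi>1))"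
proof -
 have f: "fn r p \<Pi>0" "fn r q \<Pi>1" and j: "jm r \<Pi>0 \<Pi>1"
  and ex: "!!A x y. x : hom C A (fst p) ==> y : hom C A (fst q) ==> EX B. EX a:hom C B A. EX z. regular_epi C a &
    mem \<Pi>0 z (x o a) & mem \<Pi>1 z (y o a)"
  using d unfolding product_data_def by blast+
 have E: "EX u:hom K D (oc r). ac (r, p, \<Pi>0) \<odot> u = x & ac (r, q, \<Pi>1) \<odot> u = y"
  if x: "x : hom K D (oc p)" and y: "y : hom K D (oc q)" for D x y
 proof -
  obtain s where s: "D = oc s" "eqv s" using K_hom_eqv[OF x] by blast
  obtain \<Phi> where \<Phi>: "x = ac (s, p, \<Phi>)" "fn s p \<Phi>" by (rule K_homE2[OF x[unfolded s(1)] s(2) fnD(2)[OF f(1)]])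
  obtain \<Psi> where \<Psi>: "y = ac (s, q, \<Psi>)" "fn s q \<Psi>" by (rule K_homE2[OF y[unfolded s(1)] s(2) fnD(2)[OF f(2)]])
  obtain H where h: "fn s r H" "rcomp \<Pi>0 H = \<Phi>" "rcomp \<Pi>1 H = \<Psi>"
   by (rule fn_pair[OF f j \<Phi>(2) \<Psi>(2) ex]) (erule (1) mem_hom2(1)[OF fnD(4)[OF \<Phi>(2)]] mem_hom2(1)[OF fnD(4)[OF \<Psi>(2)]])+
  show ?thesis unfolding s(1) \<Phi>(1) \<Psi>(1)
   using ac_hom[OF h(1)] K_cmp[OF h(1) f(1)] K_cmp[OF h(1) f(2)] h(2,3) by auto
 qed
 show ?thesis unfolding category.is_product_iff[OF category_K]
  by (intro exI conjI ballI allI impI; (rule ac_hom[OF f(1)] ac_hom[OF f(2)] E K_joint_cancel[OF f j]; assumption)?)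
qed

text \<open>The universal property is tested on arrows out of discrete objects \<open>jo A\<close>,
  which include all elements at stage \<open>A\<close>.\<close>

lemma product_dataD:
 assumes "is_product K (oc p) (oc q) (ac (r, p, \<Pi>0)) (ac (r, q, \<Pi>1))" and f: "fn r p \<Pi>0" "fn r q \<Pi>1"
 shows "product_data p q r \<Pi>0 \<Pi>1"
proof -
 obtain P where P: "ac (r, p, \<Pi>0) : hom K P (oc p)"
  and ex: "ALL A. ALL x:hom K A (oc p). ALL y:hom K A (oc q). EX u:hom K A P. ac (r, p, \<Pi>0) \<odot> u = x & ac (r, q, \<Pi>1) \<odot> u = y"
  and un: "ALL A. ALL u:hom K A P. ALL v:hom K A P. ac (r, p, \<Pi>0) \<odot> u = ac (r, p, \<Pi>0) \<odot> v -->
   ac (r, q, \<Pi>1) \<odot> u = ac (r, q, \<Pi>1) \<odot> v --> u = v"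
  using assms(1) unfolding category.is_product_iff[OF category_K] by blast
 have Pr: "P = oc r" using P ac_hom[OF f(1)] by (simp add: hom_iff)
 have "EX B. EX a:hom C B A. EX z. regular_epi C a & mem \<Pi>0 z (x o a) & mem \<Pi>1 z (y o a)"
  if x: "x : hom C A (fst p)" and y: "y : hom C A (fst q)" for A x y
 proof -
  have A: "A : Ob C" using hom_Ob[OF x] by blast
  obtain u where u: "u : hom K (oc (jo A)) (oc r)" "ac (r, p, \<Pi>0) \<odot> u = ac (jo A, p, pt p x)" "ac (r, q, \<Pi>1) \<odot> u = ac (jo A, q, pt q y)"
   using ex ac_hom[OF fn_pt[OF fnD(2)[OF f(1)] x]] ac_hom[OF fn_pt[OF fnD(2)[OF f(2)] y]] unfolding Pr by blast
  show ?thesis by (rule jo_lift[OF u(1) A fnD(1)[OF f(1)]]) (use f x y u(2,3) in blast)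
 qed
 then show ?thesis unfolding product_data_def using f jmI[OF f un[unfolded Pr]] by blast
qed

end

section \<open>Pulled back equivalence relations, descent and kernels\<close>

context regular begin

lemma pull_eqv:
 assumes p: "eqv p" and t: "t : hom C T (fst p)"
 obtains S where "eqv (T, S)"
  "ALL z z'. mem S z z' \<longleftrightarrow> (EX A. z : hom C A T & z' : hom C A T) & mem (snd p) (t o z) (t o z')"
proof -
 obtain S where S: "S : Rel T T"
  "ALL x y. mem S x y \<longleftrightarrow> (EX A. x : hom C A T & y : hom C A T) & mem (snd p) (t o x) (t o y)"
  by (rule rel_inv_image[OF eqvD(2)[OF p] t t])
 have "eqv (T, S)"
 proof (rule eqvI)
  show "T : Ob C" using hom_Ob[OF t] by blast
  show "S : Rel T T" by (rule S(1))
  fix A x assume x: "x : hom C A T"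
  then have "t o x : hom C A (fst p)" using t by (simp add: hom_iff)
  then show "mem S x x" using S(2) x eqvD(3)[OF p] by blast
 next
  fix x y assume "mem S x y" then show "mem S y x" using S(2) eqvD(4)[OF p] by blast
 next
  fix x y z assume 1: "mem S x y" "mem S y z"
  then obtain A where A: "x : hom C A T" "y : hom C A T" using S(2) by blast
  have "z : hom C A T" by (rule mem_hom2(1)[OF S(1) 1(2) A(2)])
  then show "mem S x z" using S(2) A 1 eqvD(5)[OF p] by blast
 qed
 then show thesis using that S(2) by blast
qed

lemma inter_eqv:
 assumes p: "eqv (X, R)" and q: "eqv (X, S)"
 obtains T where "eqv (X, T)" "ALL z z'. mem T z z' \<longleftrightarrow> mem R z z' & mem S z z'"
proof -
 note e = eqvD[OF p, unfolded fst_conv snd_conv] and f = eqvD[OF q, unfolded fst_conv snd_conv]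
 obtain T where T: "T : Rel X X" "ALL x y. mem T x y \<longleftrightarrow> mem R x y & mem S x y" by (rule rel_inter[OF e(2) f(2)])
 have "eqv (X, T)"
 proof (rule eqvI[OF e(1) T(1)])
  fix A x assume x: "x : hom C A X" then show "mem T x x" using T(2) e(3) f(3) by blast
 next
  fix x y assume "mem T x y" then show "mem T y x" using T(2) e(4) f(4) by blast
 next
  fix x y z assume "mem T x y" "mem T y z" then show "mem T x z" using T(2) e(5) f(5) by blast
 qed
 then show thesis using that T(2) by blast
qed

lemma fn_of_hom:
 assumes r: "eqv r" and p: "eqv p" and t: "t : hom C (fst r) (fst p)"
  and c: "!!z z'. mem (snd r) z z' ==> mem (snd p) (t o z) (t o z')"
 shows "fn r p (pt p t)"
proof (rule fnI[OF r p pt_rels[OF p t]])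
 fix z' z y assume 1: "mem (snd r) z' z" and 2: "mem (pt p t) z y"
 then obtain A where z: "z : hom C A (fst r)" "mem (snd p) (t o z) y" unfolding mem_pt[OF p t] by blast
 have "z' : hom C A (fst r)" by (rule mem_hom2(2)[OF eqvD(2)[OF r] 1 z(1)])
 then show "mem (pt p t) z' y" unfolding mem_pt[OF p t] using eqvD(5)[OF p c[OF 1] z(2)] by blast
next
 fix z y y' assume "mem (pt p t) z y" "mem (snd p) y y'"
 then show "mem (pt p t) z y'" unfolding mem_pt[OF p t] using eqvD(5)[OF p] by blast
next
 fix z y y' assume "mem (pt p t) z y" "mem (pt p t) z y'"
 then show "mem (snd p) y y'" unfolding mem_pt[OF p t] using eqvD(4,5)[OF p] by blast
next
 fix A z assume z: "z : hom C A (fst r)"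
 then have "t o z : hom C A (fst p)" using t by (simp add: hom_iff)
 then have "mem (pt p t) z (t o z)" unfolding mem_pt[OF p t] using z eqvD(3)[OF p] by blast
 then show "EX B. EX a:hom C B A. EX y. regular_epi C a & mem (pt p t) (z o a) y"
  using cover_self[OF z, of "%z. EX y. mem (pt p t) z y"] by blast
qed

text \<open>\<open>H\<close> is \<open>\<Xi>\<close> after the converse of \<open>\<Phi>\<close>.
  Surjectivity of \<open>\<Phi>\<close> makes it total, and \<open>c\<close>, the constancy of
  \<open>\<Xi>\<close> on the fibres of \<open>\<Phi>\<close>, makes it single-valued.\<close>

lemma fn_desc:
 assumes f: "fn p q \<Phi>" and s: "surj q \<Phi>" and g: "fn p w \<Xi>"
  and c: "!!x x' y z. mem \<Phi> x y ==> mem \<Phi> x' y ==> mem \<Xi> x z ==> mem \<Xi> x' z"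
 obtains H where "fn q w H" "rcomp H \<Phi> = \<Xi>"
proof -
 note e = fnD(1)[OF f] fnD(2)[OF f] fnD(2)[OF g] and F = fnD(4)[OF f] and G = fnD(4)[OF g]
 note k = rel_converse[OF F]
 define H where "H = rcomp \<Xi> (\<Phi>\<inverse>)"
 have lm: "lax_module (disc C) q w H" unfolding H_def
  by (rule rel.lax_module_comp[OF eqvD(6)[OF e(2)] eqvD(6)[OF e(1)] eqvD(6)[OF e(3)] lax_module_converse[OF f] fnD(3)[OF g]])
 have HR: "H : Rel (fst q) (fst w)" unfolding H_def by (rule rel.rel_comp_rels[OF k(1) G])
 have m0: "mem \<Xi> x z" if h: "mem \<Phi> x y" "mem H y z" for x y z
 proof -
  obtain A B b x' where a: "y : hom C A (fst q)" "z : hom C A (fst w)" "b : hom C B A" "regular_epi C b"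
   "x' : hom C B (fst p)" "mem (\<Phi>\<inverse>) (y o b) x'" "mem \<Xi> x' (z o b)"
   by (rule rel.mem_compE[OF k(1) G h(2)[unfolded H_def]])
  have x: "x : hom C A (fst p)" by (rule mem_hom2(2)[OF F h(1) a(1)])
  have "mem \<Phi> (x o b) (y o b)" by (rule rel.mem_stable[OF F h(1) a(3) x])
  then have "mem \<Xi> (x o b) (z o b)" using c a(6,7) k(2) by blast
  then show ?thesis by (rule rel.mem_local[OF G a(4,3) x a(2)])
 qed
 have tot: "EX B. EX b:hom C B A. EX z. regular_epi C b & mem H (y o b) z" if y: "y : hom C A (fst q)" for A y
 proof -
  obtain B b x where b: "b : hom C B A" "regular_epi C b" "x : hom C B (fst p)" "mem \<Phi> x (y o b)" by (rule surjE[OF s F y])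
  obtain D d z where d: "d : hom C D B" "regular_epi C d" "z : hom C D (fst w)" "mem \<Xi> (x o d) z" by (rule fn_total[OF g b(3)])
  have "mem \<Phi> (x o d) ((y o b) o d)" by (rule rel.mem_stable[OF F b(4) d(1) b(3)])
  then have "mem H ((y o b) o d) z" unfolding H_def
   by (intro rel.mem_compI[OF k(1) G _ d(4)]) (use k(2) in blast)
  moreover have "(y o b) o d = y o (b o d)" "b o d : hom C D A" using y b d by (auto simp: hom_iff)
  ultimately show ?thesis using regular_epi_cmp[OF d(2,1) b(2,1)] by auto
 qed
 have sv: "mem (snd w) z z'" if h: "mem H y z" "mem H y z'" for y z z'
 proof -
  obtain A where A: "y : hom C A (fst q)" "z : hom C A (fst w)" using rel.mem_hom[OF HR h(1)] by blast
  have z': "z' : hom C A (fst w)" by (rule mem_hom2(1)[OF HR h(2) A(1)])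
  obtain B b x where b: "b : hom C B A" "regular_epi C b" "x : hom C B (fst p)" "mem \<Phi> x (y o b)" by (rule surjE[OF s F A(1)])
  have "mem H (y o b) (z o b)" "mem H (y o b) (z' o b)"
   using rel.mem_stable[OF HR h(1) b(1) A(1)] rel.mem_stable[OF HR h(2) b(1) A(1)] by auto
  then have "mem (snd w) (z o b) (z' o b)" using fnD(5)[OF g m0[OF b(4)] m0[OF b(4)]] by blast
  then show ?thesis by (rule rel.mem_local[OF eqvD(2)[OF e(3)] b(2,1) A(2) z'])
 qed
 have h: "fn q w H" unfolding fn_def using e lm by (intro conjI allI ballI impI) (assumption | rule tot | erule (1) sv)+
 show thesis by (rule that[OF h fn_comp_eqI[OF f h g m0]])
qed

lemma surj_cancel:
 assumes f: "fn p q \<Phi>" and s: "surj q \<Phi>" and u: "fn q w U" and v: "fn q w V" and e: "rcomp U \<Phi> = rcomp V \<Phi>"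
 shows "U = V"
proof (rule fn_eqI[OF u v])
 fix y z assume m: "mem U y z"
 obtain A where A: "y : hom C A (fst q)" "z : hom C A (fst w)" using rel.mem_hom[OF fnD(4)[OF u] m] by blast
 obtain B b x where b: "b : hom C B A" "regular_epi C b" "x : hom C B (fst p)" "mem \<Phi> x (y o b)" by (rule surjE[OF s fnD(4)[OF f] A(1)])
 have "mem U (y o b) (z o b)" by (rule rel.mem_stable[OF fnD(4)[OF u] m b(1) A(1)])
 then have "mem (rcomp V \<Phi>) x (z o b)" by (rule fn_compD[OF e f u b(4)])
 then have "mem V (y o b) (z o b)" by (rule fn_comp_factor[OF refl f v b(4)])
 then show "mem V y z" by (rule rel.mem_local[OF fnD(4)[OF v] b(2,1) A])
qed

text \<open>The kernel pair of \<open>\<Phi>\<close> as a relation in \<open>C\<close>: having,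
  locally, a common value.\<close>

definition ker :: "'m rel => 'm rel" where
 "ker \<Phi> = rcomp (\<Phi>\<inverse>) \<Phi>"

lemma ker_rels: "fn p q \<Phi> ==> ker \<Phi> : Rel (fst p) (fst p)"
 unfolding ker_def by (rule rel.rel_comp_rels[OF fnD(4) rel_converse(1)[OF fnD(4)]])

lemma kerI: "fn p q \<Phi> ==> mem \<Phi> x y ==> mem \<Phi> x' y ==> mem (ker \<Phi>) x x'"
 unfolding ker_def
 by (rule rel.mem_compI[OF fnD(4) rel_converse(1)[OF fnD(4)]]) (assumption | subst rel_converse(2), erule fnD(4))+

lemma ker_mem:
 assumes f: "fn p q \<Phi>" and k: "mem (ker \<Phi>) x x'" and m: "mem \<Phi> x y"
 shows "mem \<Phi> x' y"
proof -
 note F = fnD(4)[OF f]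
 obtain A B b z where a: "x : hom C A (fst p)" "x' : hom C A (fst p)" "b : hom C B A" "regular_epi C b"
   "z : hom C B (fst q)" "mem \<Phi> (x o b) z" "mem (\<Phi>\<inverse>) z (x' o b)"
  by (rule rel.mem_compE[OF F rel_converse(1)[OF F] k[unfolded ker_def]])
 have y: "y : hom C A (fst q)" by (rule mem_hom2(1)[OF F m a(1)])
 have 1: "mem \<Phi> (x' o b) z" using a(7) rel_converse(2)[OF F] by blast
 have "mem \<Phi> (x o b) (y o b)" by (rule rel.mem_stable[OF F m a(3,1)])
 then have "mem \<Phi> (x' o b) (y o b)" by (rule fnD(8)[OF f 1 fnD(5)[OF f a(6)]])
 then show ?thesis by (rule rel.mem_local[OF F a(4,3,2) y])
qed

lemma eqv_ker:
 assumes f: "fn p q \<Phi>" shows "eqv (fst p, ker \<Phi>)"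
proof (rule eqvI[OF eqvD(1)[OF fnD(1)[OF f]] ker_rels[OF f]])
 fix A x assume x: "x : hom C A (fst p)"
 obtain B b y where b: "b : hom C B A" "regular_epi C b" "y : hom C B (fst q)" "mem \<Phi> (x o b) y" by (rule fn_total[OF f x])
 show "mem (ker \<Phi>) x x" by (rule rel.mem_local[OF ker_rels[OF f] b(2,1) x x kerI[OF f b(4,4)]])
next
 have sym: "mem (ker \<Phi>) x' x & mem (ker \<Phi>) x x''" if k: "mem (ker \<Phi>) x x'" "mem (ker \<Phi>) x' x''" for x x' x''
 proof -
  obtain A where A: "x : hom C A (fst p)" "x' : hom C A (fst p)" using rel.mem_hom[OF ker_rels[OF f] k(1)] by blast
  have x'': "x'' : hom C A (fst p)" by (rule mem_hom2(1)[OF ker_rels[OF f] k(2) A(2)])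
  obtain B b y where b: "b : hom C B A" "regular_epi C b" "y : hom C B (fst q)" "mem \<Phi> (x o b) y" by (rule fn_total[OF f A(1)])
  have 1: "mem \<Phi> (x' o b) y" by (rule ker_mem[OF f rel.mem_stable[OF ker_rels[OF f] k(1) b(1) A(1)] b(4)])
  have 2: "mem \<Phi> (x'' o b) y" by (rule ker_mem[OF f rel.mem_stable[OF ker_rels[OF f] k(2) b(1) A(2)] 1])
  show ?thesis
   using rel.mem_local[OF ker_rels[OF f] b(2,1) A(2,1) kerI[OF f 1 b(4)]]
    rel.mem_local[OF ker_rels[OF f] b(2,1) A(1) x'' kerI[OF f b(4) 2]] by blast
 qed
 fix x y assume k: "mem (ker \<Phi>) x y"
 obtain A where A: "x : hom C A (fst p)" "y : hom C A (fst p)" using rel.mem_hom[OF ker_rels[OF f] k] by blast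
 obtain B b z where b: "b : hom C B A" "regular_epi C b" "z : hom C B (fst q)" "mem \<Phi> (x o b) z" by (rule fn_total[OF f A(1)])
 have 1: "mem \<Phi> (y o b) z" by (rule ker_mem[OF f rel.mem_stable[OF ker_rels[OF f] k b(1) A(1)] b(4)])
 show "mem (ker \<Phi>) y x" by (rule rel.mem_local[OF ker_rels[OF f] b(2,1) A(2,1) kerI[OF f 1 b(4)]])
 show "mem (ker \<Phi>) y z ==> mem (ker \<Phi>) x z" for z using sym[OF k] by blast
qed

text \<open>\<open>N\<close> appears in two roles: as the equivalence relation of the quotient
  object and as the functional relation that is the quotient map.\<close>

lemma fn_coarsen:
 assumes p: "eqv p" and q: "eqv (fst p, N)" and le: "!!x y. mem (snd p) x y ==> mem N x y"
 shows "fn p (fst p, N) N" "surj (fst p, N) N"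
proof -
 note e = eqvD[OF q, unfolded fst_conv snd_conv]
 show "fn p (fst p, N) N"
 proof (rule fnI[OF p q], unfold fst_conv snd_conv)
  show "N : Rel (fst p) (fst p)" by (rule e(2))
  show "mem (snd p) x' x ==> mem N x y ==> mem N x' y" for x' x y using e(5) le by blast
  show "mem N x y ==> mem N y y' ==> mem N x y'" for x y y' by (rule e(5))
  show "mem N x y ==> mem N x y' ==> mem N y y'" for x y y' using e(4,5) by blast
  show "EX B. EX a:hom C B A. EX y. regular_epi C a & mem N (x o a) y" if x: "x : hom C A (fst p)" for A x
   using cover_self[OF x, of "%x. mem N x x"] e(3)[OF x] by blast
 qed
 show "surj (fst p, N) N" unfolding surj_def fst_conv
 proof (intro allI ballI)
  fix A x assume x: "x : hom C A (fst p)"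
  show "EX B. EX a:hom C B A. EX y. regular_epi C a & mem N y (x o a)"
   using cover_self[OF x, of "%x. mem N x x"] e(3)[OF x] by blast
 qed
qed

text \<open>This is the image of \<open>\<Phi>\<close> in the completion: the same underlying object
  with the coarser relation \<open>ker \<Phi>\<close>.\<close>

lemma fn_ker:
 assumes h: "fn p q \<Phi>"
 shows "fn p (fst p, ker \<Phi>) (ker \<Phi>)" "surj (fst p, ker \<Phi>) (ker \<Phi>)"
proof -
 note p = fnD(1)[OF h]
 have "mem (ker \<Phi>) x y" if xy: "mem (snd p) x y" for x y
 proof -
  obtain A where A: "x : hom C A (fst p)" "y : hom C A (fst p)" using rel.mem_hom[OF eqvD(2)[OF p] xy] by blast
  obtain B b z where b: "b : hom C B A" "regular_epi C b" "z : hom C B (fst q)" "mem \<Phi> (x o b) z" by (rule fn_total[OF h A(1)])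
  have "mem \<Phi> (y o b) z" by (rule fnD(7)[OF h rel.mem_stable[OF eqvD(2)[OF p] xy b(1) A(1)] b(4)])
  then show ?thesis by (rule rel.mem_local[OF ker_rels[OF h] b(2,1) A kerI[OF h b(4)]])
 qed
 then show "fn p (fst p, ker \<Phi>) (ker \<Phi>)" "surj (fst p, ker \<Phi>) (ker \<Phi>)" using fn_coarsen[OF p eqv_ker[OF h]] by blast+
qed

text \<open>The quotient map \<open>ker \<Phi>\<close> identifies any two elements with a common
  value under \<open>\<Phi>\<close>, so it coequalizes every pair that \<open>\<Phi>\<close>
  coequalizes.\<close>

lemma ker_comp_eq:
 assumes h: "fn p q \<Phi>" and f: "fn r p \<Gamma>" and g: "fn r p \<Delta>" and c: "rcomp \<Phi> \<Gamma> = rcomp \<Phi> \<Delta>"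
 shows "rcomp (ker \<Phi>) \<Gamma> = rcomp (ker \<Phi>) \<Delta>"
proof (rule fn_comp_eqI[OF f fn_ker(1)[OF h] fn_comp[OF g fn_ker(1)[OF h]]])
 fix a x y assume 1: "mem \<Gamma> a x" and 2: "mem (ker \<Phi>) x y"
 obtain A where A: "a : hom C A (fst r)" "x : hom C A (fst p)" using rel.mem_hom[OF fnD(4)[OF f] 1] by blast
 have y: "y : hom C A (fst p)" by (rule mem_hom2(1)[OF ker_rels[OF h] 2 A(2)])
 obtain B b x' where b: "b : hom C B A" "regular_epi C b" "x' : hom C B (fst p)" "mem \<Delta> (a o b) x'" by (rule fn_total[OF g A(1)])
 have ab: "a o b : hom C B (fst r)" "x o b : hom C B (fst p)" "y o b : hom C B (fst p)" using A y b by (auto simp: hom_iff)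
 obtain D d z where d: "d : hom C D B" "regular_epi C d" "z : hom C D (fst q)" "mem \<Phi> ((x o b) o d) z" by (rule fn_total[OF h ab(2)])
 have 3: "mem \<Gamma> ((a o b) o d) ((x o b) o d)"
  by (rule rel.mem_stable[OF fnD(4)[OF f] rel.mem_stable[OF fnD(4)[OF f] 1 b(1) A(1)] d(1) ab(1)])
 have 4: "mem \<Delta> ((a o b) o d) (x' o d)" by (rule rel.mem_stable[OF fnD(4)[OF g] b(4) d(1) ab(1)])
 have 5: "mem \<Phi> (x' o d) z" by (rule fn_comp_factor[OF refl g h 4 fn_compD[OF c f h 3 d(4)]])
 have 6: "mem (ker \<Phi>) ((x o b) o d) ((y o b) o d)"
  by (rule rel.mem_stable[OF ker_rels[OF h] rel.mem_stable[OF ker_rels[OF h] 2 b(1) A(2)] d(1) ab(2)])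
 have "mem (ker \<Phi>) (x' o d) ((y o b) o d)" by (rule kerI[OF h 5 ker_mem[OF h 6 d(4)]])
 then have "mem (rcomp (ker \<Phi>) \<Delta>) ((a o b) o d) ((y o b) o d)" by (rule rel.mem_compI[OF fnD(4)[OF g] ker_rels[OF h] 4])
 then have "mem (rcomp (ker \<Phi>) \<Delta>) (a o b) (y o b)"
  by (rule rel.mem_local[OF rel.rel_comp_rels[OF fnD(4)[OF g] ker_rels[OF h]] d(2,1) ab(1,3)])
 then show "mem (rcomp (ker \<Phi>) \<Delta>) a y"
  by (rule rel.mem_local[OF rel.rel_comp_rels[OF fnD(4)[OF g] ker_rels[OF h]] b(2,1) A(1) y])
qed

end

context excat begin

text \<open>The product in \<open>C\<close> of the underlying objects carries the componentwise
  relation, an intersection of two pulled back ones.\<close>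

lemma K_product_ex:
 assumes p: "eqv p" and q: "eqv q" shows "EX p0 p1. is_product K (oc p) (oc q) p0 p1"
proof -
 obtain P p0 p1 where P: "p0 : hom C P (fst p)" "p1 : hom C P (fst q)"
  and pe: "!!A x y. x : hom C A (fst p) ==> y : hom C A (fst q) ==> EX u:hom C A P. p0 o u = x & p1 o u = y"
  by (rule product_ex[OF eqvD(1)[OF p] eqvD(1)[OF q]]) blast
 obtain R where R: "eqv (P, R)" "ALL z z'. mem R z z' \<longleftrightarrow> (EX A. z : hom C A P & z' : hom C A P) & mem (snd p) (p0 o z) (p0 o z')"
  by (rule pull_eqv[OF p P(1)])
 obtain S where S: "eqv (P, S)" "ALL z z'. mem S z z' \<longleftrightarrow> (EX A. z : hom C A P & z' : hom C A P) & mem (snd q) (p1 o z) (p1 o z')"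
  by (rule pull_eqv[OF q P(2)])
 obtain T where T: "eqv (P, T)" "ALL z z'. mem T z z' \<longleftrightarrow> mem R z z' & mem S z z'" by (rule inter_eqv[OF R(1) S(1)])
 have f: "fn (P, T) p (pt p p0)" by (rule fn_of_hom[OF T(1) p]) (use P(1) R(2) T(2) in auto)
 have g: "fn (P, T) q (pt q p1)" by (rule fn_of_hom[OF T(1) q]) (use P(2) S(2) T(2) in auto)
 have "product_data p q (P, T) (pt p p0) (pt q p1)" unfolding product_data_def
 proof (intro conjI allI ballI impI f g, unfold jm_def)
  fix A x y assume xy: "x : hom C A (fst p)" "y : hom C A (fst q)"
  then obtain z where z: "z : hom C A P" "p0 o z = x" "p1 o z = y" using pe by blast
  then have "mem (pt p p0) z x" "mem (pt q p1) z y"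
   unfolding mem_pt[OF p P(1)] mem_pt[OF q P(2)] using eqvD(3)[OF p xy(1)] eqvD(3)[OF q xy(2)] by blast+
  moreover have "A : Ob C" "x o idt C A = x" "y o idt C A = y" using xy hom_Ob[OF xy(1)] by (auto simp: hom_iff)
  ultimately show "EX B. EX a:hom C B A. EX z. regular_epi C a & mem (pt p p0) z (x o a) & mem (pt q p1) z (y o a)"
   by (intro exI[of _ A] bexI[of _ "idt C A"] exI[of _ z]) (auto simp: rel.cv_idt idt_hom)
 next
  have "mem (snd (P, T)) z z'" if 3: "mem (pt p p0) z x" "mem (pt p p0) z' x" and 2: "mem (pt q p1) z y" "mem (pt q p1) z' y" for z z' x y
  proof -
  have 1: "mem (snd p) (p0 o z) (p0 o z')" "mem (snd q) (p1 o z) (p1 o z')"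
   using 2 3 eqvD(4,5)[OF p] eqvD(4,5)[OF q] unfolding mem_pt[OF p P(1)] mem_pt[OF q P(2)] by blast+
  obtain A where A: "z : hom C A P" "y : hom C A (fst q)" using rel.mem_hom[OF fnD(4)[OF g] 2(1)] by auto
  have "z' : hom C A P" using mem_hom2(2)[OF fnD(4)[OF g] 2(2) A(2)] by simp
  then show "mem (snd (P, T)) z z'" using A 1 R(2) S(2) T(2) by auto
  qed
  then show "ALL z z' x y. mem (pt p p0) z x --> mem (pt p p0) z' x --> mem (pt q p1) z y --> mem (pt q p1) z' y --> mem (snd (P, T)) z z'" by blast
 qed
 then show ?thesis using product_dataI by blast
qed

text \<open>\<open>jm s M M\<close> expresses that \<open>M\<close> is a monomorphism; with equal
  legs the lemmas on pairs apply to equalizers.\<close>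

definition equalizer_data :: "'o \<times> 'm rel => 'o \<times> 'm rel => 'o \<times> 'm rel => 'm rel => 'm rel => 'm rel => bool" where
 "equalizer_data p q s \<Phi> \<Psi> M \<longleftrightarrow> fn p q \<Phi> & fn p q \<Psi> & fn s p M & rcomp \<Phi> M = rcomp \<Psi> M & jm s M M &
   (ALL A. ALL x:hom C A (fst p). ALL y. mem \<Phi> x y --> mem \<Psi> x y -->
    (EX B. EX a:hom C B A. EX u. regular_epi C a & mem M u (x o a)))"

lemma equalizer_dataI:
 assumes d: "equalizer_data p q s \<Phi> \<Psi> M"
 shows "is_equalizer K (ac (p, q, \<Phi>)) (ac (p, q, \<Psi>)) (ac (s, p, M))"
proof -
 have f: "fn p q \<Phi>" and g: "fn p q \<Psi>" and m: "fn s p M" and eq: "rcomp \<Phi> M = rcomp \<Psi> M" and j: "jm s M M"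
  and ex: "!!A x y. x : hom C A (fst p) ==> mem \<Phi> x y ==> mem \<Psi> x y ==>
    EX B. EX a:hom C B A. EX u. regular_epi C a & mem M u (x o a)"
  using d unfolding equalizer_data_def by blast+
 have E: "EX u:hom K D (oc s). ac (s, p, M) \<odot> u = x"
  if x: "x : hom K D (oc p)" and xx: "ac (p, q, \<Phi>) \<odot> x = ac (p, q, \<Psi>) \<odot> x" for D x
 proof -
  obtain t where t: "D = oc t" "eqv t" using K_hom_eqv[OF x] by blast
  obtain \<Theta> where \<Theta>: "x = ac (t, p, \<Theta>)" "fn t p \<Theta>" by (rule K_homE2[OF x[unfolded t(1)] t(2) fnD(1)[OF f]])
  have c: "rcomp \<Phi> \<Theta> = rcomp \<Psi> \<Theta>" using xx unfolding \<Theta>(1) K_cmp_eq_iff2[OF \<Theta>(2) f \<Theta>(2) g] .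
  have l: "EX B. EX b:hom C B A. EX u. regular_epi C b & mem M u (x o b) & mem M u (y o b)"
   if a: "a : hom C A (fst t)" and ax: "mem \<Theta> a x" "mem \<Theta> a y" for A a x y
  proof -
   have x: "x : hom C A (fst p)" by (rule mem_hom2(1)[OF fnD(4)[OF \<Theta>(2)] ax(1) a])
   obtain B b z where b: "b : hom C B A" "regular_epi C b" "z : hom C B (fst q)" "mem \<Phi> (x o b) z" by (rule fn_total[OF f x])
   have ab: "mem \<Theta> (a o b) (x o b)" by (rule rel.mem_stable[OF fnD(4)[OF \<Theta>(2)] ax(1) b(1) a])
   have "mem \<Psi> (x o b) z" by (rule fn_comp_factor[OF refl \<Theta>(2) g ab fn_compD[OF c \<Theta>(2) f ab b(4)]])
   then obtain D d u where d: "d : hom C D B" "regular_epi C d" "mem M u ((x o b) o d)" using ex[OF cmp_hom[OF b(1) x] b(4)] by blast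
   note bd = cmp_hom[OF d(1) b(1)]
   have 1: "mem M u (x o b o d)" using d(3) assoc[OF d(1) b(1) x] by simp
   have "mem M u (y o b o d)" by (rule fnD(8)[OF m 1 rel.mem_stable[OF eqvD(2)[OF fnD(1)[OF f]] fnD(5)[OF \<Theta>(2) ax] bd x]])
   then show ?thesis using 1 bd regular_epi_cmp[OF d(2,1) b(2,1)] by blast
  qed
  obtain H where H: "fn t s H" "rcomp M H = \<Theta>" "rcomp M H = \<Theta>" by (rule fn_pair[OF m m j \<Theta>(2) \<Theta>(2) l])
  show ?thesis unfolding t(1) \<Theta>(1) using ac_hom[OF H(1)] K_cmp_eq_iff[OF H(1) m \<Theta>(2)] H(2) by blast
 qed
 have Q: "ac (p, q, \<Phi>) \<odot> ac (s, p, M) = ac (p, q, \<Psi>) \<odot> ac (s, p, M)"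
  unfolding K_cmp_eq_iff2[OF m f m g] by (rule eq)
 have U: "u = v" if "u : hom K D (oc s)" "v : hom K D (oc s)" "ac (s, p, M) \<odot> u = ac (s, p, M) \<odot> v" for D u v
  by (rule K_joint_cancel[OF m m j that that(3)])
 show ?thesis unfolding category.is_equalizer_iff[OF category_K]
  by (intro exI conjI ballI allI impI; (rule ac_hom[OF f] ac_hom[OF g] ac_hom[OF m] Q E U; assumption)?)
qed

lemma equalizer_dataD:
 assumes "is_equalizer K (ac (p, q, \<Phi>)) (ac (p, q, \<Psi>)) (ac (s, p, M))" and f: "fn p q \<Phi>" and g: "fn p q \<Psi>" and m: "fn s p M"
 shows "equalizer_data p q s \<Phi> \<Psi> M"
proof -
 note p = fnD(1)[OF f]
 obtain X Y Z where 1: "ac (p, q, \<Phi>) : hom K X Y" "ac (s, p, M) : hom K Z X"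
  and eq: "ac (p, q, \<Phi>) \<odot> ac (s, p, M) = ac (p, q, \<Psi>) \<odot> ac (s, p, M)"
  and ex: "ALL A. ALL x:hom K A X. ac (p, q, \<Phi>) \<odot> x = ac (p, q, \<Psi>) \<odot> x --> (EX u:hom K A Z. ac (s, p, M) \<odot> u = x)"
  and un: "ALL A. ALL u:hom K A Z. ALL v:hom K A Z. ac (s, p, M) \<odot> u = ac (s, p, M) \<odot> v --> u = v"
  using assms(1) unfolding category.is_equalizer_iff[OF category_K] by blast
 have XZ: "X = oc p" "Z = oc s" using 1 ac_hom[OF m] by (auto simp: hom_iff)
 have c: "rcomp \<Phi> M = rcomp \<Psi> M" using eq unfolding K_cmp_eq_iff2[OF m f m g] .
 have "EX B. EX a:hom C B A. EX u. regular_epi C a & mem M u (x o a)"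
  if x: "x : hom C A (fst p)" and y: "mem \<Phi> x y" "mem \<Psi> x y" for A x y
 proof -
  have A: "A : Ob C" using hom_Ob[OF x] by blast
  note px = fn_pt[OF p x]
  have "rcomp \<Phi> (pt p x) = rcomp \<Psi> (pt p x)" using pt_comp[OF f y(1) x] pt_comp[OF g y(2) x] by simp
  then obtain u where u: "u : hom K (oc (jo A)) (oc s)" "ac (s, p, M) \<odot> u = ac (jo A, p, pt p x)"
   using ex ac_hom[OF px] K_cmp_eq_iff2[OF px f px g] unfolding XZ by blast
  show ?thesis by (rule jo_lift[OF u(1) A fnD(1)[OF m]]) (use m x u(2) in blast)
 qed
 moreover have "jm s M M" by (rule jmI[OF m m]) (use un XZ in blast)
 ultimately show ?thesis unfolding equalizer_data_def using f g m c by blast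
qed

text \<open>The parallel arrows are relations, so no equalizer in \<open>C\<close> is at hand. The
  object is the apex of the span of \<open>\<Phi> \<inter> \<Psi>\<close>, with the relation of
  \<open>p\<close> pulled back along the first leg.\<close>

lemma K_equalizer_ex:
 assumes f: "fn p q \<Phi>" and g: "fn p q \<Psi>" shows "EX k. is_equalizer K (ac (p, q, \<Phi>)) (ac (p, q, \<Psi>)) k"
proof -
 note p = fnD(1)[OF f]
 obtain N where N: "N : Rel (fst p) (fst q)" "ALL x y. mem N x y \<longleftrightarrow> mem \<Phi> x y & mem \<Psi> x y"
  by (rule rel_inter[OF fnD(4)[OF f] fnD(4)[OF g]])
 obtain T t0 t1 where t: "t0 : hom C T (fst p)" "t1 : hom C T (fst q)" "N = span_class C t0 t1"
  by (rule rel.relsE[OF N(1)]; blast)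
 note tm = rel_mem_span_class[OF t(1,2), folded t(3)]
 obtain S where S: "eqv (T, S)" "ALL z z'. mem S z z' \<longleftrightarrow> (EX A. z : hom C A T & z' : hom C A T) & mem (snd p) (t0 o z) (t0 o z')"
  by (rule pull_eqv[OF p t(1)])
 define M where "M = pt p t0"
 have mM: "mem M u x \<longleftrightarrow> (EX A. u : hom C A T) & mem (snd p) (t0 o u) x" for u x
  unfolding M_def mem_pt[OF p t(1)] ..
 have m: "fn (T, S) p M" unfolding M_def by (rule fn_of_hom[OF S(1) p]) (use t(1) S(2) in auto)
 have c: "rcomp \<Phi> M = rcomp \<Psi> M"
 proof (rule fn_comp_eqI[OF m f fn_comp[OF m g]])
  fix u x y assume 1: "mem M u x" and 2: "mem \<Phi> x y"
  obtain A where u: "u : hom C A T" "mem (snd p) (t0 o u) x" using 1 mM by blast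
  have "mem N (t0 o u) (t1 o u)" unfolding tm using u by blast
  then have "mem \<Phi> (t0 o u) (t1 o u)" and 3: "mem \<Psi> (t0 o u) (t1 o u)" using N(2) by blast+
  then have "mem \<Phi> x (t1 o u)" using fnD(7)[OF f u(2)] by blast
  then have "mem (snd q) (t1 o u) y" by (rule fnD(5)[OF f _ 2])
  then have "mem \<Psi> x y" by (rule fnD(8)[OF g fnD(7)[OF g u(2) 3]])
  then show "mem (rcomp \<Psi> M) u y" by (rule rel.mem_compI[OF fnD(4)[OF m] fnD(4)[OF g] 1])
 qed
 have "equalizer_data p q (T, S) \<Phi> \<Psi> M" unfolding equalizer_data_def
 proof (intro conjI allI ballI impI f g m c, unfold jm_def, intro allI impI)
  fix u u' x assume 1: "mem M u x" "mem M u' x"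
  obtain A where A: "u : hom C A (fst (T, S))" "x : hom C A (fst p)" using rel.mem_hom[OF fnD(4)[OF m] 1(1)] by blast
  have "u' : hom C A (fst (T, S))" by (rule mem_hom2(2)[OF fnD(4)[OF m] 1(2) A(2)])
  then show "mem (snd (T, S)) u u'" using A 1 mM S(2) eqvD(4,5)[OF p] unfolding fst_conv snd_conv by blast
 next
  fix A x y assume x: "x : hom C A (fst p)" and "mem \<Phi> x y" "mem \<Psi> x y"
  then have "mem N x y" using N(2) by blast
  then obtain B h where h: "h : hom C B T" "x = t0 o h" unfolding tm by blast
  then have "EX u. mem M u x" using mM eqvD(3)[OF p x] by blast
  then show "EX B. EX a:hom C B A. EX u. regular_epi C a & mem M u (x o a)"
   using cover_self[OF x, of "%x. EX u. mem M u x"] by blast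
 qed
 then show ?thesis using equalizer_dataI by blast
qed

lemma K_finitely_complete: "finitely_complete K"
proof -
 obtain T where T: "is_terminal C T" using terminal_ex by blast
 then have TO: "T : Ob C" and Tu: "ALL X:Ob C. EX! f. f : hom C X T" unfolding is_terminal_def by auto
 have "terminal_data (jo T)" unfolding terminal_data_def fst_jo mem_jo[OF TO]
 proof (intro conjI ballI allI eqv_jo[OF TO])
  fix A assume A: "A : Ob C"
  then show "EX B. EX a:hom C B A. EX z:hom C B T. regular_epi C a"
   using Tu rel.cv_idt[OF A] idt_hom[OF A] by blast
 next
  fix A z z' assume z: "z : hom C A T" "z' : hom C A T"
  then show "EX A. z : hom C A T" by blast
  have "A : Ob C" using hom_Ob[OF z(1)] by blast
  then show "z = z'" using Tu z by blast
 qed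
 then have "EX T. is_terminal K T" using terminal_dataI by blast
 moreover have "EX p0 p1. is_product K X Y p0 p1" if "X : Ob K" "Y : Ob K" for X Y
  using that K_product_ex unfolding K_Ob by blast
 moreover have "EX k. is_equalizer K f g k" if fg: "f : hom K X Y" "g : hom K X Y" for X Y f g
 proof -
  obtain p q \<Phi> where f: "X = oc p" "Y = oc q" "f = ac (p, q, \<Phi>)" "fn p q \<Phi>" by (rule K_homE[OF fg(1)])
  obtain \<Psi> where g: "g = ac (p, q, \<Psi>)" "fn p q \<Psi>" by (rule K_homE2[OF fg(2)[unfolded f] fnD(1,2)[OF f(4)]])
  show ?thesis unfolding f(3) g(1) by (rule K_equalizer_ex[OF f(4) g(2)])
 qed
 ultimately show ?thesis unfolding finitely_complete_def by blast
qed

subsection \<open>Regularity\<close>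

lemma coequalizerI:
 assumes f: "fn r p \<Gamma>" and g: "fn r p \<Delta>" and h: "fn p q \<Phi>" and s: "surj q \<Phi>" and eq: "rcomp \<Phi> \<Gamma> = rcomp \<Phi> \<Delta>"
  and c: "!!w \<Xi> x x' y z. fn p w \<Xi> ==> rcomp \<Xi> \<Gamma> = rcomp \<Xi> \<Delta> ==> mem \<Phi> x y ==> mem \<Phi> x' y ==> mem \<Xi> x z ==> mem \<Xi> x' z"
 shows "is_coequalizer K (ac (r, p, \<Gamma>)) (ac (r, p, \<Delta>)) (ac (p, q, \<Phi>))"
proof -
 note e = fnD(1)[OF h] fnD(2)[OF h]
 have E: "EX u:hom K (oc q) W. u \<odot> ac (p, q, \<Phi>) = x"
  if x: "x : hom K (oc p) W" and xx: "x \<odot> ac (r, p, \<Gamma>) = x \<odot> ac (r, p, \<Delta>)" for W x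
 proof -
  obtain w where w: "W = oc w" "eqv w" using K_hom_eqv[OF x] by blast
  obtain \<Xi> where \<Xi>: "x = ac (p, w, \<Xi>)" "fn p w \<Xi>" by (rule K_homE2[OF x[unfolded w(1)] e(1) w(2)])
  have k: "rcomp \<Xi> \<Gamma> = rcomp \<Xi> \<Delta>" using xx unfolding \<Xi>(1) K_cmp_eq_iff2[OF f \<Xi>(2) g \<Xi>(2)] .
  obtain H where H: "fn q w H" "rcomp H \<Phi> = \<Xi>" by (rule fn_desc[OF h s \<Xi>(2) c[OF \<Xi>(2) k]])
  show ?thesis unfolding w(1) \<Xi>(1) using ac_hom[OF H(1)] K_cmp_eq_iff[OF h H(1) \<Xi>(2)] H(2) by blast
 qed
 have U: "u = v" if u: "u : hom K (oc q) W" and v: "v : hom K (oc q) W" and k: "u \<odot> ac (p, q, \<Phi>) = v \<odot> ac (p, q, \<Phi>)" for W u v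
 proof -
  obtain w where w: "W = oc w" "eqv w" using K_hom_eqv[OF u] by blast
  obtain \<Xi> where \<Xi>: "u = ac (q, w, \<Xi>)" "fn q w \<Xi>" by (rule K_homE2[OF u[unfolded w(1)] e(2) w(2)])
  obtain \<Xi>' where \<Xi>': "v = ac (q, w, \<Xi>')" "fn q w \<Xi>'" by (rule K_homE2[OF v[unfolded w(1)] e(2) w(2)])
  have "rcomp \<Xi> \<Phi> = rcomp \<Xi>' \<Phi>" using k unfolding \<Xi>(1) \<Xi>'(1) K_cmp_eq_iff2[OF h \<Xi>(2) h \<Xi>'(2)] .
  then have "\<Xi> = \<Xi>'" by (rule surj_cancel[OF h s \<Xi>(2) \<Xi>'(2)])
  then show ?thesis using \<Xi> \<Xi>' by simp
 qed
 have Q: "ac (p, q, \<Phi>) \<odot> ac (r, p, \<Gamma>) = ac (p, q, \<Phi>) \<odot> ac (r, p, \<Delta>)"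
  unfolding K_cmp_eq_iff2[OF f h g h] by (rule eq)
 show ?thesis unfolding category.is_coequalizer_iff[OF category_K]
  by (intro exI conjI ballI allI impI; (rule ac_hom[OF f] ac_hom[OF g] ac_hom[OF h] Q E U; assumption)?)
qed

text \<open>A surjection is the coequalizer of its kernel pair. The apex of the span of
  \<open>ker \<Phi>\<close> becomes an object of \<open>K\<close> through the relation that makes
  both legs respect equivalence.\<close>

lemma surj_regular_epi:
 assumes h: "fn p q \<Phi>" and s: "surj q \<Phi>"
 shows "regular_epi K (ac (p, q, \<Phi>))"
proof -
 note p = fnD(1)[OF h]
 obtain T n0 n1 where n: "n0 : hom C T (fst p)" "n1 : hom C T (fst p)" "ker \<Phi> = span_class C n0 n1"
  by (rule rel.relsE[OF ker_rels[OF h]]; blast)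
 note nm = rel_mem_span_class[OF n(1,2), folded n(3)]
 obtain R where R: "eqv (T, R)" "ALL z z'. mem R z z' \<longleftrightarrow> (EX A. z : hom C A T & z' : hom C A T) & mem (snd p) (n0 o z) (n0 o z')"
  by (rule pull_eqv[OF p n(1)])
 obtain S where S: "eqv (T, S)" "ALL z z'. mem S z z' \<longleftrightarrow> (EX A. z : hom C A T & z' : hom C A T) & mem (snd p) (n1 o z) (n1 o z')"
  by (rule pull_eqv[OF p n(2)])
 obtain Q where Q: "eqv (T, Q)" "ALL z z'. mem Q z z' \<longleftrightarrow> mem R z z' & mem S z z'" by (rule inter_eqv[OF R(1) S(1)])
 have f: "fn (T, Q) p (pt p n0)" by (rule fn_of_hom[OF Q(1) p]) (use n(1) R(2) Q(2) in auto)
 have g: "fn (T, Q) p (pt p n1)" by (rule fn_of_hom[OF Q(1) p]) (use n(2) S(2) Q(2) in auto)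
 have "is_coequalizer K (ac ((T, Q), p, pt p n0)) (ac ((T, Q), p, pt p n1)) (ac (p, q, \<Phi>))"
 proof (rule coequalizerI[OF f g h s])
  show "rcomp \<Phi> (pt p n0) = rcomp \<Phi> (pt p n1)"
  proof (rule fn_comp_eqI[OF f h fn_comp[OF g h]])
   fix t x y assume 1: "mem (pt p n0) t x" and 2: "mem \<Phi> x y"
   obtain A where t: "t : hom C A T" "mem (snd p) (n0 o t) x" using 1 unfolding mem_pt[OF p n(1)] by blast
   have k: "mem (ker \<Phi>) (n0 o t) (n1 o t)" unfolding nm using t by blast
   have "mem \<Phi> (n1 o t) y" by (rule ker_mem[OF h k fnD(6)[OF h t(2) 2]])
   moreover have "n1 o t : hom C A (fst p)" using t n by (simp add: hom_iff)
   then have "mem (pt p n1) t (n1 o t)" unfolding mem_pt[OF p n(2)] using t(1) eqvD(3)[OF p] by blast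
   ultimately show "mem (rcomp \<Phi> (pt p n1)) t y" by (intro rel.mem_compI[OF fnD(4)[OF g] fnD(4)[OF h]])
  qed
 next
  fix w \<Xi> x x' y z assume \<Xi>: "fn p w \<Xi>" and c: "rcomp \<Xi> (pt p n0) = rcomp \<Xi> (pt p n1)" and m: "mem \<Phi> x y" "mem \<Phi> x' y" "mem \<Xi> x z"
  have "mem (ker \<Phi>) x x'" by (rule kerI[OF h m(1,2)])
  then obtain A t where t: "t : hom C A T" "x = n0 o t" "x' = n1 o t" unfolding nm by blast
  have "x : hom C A (fst p)" "x' : hom C A (fst p)" using t n by (auto simp: hom_iff)
  then have 0: "mem (pt p n0) t x" "mem (pt p n1) t x'"
   unfolding mem_pt[OF p n(1)] mem_pt[OF p n(2)] using t eqvD(3)[OF p] by blast+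
  show "mem \<Xi> x' z" by (rule fn_comp_factor[OF refl g \<Xi> 0(2) fn_compD[OF c f \<Xi> 0(1) m(3)]])
 qed
 then show ?thesis unfolding regular_epi_def by blast
qed

text \<open>\<open>\<Phi>\<close> factors as \<open>M\<close> after the surjection
  \<open>ker \<Phi>\<close>, and \<open>ker \<Phi>\<close> coequalizes the pair of which
  \<open>\<Phi>\<close> is a coequalizer. The induced arrow \<open>W\<close> is a section of
  \<open>M\<close>, and its values are local preimages under \<open>\<Phi>\<close>.\<close>

lemma regular_epi_surj:
 assumes re: "regular_epi K (ac (p, q, \<Phi>))" and h: "fn p q \<Phi>"
 shows "surj q \<Phi>"
proof -
 note p = fnD(1)[OF h] and q = fnD(2)[OF h]
 note k = fn_ker[OF h]
 obtain M where M: "fn (fst p, ker \<Phi>) q M" "rcomp M (ker \<Phi>) = \<Phi>"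
 proof (rule fn_desc[OF k h])
  fix x x' y z assume 1: "mem (ker \<Phi>) x y" "mem (ker \<Phi>) x' y" "mem \<Phi> x z"
  have "mem (ker \<Phi>) y x'" using eqvD(4)[OF eqv_ker[OF h]] 1(2) unfolding snd_conv .
  then show "mem \<Phi> x' z" by (rule ker_mem[OF h _ ker_mem[OF h 1(1,3)]])
 qed
 interpret K: category K by (rule category_K)
 obtain f g X Q where fg: "f : hom K X (oc p)" "g : hom K X (oc p)" "ac (p, q, \<Phi>) \<odot> f = ac (p, q, \<Phi>) \<odot> g"
  and ex: "!!A x. x : hom K (oc p) A ==> x \<odot> f = x \<odot> g ==> EX u:hom K (oc q) A. u \<odot> ac (p, q, \<Phi>) = x"
  using re ac_hom[OF h] unfolding regular_epi_def category.is_coequalizer_iff[OF category_K] by (auto simp: hom_iff)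
 obtain r \<Gamma> where f: "X = oc r" "f = ac (r, p, \<Gamma>)" "fn r p \<Gamma>"
 proof -
  obtain r where r: "X = oc r" "eqv r" using K_hom_eqv[OF fg(1)] by blast
  show thesis by (rule K_homE2[OF fg(1)[unfolded r(1)] r(2) p]) (use that r in blast)
 qed
 obtain \<Delta> where g: "g = ac (r, p, \<Delta>)" "fn r p \<Delta>" by (rule K_homE2[OF fg(2)[unfolded f(1)] fnD(1)[OF f(3)] p])
 have c: "rcomp \<Phi> \<Gamma> = rcomp \<Phi> \<Delta>" using fg(3) unfolding f(2) g(1) K_cmp_eq_iff2[OF f(3) h g(2) h] .
 note ck = ker_comp_eq[OF h f(3) g(2) c]
 obtain w where w: "w : hom K (oc q) (oc (fst p, ker \<Phi>))" "w \<odot> ac (p, q, \<Phi>) = ac (p, (fst p, ker \<Phi>), ker \<Phi>)"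
  using ex[OF ac_hom[OF k(1)]] ck unfolding f(2) g(1) K_cmp_eq_iff2[OF f(3) k(1) g(2) k(1)] by blast
 obtain W where W: "w = ac (q, (fst p, ker \<Phi>), W)" "fn q (fst p, ker \<Phi>) W" by (rule K_homE2[OF w(1) q eqv_ker[OF h]])
 have mw: "ac ((fst p, ker \<Phi>), q, M) \<odot> w : hom K (oc q) (oc q)" by (rule K.cmp_hom[OF w(1) ac_hom[OF M(1)]])
 have "(ac ((fst p, ker \<Phi>), q, M) \<odot> w) \<odot> ac (p, q, \<Phi>) = ac ((fst p, ker \<Phi>), q, M) \<odot> (w \<odot> ac (p, q, \<Phi>))"
  by (rule K.assoc[OF ac_hom[OF h] w(1) ac_hom[OF M(1)]])
 also have "\<dots> = ac (p, q, \<Phi>)" unfolding w(2) K_cmp_eq_iff[OF k(1) M(1) h] by (rule M(2))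
 also have "\<dots> = idt K (oc q) \<odot> ac (p, q, \<Phi>)" by (rule K.idt_left[OF ac_hom[OF h], symmetric])
 finally have "ac ((fst p, ker \<Phi>), q, M) \<odot> w = ac (q, q, snd q)"
  using K.regular_epi_cancel[OF re ac_hom[OF h] mw, of "idt K (oc q)"] ac_hom[OF fn_id[OF q]] unfolding K_idt[OF q] by blast
 then have MW: "rcomp M W = snd q" unfolding W(1) K_cmp_eq_iff[OF W(2) M(1) fn_id[OF q]] .
 show ?thesis unfolding surj_def
 proof (intro allI ballI)
  fix A y assume y: "y : hom C A (fst q)"
  obtain B b x where b: "b : hom C B A" "regular_epi C b" "x : hom C B (fst (fst p, ker \<Phi>))" "mem W (y o b) x" by (rule fn_total[OF W(2) y])
  have x: "x : hom C B (fst p)" using b(3) by simp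
  have "y o b : hom C B (fst q)" using y b by (simp add: hom_iff)
  then have m: "mem M x (y o b)" by (intro fn_comp_factor[OF MW W(2) M(1) b(4)] eqvD(3)[OF q])
  have "mem (ker \<Phi>) x x" using eqvD(3)[OF eqv_ker[OF h]] x by simp
  then have "mem \<Phi> x (y o b)" by (rule fn_compD[OF M(2) k(1) M(1) _ m])
  then show "EX B. EX a:hom C B A. EX x. regular_epi C a & mem \<Phi> x (y o a)" using b by blast
 qed
qed

end

context regular begin

lemma surj_pt:
 assumes p: "eqv p" and m: "m : hom C B (fst p)" "regular_epi C m"
 shows "surj p (pt p m)"
 unfolding surj_def
proof (intro allI ballI)
 fix A y assume y: "y : hom C A (fst p)"
 obtain D a x where a: "a : hom C D A" "regular_epi C a" "x : hom C D B" "m o x = y o a" by (rule cover_lift[OF m(2,1) y])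
 have "y o a : hom C D (fst p)" using y a by (simp add: hom_iff)
 then have "mem (pt p m) x (y o a)" unfolding mem_pt[OF p m(1)] a(4) using a eqvD(3)[OF p] by blast
 then show "EX D. EX a:hom C D A. EX x. regular_epi C a & mem (pt p m) x (y o a)" using a by blast
qed

end

context excat begin

lemma K_homE3:
 assumes "f : hom K P (oc q)" "eqv q"
 obtains p \<Phi> where "P = oc p" "f = ac (p, q, \<Phi>)" "fn p q \<Phi>"
proof -
 obtain p where p: "P = oc p" "eqv p" using K_hom_eqv[OF assms(1)] by blast
 obtain \<Phi> where "f = ac (p, q, \<Phi>)" "fn p q \<Phi>" by (rule K_homE2[OF assms(1)[unfolded p(1)] p(2) assms(2)])
 then show thesis using that p(1) by blast
qed

lemma K_kernel_coequalizer:
 assumes "is_pullback K f f P0 P1" shows "EX e. is_coequalizer K P0 P1 e"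
proof -
 obtain X Z P where 0: "f : hom K X Z" "P0 : hom K P X" "P1 : hom K P X" "f \<odot> P0 = f \<odot> P1"
  and ex: "ALL A. ALL x:hom K A X. ALL y:hom K A X. f \<odot> x = f \<odot> y -->
    (EX u:hom K A P. P0 \<odot> u = x & P1 \<odot> u = y)"
  using assms unfolding category.is_pullback_iff[OF category_K] by (auto simp: hom_iff)
 obtain p q \<Phi> where f: "X = oc p" "Z = oc q" "f = ac (p, q, \<Phi>)" "fn p q \<Phi>" by (rule K_homE[OF 0(1)])
 note p = fnD(1)[OF f(4)]
 obtain s \<Gamma> where g: "P = oc s" "P0 = ac (s, p, \<Gamma>)" "fn s p \<Gamma>" by (rule K_homE3[OF 0(2)[unfolded f] p])
 note s = fnD(1)[OF g(3)]
 obtain \<Delta> where d: "P1 = ac (s, p, \<Delta>)" "fn s p \<Delta>" by (rule K_homE2[OF 0(3)[unfolded f g(1)] s p])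
 have c: "rcomp \<Phi> \<Gamma> = rcomp \<Phi> \<Delta>" using 0(4) unfolding f(3) g(2) d(1) K_cmp_eq_iff2[OF g(3) f(4) d(2) f(4)] .
 have "is_coequalizer K (ac (s, p, \<Gamma>)) (ac (s, p, \<Delta>)) (ac (p, (fst p, ker \<Phi>), ker \<Phi>))"
 proof (rule coequalizerI[OF g(3) d(2) fn_ker[OF f(4)] ker_comp_eq[OF f(4) g(3) d(2) c]])
  fix w \<Xi> x x' y z assume \<Xi>: "fn p w \<Xi>" and e: "rcomp \<Xi> \<Gamma> = rcomp \<Xi> \<Delta>"
   and m: "mem (ker \<Phi>) x y" "mem (ker \<Phi>) x' y" "mem \<Xi> x z"
  have xx: "mem (ker \<Phi>) x x'" using eqvD(4,5)[OF eqv_ker[OF f(4)], unfolded snd_conv] m(1,2) by blast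
  obtain A where A: "x : hom C A (fst p)" "z : hom C A (fst w)" using rel.mem_hom[OF fnD(4)[OF \<Xi>] m(3)] by blast
  have x': "x' : hom C A (fst p)" by (rule mem_hom2(1)[OF ker_rels[OF f(4)] xx A(1)])
  obtain B b v where b: "b : hom C B A" "regular_epi C b" "v : hom C B (fst q)" "mem \<Phi> (x o b) v" by (rule fn_total[OF f(4) A(1)])
  have v': "mem \<Phi> (x' o b) v" by (rule ker_mem[OF f(4) rel.mem_stable[OF ker_rels[OF f(4)] xx b(1) A(1)] b(4)])
  have xb: "x o b : hom C B (fst p)" "x' o b : hom C B (fst p)" "z o b : hom C B (fst w)" using A x' b by (auto simp: hom_iff)
  note px = fn_pt[OF p xb(1)] and px' = fn_pt[OF p xb(2)]
  \<comment> \<open>Two elements with a common value, read as arrows out of \<open>jo B\<close>,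
    factor through the given kernel pair, and \<open>\<Xi>\<close> agrees on its two
    projections.\<close>
  have "rcomp \<Phi> (pt p (x o b)) = rcomp \<Phi> (pt p (x' o b))" using pt_comp[OF f(4) b(4) xb(1)] pt_comp[OF f(4) v' xb(2)] by simp
  then obtain u where u: "u : hom K (oc (jo B)) (oc s)" "ac (s, p, \<Gamma>) \<odot> u = ac (jo B, p, pt p (x o b))"
    "ac (s, p, \<Delta>) \<odot> u = ac (jo B, p, pt p (x' o b))"
   using ex ac_hom[OF px] ac_hom[OF px'] K_cmp_eq_iff2[OF px f(4) px' f(4)] unfolding f(1,3) g(1,2) d(1) by blast
  obtain U where U: "u = ac (jo B, s, U)" "fn (jo B) s U" by (rule K_homE2[OF u(1) fnD(1)[OF px] s])
  have U2: "rcomp \<Gamma> U = pt p (x o b)" "rcomp \<Delta> U = pt p (x' o b)"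
   using u(2,3) unfolding U(1) K_cmp_eq_iff[OF U(2) g(3) px] K_cmp_eq_iff[OF U(2) d(2) px'] .
  have "rcomp \<Xi> (pt p (x' o b)) = rcomp \<Xi> (pt p (x o b))"
   unfolding U2[symmetric] rel.rel_comp_assoc[OF fnD(4)[OF U(2)] fnD(4)[OF g(3)] fnD(4)[OF \<Xi>]]
    rel.rel_comp_assoc[OF fnD(4)[OF U(2)] fnD(4)[OF d(2)] fnD(4)[OF \<Xi>]] e ..
  also have "\<dots> = pt w (z o b)" by (rule pt_comp[OF \<Xi> rel.mem_stable[OF fnD(4)[OF \<Xi>] m(3) b(1) A(1)] xb(1)])
  finally have "mem \<Xi> (x' o b) (z o b)" by (rule pt_factor[OF \<Xi> xb(2,3)])
  then show "mem \<Xi> x' z" by (rule rel.mem_local[OF fnD(4)[OF \<Xi>] b(2,1) x' A(2)])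
 qed
 then show ?thesis unfolding g(2) d(1) by blast
qed

text \<open>Surjectivity of \<open>P1\<close> is checked on elements: after a cover, the value of
  \<open>y\<close> under \<open>g\<close> has a preimage under \<open>e\<close>, and preimage and
  \<open>y\<close> together give an element of the pullback.\<close>

lemma K_regular_epi_stable:
 assumes re: "regular_epi K e" and pb: "is_pullback K e g P0 P1"
 shows "regular_epi K P1"
proof -
 obtain X Y Z P where 0: "e : hom K X Z" "g : hom K Y Z" "P0 : hom K P X" "P1 : hom K P Y"
  and ex: "ALL A. ALL x:hom K A X. ALL y:hom K A Y. e \<odot> x = g \<odot> y -->
    (EX u:hom K A P. P0 \<odot> u = x & P1 \<odot> u = y)"
  using pb unfolding category.is_pullback_iff[OF category_K] by blast
 obtain p r \<Phi> where f: "X = oc p" "Z = oc r" "e = ac (p, r, \<Phi>)" "fn p r \<Phi>" by (rule K_homE[OF 0(1)])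
 note p = fnD(1)[OF f(4)] and r = fnD(2)[OF f(4)]
 obtain q \<Psi> where g: "Y = oc q" "g = ac (q, r, \<Psi>)" "fn q r \<Psi>" by (rule K_homE3[OF 0(2)[unfolded f] r])
 note q = fnD(1)[OF g(3)]
 obtain s \<Delta> where d: "P = oc s" "P1 = ac (s, q, \<Delta>)" "fn s q \<Delta>" by (rule K_homE3[OF 0(4)[unfolded g] q])
 note s = fnD(1)[OF d(3)]
 have sf: "surj r \<Phi>" by (rule regular_epi_surj[OF re[unfolded f(3)] f(4)])
 have "surj q \<Delta>" unfolding surj_def
 proof (intro allI ballI)
  fix A y assume y: "y : hom C A (fst q)"
  obtain B b z where b: "b : hom C B A" "regular_epi C b" "z : hom C B (fst r)" "mem \<Psi> (y o b) z" by (rule fn_total[OF g(3) y])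
  obtain B' b' x where b': "b' : hom C B' B" "regular_epi C b'" "x : hom C B' (fst p)" "mem \<Phi> x (z o b')"
   by (rule surjE[OF sf fnD(4)[OF f(4)] b(3)])
  define c where "c = b o b'"
  have c: "c : hom C B' A" "regular_epi C c" unfolding c_def
   using b b' regular_epi_cmp[OF b'(2,1) b(2,1)] by (auto simp: hom_iff)
  have yb: "y o b : hom C B (fst q)" "y o c : hom C B' (fst q)" "(y o b) o b' = y o c" using y b b' c unfolding c_def by (auto simp: hom_iff)
  have z: "mem \<Psi> (y o c) (z o b')" using rel.mem_stable[OF fnD(4)[OF g(3)] b(4) b'(1) yb(1)] unfolding yb(3) .
  note px = fn_pt[OF p b'(3)] and py = fn_pt[OF q yb(2)]
  have "rcomp \<Phi> (pt p x) = rcomp \<Psi> (pt q (y o c))" using pt_comp[OF f(4) b'(4,3)] pt_comp[OF g(3) z yb(2)] by simp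
  then obtain u where u: "u : hom K (oc (jo B')) (oc s)" "P1 \<odot> u = ac (jo B', q, pt q (y o c))"
   using ex ac_hom[OF px] ac_hom[OF py] K_cmp_eq_iff2[OF px f(4) py g(3)] unfolding f(1,3) g(1,2) d(1) by blast
  have "B' : Ob C" using hom_Ob[OF c(1)] by blast
  then obtain D a t where a: "a : hom C D B'" "regular_epi C a" "mem \<Delta> t ((y o c) o a)"
   by (rule jo_lift[OF u(1) _ s]) (use d(3) yb(2) u(2)[unfolded d(2)] in blast)
  then show "EX B. EX a:hom C B A. EX x. regular_epi C a & mem \<Delta> x (y o a)"
   using assoc[OF a(1) c(1) y] cmp_hom[OF a(1) c(1)] regular_epi_cmp[OF a(2,1) c(2,1)] by auto
 qed
 then show ?thesis unfolding d(2) by (rule surj_regular_epi[OF d(3)])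
qed

lemma regular_K: "regular K"
 unfolding regular_def regular_category_def
 using category_K K_finitely_complete K_kernel_coequalizer K_regular_epi_stable by blast

subsection \<open>Exactness\<close>

text \<open>An equivalence relation in \<open>K\<close> on \<open>p\<close> is traced back to a
  relation \<open>N\<close> on the underlying object in \<open>C\<close>. That object with the
  relation \<open>N\<close> is the quotient, and \<open>N\<close> is the quotient map.\<close>

lemma K_effective:
 assumes kO: "k : Ob K" and RR: "equivalence_rel K k RR"
 shows "EX f. EX (r0, r1):RR. is_pullback K f f r0 r1"
proof -
 interpret KR: regular K by (rule regular_K)
 obtain p where p: "k = oc p" "eqv p" using kO unfolding K_Ob by blast
 note RR = RR[unfolded p(1)]
 have R: "RR : rels (disc K) (oc p) (oc p)" "rel_refl K (oc p) RR" "rel_sym K RR" "rel_trans K RR"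
  using RR unfolding equivalence_rel_def by blast+
 obtain T r0 r1 where r: "jointly_ff (disc K) T (oc p) (oc p) r0 r1" "r0 : hom K T (oc p)" "r1 : hom K T (oc p)"
   "(r0, r1) : RR" "RR = span_class K r0 r1"
  by (rule KR.rel.relsE[OF R(1)]; blast)
 note rm = KR.rel_mem_span_class[OF r(2,3), folded r(5)]
 obtain s \<Gamma> where g: "T = oc s" "r0 = ac (s, p, \<Gamma>)" "fn s p \<Gamma>" by (rule K_homE3[OF r(2) p(2)])
 note s = fnD(1)[OF g(3)]
 obtain \<Delta> where d: "r1 = ac (s, p, \<Delta>)" "fn s p \<Delta>" by (rule K_homE2[OF r(3)[unfolded g(1)] s p(2)])
 note G = fnD(4)[OF g(3)] and D = fnD(4)[OF d(2)]
 note Gc = rel_converse[OF G]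
 define N where "N = rcomp \<Delta> (\<Gamma>\<inverse>)"
 have NR: "N : Rel (fst p) (fst p)" unfolding N_def by (rule rel.rel_comp_rels[OF Gc(1) D])
 \<comment> \<open>\<open>N\<close> is a composite and is witnessed only after a cover
   \<open>a\<close>. The image of \<open>a\<close> in \<open>K\<close> is again a regular
   epimorphism, so membership in \<open>RR\<close> descends along it.\<close>
 have N1: "KR.mem RR (ac (jo A, p, pt p x)) (ac (jo A, p, pt p x'))"
  if x: "x : hom C A (fst p)" and x': "x' : hom C A (fst p)" and n: "mem N x x'" for A x x'
 proof -
  obtain A' B a z where a: "x : hom C A' (fst p)" "x' : hom C A' (fst p)" "a : hom C B A'" "regular_epi C a"
   "z : hom C B (fst s)" "mem (\<Gamma>\<inverse>) (x o a) z" "mem \<Delta> z (x' o a)"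
   by (rule rel.mem_compE[OF Gc(1) D n[unfolded N_def]])
  have "A' = A" using a(1) x by (simp add: hom_iff)
  note a = a[unfolded this]
  have gz: "mem \<Gamma> z (x o a)" using a(6) Gc(2) by blast
  note pz = fn_pt[OF s a(5)] and px = fn_pt[OF p(2) x] and px' = fn_pt[OF p(2) x']
  have A: "A : Ob C" using hom_Ob[OF x] by blast
  have a': "a : hom C B (fst (jo A))" using a(3) by simp
  note pa = fn_pt[OF eqv_jo[OF A] a']
  have e: "rcomp \<Gamma> (pt s z) = rcomp (pt p x) (pt (jo A) a)" "rcomp \<Delta> (pt s z) = rcomp (pt p x') (pt (jo A) a)"
   unfolding pt_res[OF p(2) x a(3)] pt_res[OF p(2) x' a(3)]
   by (rule pt_comp[OF g(3) gz a(5)], rule pt_comp[OF d(2) a(7,5)])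
  have "KR.mem RR (ac (jo A, p, pt p x) \<odot> ac (jo B, jo A, pt (jo A) a)) (ac (jo A, p, pt p x') \<odot> ac (jo B, jo A, pt (jo A) a))"
   unfolding rm K_cmp[OF pa px] K_cmp[OF pa px'] e[symmetric]
   by (rule exI[of _ "oc (jo B)"], rule bexI[of _ "ac (jo B, s, pt s z)"])
    (use ac_hom[OF pz] K_cmp[OF pz g(3)] K_cmp[OF pz d(2)] g(1,2) d(1) in auto)
  moreover have "regular_epi K (ac (jo B, jo A, pt (jo A) a))"
   by (rule surj_regular_epi[OF pa surj_pt[OF eqv_jo[OF A] a' a(4)]])
  ultimately show ?thesis using KR.rel.mem_local[OF R(1) _ ac_hom[OF pa] ac_hom[OF px] ac_hom[OF px']] by blast
 qed
 have N2: "mem N x x'"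
  if x: "x : hom C A (fst p)" and x': "x' : hom C A (fst p)" and m: "KR.mem RR (ac (jo A, p, pt p x)) (ac (jo A, p, pt p x'))" for A x x'
 proof -
  note px = fn_pt[OF p(2) x]
  obtain Z h where h: "h : hom K Z (oc s)" "ac (jo A, p, pt p x) = r0 \<odot> h" "ac (jo A, p, pt p x') = r1 \<odot> h"
   using m unfolding rm g(1) by blast
  have "src K (r0 \<odot> h) = Z" using h(1) r(2) g(1) by (simp add: hom_iff)
  then have Z: "Z = oc (jo A)" using h(2) ac_hom[OF px] by (simp add: hom_iff)
  have "A : Ob C" using hom_Ob[OF x] by blast
  then obtain B a z where a: "a : hom C B A" "regular_epi C a" "mem \<Gamma> z (x o a)" "mem \<Delta> z (x' o a)"
   by (rule jo_lift[OF h(1)[unfolded Z] _ s]) (use g(2,3) d x x' h(2,3) in metis)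
  then have "mem N (x o a) (x' o a)" unfolding N_def by (intro rel.mem_compI[OF Gc(1) D]) (use Gc(2) in blast)
  then show ?thesis by (rule rel.mem_local[OF NR a(2,1) x x'])
 qed
 have q: "eqv (fst p, N)"
 proof (rule eqvI[OF eqvD(1)[OF p(2)] NR])
  fix A x assume x: "x : hom C A (fst p)"
  show "mem N x x" by (rule N2[OF x x]) (use R(2) ac_hom[OF fn_pt[OF p(2) x]] in \<open>unfold rel_refl_def, blast\<close>)
 next
  fix x y assume n: "mem N x y"
  then obtain A where A: "x : hom C A (fst p)" "y : hom C A (fst p)" using rel.mem_hom[OF NR] by blast
  show "mem N y x" by (rule N2[OF A(2,1)]) (use R(3) N1[OF A n] in \<open>unfold rel_sym_def, blast\<close>)
 next
  fix x y z assume n: "mem N x y" "mem N y z"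
  then obtain A where A: "x : hom C A (fst p)" "y : hom C A (fst p)" using rel.mem_hom[OF NR] by blast
  have z: "z : hom C A (fst p)" by (rule mem_hom2(1)[OF NR n(2) A(2)])
  show "mem N x z" by (rule N2[OF A(1) z]) (use R(4) N1[OF A n(1)] N1[OF A(2) z n(2)] in \<open>unfold rel_trans_def, blast\<close>)
 qed
 note Ne = eqvD[OF q, unfolded fst_conv snd_conv]
 \<comment> \<open>Elements related by \<open>snd p\<close> are the same arrow of \<open>K\<close>,
   and \<open>N\<close> is reflexive.\<close>
 have le: "mem N x y" if xy: "mem (snd p) x y" for x y
 proof -
  obtain A where A: "x : hom C A (fst p)" "y : hom C A (fst p)" using rel.mem_hom[OF eqvD(2)[OF p(2)] xy] by blast
  have "mem (pt p x) (idt C A) y" by (rule fnD(8)[OF fn_pt[OF p(2) A(1)] pt_self[OF p(2) A(1)] xy])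
  have "pt p x = pt p y" using pt_eq_iff[OF p(2) A] xy by simp
  then show ?thesis using N2[OF A] N1[OF A(2,2) Ne(3)[OF A(2)]] by simp
 qed
 have e: "fn p (fst p, N) N" by (rule fn_coarsen(1)[OF p(2) q le])
 have gd: "mem N x x'" if "mem \<Gamma> z x" "mem \<Delta> z x'" for z x x'
  unfolding N_def by (rule rel.mem_compI[OF Gc(1) D _ that(2)]) (use that Gc(2) in blast)
 have c: "rcomp N \<Gamma> = rcomp N \<Delta>"
 proof (rule fn_comp_eqI[OF g(3) e fn_comp[OF d(2) e]])
  fix z x y assume 1: "mem \<Gamma> z x" and 2: "mem N x y"
  obtain A where A: "z : hom C A (fst s)" "x : hom C A (fst p)" using rel.mem_hom[OF G 1] by blast
  have y: "y : hom C A (fst p)" by (rule mem_hom2(1)[OF NR 2 A(2)])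
  obtain B b x' where b: "b : hom C B A" "regular_epi C b" "x' : hom C B (fst p)" "mem \<Delta> (z o b) x'" by (rule fn_total[OF d(2) A(1)])
  have "mem N (x o b) x'" by (rule gd[OF rel.mem_stable[OF G 1 b(1) A(1)] b(4)])
  then have "mem N x' (y o b)" by (rule Ne(5)[OF Ne(4) rel.mem_stable[OF NR 2 b(1) A(2)]])
  then have "mem (rcomp N \<Delta>) (z o b) (y o b)" by (rule rel.mem_compI[OF D NR b(4)])
  then show "mem (rcomp N \<Delta>) z y" by (rule rel.mem_local[OF rel.rel_comp_rels[OF D NR] b(2,1) A(1) y])
 qed
 define f where "f = ac (p, (fst p, N), N)"
 have E: "EX u:hom K W T. r0 \<odot> u = x & r1 \<odot> u = y"
  if x: "x : hom K W (oc p)" and y: "y : hom K W (oc p)" and xy: "f \<odot> x = f \<odot> y" for W x y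
 proof -
  obtain t \<Phi> where \<Phi>: "W = oc t" "x = ac (t, p, \<Phi>)" "fn t p \<Phi>" by (rule K_homE3[OF x p(2)])
  note t = fnD(1)[OF \<Phi>(3)]
  obtain \<Psi> where \<Psi>: "y = ac (t, p, \<Psi>)" "fn t p \<Psi>" by (rule K_homE2[OF y[unfolded \<Phi>(1)] t p(2)])
  have cc: "rcomp N \<Phi> = rcomp N \<Psi>" using xy unfolding f_def \<Phi>(2) \<Psi>(1) K_cmp_eq_iff2[OF \<Phi>(3) e \<Psi>(2) e] .
  have i: "idt C (fst t) : hom C (fst t) (fst t)" by (rule idt_hom[OF eqvD(1)[OF t]])
  obtain V c x0 where c: "c : hom C V (fst t)" "regular_epi C c" "x0 : hom C V (fst p)" "mem \<Phi> (idt C (fst t) o c) x0" by (rule fn_total[OF \<Phi>(3) i])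
  have ic: "idt C (fst t) o c = c" using c by (simp add: hom_iff)
  \<comment> \<open>The generic element of \<open>t\<close> is covered until both arrows have
    values; there they are elements of \<open>p\<close> related by \<open>N\<close>, hence by
    \<open>RR\<close>, and this descends to the stage \<open>W\<close>.\<close>
  obtain V' b y0 where b: "b : hom C V' V" "regular_epi C b" "y0 : hom C V' (fst p)" "mem \<Psi> (c o b) y0" by (rule fn_total[OF \<Psi>(2) c(1)])
  have m: "c o b : hom C V' (fst t)" "regular_epi C (c o b)" "x0 o b : hom C V' (fst p)"
   using c b regular_epi_cmp[OF b(2,1) c(2,1)] by (auto simp: hom_iff)
  have mx: "mem \<Phi> (c o b) (x0 o b)" using rel.mem_stable[OF fnD(4)[OF \<Phi>(3)] c(4) b(1)] c(1) unfolding ic by blast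
  have "mem (rcomp N \<Psi>) (c o b) (x0 o b)" by (rule fn_compD[OF cc \<Phi>(3) e mx Ne(3)[OF m(3)]])
  then have "mem N y0 (x0 o b)" by (rule fn_comp_factor[OF refl \<Psi>(2) e b(4)])
  then have n: "mem N (x0 o b) y0" by (rule Ne(4))
  note pm = fn_pt[OF t m(1)]
  have "KR.mem RR (ac (jo V', p, pt p (x0 o b))) (ac (jo V', p, pt p y0))" by (rule N1[OF m(3) b(3) n])
  then have "KR.mem RR (x \<odot> ac (jo V', t, pt t (c o b))) (y \<odot> ac (jo V', t, pt t (c o b)))"
   unfolding \<Phi>(2) \<Psi>(1) K_cmp[OF pm \<Phi>(3)] K_cmp[OF pm \<Psi>(2)] pt_comp[OF \<Phi>(3) mx m(1)] pt_comp[OF \<Psi>(2) b(4) m(1)] .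
  then have "KR.mem RR x y"
   using KR.rel.mem_local[OF R(1) surj_regular_epi[OF pm surj_pt[OF t m(1,2)]] ac_hom[OF pm]] x y unfolding \<Phi>(1) by blast
  then obtain Z h where h: "h : hom K Z T" "x = r0 \<odot> h" "y = r1 \<odot> h" unfolding rm by blast
  have "src K (r0 \<odot> h) = Z" using h(1) r(2) by (simp add: hom_iff)
  then have "Z = W" using h(2) x by (simp add: hom_iff)
  then show ?thesis using h by blast
 qed
 have U: "u = v" if "u : hom K W T" "v : hom K W T" "r0 \<odot> u = r0 \<odot> v" "r1 \<odot> u = r1 \<odot> v" for W u v
  using r(1) that unfolding jointly_ff_disc[OF category_K] by blast
 have f: "f : hom K (oc p) (oc (fst p, N))" unfolding f_def by (rule ac_hom[OF e])
 have Q: "f \<odot> r0 = f \<odot> r1" unfolding f_def g(2) d(1) K_cmp_eq_iff2[OF g(3) e d(2) e] by (rule c)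
 have "is_pullback K f f r0 r1" unfolding category.is_pullback_iff[OF category_K]
  by (intro exI conjI ballI allI impI; (rule f r(2,3) Q E U; assumption)?)
 then show ?thesis using r(4) by blast
qed

lemma exact_K: "exact_category K"
 unfolding exact_category_def using regular_K K_effective unfolding regular_def by blast

section \<open>The embedding \<open>J\<close> of \<open>C\<close> into the completion\<close>

definition J :: "('o, 'm, 'p, 'q) ftor" where
 "J = \<lparr>fob = (%X. oc (jo X)), far = (%f. ac (jo (src C f), jo (tgt C f), pt (jo (tgt C f)) f))\<rparr>"

lemma fob_J [simp]: "fob J X = oc (jo X)"
 by (simp add: J_def)

lemma far_J: "f : hom C X Y ==> far J f = ac (jo X, jo Y, pt (jo Y) f)"
 by (simp add: J_def hom_iff)

lemma fn_J: "f : hom C X Y ==> fn (jo X) (jo Y) (pt (jo Y) f)"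
 using fn_pt[OF eqv_jo, of Y f X] hom_Ob by simp

lemma mem_J: "f : hom C X Y ==> mem (pt (jo Y) f) x y \<longleftrightarrow> (EX A. x : hom C A X) & f o x = y"
 using hom_Ob[of f X Y] mem_pt[OF eqv_jo, of Y f X x y] mem_jo[of Y "f o x" y] by (auto simp: hom_iff)

lemma functor_J: "is_functor C K J"
 unfolding is_functor_def
proof (intro conjI allI ballI category_axioms category_K)
 show "fob J X : Ob K" if "X : Ob C" for X using eqv_jo[OF that] K_Ob by auto
 show "far J f : hom K (fob J X) (fob J Y)" if "f : hom C X Y" for X Y f
  unfolding far_J[OF that] fob_J by (rule ac_hom[OF fn_J[OF that]])
 show "far J (idt C X) = idt K (fob J X)" if X: "X : Ob C" for X
 proof -
  have "pt (jo X) (idt C X) = snd (jo X)"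
   by (rule fn_eqI[OF fn_J[OF idt_hom[OF X]] fn_id[OF eqv_jo[OF X]]])
    (auto simp: mem_J[OF idt_hom[OF X]] mem_jo[OF X] hom_iff)
  then show ?thesis unfolding far_J[OF idt_hom[OF X]] fob_J K_idt[OF eqv_jo[OF X]] by simp
 qed
 show "far J (g o f) = far J g \<odot> far J f" if f: "f : hom C X Y" and g: "g : hom C Y Z" for X Y Z f g
 proof -
  have "Z : Ob C" using hom_Ob[OF g] by blast
  then have "rcomp (pt (jo Z) g) (pt (jo Y) f) = pt (jo Z) (g o f)" using pt_res[OF eqv_jo _ f] g by simp
  then show ?thesis unfolding far_J[OF f] far_J[OF g] far_J[OF cmp_hom[OF f g]] K_cmp[OF fn_J[OF f] fn_J[OF g]] by simp
 qed
qed

lemma J_faithful: "f : hom C X Y ==> g : hom C X Y ==> far J f = far J g ==> f = g"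
proof -
 assume f: "f : hom C X Y" and g: "g : hom C X Y" and e: "far J f = far J g"
 have Y: "Y : Ob C" using hom_Ob[OF f] by blast
 have "pt (jo Y) f = pt (jo Y) g" using e unfolding far_J[OF f] far_J[OF g] ac_eq[OF fn_J[OF f] fn_J[OF g]] .
 then show "f = g" using pt_eq_iff[OF eqv_jo[OF Y], of f X g] f g mem_jo[OF Y] by simp
qed

text \<open>Between discrete objects a functional relation is single-valued in the strict sense, so
  its value \<open>y\<close>, found on a cover of \<open>X\<close>, is compatible with that cover
  and descends to an arrow \<open>f\<close>.\<close>

lemma J_full:
 assumes h: "h : hom K (fob J X) (fob J Y)" and X: "X : Ob C" and Y: "Y : Ob C"
 obtains f where "f : hom C X Y" "far J f = h"
proof -
 obtain \<Phi> where \<Phi>: "h = ac (jo X, jo Y, \<Phi>)" "fn (jo X) (jo Y) \<Phi>"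
  by (rule K_homE2[OF h[unfolded fob_J] eqv_jo[OF X] eqv_jo[OF Y]])
 note F = fnD(4)[OF \<Phi>(2), unfolded fst_jo]
 have sv: "y = y'" if "mem \<Phi> x y" "mem \<Phi> x y'" for x y y' using fnD(5)[OF \<Phi>(2) that] mem_jo[OF Y] by blast
 obtain B a y where a: "a : hom C B X" "regular_epi C a" "y : hom C B (fst (jo Y))" "mem \<Phi> a y" "rcomp \<Phi> (pt (jo X) a) = pt (jo Y) y"
  by (rule jo_arrow_local[OF \<Phi>(2)])
 have y: "y : hom C B Y" using a(3) by simp
 have "y o u = y o v" if uv: "u : hom C D B" "v : hom C D B" "a o u = a o v" for D u v
  using sv[OF rel.mem_stable[OF F a(4) uv(1) a(1)]] rel.mem_stable[OF F a(4) uv(2) a(1)] uv(3) by simp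
 then obtain f where f: "f : hom C X Y" "f o a = y" by (rule regular_epi_desc[OF a(2,1) y]) blast
 have i: "idt C X : hom C X X" by (rule idt_hom[OF X])
 have "mem \<Phi> (idt C X o a) (f o a)" using a(1,4) f(2) by (simp add: hom_iff)
 then have m: "mem \<Phi> (idt C X) f" by (rule rel.mem_local[OF F a(2,1) i f(1)])
 have "pt (jo Y) f = \<Phi>"
 proof (rule fn_eqI[OF fn_J[OF f(1)] \<Phi>(2)])
  fix x z assume "mem (pt (jo Y) f) x z"
  then obtain A where x: "x : hom C A X" "f o x = z" unfolding mem_J[OF f(1)] by blast
  have "idt C X o x = x" using x(1) by (simp add: hom_iff)
  then show "mem \<Phi> x z" using rel.mem_stable[OF F m x(1) i] x(2) by simp
 qed
 then show thesis using that[OF f(1)] unfolding far_J[OF f(1)] \<Phi>(1) by simp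
qed

text \<open>Each \<open>p\<close> is a quotient of its own underlying object; the cover is the
  identity read as an element of \<open>p\<close>.\<close>

lemma J_covers:
 assumes "k : Ob K" obtains X e where "X : Ob C" "e : hom K (fob J X) k" "regular_epi K e"
proof -
 obtain p where p: "k = oc p" "eqv p" using assms unfolding K_Ob by blast
 have i: "idt C (fst p) : hom C (fst p) (fst p)" by (rule idt_hom[OF eqvD(1)[OF p(2)]])
 have "regular_epi C (idt C (fst p))" by (rule rel.cv_idt[OF eqvD(1)[OF p(2)]])
 then have "regular_epi K (ac (jo (fst p), p, pt p (idt C (fst p))))"
  by (rule surj_regular_epi[OF fn_pt[OF p(2) i] surj_pt[OF p(2) i]])
 then show thesis using that[OF eqvD(1)[OF p(2)]] ac_hom[OF fn_pt[OF p(2) i]] unfolding p(1) fob_J by blast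
qed

lemma regular_functor_J: "regular_functor C K J"
 unfolding regular_functor_def
proof (intro conjI allI impI functor_J)
 fix T assume T: "is_terminal C T"
 then have TO: "T : Ob C" and Tu: "ALL X:Ob C. EX! f. f : hom C X T" unfolding is_terminal_def by auto
 show "is_terminal K (fob J T)" unfolding fob_J
 proof (rule terminal_dataI, unfold terminal_data_def fst_jo mem_jo[OF TO], intro conjI ballI allI eqv_jo[OF TO])
  fix A assume A: "A : Ob C"
  then show "EX B. EX a:hom C B A. EX z:hom C B T. regular_epi C a"
   using Tu rel.cv_idt[OF A] idt_hom[OF A] by blast
 next
  fix A z z' assume z: "z : hom C A T" "z' : hom C A T"
  then show "EX A. z : hom C A T" by blast
  have "A : Ob C" using hom_Ob[OF z(1)] by blast
  then show "z = z'" using Tu z by blast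
 qed
next
 fix X Y p0 p1 assume "is_product C X Y p0 p1"
 then obtain P where P: "p0 : hom C P X" "p1 : hom C P Y"
  "ALL A. ALL x:hom C A X. ALL y:hom C A Y. EX u:hom C A P. p0 o u = x & p1 o u = y"
  "ALL A. ALL u:hom C A P. ALL v:hom C A P. p0 o u = p0 o v --> p1 o u = p1 o v --> u = v"
  unfolding is_product_iff by blast
 have "product_data (jo X) (jo Y) (jo P) (pt (jo X) p0) (pt (jo Y) p1)"
  unfolding product_data_def mem_J[OF P(1)] mem_J[OF P(2)] fst_jo
 proof (intro conjI allI ballI impI fn_J[OF P(1)] fn_J[OF P(2)], unfold jm_def mem_J[OF P(1)] mem_J[OF P(2)])
  fix A x y assume xy: "x : hom C A X" "y : hom C A Y"
  obtain u where u: "u : hom C A P" "p0 o u = x" "p1 o u = y" using P(3) xy by blast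
  have "A : Ob C" "x o idt C A = x" "y o idt C A = y" using xy hom_Ob[OF xy(1)] by (auto simp: hom_iff)
  then show "EX B. EX a:hom C B A. EX z. regular_epi C a & ((EX A. z : hom C A P) & p0 o z = x o a) & (EX A. z : hom C A P) & p1 o z = y o a"
   using u by (intro exI[of _ A] bexI[of _ "idt C A"] exI[of _ u]) (auto simp: rel.cv_idt idt_hom)
 next
  show "ALL z z' x y. (EX A. z : hom C A P) & p0 o z = x --> (EX A. z' : hom C A P) & p0 o z' = x -->
   (EX A. z : hom C A P) & p1 o z = y --> (EX A. z' : hom C A P) & p1 o z' = y --> mem (snd (jo P)) z z'"
  proof (intro allI impI)
  fix z z' x y
  assume *: "(EX A. z : hom C A P) & p0 o z = x" "(EX A. z' : hom C A P) & p0 o z' = x"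
   "(EX A. z : hom C A P) & p1 o z = y" "(EX A. z' : hom C A P) & p1 o z' = y"
  then obtain A A' where A: "z : hom C A P" "z' : hom C A' P" by blast
  have "src C (p0 o z) = A" "src C (p0 o z') = A'" using A P(1) by (auto simp: hom_iff)
  then have "A' = A" using * by simp
  then have "z = z'" using P(4) A * by blast
  moreover have "P : Ob C" using hom_Ob[OF P(1)] by blast
  ultimately show "mem (snd (jo P)) z z'" using mem_jo A by blast
  qed
 qed
 then show "is_product K (fob J X) (fob J Y) (far J p0) (far J p1)"
  unfolding far_J[OF P(1)] far_J[OF P(2)] fob_J by (rule product_dataI)
next
 fix f g k assume "is_equalizer C f g k"
 then obtain X Y Z where k: "f : hom C X Y" "g : hom C X Y" "k : hom C Z X" "f o k = g o k"
  "ALL A. ALL x:hom C A X. f o x = g o x --> (EX u:hom C A Z. k o u = x)"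
  "ALL A. ALL u:hom C A Z. ALL v:hom C A Z. k o u = k o v --> u = v"
  unfolding is_equalizer_iff by blast
 have "equalizer_data (jo X) (jo Y) (jo Z) (pt (jo Y) f) (pt (jo Y) g) (pt (jo X) k)"
  unfolding equalizer_data_def fst_jo
 proof (intro conjI allI ballI impI fn_J[OF k(1)] fn_J[OF k(2)] fn_J[OF k(3)], goal_cases)
  case 1
  have "Y : Ob C" using hom_Ob[OF k(1)] by blast
  then show ?case
   using pt_res[OF eqv_jo _ k(3)] k(1,2,4) by simp
 next
  case 2
  show ?case unfolding jm_def
  proof (intro allI impI)
  fix u u' x assume *: "mem (pt (jo X) k) u x" "mem (pt (jo X) k) u' x"
  then obtain A A' where A: "u : hom C A Z" "u' : hom C A' Z" "k o u = x" "k o u' = x" unfolding mem_J[OF k(3)] by blast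
  have "src C (k o u) = A" "src C (k o u') = A'" using A(1,2) k(3) by (auto simp: hom_iff)
  then have "A' = A" using A(3,4) by simp
  then have "u = u'" using k(6) A by blast
  moreover have "Z : Ob C" using hom_Ob[OF k(3)] by blast
  ultimately show "mem (snd (jo Z)) u u'" using mem_jo A(1) by blast
  qed
 next
  case (3 A x y)
  note x = 3(1)
  from 3 have "f o x = g o x" unfolding mem_J[OF k(1)] mem_J[OF k(2)] by simp
  then have "EX u. mem (pt (jo X) k) u x" unfolding mem_J[OF k(3)] using k(5) x by blast
  then show ?case
   using cover_self[OF x, of "%x. EX u. mem (pt (jo X) k) u x"] by blast
 qed
 then show "is_equalizer K (far J f) (far J g) (far J k)"
  unfolding far_J[OF k(1)] far_J[OF k(2)] far_J[OF k(3)] by (rule equalizer_dataI)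
next
 fix e assume e: "regular_epi C e"
 then obtain X Y where h: "e : hom C X Y" using regular_epi_Ar by (auto simp: hom_iff)
 have "Y : Ob C" using hom_Ob[OF h] by blast
 then show "regular_epi K (far J e)" unfolding far_J[OF h]
  using surj_regular_epi[OF fn_J[OF h] surj_pt[OF eqv_jo _ e]] h by simp
qed

end

section \<open>Regular functors and relations\<close>

locale regular_fun = C: regular C + D: regular D
 for C :: "('o, 'm) cat" and D :: "('a, 'b) cat" (structure) +
 fixes I :: "('o, 'm, 'a, 'b) ftor"
 assumes regular_fun: "regular_functor C D I"
begin

abbreviation "IO == fob I"
abbreviation "IM == far I"
abbreviation cmpC (infixr "\<star>" 70) where "cmpC == cmp C"

lemma IO_Ob: "X : Ob C ==> IO X : Ob D"
 and IM_hom: "f : hom C X Y ==> IM f : hom D (IO X) (IO Y)"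
 and IM_idt: "X : Ob C ==> IM (idt C X) = idt D (IO X)"
 and IM_cmp: "f : hom C X Y ==> g : hom C Y Z ==> IM (g \<star> f) = IM g o IM f"
 and IM_regular_epi: "regular_epi C e ==> regular_epi D (IM e)"
 and IO_terminal: "is_terminal C T ==> is_terminal D (IO T)"
 using regular_fun unfolding regular_functor_def is_functor_def by blast+

lemma IM_product:
 assumes "X : Ob C" "Y : Ob C"
 obtains P p0 p1 where "p0 : hom C P X" "p1 : hom C P Y"
  "ALL A. ALL x:hom D A (IO X). ALL y:hom D A (IO Y). EX u:hom D A (IO P). IM p0 o u = x & IM p1 o u = y"
proof -
 obtain P p0 p1 where p: "p0 : hom C P X" "p1 : hom C P Y" "is_product C X Y p0 p1"
  by (rule C.product_ex[OF assms]; blast)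
 have "is_product D (IO X) (IO Y) (IM p0) (IM p1)"
  using regular_fun p(3) unfolding regular_functor_def by blast
 then obtain Q where Q: "IM p0 : hom D Q (IO X)"
  "ALL A. ALL x:hom D A (IO X). ALL y:hom D A (IO Y). EX u:hom D A Q. IM p0 o u = x & IM p1 o u = y"
  unfolding D.is_product_iff by blast
 have "Q = IO P" using Q(1) IM_hom[OF p(1)] by (simp add: hom_iff)
 then show thesis using that[OF p(1,2)] Q(2) by blast
qed

lemma IM_equalizer:
 assumes f: "f : hom C X Y" and g: "g : hom C X Y"
 obtains Z k where "k : hom C Z X" "f \<star> k = g \<star> k"
  "ALL A. ALL x:hom D A (IO X). IM f o x = IM g o x --> (EX u:hom D A (IO Z). IM k o u = x)"
proof -
 obtain Z k where k: "k : hom C Z X" "is_equalizer C f g k" "f \<star> k = g \<star> k"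
  by (rule C.equalizer_ex[OF f g]; blast)
 have "is_equalizer D (IM f) (IM g) (IM k)"
  using regular_fun k(2) unfolding regular_functor_def by blast
 then obtain X' Y' Q where Q: "IM k : hom D Q X'"
  "ALL A. ALL x:hom D A X'. IM f o x = IM g o x --> (EX u:hom D A Q. IM k o u = x)"
  unfolding D.is_equalizer_iff by blast
 have "Q = IO Z" "X' = IO X" using Q(1) IM_hom[OF k(1)] by (auto simp: hom_iff)
 then show thesis using that[OF k(1,3)] Q(2) by blast
qed

text \<open>Preservation is assumed for products and equalizers, so it is derived for the pullback
  that is built from these.\<close>

lemma IM_pullback:
 assumes f: "f : hom C X Z" and g: "g : hom C Y Z"
 obtains P p0 p1 where "p0 : hom C P X" "p1 : hom C P Y" "f \<star> p0 = g \<star> p1"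
  "ALL A. ALL x:hom D A (IO X). ALL y:hom D A (IO Y). IM f o x = IM g o y -->
    (EX u:hom D A (IO P). IM p0 o u = x & IM p1 o u = y)"
proof -
 obtain Q q0 q1 where q: "q0 : hom C Q X" "q1 : hom C Q Y"
  and q2: "ALL A. ALL x:hom D A (IO X). ALL y:hom D A (IO Y). EX u:hom D A (IO Q). IM q0 o u = x & IM q1 o u = y"
  by (rule IM_product[of X Y]) (use C.hom_Ob f g in blast)+
 have fg: "f \<star> q0 : hom C Q Z" "g \<star> q1 : hom C Q Z" using q f g by (auto simp: hom_iff)
 obtain P k where k: "k : hom C P Q" "(f \<star> q0) \<star> k = (g \<star> q1) \<star> k"
  and k2: "ALL A. ALL x:hom D A (IO Q). IM (f \<star> q0) o x = IM (g \<star> q1) o x --> (EX u:hom D A (IO P). IM k o u = x)"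
  by (rule IM_equalizer[OF fg])
 have p: "q0 \<star> k : hom C P X" "q1 \<star> k : hom C P Y" "f \<star> (q0 \<star> k) = g \<star> (q1 \<star> k)"
  using q k f g by (auto simp: hom_iff)
 note h = IM_hom[OF q(1)] IM_hom[OF q(2)] IM_hom[OF k(1)] IM_hom[OF f] IM_hom[OF g]
 have e: "EX u:hom D A (IO P). IM (q0 \<star> k) o u = x & IM (q1 \<star> k) o u = y"
  if xy: "x : hom D A (IO X)" "y : hom D A (IO Y)" "IM f o x = IM g o y" for A x y
 proof -
  obtain v where v: "v : hom D A (IO Q)" "IM q0 o v = x" "IM q1 o v = y" using q2 xy by blast
  have "IM (f \<star> q0) o v = IM (g \<star> q1) o v"
   using h v xy(3) by (simp add: IM_cmp[OF q(1) f] IM_cmp[OF q(2) g] hom_iff)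
  then obtain u where u: "u : hom D A (IO P)" "IM k o u = v" using k2 v by blast
  then have "IM (q0 \<star> k) o u = x" "IM (q1 \<star> k) o u = y"
   using h v by (simp_all add: IM_cmp[OF k(1) q(1)] IM_cmp[OF k(1) q(2)] hom_iff)
  then show ?thesis using u(1) by blast
 qed
 show thesis by (rule that[OF p]) (use e in blast)
qed

text \<open>Joint monicity says that the projections of the kernel pair of \<open>(r0, r1)\<close>
  coincide. That kernel pair is a pullback followed by an equalizer, both preserved by
  \<open>I\<close>.\<close>

lemma IM_jointly_ff:
 assumes r: "jointly_ff (disc C) T X Y r0 r1"
 shows "jointly_ff (disc D) (IO T) (IO X) (IO Y) (IM r0) (IM r1)"
proof -
 have rh: "r0 : hom C T X" "r1 : hom C T Y" using r by (auto simp: jointly_ff_def)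
 have "u = v" if uv: "u : hom D A (IO T)" "v : hom D A (IO T)" "IM r0 o u = IM r0 o v" "IM r1 o u = IM r1 o v" for A u v
 proof -
  obtain P p0 p1 where p: "p0 : hom C P T" "p1 : hom C P T" "r0 \<star> p0 = r0 \<star> p1"
   and pe: "ALL A. ALL x:hom D A (IO T). ALL y:hom D A (IO T). IM r0 o x = IM r0 o y -->
    (EX u:hom D A (IO P). IM p0 o u = x & IM p1 o u = y)"
   by (rule IM_pullback[OF rh(1,1)])
  have rp: "r1 \<star> p0 : hom C P Y" "r1 \<star> p1 : hom C P Y" using rh p by (auto simp: hom_iff)
  obtain Z k where k: "k : hom C Z P" "(r1 \<star> p0) \<star> k = (r1 \<star> p1) \<star> k"
   and ke: "ALL A. ALL x:hom D A (IO P). IM (r1 \<star> p0) o x = IM (r1 \<star> p1) o x --> (EX u:hom D A (IO Z). IM k o u = x)"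
   by (rule IM_equalizer[OF rp])
  have kk: "p0 \<star> k : hom C Z T" "p1 \<star> k : hom C Z T" using p k by (auto simp: hom_iff)
  have "r0 \<star> (p0 \<star> k) = r0 \<star> (p1 \<star> k)" using rh p(1,2) k(1) by (intro C.cmp_reassoc[OF p(3)]) (auto simp: hom_iff)
  moreover have "r1 \<star> (p0 \<star> k) = r1 \<star> (p1 \<star> k)" using k rh p(1,2) by (simp add: hom_iff)
  ultimately have eq: "p0 \<star> k = p1 \<star> k" using r kk unfolding jointly_ff_disc[OF C.category_axioms] by blast
  obtain w where w: "w : hom D A (IO P)" "IM p0 o w = u" "IM p1 o w = v" using pe uv by blast
  note h = IM_hom[OF p(1)] IM_hom[OF p(2)] IM_hom[OF rh(2)] IM_hom[OF k(1)]
  have "IM (r1 \<star> p0) o w = IM r1 o (IM p0 o w)" "IM (r1 \<star> p1) o w = IM r1 o (IM p1 o w)"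
   using h w(1) by (simp_all add: IM_cmp[OF p(1) rh(2)] IM_cmp[OF p(2) rh(2)] hom_iff)
  then have "IM (r1 \<star> p0) o w = IM (r1 \<star> p1) o w" using uv(4) w(2,3) by simp
  then obtain z where z: "z : hom D A (IO Z)" "IM k o z = w" using ke w by blast
  have "IM (p0 \<star> k) o z = IM p0 o (IM k o z)" "IM (p1 \<star> k) o z = IM p1 o (IM k o z)"
   using h z(1) by (simp_all add: IM_cmp[OF k(1) p(1)] IM_cmp[OF k(1) p(2)] hom_iff)
  then show "u = v" using eq z(2) w(2,3) by simp
 qed
 then show ?thesis unfolding jointly_ff_disc[OF D.category_axioms] using IM_hom rh by blast
qed

section \<open>Images of relations under a regular functor and transfer of entailments\<close>

definition IRel :: "'m rel => 'b rel" where
 "IRel \<Phi> = (let r = SOME r. r : \<Phi> in span_class D (IM (fst r)) (IM (snd r)))"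

abbreviation "imem \<Phi> == D.mem (IRel \<Phi>)"

text \<open>What is known of the representing span selected in \<open>IRel\<close> and of its image.
  \<open>C.mem \<Phi> r0 r1\<close> presents the span as the generic element of
  \<open>\<Phi>\<close>.\<close>

definition "ispan \<Phi> X Y T r0 r1 \<longleftrightarrow> r0 : hom C T X & r1 : hom C T Y &
  IM r0 : hom D (IO T) (IO X) & IM r1 : hom D (IO T) (IO Y) & C.mem \<Phi> r0 r1 &
  (ALL x y. imem \<Phi> x y \<longleftrightarrow> (EX A. EX h:hom D A (IO T). x = IM r0 o h & y = IM r1 o h)) &
  IRel \<Phi> : D.Rel (IO X) (IO Y) &
  (ALL x y. C.mem \<Phi> x y \<longleftrightarrow> (EX A. EX h:hom C A T. x = r0 \<star> h & y = r1 \<star> h))"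

lemma ispanD:
 assumes "ispan \<Phi> X Y T r0 r1"
 shows "r0 : hom C T X" "r1 : hom C T Y" "IM r0 : hom D (IO T) (IO X)" "IM r1 : hom D (IO T) (IO Y)" "C.mem \<Phi> r0 r1"
  "ALL x y. imem \<Phi> x y \<longleftrightarrow> (EX A. EX h:hom D A (IO T). x = IM r0 o h & y = IM r1 o h)" "IRel \<Phi> : D.Rel (IO X) (IO Y)"
  "ALL x y. C.mem \<Phi> x y \<longleftrightarrow> (EX A. EX h:hom C A T. x = r0 \<star> h & y = r1 \<star> h)"
 using assms unfolding ispan_def by blast+

lemma IRelE:
 assumes \<Phi>: "\<Phi> : C.Rel X Y"
 obtains T r0 r1 where "ispan \<Phi> X Y T r0 r1"
proof -
 obtain T' s0 s1 where s: "(s0, s1) : \<Phi>" by (rule C.rel.relsE[OF \<Phi>]; blast)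
 define r where "r = (SOME r. r : \<Phi>)"
 have "r : \<Phi>" unfolding r_def by (rule someI[of "%r. r : \<Phi>", OF s])
 then have "(fst r, snd r) : \<Phi>" by simp
 then obtain T where t: "jointly_ff (disc C) T X Y (fst r) (snd r)" "fst r : hom C T X" "snd r : hom C T Y" "\<Phi> = span_class C (fst r) (snd r)"
  by (rule C.rel.rels_span[OF \<Phi>]; blast)
 note h = IM_hom[OF t(2)] IM_hom[OF t(3)]
 have I: "IRel \<Phi> = span_class D (IM (fst r)) (IM (snd r))" unfolding IRel_def Let_def r_def ..
 show thesis
 proof (rule that[of T "fst r" "snd r"], unfold ispan_def, intro conjI t(2,3) h)
  show "IRel \<Phi> : D.Rel (IO X) (IO Y)" unfolding I by (rule D.rel.rels_spanI[OF IM_jointly_ff[OF t(1)]])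
  show 2: "ALL x y. C.mem \<Phi> x y \<longleftrightarrow> (EX A. EX h:hom C A T. x = fst r \<star> h & y = snd r \<star> h)"
   using C.rel_mem_span_class[OF t(2,3)] t(4) by simp
  have "T : Ob C" "fst r \<star> idt C T = fst r" "snd r \<star> idt C T = snd r" using t(2,3) C.hom_Ob[OF t(2)] by (auto simp: hom_iff)
  then show "C.mem \<Phi> (fst r) (snd r)" using 2 C.idt_hom[of T] by metis
  show "ALL x y. imem \<Phi> x y \<longleftrightarrow> (EX A. EX h:hom D A (IO T). x = IM (fst r) o h & y = IM (snd r) o h)"
   unfolding I using D.rel_mem_span_class[OF h] by blast
 qed
qed

lemma IRel_rels: "\<Phi> : C.Rel X Y ==> IRel \<Phi> : D.Rel (IO X) (IO Y)"
 by (erule IRelE, erule ispanD)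

lemma imem_hom: "\<Phi> : C.Rel X Y ==> imem \<Phi> x y ==> EX A. x : hom D A (IO X) & y : hom D A (IO Y)"
 by (rule D.rel.mem_hom[OF IRel_rels])

lemma imem_stable: "\<Phi> : C.Rel X Y ==> imem \<Phi> x y ==> a : hom D B A ==> x : hom D A (IO X) ==> imem \<Phi> (x o a) (y o a)"
 by (rule D.rel.mem_stable[OF IRel_rels])

lemma imem_local: "\<Phi> : C.Rel X Y ==> regular_epi D a ==> a : hom D B A ==> x : hom D A (IO X) ==> y : hom D A (IO Y) ==>
  imem \<Phi> (x o a) (y o a) ==> imem \<Phi> x y"
 by (rule D.rel.mem_local[OF IRel_rels])

lemma imem_IM:
 assumes \<Phi>: "\<Phi> : C.Rel X Y" and m: "C.mem \<Phi> x y"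
 shows "imem \<Phi> (IM x) (IM y)"
proof -
 obtain T r0 r1 where "ispan \<Phi> X Y T r0 r1" by (rule IRelE[OF \<Phi>])
 note r = ispanD[OF this]
 obtain A h where h: "h : hom C A T" "x = r0 \<star> h" "y = r1 \<star> h" using m r(8) by blast
 show ?thesis unfolding r(6)[rule_format] h(2,3) IM_cmp[OF h(1) r(1)] IM_cmp[OF h(1) r(2)] using IM_hom[OF h(1)] by blast
qed

lemma imem_IM_stable:
 assumes \<Phi>: "\<Phi> : C.Rel X Y" and m: "C.mem \<Phi> x y" and x: "x : hom C A X" and u: "u : hom D B (IO A)"
 shows "imem \<Phi> (IM x o u) (IM y o u)"
 by (rule imem_stable[OF \<Phi> imem_IM[OF \<Phi> m] u IM_hom[OF x]])

text \<open>Each entailment between relations that holds for the elements of \<open>C\<close> is witnessed by a generic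
 instance, which \<open>I\<close> carries over to \<open>D\<close>.\<close>

lemma transfer_comp:
 assumes \<Phi>: "\<Phi> : C.Rel X Y" and \<Psi>: "\<Psi> : C.Rel Y Z" and \<Theta>: "\<Theta> : C.Rel X Z"
  and ent: "!!x y z. C.mem \<Phi> x y ==> C.mem \<Psi> y z ==> C.mem \<Theta> x z"
  and m: "imem \<Phi> x y" "imem \<Psi> y z"
 shows "imem \<Theta> x z"
proof -
 obtain T r0 r1 where "ispan \<Phi> X Y T r0 r1" by (rule IRelE[OF \<Phi>])
 note r = ispanD[OF this]
 obtain U s0 s1 where "ispan \<Psi> Y Z U s0 s1" by (rule IRelE[OF \<Psi>])
 note s = ispanD[OF this]
 \<comment> \<open>This pullback carries the generic composable pair.\<close>
 obtain P p0 p1 where p: "p0 : hom C P T" "p1 : hom C P U" "r1 \<star> p0 = s0 \<star> p1"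
   and pe: "ALL A. ALL x:hom D A (IO T). ALL y:hom D A (IO U). IM r1 o x = IM s0 o y -->
    (EX u:hom D A (IO P). IM p0 o u = x & IM p1 o u = y)"
  by (rule IM_pullback[OF r(2) s(1)])
 obtain A h B k where h: "h : hom D A (IO T)" "x = IM r0 o h" "y = IM r1 o h"
   and k: "k : hom D B (IO U)" "y = IM s0 o k" "z = IM s1 o k"
  using m unfolding r(6)[rule_format] s(6)[rule_format] by blast
 have "src D (IM r1 o h) = A" "src D (IM s0 o k) = B" using h(1) k(1) r(4) s(3) by (auto simp: hom_iff)
 then have "B = A" using h(3) k(2) by simp
 then obtain u where u: "u : hom D A (IO P)" "IM p0 o u = h" "IM p1 o u = k" using pe h(1,3) k(1,2) by metis
 have "C.mem \<Theta> (r0 \<star> p0) (s1 \<star> p1)"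
  using ent C.rel.mem_stable[OF \<Phi> r(5) p(1) r(1)] C.rel.mem_stable[OF \<Psi> s(5) p(2) s(1)] p(3) by simp
 moreover have "r0 \<star> p0 : hom C P X" using r p by (simp add: hom_iff)
 ultimately have "imem \<Theta> (IM (r0 \<star> p0) o u) (IM (s1 \<star> p1) o u)" using imem_IM_stable[OF \<Theta>] u(1) by blast
 moreover have "IM (r0 \<star> p0) o u = IM r0 o (IM p0 o u)" "IM (s1 \<star> p1) o u = IM s1 o (IM p1 o u)"
  using r(3) s(4) u(1) IM_hom[OF p(1)] IM_hom[OF p(2)] by (simp_all add: IM_cmp[OF p(1) r(1)] IM_cmp[OF p(2) s(2)] hom_iff)
 ultimately show ?thesis using u(2,3) h(2) k(3) by simp
qed

text \<open>The generic element common to both relations lives on the pullback of the first legs,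
  cut down by the equalizer of the second ones.\<close>

lemma transfer_inter:
 assumes \<Phi>: "\<Phi> : C.Rel X Y" and \<Psi>: "\<Psi> : C.Rel X Y" and \<Theta>: "\<Theta> : C.Rel X Y"
  and ent: "!!x y. C.mem \<Phi> x y ==> C.mem \<Psi> x y ==> C.mem \<Theta> x y"
  and m: "imem \<Phi> x y" "imem \<Psi> x y"
 shows "imem \<Theta> x y"
proof -
 obtain T r0 r1 where "ispan \<Phi> X Y T r0 r1" by (rule IRelE[OF \<Phi>])
 note r = ispanD[OF this]
 obtain U s0 s1 where "ispan \<Psi> X Y U s0 s1" by (rule IRelE[OF \<Psi>])
 note s = ispanD[OF this]
 obtain P p0 p1 where p: "p0 : hom C P T" "p1 : hom C P U" "r0 \<star> p0 = s0 \<star> p1"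
   and pe: "ALL A. ALL x:hom D A (IO T). ALL y:hom D A (IO U). IM r0 o x = IM s0 o y -->
    (EX u:hom D A (IO P). IM p0 o u = x & IM p1 o u = y)"
  by (rule IM_pullback[OF r(1) s(1)])
 have rp: "r1 \<star> p0 : hom C P Y" "s1 \<star> p1 : hom C P Y" using r s p by (auto simp: hom_iff)
 obtain Z k where k: "k : hom C Z P" "(r1 \<star> p0) \<star> k = (s1 \<star> p1) \<star> k"
  and ke: "ALL A. ALL x:hom D A (IO P). IM (r1 \<star> p0) o x = IM (s1 \<star> p1) o x --> (EX u:hom D A (IO Z). IM k o u = x)"
  by (rule IM_equalizer[OF rp])
 obtain A h B l where h: "h : hom D A (IO T)" "x = IM r0 o h" "y = IM r1 o h"
   and l: "l : hom D B (IO U)" "x = IM s0 o l" "y = IM s1 o l"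
  using m unfolding r(6)[rule_format] s(6)[rule_format] by blast
 have "src D (IM r0 o h) = A" "src D (IM s0 o l) = B" using h(1) l(1) r(3) s(3) by (auto simp: hom_iff)
 then have "B = A" using h(2) l(2) by simp
 then obtain u where u: "u : hom D A (IO P)" "IM p0 o u = h" "IM p1 o u = l" using pe h(1,2) l(1,2) by metis
 note hh = IM_hom[OF p(1)] IM_hom[OF p(2)] IM_hom[OF k(1)]
 have "IM (r1 \<star> p0) o u = IM r1 o (IM p0 o u)" "IM (s1 \<star> p1) o u = IM s1 o (IM p1 o u)"
  using r(4) s(4) u(1) hh by (simp_all add: IM_cmp[OF p(1) r(2)] IM_cmp[OF p(2) s(2)] hom_iff)
 then have "IM (r1 \<star> p0) o u = IM (s1 \<star> p1) o u" using u(2,3) h(3) l(3) by simp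
 then obtain v where v: "v : hom D A (IO Z)" "IM k o v = u" using ke u(1) by blast
 have pk: "p0 \<star> k : hom C Z T" "p1 \<star> k : hom C Z U" using p k by (auto simp: hom_iff)
 have eq: "r0 \<star> (p0 \<star> k) = s0 \<star> (p1 \<star> k)" "r1 \<star> (p0 \<star> k) = s1 \<star> (p1 \<star> k)"
  using r(1,2) s(1,2) p(1,2) k by (auto intro!: C.cmp_reassoc[OF p(3)] simp: hom_iff)
 have "C.mem \<Theta> (r0 \<star> (p0 \<star> k)) (r1 \<star> (p0 \<star> k))"
  using ent C.rel.mem_stable[OF \<Phi> r(5) pk(1) r(1)] C.rel.mem_stable[OF \<Psi> s(5) pk(2) s(1)] eq by simp
 moreover have "r0 \<star> (p0 \<star> k) : hom C Z X" using r pk by (simp add: hom_iff)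
 ultimately have "imem \<Theta> (IM (r0 \<star> (p0 \<star> k)) o v) (IM (r1 \<star> (p0 \<star> k)) o v)" using imem_IM_stable[OF \<Theta>] v(1) by blast
 moreover have "IM (r0 \<star> (p0 \<star> k)) o v = IM r0 o (IM p0 o (IM k o v))" "IM (r1 \<star> (p0 \<star> k)) o v = IM r1 o (IM p0 o (IM k o v))"
  using r(3,4) v(1) hh by (simp_all add: IM_cmp[OF pk(1) r(1)] IM_cmp[OF pk(1) r(2)] IM_cmp[OF k(1) p(1)] hom_iff)
 ultimately show ?thesis using u(2) v(2) h(2,3) by simp
qed

lemma transfer_incl:
 assumes \<Phi>: "\<Phi> : C.Rel X Y" and \<Theta>: "\<Theta> : C.Rel X Y" and ent: "!!x y. C.mem \<Phi> x y ==> C.mem \<Theta> x y" and m: "imem \<Phi> x y"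
 shows "imem \<Theta> x y"
 by (rule transfer_inter[OF \<Phi> \<Phi> \<Theta> ent m m])

lemma transfer_sym:
 assumes \<Phi>: "\<Phi> : C.Rel X Y" and \<Theta>: "\<Theta> : C.Rel Y X" and ent: "!!x y. C.mem \<Phi> x y ==> C.mem \<Theta> y x" and m: "imem \<Phi> x y"
 shows "imem \<Theta> y x"
proof -
 obtain T r0 r1 where "ispan \<Phi> X Y T r0 r1" by (rule IRelE[OF \<Phi>])
 note r = ispanD[OF this]
 obtain A h where h: "h : hom D A (IO T)" "x = IM r0 o h" "y = IM r1 o h" using m r(6) by blast
 show ?thesis unfolding h(2,3) by (rule imem_IM_stable[OF \<Theta> ent[OF r(5)] r(2) h(1)])
qed

lemma imem_converse: "\<Phi> : C.Rel X Y ==> imem (\<Phi>\<inverse>) y x \<longleftrightarrow> imem \<Phi> x y"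
 using transfer_sym[of \<Phi> X Y "\<Phi>\<inverse>" x y] transfer_sym[of "\<Phi>\<inverse>" Y X \<Phi> y x] C.rel_converse by blast

text \<open>For the generic element of \<open>\<Theta>\<close> the witness exists after a cover
  \<open>a\<close> in \<open>C\<close>. As \<open>I\<close> sends \<open>a\<close> to a cover, an
  arbitrary element of the image relation lifts along it.\<close>

lemma transfer_comp_ex:
 assumes \<Phi>: "\<Phi> : C.Rel X Y" and \<Psi>: "\<Psi> : C.Rel Y Z" and \<Theta>: "\<Theta> : C.Rel X Z"
  and ent: "!!A x z. C.mem \<Theta> x z ==> x : hom C A X ==> z : hom C A Z ==>
    EX B. EX a:hom C B A. EX y. regular_epi C a & C.mem \<Phi> (x \<star> a) y & C.mem \<Psi> y (z \<star> a)"
  and m: "imem \<Theta> x z" and x: "x : hom D A (IO X)" and z: "z : hom D A (IO Z)"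
 obtains B a y where "a : hom D B A" "regular_epi D a" "y : hom D B (IO Y)" "imem \<Phi> (x o a) y" "imem \<Psi> y (z o a)"
proof -
 obtain T r0 r1 where "ispan \<Theta> X Z T r0 r1" by (rule IRelE[OF \<Theta>])
 note r = ispanD[OF this]
 obtain A' h where h: "h : hom D A' (IO T)" "x = IM r0 o h" "z = IM r1 o h" using m r(6) by blast
 have "src D (IM r0 o h) = A'" using h(1) r(3) by (simp add: hom_iff)
 then have A': "A' = A" using h(2) x by (simp add: hom_iff)
 obtain B a y where a: "a : hom C B T" "regular_epi C a" "C.mem \<Phi> (r0 \<star> a) y" "C.mem \<Psi> y (r1 \<star> a)" using ent[OF r(5,1,2)] by blast
 have ra: "r0 \<star> a : hom C B X" using r a by (simp add: hom_iff)
 have y: "y : hom C B Y" by (rule C.mem_hom2(1)[OF \<Phi> a(3) ra])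
 obtain E b k where b: "b : hom D E A" "regular_epi D b" "k : hom D E (IO B)" "IM a o k = h o b"
  by (rule D.cover_lift[OF IM_regular_epi[OF a(2)] IM_hom[OF a(1)] h(1)[unfolded A']])
 have "imem \<Phi> (IM (r0 \<star> a) o k) (IM y o k)" "imem \<Psi> (IM y o k) (IM (r1 \<star> a) o k)"
  by (rule imem_IM_stable[OF \<Phi> a(3) ra b(3)], rule imem_IM_stable[OF \<Psi> a(4) y b(3)])
 moreover have "IM (r0 \<star> a) o k = IM r0 o (IM a o k)" "IM (r1 \<star> a) o k = IM r1 o (IM a o k)"
  using r(3,4) IM_hom[OF a(1)] b(3) by (simp_all add: IM_cmp[OF a(1) r(1)] IM_cmp[OF a(1) r(2)] hom_iff)
 moreover have "IM r0 o (IM a o k) = x o b" "IM r1 o (IM a o k) = z o b"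
  unfolding b(4) h(2,3) using r(3,4) h(1) A' b(1) by (auto simp: hom_iff)
 moreover have "IM y o k : hom D E (IO Y)" using IM_hom[OF y] b(3) by (simp add: hom_iff)
 ultimately show thesis using that[OF b(1,2)] by simp
qed

text \<open>The generic element of \<open>X\<close> is its identity; its local value is moved to an
  arbitrary stage by lifting along the image of the cover.\<close>

lemma transfer_total:
 assumes \<Phi>: "\<Phi> : C.Rel X Y" and X: "X : Ob C"
  and ent: "!!A x. x : hom C A X ==> EX B. EX a:hom C B A. EX y. regular_epi C a & C.mem \<Phi> (x \<star> a) y"
  and x: "x : hom D A (IO X)"
 obtains B a y where "a : hom D B A" "regular_epi D a" "y : hom D B (IO Y)" "imem \<Phi> (x o a) y"
proof -
 obtain B a y where a: "a : hom C B X" "regular_epi C a" "C.mem \<Phi> (idt C X \<star> a) y" using ent[OF C.idt_hom[OF X]] by blast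
 have m: "C.mem \<Phi> a y" using a(1,3) by (simp add: hom_iff)
 have y: "y : hom C B Y" by (rule C.mem_hom2(1)[OF \<Phi> m a(1)])
 obtain E b k where b: "b : hom D E A" "regular_epi D b" "k : hom D E (IO B)" "IM a o k = x o b"
  by (rule D.cover_lift[OF IM_regular_epi[OF a(2)] IM_hom[OF a(1)] x])
 have "imem \<Phi> (x o b) (IM y o k)" using imem_IM_stable[OF \<Phi> m a(1) b(3)] b(4) by simp
 moreover have "IM y o k : hom D E (IO Y)" using IM_hom[OF y] b(3) by (simp add: hom_iff)
 ultimately show thesis using that[OF b(1,2)] by blast
qed

lemma transfer_refl:
 assumes R: "R : C.Rel X X" and X: "X : Ob C" and ent: "!!A x. x : hom C A X ==> C.mem R x x" and x: "x : hom D A (IO X)"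
 shows "imem R x x"
proof -
 note i = C.idt_hom[OF X]
 have "imem R (IM (idt C X) o x) (IM (idt C X) o x)" by (rule imem_IM_stable[OF R ent[OF i] i x])
 moreover have "IM (idt C X) o x = x" unfolding IM_idt[OF X] using x by (simp add: hom_iff)
 ultimately show ?thesis by simp
qed

lemma imem_top:
 assumes X: "X : Ob C" and Y: "Y : Ob C" and \<Phi>: "\<Phi> : C.Rel X Y"
  and top: "!!A x y. x : hom C A X ==> y : hom C A Y ==> C.mem \<Phi> x y"
  and x: "x : hom D A (IO X)" and y: "y : hom D A (IO Y)"
 shows "imem \<Phi> x y"
proof -
 obtain P p0 p1 where p: "p0 : hom C P X" "p1 : hom C P Y"
  "ALL A. ALL x:hom D A (IO X). ALL y:hom D A (IO Y). EX u:hom D A (IO P). IM p0 o u = x & IM p1 o u = y"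
  by (rule IM_product[OF X Y])
 obtain u where "u : hom D A (IO P)" "IM p0 o u = x" "IM p1 o u = y" using p(3) x y by blast
 then show ?thesis using imem_IM_stable[OF \<Phi> top[OF p(1,2)] p(1)] by blast
qed

end

section \<open>Extension of regular functors to the exact completion\<close>

text \<open>Exactness provides some arrow with kernel pair \<open>R\<close>. Its regular epi part
  has the same kernel pair, because the mono part can be cancelled.\<close>

lemma (in regular) exact_quotient:
 assumes ex: "exact_category C" and X: "X : Ob C" and R: "equivalence_rel C X R"
 obtains d q where "q : hom C X d" "regular_epi C q"
  "!!A x x'. x : hom C A X ==> x' : hom C A X ==> q o x = q o x' \<longleftrightarrow> mem R x x'"
proof -
 have RR: "R : Rel X X" using R by (simp add: equivalence_rel_def)
 obtain f r0 r1 where f: "(r0, r1) : R" "is_pullback C f f r0 r1"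
  using ex X R unfolding exact_category_def by blast
 obtain T where r: "r0 : hom C T X" "r1 : hom C T X" "R = span_class C r0 r1"
  by (rule rel.rels_span[OF RR f(1)]; blast)
 note rm = rel_mem_span_class[OF r(1,2), folded r(3)]
 obtain X' Y' Z P where p: "f : hom C X' Z" "r0 : hom C P X'" "f o r0 = f o r1"
  and pe: "ALL A. ALL x:hom C A X'. ALL y:hom C A Y'. f o x = f o y --> (EX u:hom C A P. r0 o u = x & r1 o u = y)"
  and p': "f : hom C Y' Z"
  using f(2) unfolding is_pullback_iff by blast
 have e: "X' = X" "Y' = X" "P = T" using p(1,2) p' r(1) by (auto simp: hom_iff)
 have fh: "f : hom C X Z" using p(1) e by simp
 obtain Q q m where m: "q : hom C X Q" "regular_epi C q" "m : hom C Q Z" "mono_ar C m" "f = m o q"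
  by (rule factorization[OF fh])
 have "q o x = q o x' \<longleftrightarrow> mem R x x'" if x: "x : hom C A X" "x' : hom C A X" for A x x'
 proof
  assume "q o x = q o x'"
  then have "m o (q o x) = m o (q o x')" by simp
  then have "f o x = f o x'" using m(1,3) x unfolding m(5) by (simp add: hom_iff)
  then obtain u where "u : hom C A T" "r0 o u = x" "r1 o u = x'" using pe x unfolding e by blast
  then show "mem R x x'" unfolding rm by blast
 next
  assume "mem R x x'"
  then obtain B h where h: "h : hom C B T" "x = r0 o h" "x' = r1 o h" unfolding rm by blast
  have "f o (r0 o h) = f o (r1 o h)" using h(1) r(1,2) fh by (intro cmp_reassoc[OF p(3)]) (auto simp: hom_iff)
  then have "m o (q o x) = m o (q o x')" using m(1,3) x unfolding m(5) h(2,3)[symmetric] by (simp add: hom_iff)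
  moreover have "q o x : hom C A Q" "q o x' : hom C A Q" using x m(1) by (auto simp: hom_iff)
  ultimately show "q o x = q o x'" using mono_ar_cancel[OF m(4,3)] by blast
 qed
 then show thesis using that[OF m(1,2)] by blast
qed

text \<open>Symmetry and transitivity are entailments between relations and transfer as such;
  reflexivity is read off at the identity.\<close>

lemma (in regular_fun) IRel_equivalence:
 assumes p: "C.eqv p" shows "equivalence_rel D (IO (fst p)) (IRel (snd p))"
proof -
 note e = C.eqvD[OF p]
 show ?thesis unfolding equivalence_rel_def rel_refl_def rel_sym_def rel_trans_def
 proof (intro conjI allI ballI impI)
  show "IRel (snd p) : D.Rel (IO (fst p)) (IO (fst p))" by (rule IRel_rels[OF e(2)])
  show "imem (snd p) x x" if "x : hom D A (IO (fst p))" for A x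
   by (rule transfer_refl[OF e(2,1) e(3) that])
  show "imem (snd p) y x" if "imem (snd p) x y" for x y
   by (rule transfer_sym[OF e(2,2) e(4) that])
  show "imem (snd p) x z" if "imem (snd p) x y & imem (snd p) y z" for x y z
   by (rule transfer_comp[OF e(2,2,2) e(5) conjunct1[OF that] conjunct2[OF that]])
 qed
qed

section \<open>The extension \<open>H\<close> on objects and arrows\<close>

locale excat_extension = excat C oc ac + regular_fun C D I
 for C :: "('o, 'm) cat" and D :: "('a, 'b) cat" (structure) and I :: "('o, 'm, 'a, 'b) ftor"
 and oc :: "'o \<times> 'm rel => 'p" and ac :: "('o \<times> 'm rel) \<times> ('o \<times> 'm rel) \<times> 'm rel => 'q" +
 assumes D_exact: "exact_category D"
begin

text \<open>The quotient in \<open>D\<close> of the image of the underlying object by the image of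
  the equivalence relation. Reading the quotient object as \<open>tgt D q\<close> avoids a second
  choice.\<close>

definition qm :: "'o \<times> 'm rel => 'b" where
 "qm p = (SOME q. q : hom D (IO (fst p)) (tgt D q) & regular_epi D q &
   (ALL A. ALL x:hom D A (IO (fst p)). ALL x':hom D A (IO (fst p)). q o x = q o x' \<longleftrightarrow> imem (snd p) x x'))"

abbreviation "dob p == tgt D (qm p)"

lemma qm:
 assumes p: "eqv p"
 shows "qm p : hom D (IO (fst p)) (dob p)" "regular_epi D (qm p)"
  "x : hom D A (IO (fst p)) ==> x' : hom D A (IO (fst p)) ==> qm p o x = qm p o x' \<longleftrightarrow> imem (snd p) x x'"
proof -
 obtain d q where q: "q : hom D (IO (fst p)) d" "regular_epi D q"
  "!!A x x'. x : hom D A (IO (fst p)) ==> x' : hom D A (IO (fst p)) ==> q o x = q o x' \<longleftrightarrow> imem (snd p) x x'"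
  by (rule D.exact_quotient[OF D_exact IO_Ob[OF eqvD(1)[OF p]] IRel_equivalence[OF p]]) blast
 have "tgt D q = d" using q(1) by (simp add: hom_iff)
 then have "EX q. q : hom D (IO (fst p)) (tgt D q) & regular_epi D q &
   (ALL A. ALL x:hom D A (IO (fst p)). ALL x':hom D A (IO (fst p)). q o x = q o x' \<longleftrightarrow> imem (snd p) x x')"
  using q by blast
 from someI_ex[OF this, folded qm_def]
 show "qm p : hom D (IO (fst p)) (dob p)" "regular_epi D (qm p)"
  "x : hom D A (IO (fst p)) ==> x' : hom D A (IO (fst p)) ==> qm p o x = qm p o x' \<longleftrightarrow> imem (snd p) x x'"
  by blast+
qed

lemma dob_Ob: "eqv p ==> dob p : Ob D"
 using D.hom_Ob[OF qm(1)] by blast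

lemma qm_lift:
 assumes p: "eqv p" and u: "u : hom D A (dob p)"
 obtains B a x where "a : hom D B A" "regular_epi D a" "x : hom D B (IO (fst p))" "qm p o x = u o a"
 by (rule D.cover_lift[OF qm(2,1)[OF p] u])

lemma qm_cmp: "eqv p ==> x : hom D A (IO (fst p)) ==> qm p o x : hom D A (dob p)"
 using qm(1) D.cmp_hom by blast

lemma imem_single:
 assumes f: "fn p q \<Phi>" and m: "imem \<Phi> x y" "imem \<Phi> x y'"
 shows "imem (snd q) y y'"
proof -
 note F = fnD(4)[OF f]
 note c = rel_converse[OF F]
 show ?thesis
  by (rule transfer_comp[OF c(1) F eqvD(2)[OF fnD(2)[OF f]] _ imem_converse[OF F, THEN iffD2, OF m(1)] m(2)])
   (unfold c(2), rule fnD(5)[OF f])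
qed

lemma imem_left:
 assumes f: "fn p q \<Phi>" and m: "imem (snd p) x' x" "imem \<Phi> x y"
 shows "imem \<Phi> x' y"
 by (rule transfer_comp[OF eqvD(2)[OF fnD(1)[OF f]] fnD(4,4)[OF f] fnD(6)[OF f] m])

lemma imem_right:
 assumes f: "fn p q \<Phi>" and m: "imem \<Phi> x y" "imem (snd q) y y'"
 shows "imem \<Phi> x y'"
 by (rule transfer_comp[OF fnD(4)[OF f] eqvD(2)[OF fnD(2)[OF f]] fnD(4)[OF f] fnD(8)[OF f] m])

lemma imem_total:
 assumes f: "fn p q \<Phi>" and x: "x : hom D A (IO (fst p))"
 obtains B a y where "a : hom D B A" "regular_epi D a" "y : hom D B (IO (fst q))" "imem \<Phi> (x o a) y"
proof (rule transfer_total[OF fnD(4)[OF f] eqvD(1)[OF fnD(1)[OF f]] _ x])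
 fix A x assume x: "x : hom C A (fst p)"
 show "EX B. EX a:hom C B A. EX y. regular_epi C a & mem \<Phi> (x \<star> a) y"
  by (rule fn_total[OF f x]) blast
qed (rule that)

text \<open>Totality of \<open>\<Phi>\<close> makes the first leg \<open>r0\<close> of its span a
  cover, so \<open>qm p o IM r0\<close> covers \<open>dob p\<close>. The other composite
  \<open>qm q o IM r1\<close> descends along it, since \<open>\<Phi>\<close> is single-valued up to
  equivalence.\<close>

lemma hmap_ex:
 assumes f: "fn p q \<Phi>"
 shows "EX h:hom D (dob p) (dob q). ALL x y. imem \<Phi> x y --> h o (qm p o x) = qm q o y"
proof -
 note p = fnD(1)[OF f] and q = fnD(2)[OF f] and F = fnD(4)[OF f]
 obtain T r0 r1 where "ispan \<Phi> (fst p) (fst q) T r0 r1" by (rule IRelE[OF F])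
 note r = ispanD[OF this]
 note i = idt_hom[OF eqvD(1)[OF p]]
 obtain B a y where a: "a : hom C B (fst p)" "regular_epi C a" "y : hom C B (fst q)" "mem \<Phi> (idt C (fst p) \<star> a) y"
  by (rule fn_total[OF f i])
 have "mem \<Phi> a y" using a by (simp add: hom_iff)
 then obtain B' k where k: "k : hom C B' T" "a = r0 \<star> k" using r(8) by blast
 have "regular_epi C r0" by (rule regular_epi_right[OF a(2)[unfolded k(2)] k(1) r(1)])
 then have s: "regular_epi D (qm p o IM r0)" "qm p o IM r0 : hom D (IO T) (dob p)"
  using D.regular_epi_cmp[OF IM_regular_epi r(3) qm(2,1)[OF p]] qm_cmp[OF p r(3)] by auto
 have t: "qm q o IM r1 : hom D (IO T) (dob q)" by (rule qm_cmp[OF q r(4)])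
 have d: "(qm q o IM r1) o u = (qm q o IM r1) o v"
  if uv: "u : hom D A (IO T)" "v : hom D A (IO T)" "(qm p o IM r0) o u = (qm p o IM r0) o v" for A u v
 proof -
  have h: "IM r0 o u : hom D A (IO (fst p))" "IM r0 o v : hom D A (IO (fst p))"
    "IM r1 o u : hom D A (IO (fst q))" "IM r1 o v : hom D A (IO (fst q))"
   using uv r(3,4) by (auto simp: hom_iff)
  have "qm p o (IM r0 o u) = qm p o (IM r0 o v)" using uv r(3) qm(1)[OF p] by (simp add: hom_iff)
  then have 1: "imem (snd p) (IM r0 o u) (IM r0 o v)" using qm(3)[OF p h(1,2)] by blast
  have 2: "imem \<Phi> (IM r0 o u) (IM r1 o u)" "imem \<Phi> (IM r0 o v) (IM r1 o v)" using r(6) uv(1,2) by blast+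
  have "imem (snd q) (IM r1 o u) (IM r1 o v)" by (rule imem_single[OF f 2(1) imem_left[OF f 1 2(2)]])
  then have "qm q o (IM r1 o u) = qm q o (IM r1 o v)" using qm(3)[OF q h(3,4)] by blast
  then show ?thesis using uv(1,2) r(4) qm(1)[OF q] by (simp add: hom_iff)
 qed
 obtain h where h: "h : hom D (dob p) (dob q)" "h o (qm p o IM r0) = qm q o IM r1"
  by (rule D.regular_epi_desc[OF s t d])
 have "h o (qm p o x) = qm q o y" if m: "imem \<Phi> x y" for x y
 proof -
  obtain A k where k: "k : hom D A (IO T)" "x = IM r0 o k" "y = IM r1 o k" using m r(6) by blast
  have "h o (qm p o x) = (h o (qm p o IM r0)) o k"
   unfolding k(2) using h(1) qm(1)[OF p] r(3) k(1) by (simp add: hom_iff)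
  also have "\<dots> = qm q o y" unfolding h(2) k(3) using qm(1)[OF q] r(4) k(1) by (simp add: hom_iff)
  finally show ?thesis .
 qed
 then show ?thesis using h(1) by blast
qed

definition hmap :: "'o \<times> 'm rel => 'o \<times> 'm rel => 'm rel => 'b" where
 "hmap p q \<Phi> = (SOME h. h : hom D (dob p) (dob q) & (ALL x y. imem \<Phi> x y --> h o (qm p o x) = qm q o y))"

lemma hmap:
 assumes f: "fn p q \<Phi>"
 shows "hmap p q \<Phi> : hom D (dob p) (dob q)" "imem \<Phi> x y ==> hmap p q \<Phi> o (qm p o x) = qm q o y"
proof -
 have "EX h. h : hom D (dob p) (dob q) & (ALL x y. imem \<Phi> x y --> h o (qm p o x) = qm q o y)" using hmap_ex[OF f] by blast
 from someI_ex[OF this, folded hmap_def]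
 show "hmap p q \<Phi> : hom D (dob p) (dob q)" "imem \<Phi> x y ==> hmap p q \<Phi> o (qm p o x) = qm q o y" by blast+
qed

text \<open>The quotient \<open>qm q\<close> has the image of \<open>snd q\<close> as its kernel, so
  an equation in the quotient can be pulled back to the image of \<open>\<Phi>\<close>.\<close>

lemma hmap_mem:
 assumes f: "fn p q \<Phi>" and x: "x : hom D A (IO (fst p))" and y: "y : hom D A (IO (fst q))"
  and eq: "hmap p q \<Phi> o (qm p o x) = qm q o y"
 shows "imem \<Phi> x y"
proof -
 note p = fnD(1)[OF f] and q = fnD(2)[OF f] and F = fnD(4)[OF f]
 obtain B a z where a: "a : hom D B A" "regular_epi D a" "z : hom D B (IO (fst q))" "imem \<Phi> (x o a) z"
  by (rule imem_total[OF f x])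
 have xa: "x o a : hom D B (IO (fst p))" "y o a : hom D B (IO (fst q))" using x y a by (auto simp: hom_iff)
 have "hmap p q \<Phi> o (qm p o (x o a)) = (hmap p q \<Phi> o (qm p o x)) o a"
  using hmap(1)[OF f] qm(1)[OF p] x a(1) by (simp add: hom_iff)
 also have "\<dots> = qm q o (y o a)" unfolding eq using qm(1)[OF q] y a(1) by (simp add: hom_iff)
 finally have "qm q o z = qm q o (y o a)" using hmap(2)[OF f a(4)] by simp
 then have "imem (snd q) z (y o a)" using qm(3)[OF q a(3) xa(2)] by blast
 then have "imem \<Phi> (x o a) (y o a)" by (rule imem_right[OF f a(4)])
 then show ?thesis by (rule imem_local[OF F a(2,1) x y])
qed

text \<open>The equation is asked for only after a cover. For composites the intermediate value
  exists only there, and \<open>functor_H\<close> needs exactly this form.\<close>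

lemma hmap_unique:
 assumes f: "fn p q \<Phi>" and g: "g : hom D (dob p) (dob q)"
  and eq: "!!A B a x y. a : hom D B A ==> x : hom D A (IO (fst p)) ==> imem \<Phi> x y ==> y : hom D A (IO (fst q)) ==>
    EX B. EX a:hom D B A. regular_epi D a & (g o (qm p o x)) o a = (qm q o y) o a"
 shows "hmap p q \<Phi> = g"
proof -
 note p = fnD(1)[OF f] and q = fnD(2)[OF f]
 note i = D.idt_hom[OF IO_Ob[OF eqvD(1)[OF p]]]
 obtain B a y where a: "a : hom D B (IO (fst p))" "regular_epi D a" "y : hom D B (IO (fst q))" "imem \<Phi> (idt D (IO (fst p)) o a) y"
  by (rule imem_total[OF f i])
 have m: "imem \<Phi> a y" using a by (simp add: hom_iff)
 have h: "hmap p q \<Phi> o qm p : hom D (IO (fst p)) (dob q)" "g o qm p : hom D (IO (fst p)) (dob q)"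
   "g o (qm p o a) : hom D B (dob q)" "qm q o y : hom D B (dob q)"
  using hmap(1)[OF f] g qm(1)[OF p] a qm_cmp[OF q a(3)] by (auto simp: hom_iff)
 obtain B' b where b: "b : hom D B' B" "regular_epi D b" "(g o (qm p o a)) o b = (qm q o y) o b"
  using eq[OF _ a(1) m a(3)] D.idt_hom D.hom_Ob[OF a(1)] by blast
 have "g o (qm p o a) = qm q o y" by (rule D.regular_epi_cancel[OF b(2,1) h(3,4) b(3)])
 then have "(hmap p q \<Phi> o qm p) o a = (g o qm p) o a"
  using hmap(2)[OF f m] hmap(1)[OF f] g qm(1)[OF p] a(1) by (simp add: hom_iff)
 then have "hmap p q \<Phi> o qm p = g o qm p" by (rule D.regular_epi_cancel[OF a(2,1) h(1,2)])
 then show ?thesis by (rule D.regular_epi_cancel[OF qm(2,1)[OF p] hmap(1)[OF f] g])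
qed

lemma hmap_uniqueI:
 assumes f: "fn p q \<Phi>" and g: "g : hom D (dob p) (dob q)" and eq: "!!x y. imem \<Phi> x y ==> g o (qm p o x) = qm q o y"
 shows "hmap p q \<Phi> = g"
proof (rule hmap_unique[OF f g])
 fix A x y assume x: "x : hom D A (IO (fst p))" and m: "imem \<Phi> x y"
 have "A : Ob D" using D.hom_Ob[OF x] by blast
 then show "EX B. EX a:hom D B A. regular_epi D a & (g o (qm p o x)) o a = (qm q o y) o a"
  unfolding eq[OF m] using D.rel.cv_idt D.idt_hom by blast
qed

definition H :: "('p, 'q, 'a, 'b) ftor" where
 "H = \<lparr>fob = (%k. dob (inv_into {p. eqv p} oc k)), far = (%a. hmap (fst (dec a)) (fst (snd (dec a))) (snd (snd (dec a))))\<rparr>"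

lemma H_simps: "eqv p ==> fob H (oc p) = dob p" "fn p q \<Phi> ==> far H (ac (p, q, \<Phi>)) = hmap p q \<Phi>"
 by (simp_all add: H_def inv_into_f_f[OF oc_inj] dec_ac)

lemma functor_H: "is_functor K D H"
 unfolding is_functor_def
proof (intro conjI allI ballI category_K D.category_axioms)
 show "fob H X : Ob D" if "X : Ob K" for X using that H_simps(1) dob_Ob unfolding K_Ob by auto
 show "far H f : hom D (fob H X) (fob H Y)" if f: "f : hom K X Y" for X Y f
 proof -
  obtain p q \<Phi> where f: "X = oc p" "Y = oc q" "f = ac (p, q, \<Phi>)" "fn p q \<Phi>" by (rule K_homE[OF f])
  show ?thesis unfolding f(1-3) H_simps(2)[OF f(4)] H_simps(1)[OF fnD(1)[OF f(4)]] H_simps(1)[OF fnD(2)[OF f(4)]] by (rule hmap(1)[OF f(4)])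
 qed
 show "far H (idt K X) = idt D (fob H X)" if X: "X : Ob K" for X
 proof -
  obtain p where p: "X = oc p" "eqv p" using X unfolding K_Ob by blast
  have "hmap p p (snd p) = idt D (dob p)"
  proof (rule hmap_uniqueI[OF fn_id[OF p(2)] D.idt_hom[OF dob_Ob[OF p(2)]]])
   fix x y assume m: "imem (snd p) x y"
   then obtain A where A: "x : hom D A (IO (fst p))" "y : hom D A (IO (fst p))" using imem_hom[OF eqvD(2)[OF p(2)]] by blast
   have "qm p o x = qm p o y" using qm(3)[OF p(2) A] m by blast
   then show "idt D (dob p) o (qm p o x) = qm p o y" using D.idt_left[OF qm_cmp[OF p(2) A(1)]] by simp
  qed
  then show ?thesis unfolding p(1) K_idt[OF p(2)] H_simps(2)[OF fn_id[OF p(2)]] H_simps(1)[OF p(2)] .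
 qed
 show "far H (g \<odot> f) = far H g o far H f" if fh: "f : hom K X Y" and gh: "g : hom K Y Z" for X Y Z f g
 proof -
  obtain p q \<Phi> where f: "X = oc p" "Y = oc q" "f = ac (p, q, \<Phi>)" "fn p q \<Phi>" by (rule K_homE[OF fh])
  obtain q' r \<Psi> where g: "Y = oc q'" "Z = oc r" "g = ac (q', r, \<Psi>)" "fn q' r \<Psi>" by (rule K_homE[OF gh])
  have "q' = q" using f(2) g(1) oc_eq[OF fnD(2)[OF f(4)] fnD(1)[OF g(4)]] by simp
  note g = g[unfolded this]
  note F = fnD(4)[OF f(4)] and G = fnD(4)[OF g(4)]
  note e = fnD(1,2)[OF f(4)] fnD(2)[OF g(4)]
  have "hmap p r (rcomp \<Psi> \<Phi>) = hmap q r \<Psi> o hmap p q \<Phi>"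
  proof (rule hmap_unique[OF fn_comp[OF f(4) g(4)] D.cmp_hom[OF hmap(1)[OF f(4)] hmap(1)[OF g(4)]]])
   fix A x z assume x: "x : hom D A (IO (fst p))" and m: "imem (rcomp \<Psi> \<Phi>) x z" and z: "z : hom D A (IO (fst r))"
   obtain B a y where a: "a : hom D B A" "regular_epi D a" "y : hom D B (IO (fst q))" "imem \<Phi> (x o a) y" "imem \<Psi> y (z o a)"
   proof (rule transfer_comp_ex[OF F G rel.rel_comp_rels[OF F G] _ m x z])
    fix A x z assume m: "mem (rcomp \<Psi> \<Phi>) x z" and x: "x : hom C A (fst p)"
    obtain A' B a y where a: "x : hom C A' (fst p)" "z : hom C A' (fst r)" "a : hom C B A'" "regular_epi C a"
     "y : hom C B (fst q)" "mem \<Phi> (x \<star> a) y" "mem \<Psi> y (z \<star> a)" by (rule rel.mem_compE[OF F G m])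
    have "A' = A" using a(1) x by (simp add: hom_iff)
    then show "EX B. EX a:hom C B A. EX y. regular_epi C a & mem \<Phi> (x \<star> a) y & mem \<Psi> y (z \<star> a)" using a by blast
   qed
   have "((hmap q r \<Psi> o hmap p q \<Phi>) o (qm p o x)) o a = hmap q r \<Psi> o (hmap p q \<Phi> o (qm p o (x o a)))"
    using hmap(1)[OF f(4)] hmap(1)[OF g(4)] qm(1)[OF e(1)] x a(1) by (simp add: hom_iff)
   also have "\<dots> = qm r o (z o a)" unfolding hmap(2)[OF f(4) a(4)] by (rule hmap(2)[OF g(4) a(5)])
   also have "\<dots> = (qm r o z) o a" using qm(1)[OF e(3)] z a(1) by (simp add: hom_iff)
   finally show "EX B. EX a:hom D B A. regular_epi D a &
     ((hmap q r \<Psi> o hmap p q \<Phi>) o (qm p o x)) o a = (qm r o z) o a" using a(1,2) by blast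
  qed
  then show ?thesis unfolding f(3) g(3) K_cmp[OF f(4) g(4)] H_simps(2)[OF f(4)] H_simps(2)[OF g(4)] H_simps(2)[OF fn_comp[OF f(4) g(4)]] .
 qed
qed

section \<open>Regularity of \<open>H\<close>\<close>

lemma qm_lift2:
 assumes p: "eqv p" and q: "eqv q" and u: "u : hom D A (dob p)" and v: "v : hom D A (dob q)"
 obtains B b x y where "b : hom D B A" "regular_epi D b" "x : hom D B (IO (fst p))" "y : hom D B (IO (fst q))"
  "qm p o x = u o b" "qm q o y = v o b"
proof -
 obtain B a x where a: "a : hom D B A" "regular_epi D a" "x : hom D B (IO (fst p))" "qm p o x = u o a" by (rule qm_lift[OF p u])
 obtain B' b y where b: "b : hom D B' B" "regular_epi D b" "y : hom D B' (IO (fst q))" "qm q o y = (v o a) o b"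
  by (rule qm_lift[OF q D.cmp_hom[OF a(1) v]])
 show thesis
  by (rule that[OF D.cmp_hom[OF b(1) a(1)] D.regular_epi_cmp[OF b(2,1) a(2,1)] D.cmp_hom[OF b(1) a(3)] b(3)])
   (use D.assoc[OF b(1) a(3) qm(1)[OF p]] D.assoc[OF b(1) a(1) u] D.assoc[OF b(1) a(1) v] a(4) b(4) in simp_all)
qed

lemma H_terminal:
 assumes "is_terminal K P" shows "is_terminal D (fob H P)"
proof -
 obtain t where t: "P = oc t" "terminal_data t" by (rule terminal_dataD[OF assms])
 have e: "eqv t" and ex: "!!A. A : Ob C ==> EX B. EX a:hom C B A. EX z:hom C B (fst t). regular_epi C a"
  and un: "!!A z z'. z : hom C A (fst t) ==> z' : hom C A (fst t) ==> mem (snd t) z z'"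
  using t(2) unfolding terminal_data_def by blast+
 have U: "g = h" if g: "g : hom D A (dob t)" and h: "h : hom D A (dob t)" for A g h
 proof -
  obtain B b x y where b: "b : hom D B A" "regular_epi D b" "x : hom D B (IO (fst t))" "y : hom D B (IO (fst t))"
   "qm t o x = g o b" "qm t o y = h o b" by (rule qm_lift2[OF e e g h])
  have "imem (snd t) x y" by (rule imem_top[OF eqvD(1,1)[OF e] eqvD(2)[OF e] un b(3,4)])
  then show ?thesis using D.regular_epi_cancel[OF b(2,1) g h] qm(3)[OF e b(3,4)] b(5,6) by simp
 qed
 obtain T where T: "is_terminal C T" using terminal_ex by blast
 then have TO: "T : Ob C" by (simp add: is_terminal_def)
 obtain B a z where a: "a : hom C B T" "z : hom C B (fst t)" "regular_epi C a" using ex[OF TO] by blast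
 have E: "EX g. g : hom D A (dob t)" if A: "A : Ob D" for A
 proof -
  obtain k where k: "k : hom D A (IO T)" using IO_terminal[OF T] A unfolding is_terminal_def by blast
  obtain A' b l where b: "b : hom D A' A" "regular_epi D b" "l : hom D A' (IO B)" "IM a o l = k o b"
   by (rule D.cover_lift[OF IM_regular_epi[OF a(3)] IM_hom[OF a(1)] k])
  have "IM z o l : hom D A' (IO (fst t))" using IM_hom[OF a(2)] b(3) by (simp add: hom_iff)
  then have w: "qm t o (IM z o l) : hom D A' (dob t)" by (rule qm_cmp[OF e])
  \<comment> \<open>Parallel arrows into \<open>dob t\<close> are equal by \<open>U\<close>, so
    \<open>w\<close> is compatible with the cover \<open>b\<close> and descends.\<close>
  obtain g where "g : hom D A (dob t)"
   by (rule D.regular_epi_desc[OF b(2,1) w]) (rule U, use w in \<open>auto simp: hom_iff\<close>)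
  then show ?thesis by blast
 qed
 show ?thesis unfolding t(1) H_simps(1)[OF e] is_terminal_def using dob_Ob[OF e] U E by blast
qed

lemma hmap_ker:
 assumes f: "fn r p M" and z: "z : hom D B (IO (fst r))" "z' : hom D B (IO (fst r))"
  and eq: "hmap r p M o qm r o z = hmap r p M o qm r o z'"
 shows "imem (ker M) z z'"
proof -
 note r = fnD(1)[OF f] and F = fnD(4)[OF f] and h = hmap(1)[OF f]
 note k = rel_converse[OF F]
 obtain B' c x where c: "c : hom D B' B" "regular_epi D c" "x : hom D B' (IO (fst p))" "imem M (z o c) x" by (rule imem_total[OF f z(1)])
 have "hmap r p M o qm r o z' o c = hmap r p M o qm r o z o c"
  using arg_cong[OF eq, of "%w. w o c"] h qm(1)[OF r] z c(1) by (simp add: hom_iff)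
 also have "\<dots> = qm p o x" by (rule hmap(2)[OF f c(4)])
 finally have "imem M (z' o c) x" by (rule hmap_mem[OF f D.cmp_hom[OF c(1) z(2)] c(3)])
 then have "imem (ker M) (z o c) (z' o c)"
  by (intro transfer_comp[OF F k(1) ker_rels[OF f] _ c(4) imem_converse[OF F, THEN iffD2]]) (unfold k(2), rule kerI[OF f])
 then show ?thesis by (rule imem_local[OF ker_rels[OF f] c(2,1) z])
qed

text \<open>Joint monicity amounts to the entailment from \<open>ker M\<close> and
  \<open>ker N\<close> to \<open>snd r\<close>, which transfers to \<open>D\<close>.\<close>

lemma H_joint_cancel:
 assumes m: "fn r p M" and n: "fn r q N" and j: "jm r M N" and u: "u : hom D A (dob r)" and v: "v : hom D A (dob r)"
  and e0: "hmap r p M o u = hmap r p M o v" and e1: "hmap r q N o u = hmap r q N o v"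
 shows "u = v"
proof -
 note r = fnD(1)[OF m]
 have kk: "mem (snd r) z z'" if k: "mem (ker M) z z'" "mem (ker N) z z'" for z z'
 proof -
  obtain A where A: "z : hom C A (fst r)" "z' : hom C A (fst r)" using rel.mem_hom[OF ker_rels[OF m] k(1)] by blast
  obtain B b x y where b: "b : hom C B A" "regular_epi C b" "z \<star> b : hom C B (fst r)" "mem M (z \<star> b) x" "mem N (z \<star> b) y" by (rule fn_total2[OF m n A(1)])
  have "mem (snd r) (z \<star> b) (z' \<star> b)" using j b(4,5) ker_mem[OF m rel.mem_stable[OF ker_rels[OF m] k(1) b(1) A(1)] b(4)]
   ker_mem[OF n rel.mem_stable[OF ker_rels[OF n] k(2) b(1) A(1)] b(5)] unfolding jm_def by blast
  then show ?thesis by (rule rel.mem_local[OF eqvD(2)[OF r] b(2,1) A])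
 qed
 obtain B b z z' where b: "b : hom D B A" "regular_epi D b" "z : hom D B (IO (fst r))" "z' : hom D B (IO (fst r))"
  "qm r o z = u o b" "qm r o z' = v o b" by (rule qm_lift2[OF r r u v])
 have "hmap r p M o qm r o z = hmap r p M o qm r o z'" "hmap r q N o qm r o z = hmap r q N o qm r o z'"
  unfolding b(5,6) using D.assoc[OF b(1) u hmap(1)] D.assoc[OF b(1) v hmap(1)] m n e0 e1 by metis+
 then have "imem (snd r) z z'"
  by (intro transfer_inter[OF ker_rels[OF m] ker_rels[OF n] eqvD(2)[OF r] kk hmap_ker[OF m b(3,4)] hmap_ker[OF n b(3,4)]])
 then show ?thesis using D.regular_epi_cancel[OF b(2,1) u v] qm(3)[OF r b(3,4)] b(5,6) by simp
qed

text \<open>The mediating arrow is given after the cover \<open>e\<close> by \<open>z\<close>; joint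
  monicity makes it compatible with \<open>e\<close>, so it descends.\<close>

lemma H_pair:
 assumes m: "fn r p M" and n: "fn r q N" and j: "jm r M N" and u: "u : hom D A (dob p)" and v: "v : hom D A (dob q)"
  and e: "e : hom D B A" "regular_epi D e" and z: "z : hom D B (IO (fst r))"
  and w: "hmap r p M o qm r o z = u o e" "hmap r q N o qm r o z = v o e"
 shows "EX w:hom D A (dob r). hmap r p M o w = u & hmap r q N o w = v"
proof -
 note h = hmap(1)[OF m] hmap(1)[OF n] and qz = qm_cmp[OF fnD(1)[OF m] z]
 have c: "hmap r p M o (qm r o z) o s = u o e o s" "hmap r q N o (qm r o z) o s = v o e o s" if "s : hom D F B" for F s
  using that h qz u v e(1) D.cmp_reassoc[OF w(1), of s] D.cmp_reassoc[OF w(2), of s] by (auto simp: hom_iff)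
 have d: "(qm r o z) o s = (qm r o z) o t" if "s : hom D F B" "t : hom D F B" "e o s = e o t" for F s t
  by (rule H_joint_cancel[OF m n j D.cmp_hom[OF that(1) qz] D.cmp_hom[OF that(2) qz]]) (use c that in simp_all)
 obtain k where k: "k : hom D A (dob r)" "k o e = qm r o z" by (rule D.regular_epi_desc[OF e(2,1) qz d])
 have "(hmap r p M o k) o e = u o e" "(hmap r q N o k) o e = v o e"
  using D.assoc[OF e(1) k(1) h(1)] D.assoc[OF e(1) k(1) h(2)] w k(2) by simp_all
 then show ?thesis using k(1) D.regular_epi_cancel[OF e(2,1) D.cmp_hom[OF k(1) h(1)] u] D.regular_epi_cancel[OF e(2,1) D.cmp_hom[OF k(1) h(2)] v] by blast
qed

lemma H_product:
 assumes "is_product K X Y P0 P1" shows "is_product D (fob H X) (fob H Y) (far H P0) (far H P1)"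
proof -
 obtain P where P: "P0 : hom K P X" "P1 : hom K P Y" using assms unfolding is_product_def by blast
 obtain r p M where f: "P = oc r" "X = oc p" "P0 = ac (r, p, M)" "fn r p M" by (rule K_homE[OF P(1)])
 note m = f(4) and r = fnD(1)[OF f(4)] and p = fnD(2)[OF f(4)]
 obtain q where Y: "Y = oc q" and q: "eqv q" using K_hom_eqv[OF P(2)] by blast
 obtain N where P1: "P1 = ac (r, q, N)" and n: "fn r q N" by (rule K_homE2[OF P(2)[unfolded f(1) Y] r q])
 have "product_data p q r M N" by (rule product_dataD[OF assms[unfolded f(2,3) Y P1] m n])
 then have ex: "!!A x y. x : hom C A (fst p) ==> y : hom C A (fst q) ==> EX B. EX a:hom C B A. EX z. regular_epi C a &
    mem M z (x \<star> a) & mem N z (y \<star> a)" and j: "jm r M N"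
  unfolding product_data_def by blast+
 note R = fnD(4)[OF m] and h = hmap(1)[OF m] hmap(1)[OF n]
 note c0 = rel_converse[OF R]
 have E: "EX w:hom D A (dob r). hmap r p M o w = u & hmap r q N o w = v"
  if u: "u : hom D A (dob p)" and v: "v : hom D A (dob q)" for A u v
 proof -
  obtain B b x y where b: "b : hom D B A" "regular_epi D b" "x : hom D B (IO (fst p))" "y : hom D B (IO (fst q))"
   "qm p o x = u o b" "qm q o y = v o b" by (rule qm_lift2[OF p q u v])
  \<comment> \<open>Existence of a common preimage for any pair is an entailment from the total
    relation to a composite through \<open>r\<close>, and so it can be transferred.\<close>
  obtain \<Theta> where T: "\<Theta> : Rel (fst p) (fst q)" "ALL x y. mem \<Theta> x y \<longleftrightarrow> (EX A. x : hom C A (fst p) & y : hom C A (fst q))"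
   by (rule rel_top[OF eqvD(1)[OF p] eqvD(1)[OF q]])
  have t: "imem \<Theta> x y" by (rule imem_top[OF eqvD(1)[OF p] eqvD(1)[OF q] T(1) _ b(3,4)]) (use T(2) in blast)
  obtain B' c z where c: "c : hom D B' B" "regular_epi D c" "z : hom D B' (IO (fst r))" "imem (M\<inverse>) (x o c) z" "imem N z (y o c)"
  proof (rule transfer_comp_ex[OF c0(1) fnD(4)[OF n] T(1) _ t b(3,4)])
   fix A x y assume "x : hom C A (fst p)" "y : hom C A (fst q)"
   then show "EX B. EX a:hom C B A. EX z. regular_epi C a & mem (M\<inverse>) (x \<star> a) z & mem N z (y \<star> a)"
    using ex c0(2) by blast
  qed
  have "imem M z (x o c)" using c(4) imem_converse[OF R] by blast
  then have w: "hmap r p M o qm r o z = qm p o x o c" "hmap r q N o qm r o z = qm q o y o c" using hmap(2)[OF m] hmap(2)[OF n c(5)] by auto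
  show ?thesis
   by (rule H_pair[OF m n j u v D.cmp_hom[OF c(1) b(1)] D.regular_epi_cmp[OF c(2,1) b(2,1)] c(3)], unfold w)
    (use D.assoc[OF c(1) b(3) qm(1)[OF p]] D.assoc[OF c(1) b(4) qm(1)[OF q]] D.assoc[OF c(1) b(1) u] D.assoc[OF c(1) b(1) v] b(5,6) in simp_all)
 qed
 show ?thesis unfolding f(2,3) Y P1 H_simps(1)[OF p] H_simps(1)[OF q] H_simps(2)[OF m] H_simps(2)[OF n]
   D.is_product_iff
  by (intro exI conjI ballI allI impI; (rule h E H_joint_cancel[OF m n j]; assumption)?)
qed

lemma H_equalizer:
 assumes "is_equalizer K F G k" shows "is_equalizer D (far H F) (far H G) (far H k)"
proof -
 obtain X Y Z where P: "F : hom K X Y" "G : hom K X Y" "k : hom K Z X" "F \<odot> k = G \<odot> k" using assms unfolding is_equalizer_def by blast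
 obtain p q \<Phi> where XY: "X = oc p" "Y = oc q" and F: "F = ac (p, q, \<Phi>)" and f: "fn p q \<Phi>" by (rule K_homE[OF P(1)])
 note p = fnD(1)[OF f] and q = fnD(2)[OF f]
 obtain \<Psi> where G: "G = ac (p, q, \<Psi>)" and g: "fn p q \<Psi>" by (rule K_homE2[OF P(2)[unfolded XY] p q])
 obtain s M where k: "k = ac (s, p, M)" and m: "fn s p M" by (rule K_homE3[OF P(3)[unfolded XY] p])
 note s = fnD(1)[OF m] and R = fnD(4)[OF m]
 have "equalizer_data p q s \<Phi> \<Psi> M" by (rule equalizer_dataD[OF assms[unfolded F G k] f g m])
 then have j: "jm s M M" and ex: "!!A x y. x : hom C A (fst p) ==> mem \<Phi> x y ==> mem \<Psi> x y ==>
    EX B. EX a:hom C B A. EX u. regular_epi C a & mem M u (x \<star> a)"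
  unfolding equalizer_data_def by blast+
 note c0 = rel_converse[OF R] and h = hmap(1)[OF m] hmap(1)[OF f] hmap(1)[OF g]
 have Q: "hmap p q \<Phi> o hmap s p M = hmap p q \<Psi> o hmap s p M"
 proof -
  have "far H (F \<odot> k) = far H F o far H k" "far H (G \<odot> k) = far H G o far H k"
   using functor_H P(1-3) unfolding is_functor_def by blast+
  then show ?thesis using P(4) unfolding F G k H_simps(2)[OF f] H_simps(2)[OF g] H_simps(2)[OF m] by simp
 qed
 obtain N where N: "N : Rel (fst p) (fst q)" "ALL x y. mem N x y \<longleftrightarrow> mem \<Phi> x y & mem \<Psi> x y"
  by (rule rel_inter[OF fnD(4)[OF f] fnD(4)[OF g]])
 \<comment> \<open>The total relation pads existence of a preimage under \<open>M\<close> to a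
   composite of relations, the shape handled by \<open>transfer_comp_ex\<close>.\<close>
 obtain \<Theta> where T: "\<Theta> : Rel (fst s) (fst q)" "ALL x y. mem \<Theta> x y \<longleftrightarrow> (EX A. x : hom C A (fst s) & y : hom C A (fst q))"
  by (rule rel_top[OF eqvD(1)[OF s] eqvD(1)[OF q]])
 have E: "EX w:hom D A (dob s). hmap s p M o w = u"
  if u: "u : hom D A (dob p)" and eq: "hmap p q \<Phi> o u = hmap p q \<Psi> o u" for A u
 proof -
  obtain B a x where a: "a : hom D B A" "regular_epi D a" "x : hom D B (IO (fst p))" "qm p o x = u o a" by (rule qm_lift[OF p u])
  obtain B1 b y where b: "b : hom D B1 B" "regular_epi D b" "y : hom D B1 (IO (fst q))" "imem \<Phi> (x o b) y" by (rule imem_total[OF f a(3)])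
  note xb = D.cmp_hom[OF b(1) a(3)] and ab = D.cmp_hom[OF b(1) a(1)]
  have qx: "qm p o x o b = u o a o b" using D.assoc[OF b(1) a(3) qm(1)[OF p]] D.assoc[OF b(1) a(1) u] a(4) by simp
  have "hmap p q \<Psi> o qm p o x o b = hmap p q \<Phi> o qm p o x o b"
   unfolding qx using u h ab by (intro D.cmp_reassoc[OF eq[symmetric]]) (auto simp: hom_iff)
  then have "imem \<Psi> (x o b) y" using hmap_mem[OF g xb b(3)] hmap(2)[OF f b(4)] by simp
  then have n: "imem N (x o b) y" using transfer_inter[OF fnD(4)[OF f] fnD(4)[OF g] N(1) _ b(4)] N(2) by blast
  obtain B2 c z where c: "c : hom D B2 B1" "regular_epi D c" "z : hom D B2 (IO (fst s))" "imem (M\<inverse>) ((x o b) o c) z" "imem \<Theta> z (y o c)"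
  proof (rule transfer_comp_ex[OF c0(1) T(1) N(1) _ n xb b(3)])
   fix A x y assume nxy: "mem N x y" and x: "x : hom C A (fst p)" and y: "y : hom C A (fst q)"
   then obtain B a u where a: "a : hom C B A" "regular_epi C a" "mem M u (x \<star> a)" using ex N(2) by blast
   then have "mem \<Theta> u (y \<star> a)" using T(2) mem_hom2(2)[OF R a(3) cmp_hom[OF a(1) x]] cmp_hom[OF a(1) y] by blast
   then show "EX B. EX a:hom C B A. EX z. regular_epi C a & mem (M\<inverse>) (x \<star> a) z & mem \<Theta> z (y \<star> a)"
    using a c0(2) by blast
  qed
  have "imem M z ((x o b) o c)" using c(4) imem_converse[OF R] by blast
  then have "hmap s p M o qm s o z = qm p o (x o b) o c" by (rule hmap(2)[OF m])
  also have "\<dots> = u o (a o b) o c" using D.assoc[OF c(1) xb qm(1)[OF p]] D.assoc[OF c(1) ab u] qx by simp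
  finally have w: "hmap s p M o qm s o z = u o (a o b) o c" .
  show ?thesis
   using H_pair[OF m m j u u D.cmp_hom[OF c(1) ab] D.regular_epi_cmp[OF c(2,1) D.regular_epi_cmp[OF b(2,1) a(2,1)] ab] c(3) w w] by blast
 qed
 have U: "u = v" if "u : hom D A (dob s)" "v : hom D A (dob s)" "hmap s p M o u = hmap s p M o v" for A u v
  by (rule H_joint_cancel[OF m m j that that(3)])
 show ?thesis unfolding F G k H_simps(2)[OF f] H_simps(2)[OF g] H_simps(2)[OF m] D.is_equalizer_iff
  by (intro exI conjI ballI allI impI; (rule h Q E U; assumption)?)
qed

text \<open>Surjectivity is totality of the converse, which transfers. The cover
  \<open>qm q o a\<close> then factors with \<open>hmap p q \<Phi>\<close> as last factor.\<close>

lemma H_regular_epi: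
 assumes "regular_epi K e" shows "regular_epi D (far H e)"
proof -
 interpret KK: category K by (rule category_K)
 obtain X Y where "e : hom K X Y" using KK.regular_epi_Ar[OF assms] by (auto simp: hom_iff)
 then obtain p q \<Phi> where f: "e = ac (p, q, \<Phi>)" "fn p q \<Phi>" by (rule K_homE)
 note p = fnD(1)[OF f(2)] and q = fnD(2)[OF f(2)] and F = fnD(4)[OF f(2)]
 have s: "surj q \<Phi>" by (rule regular_epi_surj[OF assms[unfolded f(1)] f(2)])
 note c = rel_converse[OF F]
 note i = D.idt_hom[OF IO_Ob[OF eqvD(1)[OF q]]]
 obtain B a x where a: "a : hom D B (IO (fst q))" "regular_epi D a" "x : hom D B (IO (fst p))" "imem (\<Phi>\<inverse>) (idt D (IO (fst q)) o a) x"
 proof (rule transfer_total[OF c(1) eqvD(1)[OF q] _ i])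
  fix A y assume y: "y : hom C A (fst q)"
  show "EX B. EX a:hom C B A. EX x. regular_epi C a & mem (\<Phi>\<inverse>) (y \<star> a) x"
   by (rule surjE[OF s F y]) (use c(2) in blast)
 qed
 have "imem \<Phi> x a" using a(1,4) imem_converse[OF F] by (simp add: hom_iff)
 then have eq: "hmap p q \<Phi> o (qm p o x) = qm q o a" by (rule hmap(2)[OF f(2)])
 have "regular_epi D (qm q o a)" by (rule D.regular_epi_cmp[OF a(2,1) qm(2,1)[OF q]])
 then show ?thesis unfolding f(1) H_simps(2)[OF f(2)]
  using D.regular_epi_right[OF _ qm_cmp[OF p a(3)] hmap(1)[OF f(2)]] eq by simp
qed

lemma regular_functor_H: "regular_functor K D H"
 unfolding regular_functor_def using functor_H H_terminal H_product H_equalizer H_regular_epi by blast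

text \<open>For a discrete relation the quotient map is both a monomorphism and a regular
  epimorphism; these maps are the components.\<close>

lemma H_J: "nat_iso C D I (comp_ftor H J)"
proof -
 have q: "qm (jo X) : hom D (IO X) (dob (jo X)) & iso D (qm (jo X))" if X: "X : Ob C" for X
 proof -
  note e = eqv_jo[OF X]
  have 1: "qm (jo X) : hom D (IO X) (dob (jo X))" using qm(1)[OF e] by simp
  have "x = y" if "imem (snd (jo X)) x y" for x y
  proof -
   obtain T r0 r1 where "ispan (snd (jo X)) X X T r0 r1" by (rule IRelE[OF eqvD(2)[OF e, unfolded fst_jo]])
   note r = ispanD[OF this]
   have "r0 = r1" using r(5) mem_jo[OF X] by blast
   moreover have "imem (snd (jo X)) x y" by fact
   ultimately show ?thesis using r(6) by auto
  qed
  then have "u = v" if "u : hom D A (IO X)" "v : hom D A (IO X)" "qm (jo X) o u = qm (jo X) o v" for A u v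
   using qm(3)[OF e, of u A v] that by simp
  then have "mono_ar D (qm (jo X))" using 1 unfolding mono_ar_def by (auto simp: hom_iff)
  then show ?thesis using D.mono_regular_epi_iso qm(2)[OF e] 1 by blast
 qed
 have n: "hmap (jo X) (jo Y) (pt (jo Y) f) o qm (jo X) = qm (jo Y) o IM f" if f: "f : hom C X Y" for X Y f
 proof -
  have X: "X : Ob C" using hom_Ob[OF f] by blast
  have F: "pt (jo Y) f : Rel X Y" using fnD(4)[OF fn_J[OF f]] by simp
  have i: "idt C X : hom C X X" by (rule idt_hom[OF X])
  have "mem (pt (jo Y) f) (idt C X) f" unfolding mem_J[OF f] using i f by (auto simp: hom_iff)
  then have "imem (pt (jo Y) f) (idt D (IO X)) (IM f)" using imem_IM[OF F] IM_idt[OF X] by metis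
  then have "hmap (jo X) (jo Y) (pt (jo Y) f) o (qm (jo X) o idt D (IO X)) = qm (jo Y) o IM f" by (rule hmap(2)[OF fn_J[OF f]])
  then show ?thesis using q[OF X] by (simp add: hom_iff)
 qed
 show ?thesis unfolding nat_iso_def
 proof (intro exI[of _ "%X. qm (jo X)"] conjI ballI allI)
  fix X assume X: "X : Ob C"
  show "qm (jo X) : hom D (IO X) (fob (comp_ftor H J) X)" using q[OF X] H_simps(1)[OF eqv_jo[OF X]] by (simp add: comp_ftor_def)
  show "iso D (qm (jo X))" using q[OF X] by blast
 next
  fix X Y f assume f: "f : hom C X Y"
  show "far (comp_ftor H J) f o qm (jo X) = qm (jo Y) o IM f"
   using n[OF f] H_simps(2)[OF fn_J[OF f]] far_J[OF f] by (simp add: comp_ftor_def)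
 qed
qed

end

section \<open>Natural isomorphisms and equivalences\<close>

lemma is_functorD:
 fixes B (structure)
 assumes "is_functor A B F"
 shows "category A" "category B" "X : Ob A ==> fob F X : Ob B"
  "f : hom A X Y ==> far F f : hom B (fob F X) (fob F Y)"
  "X : Ob A ==> far F (idt A X) = idt B (fob F X)"
  "f : hom A X Y ==> g : hom A Y Z ==> far F (g o\<^bsub>A\<^esub> f) = far F g o far F f"
 using assms unfolding is_functor_def by blast+

lemma ftor_simps [simp]: "fob (comp_ftor G F) X = fob G (fob F X)" "far (comp_ftor G F) f = far G (far F f)"
 "fob id_ftor X' = X'" "far id_ftor f' = f'"
 by (simp_all add: comp_ftor_def id_ftor_def)

lemma is_functor_comp: "is_functor A B F ==> is_functor B C G ==> is_functor A C (comp_ftor G F)"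
 unfolding is_functor_def ftor_simps by (elim conjE, intro conjI ballI allI) (assumption | metis)+

lemma regular_functor_comp: "regular_functor A B F ==> regular_functor B C G ==> regular_functor A C (comp_ftor G F)"
 unfolding regular_functor_def using is_functor_comp by auto

lemma regular_functor_id: "category A ==> regular_functor A A id_ftor"
 unfolding regular_functor_def is_functor_def by simp

lemma is_functor_iso:
 fixes B (structure)
 assumes F: "is_functor A B F" and i: "iso A f" shows "iso B (far F f)"
proof -
 note D = is_functorD[OF F]
 interpret A: category A by (rule D(1))
 interpret B: category B by (rule D(2))
 obtain X Y where f: "f : hom A X Y" using A.iso_Ar[OF i] by (auto simp: hom_iff)
 obtain g where g: "g : hom A Y X" "g o\<^bsub>A\<^esub> f = idt A X" "f o\<^bsub>A\<^esub> g = idt A Y" by (rule A.isoE[OF i f])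
 have "far F g o far F f = idt B (fob F X)" "far F f o far F g = idt B (fob F Y)"
  using D(6)[OF f g(1)] D(6)[OF g(1) f] g D(5) A.hom_Ob[OF f] by auto
 then show ?thesis by (rule B.isoI[OF D(4)[OF f] D(4)[OF g(1)]])
qed

lemma (in category) retract_cmp:
 "r o s = idt C X ==> s : hom C X Y ==> r : hom C Y X ==> k : hom C A X ==> r o s o k = k"
 by (metis assoc idt_left)

lemma nat_isoE:
 fixes B (structure)
 assumes "nat_iso A B F G"
 obtains \<eta> where "ALL X:Ob A. \<eta> X : hom B (fob F X) (fob G X) & iso B (\<eta> X)"
  "ALL X Y. ALL f:hom A X Y. far G f o \<eta> X = \<eta> Y o far F f"
 using assms unfolding nat_iso_def by blast

lemma nat_iso_refl:
 fixes B (structure)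
 assumes F: "is_functor A B F" shows "nat_iso A B F F"
proof -
 note D = is_functorD[OF F]
 interpret A: category A by (rule D(1))
 interpret B: category B by (rule D(2))
 show ?thesis unfolding nat_iso_def
 proof (intro exI[of _ "%X. idt B (fob F X)"] conjI ballI allI)
  fix X Y f assume f: "f : hom A X Y"
  show "far F f o idt B (fob F X) = idt B (fob F Y) o far F f" using D(4)[OF f] by (simp add: hom_iff)
 qed (simp_all add: D(3) B.idt_hom B.iso_idt)
qed

lemma nat_iso_sym:
 fixes B (structure)
 assumes F: "is_functor A B F" and G: "is_functor A B G" and n: "nat_iso A B F G"
 shows "nat_iso A B G F"
proof -
 note D = is_functorD[OF F] and D' = is_functorD[OF G]
 interpret A: category A by (rule D(1))
 interpret B: category B by (rule D(2))
 obtain \<eta> where h: "ALL X:Ob A. \<eta> X : hom B (fob F X) (fob G X) & iso B (\<eta> X)"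
  "ALL X Y. ALL f:hom A X Y. far G f o \<eta> X = \<eta> Y o far F f" by (rule nat_isoE[OF n])
 have "ALL X:Ob A. EX t. t : hom B (fob G X) (fob F X) & iso B t & t o \<eta> X = idt B (fob F X) & \<eta> X o t = idt B (fob G X)"
  using h(1) B.isoE by metis
 then obtain t where t: "ALL X:Ob A. t X : hom B (fob G X) (fob F X) & iso B (t X) & t X o \<eta> X = idt B (fob F X) & \<eta> X o t X = idt B (fob G X)"
  by metis
 show ?thesis unfolding nat_iso_def
 proof (intro exI[of _ t] conjI ballI allI)
  fix X Y f assume f: "f : hom A X Y"
  have O: "X : Ob A" "Y : Ob A" using A.hom_Ob[OF f] by auto
  note tX = bspec[OF t O(1)] and tY = bspec[OF t O(2)] and hX = bspec[OF h(1) O(1)] and hY = bspec[OF h(1) O(2)]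
  have "far F f o t X = t Y o \<eta> Y o far F f o t X"
   using B.retract_cmp[OF _ _ _ B.cmp_hom[OF _ D(4)[OF f]]] tX tY hY by metis
  also have "\<dots> = t Y o (\<eta> Y o far F f) o t X" using tX tY hY D(4)[OF f] by (simp add: hom_iff)
  also have "\<dots> = t Y o (far G f o \<eta> X) o t X" using h(2) f by simp
  also have "\<dots> = t Y o far G f o \<eta> X o t X" using tX tY hX D'(4)[OF f] by (simp add: hom_iff)
  also have "\<dots> = t Y o far G f" using tX tY D'(4)[OF f] by (simp add: hom_iff)
  finally show "far F f o t X = t Y o far G f" .
 qed (use t in auto)
qed

lemma nat_iso_trans:
 fixes B (structure)
 assumes F: "is_functor A B F" and G: "is_functor A B G" and H: "is_functor A B H"
  and n: "nat_iso A B F G" and m: "nat_iso A B G H"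
 shows "nat_iso A B F H"
proof -
 note D = is_functorD[OF F] and D' = is_functorD[OF G] and D'' = is_functorD[OF H]
 interpret A: category A by (rule D(1))
 interpret B: category B by (rule D(2))
 obtain \<eta> where h: "ALL X:Ob A. \<eta> X : hom B (fob F X) (fob G X) & iso B (\<eta> X)"
  "ALL X Y. ALL f:hom A X Y. far G f o \<eta> X = \<eta> Y o far F f" by (rule nat_isoE[OF n])
 obtain t where t: "ALL X:Ob A. t X : hom B (fob G X) (fob H X) & iso B (t X)"
  "ALL X Y. ALL f:hom A X Y. far H f o t X = t Y o far G f" by (rule nat_isoE[OF m])
 show ?thesis unfolding nat_iso_def
 proof (intro exI[of _ "%X. t X o \<eta> X"] conjI ballI allI)
  fix X assume X: "X : Ob A"
  note hX = bspec[OF h(1) X] and tX = bspec[OF t(1) X]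
  show "t X o \<eta> X : hom B (fob F X) (fob H X)" using hX tX by (auto intro: B.cmp_hom)
  show "iso B (t X o \<eta> X)" using B.iso_cmp[of "\<eta> X" "t X"] hX tX by blast
 next
  fix X Y f assume f: "f : hom A X Y"
  have O: "X : Ob A" "Y : Ob A" using A.hom_Ob[OF f] by auto
  note tX = bspec[OF t(1) O(1)] and tY = bspec[OF t(1) O(2)] and hX = bspec[OF h(1) O(1)] and hY = bspec[OF h(1) O(2)]
  have "far H f o t X o \<eta> X = (far H f o t X) o \<eta> X" using tX hX D''(4)[OF f] by (simp add: hom_iff)
  also have "\<dots> = t Y o (far G f o \<eta> X)" using t(2) f tY hX D'(4)[OF f] by (simp add: hom_iff)
  also have "\<dots> = (t Y o \<eta> Y) o far F f" using h(2) f tY hY D(4)[OF f] by (simp add: hom_iff)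
  finally show "far H f o t X o \<eta> X = (t Y o \<eta> Y) o far F f" .
 qed
qed

lemma nat_iso_post:
 fixes B (structure)
 assumes F: "is_functor A B F" and n: "nat_iso A B F G" and H: "is_functor B C H" and G: "is_functor A B G"
 shows "nat_iso A C (comp_ftor H F) (comp_ftor H G)"
proof -
 note D = is_functorD[OF F] and D' = is_functorD[OF G] and E = is_functorD[OF H]
 interpret A: category A by (rule D(1))
 obtain \<eta> where h: "ALL X:Ob A. \<eta> X : hom B (fob F X) (fob G X) & iso B (\<eta> X)"
  "ALL X Y. ALL f:hom A X Y. far G f o \<eta> X = \<eta> Y o far F f" by (rule nat_isoE[OF n])
 show ?thesis unfolding nat_iso_def
 proof (intro exI[of _ "%X. far H (\<eta> X)"] conjI ballI allI)
  fix X Y f assume f: "f : hom A X Y"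
  have O: "X : Ob A" "Y : Ob A" using A.hom_Ob[OF f] by auto
  have "far H (far G f o \<eta> X) = far H (\<eta> Y o far F f)" using h(2) f by simp
  then show "far (comp_ftor H G) f o\<^bsub>C\<^esub> far H (\<eta> X) = far H (\<eta> Y) o\<^bsub>C\<^esub> far (comp_ftor H F) f"
   using E(6)[OF conjunct1[OF bspec[OF h(1) O(1)]] D'(4)[OF f]] E(6)[OF D(4)[OF f] conjunct1[OF bspec[OF h(1) O(2)]]] by simp
 qed (use h(1) E(4) is_functor_iso[OF H] in auto)
qed

lemma nat_iso_pre: "is_functor A B H ==> nat_iso B C F G ==> nat_iso A C (comp_ftor F H) (comp_ftor G H)"
 by (erule nat_isoE, unfold nat_iso_def is_functor_def, rule_tac x = "%X. \<eta> (fob H X)" in exI) auto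

lemma comp_ftor_assoc: "comp_ftor H (comp_ftor G F) = comp_ftor (comp_ftor H G) F"
 and comp_ftor_id: "comp_ftor id_ftor F = F" "comp_ftor F id_ftor = F"
 by (simp_all add: comp_ftor_def id_ftor_def)

lemma pos_equivalent_sym: "pos_equivalent A B ==> pos_equivalent B A"
 unfolding pos_equivalent_def by blast

lemma pos_functor_comp: "pos_functor A B F ==> pos_functor B C G ==> pos_functor A C (comp_ftor G F)"
 unfolding pos_functor_def using is_functor_comp by auto

lemma nat_iso_comp_id:
 assumes F: "is_functor A B F" and G: "is_functor B A G" and F': "is_functor B C F'" and G': "is_functor C B G'"
  and n: "nat_iso A A (comp_ftor G F) id_ftor" and n': "nat_iso B B (comp_ftor G' F') id_ftor"
 shows "nat_iso A A (comp_ftor (comp_ftor G G') (comp_ftor F' F)) id_ftor"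
proof -
 have i: "is_functor B B id_ftor" "is_functor A A id_ftor"
  using is_functorD(1)[OF F'] is_functorD(1)[OF F] unfolding is_functor_def by simp_all
 have "nat_iso A B (comp_ftor (comp_ftor G' F') F) (comp_ftor id_ftor F)" by (rule nat_iso_pre[OF F n'])
 then have "nat_iso A A (comp_ftor G (comp_ftor (comp_ftor G' F') F)) (comp_ftor G (comp_ftor id_ftor F))"
  by (intro nat_iso_post[OF _ _ G]) (auto intro!: is_functor_comp[OF F] is_functor_comp[OF F' G'] i)
 then have "nat_iso A A (comp_ftor G (comp_ftor (comp_ftor G' F') F)) (comp_ftor G F)" unfolding comp_ftor_id .
 then have "nat_iso A A (comp_ftor G (comp_ftor (comp_ftor G' F') F)) id_ftor"
  by (rule nat_iso_trans[rotated 3, OF _ n])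
   (intro is_functor_comp[OF _ G] is_functor_comp[OF F] is_functor_comp[OF F' G'] i F)+
 then show ?thesis by (simp add: comp_ftor_assoc)
qed

lemma pos_equivalent_trans:
 assumes "pos_equivalent A B" "pos_equivalent B C" shows "pos_equivalent A C"
proof -
 obtain F G where f: "pos_functor A B F" "pos_functor B A G"
   "nat_iso A A (comp_ftor G F) id_ftor" "nat_iso B B (comp_ftor F G) id_ftor"
  using assms(1) unfolding pos_equivalent_def by blast
 obtain F' G' where f': "pos_functor B C F'" "pos_functor C B G'"
   "nat_iso B B (comp_ftor G' F') id_ftor" "nat_iso C C (comp_ftor F' G') id_ftor"
  using assms(2) unfolding pos_equivalent_def by blast
 have i: "is_functor A B F" "is_functor B A G" "is_functor B C F'" "is_functor C B G'"
  using f f' unfolding pos_functor_def by blast+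
 have "nat_iso A A (comp_ftor (comp_ftor G G') (comp_ftor F' F)) id_ftor" by (rule nat_iso_comp_id[OF i f(3) f'(3)])
 moreover have "nat_iso C C (comp_ftor (comp_ftor F' F) (comp_ftor G G')) id_ftor" by (rule nat_iso_comp_id[OF i(4,3,2,1) f'(4) f(4)])
 ultimately show ?thesis unfolding pos_equivalent_def using pos_functor_comp[OF f(1) f'(1)] pos_functor_comp[OF f'(2) f(2)] by blast
qed

text \<open>The weak inverse arises by choice: \<open>m h\<close> lifts the conjugate of
  \<open>h\<close> by the chosen isomorphisms. Reflection of the order gives faithfulness of
  \<open>F\<close>, through antisymmetry, and monotonicity of the inverse.\<close>

lemma pos_equivalentI:
 fixes B (structure)
 assumes F: "pos_functor A B F"
  and ff: "!!X Y f g. f : hom A X Y ==> g : hom A X Y ==> far F f \<preceq> far F g ==> f \<preceq>\<^bsub>A\<^esub> g"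
  and full: "!!X Y h. X : Ob A ==> Y : Ob A ==> h : hom B (fob F X) (fob F Y) ==> EX f:hom A X Y. far F f = h"
  and eso: "!!Z. Z : Ob B ==> EX X:Ob A. EX i:hom B (fob F X) Z. iso B i"
 shows "pos_equivalent A B"
proof -
 have pA: "pos_category A" and pB: "pos_category B" and fF: "is_functor A B F"
  and mono: "!!f g. f \<preceq>\<^bsub>A\<^esub> g ==> far F f \<preceq> far F g" using F unfolding pos_functor_def by blast+
 interpret A: pos_category A by (rule pA)
 interpret B: pos_category B by (rule pB)
 note D = is_functorD[OF fF]
 have faith: "f = g" if f: "f : hom A X Y" and g: "g : hom A X Y" and eq: "far F f = far F g" for X Y f g
 proof -
  have "far F f : Ar B" using D(4)[OF f] by (simp add: hom_iff)
  then have "far F f \<preceq> far F g" "far F g \<preceq> far F f" using B.leq_refl eq by auto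
  then show ?thesis using A.leq_antisym ff f g by blast
 qed
 have "ALL Z:Ob B. EX X i j. X : Ob A & i : hom B (fob F X) Z & iso B i & j : hom B Z (fob F X) & j o i = idt B (fob F X) & i o j = idt B Z"
  using eso B.isoE by metis
 then obtain ob i j where oij: "ALL Z:Ob B. ob Z : Ob A & i Z : hom B (fob F (ob Z)) Z & iso B (i Z) & j Z : hom B Z (fob F (ob Z)) &
   j Z o i Z = idt B (fob F (ob Z)) & i Z o j Z = idt B Z" by metis
 define m where "m h = (SOME f. f : hom A (ob (src B h)) (ob (tgt B h)) & far F f = j (tgt B h) o h o i (src B h))" for h
 have m: "m h : hom A (ob Z) (ob W) & far F (m h) = j W o h o i Z" if h: "h : hom B Z W" for h Z W
 proof -
  have O: "Z : Ob B" "W : Ob B" using B.hom_Ob[OF h] by auto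
  have e: "src B h = Z" "tgt B h = W" using h by (auto simp: hom_iff)
  have "j W o h o i Z : hom B (fob F (ob Z)) (fob F (ob W))" using oij O h by (auto intro!: B.cmp_hom)
  then have "EX f. f : hom A (ob Z) (ob W) & far F f = j W o h o i Z" using full oij O by metis
  from someI_ex[OF this] show ?thesis unfolding m_def e .
 qed
 define G where "G = \<lparr>fob = ob, far = m\<rparr>"
 have fG: "is_functor B A G" unfolding is_functor_def
 proof (intro conjI allI ballI D(1,2))
  show "fob G Z : Ob A" if "Z : Ob B" for Z using oij that by (simp add: G_def)
  show "far G h : hom A (fob G Z) (fob G W)" if "h : hom B Z W" for Z W h using m[OF that] by (simp add: G_def)
  show "far G (idt B Z) = idt A (fob G Z)" if Z: "Z : Ob B" for Z
  proof -
   note z = bspec[OF oij Z]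
   have "far F (m (idt B Z)) = far F (idt A (ob Z))" using m[OF B.idt_hom[OF Z]] z D(5) Z by (simp add: hom_iff)
   then have "m (idt B Z) = idt A (ob Z)" using faith m[OF B.idt_hom[OF Z]] A.idt_hom z by blast
   then show ?thesis by (simp add: G_def)
  qed
  show "far G (h' o h) = far G h' o\<^bsub>A\<^esub> far G h" if h: "h : hom B Z W" and h': "h' : hom B W V" for Z W V h h'
  proof -
   have O: "Z : Ob B" "W : Ob B" "V : Ob B" using B.hom_Ob[OF h] B.hom_Ob[OF h'] by auto
   note z = bspec[OF oij O(1)] and w = bspec[OF oij O(2)] and v = bspec[OF oij O(3)]
   note hh = B.cmp_hom[OF h h']
   have "far F (m h' o\<^bsub>A\<^esub> m h) = (j V o h' o i W) o (j W o h o i Z)" using m[OF h] m[OF h'] D(6) by metis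
   also have "\<dots> = far F (m (h' o h))"
   proof -
    have "i W o j W o h o i Z = h o i Z" by (rule B.retract_cmp[OF _ _ _ B.cmp_hom[OF _ h]]) (use z w in auto)
    then show ?thesis using m[OF hh] z w v h h' by (auto simp: hom_iff)
   qed
   finally have "m (h' o h) = m h' o\<^bsub>A\<^esub> m h" using faith m[OF hh] A.cmp_hom m[OF h] m[OF h'] by metis
   then show ?thesis by (simp add: G_def)
  qed
 qed
 have pG: "pos_functor B A G" unfolding pos_functor_def
 proof (intro conjI allI impI pA pB fG)
  fix h k assume le: "h \<preceq> k"
  obtain Z W where hk: "h : hom B Z W" "k : hom B Z W" using B.leq_parallel[OF le] by blast
  have O: "Z : Ob B" "W : Ob B" using B.hom_Ob[OF hk(1)] by auto
  note z = bspec[OF oij O(1)] and w = bspec[OF oij O(2)]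
  have r: "i Z \<preceq> i Z" "j W \<preceq> j W" using z w by (auto intro!: B.leq_refl simp: hom_iff)
  have "h o i Z \<preceq> k o i Z" using B.cmp_mono[OF _ hk(1) r(1) le] z by blast
  then have "j W o h o i Z \<preceq> j W o k o i Z"
   using B.cmp_mono[OF B.cmp_hom[OF _ hk(1)] _ _ r(2)] z w by blast
  then have "m h \<preceq>\<^bsub>A\<^esub> m k" using ff m[OF hk(1)] m[OF hk(2)] by metis
  then show "far G h \<preceq>\<^bsub>A\<^esub> far G k" by (simp add: G_def)
 qed
 have nB: "nat_iso B B (comp_ftor F G) id_ftor" unfolding nat_iso_def
 proof (intro exI[of _ i] conjI ballI allI)
  fix Z W h assume h: "h : hom B Z W"
  have O: "Z : Ob B" "W : Ob B" using B.hom_Ob[OF h] by auto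
  note z = bspec[OF oij O(1)] and w = bspec[OF oij O(2)]
  have "i W o j W o h o i Z = h o i Z" by (rule B.retract_cmp[OF _ _ _ B.cmp_hom[OF _ h]]) (use z w in auto)
  then show "far id_ftor h o i Z = i W o far (comp_ftor F G) h"
   using m[OF h] by (simp add: G_def)
 qed (use oij in \<open>auto simp: G_def\<close>)
 have "ALL X:Ob A. EX t. t : hom A (ob (fob F X)) X & far F t = i (fob F X)" using full oij D(3) by metis
 then obtain t where t: "ALL X:Ob A. t X : hom A (ob (fob F X)) X & far F (t X) = i (fob F X)" by metis
 have nA: "nat_iso A A (comp_ftor G F) id_ftor" unfolding nat_iso_def
 proof (intro exI[of _ t] conjI ballI allI)
  fix X assume X: "X : Ob A"
  note x = bspec[OF oij D(3)[OF X]] and tX = bspec[OF t X]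
  show "t X : hom A (fob (comp_ftor G F) X) (fob id_ftor X)" using tX by (simp add: G_def)
  obtain s where s: "s : hom A X (ob (fob F X))" "far F s = j (fob F X)" using full[OF X] x by blast
  have "s o\<^bsub>A\<^esub> t X = idt A (ob (fob F X))"
   by (rule faith[OF A.cmp_hom[OF conjunct1[OF tX] s(1)] A.idt_hom]) (use x s tX D(5) D(6)[OF conjunct1[OF tX] s(1)] in auto)
  moreover have "t X o\<^bsub>A\<^esub> s = idt A X"
   by (rule faith[OF A.cmp_hom[OF s(1) conjunct1[OF tX]] A.idt_hom]) (use x s tX D(5) X D(6)[OF s(1) conjunct1[OF tX]] in auto)
  ultimately show "iso A (t X)" using A.isoI[OF conjunct1[OF tX] s(1)] by blast
 next
  fix X Y f assume f: "f : hom A X Y"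
  have O: "X : Ob A" "Y : Ob A" using A.hom_Ob[OF f] by auto
  note tX = bspec[OF t O(1)] and tY = bspec[OF t O(2)] and x = bspec[OF oij D(3)[OF O(1)]] and y = bspec[OF oij D(3)[OF O(2)]]
  note mf = m[OF D(4)[OF f]]
  have "far F (t Y o\<^bsub>A\<^esub> m (far F f)) = i (fob F Y) o (j (fob F Y) o far F f o i (fob F X))"
   using D(6)[OF conjunct1[OF mf] conjunct1[OF tY]] mf tY by simp
  also have "\<dots> = far F f o i (fob F X)"
   by (rule B.retract_cmp[OF _ _ _ B.cmp_hom[OF _ D(4)[OF f]]]) (use x y in auto)
  also have "\<dots> = far F (f o\<^bsub>A\<^esub> t X)" using D(6)[OF conjunct1[OF tX] f] tX by simp
  finally show "far id_ftor f o\<^bsub>A\<^esub> t X = t Y o\<^bsub>A\<^esub> far (comp_ftor G F) f"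
   using faith[OF A.cmp_hom[OF conjunct1[OF mf] conjunct1[OF tY]] A.cmp_hom[OF conjunct1[OF tX] f]] by (simp add: G_def)
 qed
 show ?thesis unfolding pos_equivalent_def using F pG nA nB by blast
qed

section \<open>The embedding into the exact completion\<close>

lemma pairing_ex: "EX f :: 'u::infinite \<times> 'u => 'u. inj f"
proof -
 obtain f :: "'u \<times> 'u => 'u" where "bij_betw f (UNIV \<times> UNIV) UNIV"
  using card_of_Times_same_infinite[OF infinite_UNIV] card_of_ordIso by blast
 then show ?thesis by (auto simp: bij_betw_def)
qed

text \<open>A relation is determined by any one of the spans representing it, so in an infinite universe
 the objects and arrows of the exact completion can be encoded injectively.\<close>

lemma (in regular) rel_eq_some:
 assumes "R : Rel X Y" "S : Rel X' Y'" "(SOME r. r : R) = (SOME r. r : S)"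
 shows "R = S"
proof -
 have *: "R = span_class C (fst (SOME r. r : R)) (snd (SOME r. r : R))" if R: "R : Rel X Y" for R X Y
 proof -
  obtain r0 r1 where "(r0, r1) : R" by (rule rel.relsE[OF R])
  then have "(SOME r. r : R) : R" by (rule someI)
  then have m: "(fst (SOME r. r : R), snd (SOME r. r : R)) : R" by simp
  show ?thesis by (rule rel.rels_span[OF R m])
 qed
 show ?thesis using *[OF assms(1)] *[OF assms(2)] assms(3) by simp
qed

lemma excat_ex:
 fixes C :: "('u, 'u) cat" and pr :: "'u \<times> 'u => 'u"
 assumes C: "regular C" and inj: "inj pr"
 defines "oc == %(X, R). pr (X, pr (SOME r. r : R))"
 shows "excat C oc (%(p, q, \<Phi>). pr (oc p, pr (oc q, pr (SOME r. r : \<Phi>))))"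
proof -
 interpret regular C by (rule C)
 have pr: "pr x = pr y \<longleftrightarrow> x = y" for x y using inj by (auto dest: injD)
 have o: "inj_on oc {p. eqv p}"
 proof (rule inj_onI)
  fix p q assume pq: "p : {p. eqv p}" "q : {p. eqv p}" "oc p = oc q"
  then have e: "fst p = fst q" "(SOME r. r : snd p) = (SOME r. r : snd q)" by (auto simp: oc_def pr split: prod.splits)
  have "snd p = snd q" using rel_eq_some[OF _ _ e(2)] eqvD(2) pq(1,2) by blast
  then show "p = q" using e by (simp add: prod_eq_iff)
 qed
 have a: "inj_on (%(p, q, \<Phi>). pr (oc p, pr (oc q, pr (SOME r. r : \<Phi>)))) {(p, q, \<Phi>). fn p q \<Phi>}"
 proof (rule inj_onI)
  fix f g assume fg: "f : {(p, q, \<Phi>). fn p q \<Phi>}" "g : {(p, q, \<Phi>). fn p q \<Phi>}"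
   "(%(p, q, \<Phi>). pr (oc p, pr (oc q, pr (SOME r. r : \<Phi>)))) f = (%(p, q, \<Phi>). pr (oc p, pr (oc q, pr (SOME r. r : \<Phi>)))) g"
  obtain p q \<Phi> p' q' \<Psi> where f: "f = (p, q, \<Phi>)" "fn p q \<Phi>" "g = (p', q', \<Psi>)" "fn p' q' \<Psi>" using fg(1,2) by auto
  have e: "oc p = oc p'" "oc q = oc q'" "(SOME r. r : \<Phi>) = (SOME r. r : \<Psi>)" using fg(3) unfolding f(1,3) by (simp_all add: pr)
  have "p = p'" "q = q'" using inj_onD[OF o] e(1,2) fnD(1,2)[OF f(2)] fnD(1,2)[OF f(4)] by blast+
  moreover have "\<Phi> = \<Psi>" by (rule rel_eq_some[OF fnD(4)[OF f(2)] fnD(4)[OF f(4)] e(3)])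
  ultimately show "f = g" unfolding f by simp
 qed
 show ?thesis by unfold_locales (rule o a)+
qed

text \<open>The interface through which the universal property enters: what the comparison of
  internal posets in \<open>D\<close> with congruences in \<open>C\<close> has to know about the
  completion.\<close>

locale covering = regular_fun C D I
 for C :: "('o, 'm) cat" and D :: "('a, 'b) cat" (structure) and I :: "('o, 'm, 'a, 'b) ftor" +
 assumes D_exact: "exact_category D"
  and full: "X : Ob C ==> Y : Ob C ==> u : hom D (IO X) (IO Y) ==> EX f:hom C X Y. IM f = u"
  and faithful: "f : hom C X Y ==> g : hom C X Y ==> IM f = IM g ==> f = g"
  and covers: "d : Ob D ==> EX X:Ob C. EX e:hom D (IO X) d. regular_epi D e"
  and reflects: "e : hom C X Y ==> regular_epi D (IM e) ==> regular_epi C e"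

text \<open>Surjectivity at the identity of \<open>Y\<close> gives a cover \<open>a\<close> that
  factors through \<open>e\<close>, and the last factor of a cover is a cover.\<close>

lemma (in excat) J_reflects:
 assumes e: "e : hom C X Y" and r: "regular_epi K (far J e)" shows "regular_epi C e"
proof -
 have Y: "Y : Ob C" using hom_Ob[OF e] by blast
 have s: "surj (jo Y) (pt (jo Y) e)" by (rule regular_epi_surj[OF r[unfolded far_J[OF e]] fn_J[OF e]])
 have F: "pt (jo Y) e : Rel X (fst (jo Y))" using fnD(4)[OF fn_J[OF e]] by simp
 have i: "idt C Y : hom C Y (fst (jo Y))" using idt_hom[OF Y] by simp
 obtain B a x where a: "a : hom C B Y" "regular_epi C a" "x : hom C B X" "mem (pt (jo Y) e) x (idt C Y o a)"
  by (rule surjE[OF s F i])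
 have "e o x = a" using a mem_J[OF e] by (simp add: hom_iff)
 then show ?thesis using regular_epi_right[OF _ a(3) e] a(2) by simp
qed

text \<open>The universal property makes \<open>D\<close> a retract of the concrete completion \<open>K\<close>, compatibly with
 the functors from \<open>C\<close>; the properties of \<open>J\<close> are then inherited by \<open>I\<close>.\<close>

lemma exact_completion_covering:
 fixes C D :: "('u :: infinite, 'u) cat"
 assumes C: "regular_category C" and ec: "exact_completion C D I"
 shows "covering C D I"
proof -
 have Dx: "exact_category D" and rI: "regular_functor C D I"
  and up: "!!(E :: ('u, 'u) cat) F. exact_category E ==> regular_functor C E F ==>
    (EX G. regular_functor D E G & nat_iso C E (comp_ftor G I) F) &
    (ALL G G'. regular_functor D E G & nat_iso C E (comp_ftor G I) F &
      regular_functor D E G' & nat_iso C E (comp_ftor G' I) F --> nat_iso D E G G')"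
  using ec unfolding exact_completion_def by blast+
 have rD: "regular_category D" using Dx by (simp add: exact_category_def)
 interpret c: regular C by (rule regular.intro[OF C])
 interpret d: regular D by (rule regular.intro[OF rD])
 \<comment> \<open>The completion is tested only against categories in the universe
   \<open>'u\<close>; the codes place \<open>K\<close> there.\<close>
 obtain pr :: "'u \<times> 'u => 'u" where pr: "inj pr" using pairing_ex by blast
 obtain oc :: "'u \<times> 'u rel => 'u" and ac :: "('u \<times> 'u rel) \<times> ('u \<times> 'u rel) \<times> 'u rel => 'u" where k: "excat C oc ac"
  using excat_ex[OF c.regular_axioms pr] by blast
 interpret k: excat_extension C D I oc ac
  by (intro excat_extension.intro k regular_fun.intro regular_fun_axioms.intro excat_extension_axioms.intro
   regular.intro C rD rI Dx)
 interpret K: regular k.K by (rule k.regular_K)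
 note fI = rI[unfolded regular_functor_def, THEN conjunct1]
 note fJ = k.regular_functor_J[unfolded regular_functor_def, THEN conjunct1]
 note fH = k.regular_functor_H[unfolded regular_functor_def, THEN conjunct1]
 obtain G where G: "regular_functor D k.K G" and n: "nat_iso C k.K (comp_ftor G I) k.J"
  using up[OF k.exact_K k.regular_functor_J] by blast
 note fG = G[unfolded regular_functor_def, THEN conjunct1]
 have rHG: "regular_functor D D (comp_ftor k.H G)" by (rule regular_functor_comp[OF G k.regular_functor_H])
 have rid: "regular_functor D D id_ftor" by (rule regular_functor_id[OF d.category_axioms])
 have "nat_iso C D (comp_ftor k.H (comp_ftor G I)) (comp_ftor k.H k.J)"
  by (rule nat_iso_post[OF is_functor_comp[OF fI fG] n fH fJ])
 then have "nat_iso C D (comp_ftor k.H (comp_ftor G I)) I"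
  by (rule nat_iso_trans[OF is_functor_comp[OF is_functor_comp[OF fI fG] fH] is_functor_comp[OF fJ fH] fI _
    nat_iso_sym[OF fI is_functor_comp[OF fJ fH] k.H_J]])
 then have 1: "nat_iso C D (comp_ftor (comp_ftor k.H G) I) I" by (simp add: comp_ftor_assoc)
 have 2: "nat_iso C D (comp_ftor id_ftor I) I" unfolding comp_ftor_id by (rule nat_iso_refl[OF fI])
 \<comment> \<open>\<open>H G\<close> and the identity both extend \<open>I\<close> along
   \<open>I\<close> itself, so the uniqueness half of the universal property identifies
   them.\<close>
 have HG: "nat_iso D D (comp_ftor k.H G) id_ftor" using up[OF Dx rI] rHG rid 1 2 by blast
 obtain t where t: "ALL X:Ob C. t X : hom k.K (fob G (fob I X)) (fob k.J X) & iso k.K (t X)"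
  "ALL X Y. ALL f:hom C X Y. far k.J f o\<^bsub>k.K\<^esub> t X = t Y o\<^bsub>k.K\<^esub> far G (far I f)"
  by (rule nat_isoE[OF n]) (unfold ftor_simps, blast)
 obtain s where s: "ALL X:Ob D. s X : hom D (fob k.H (fob G X)) X & iso D (s X)"
  "ALL X Y. ALL f:hom D X Y. f o\<^bsub>D\<^esub> s X = s Y o\<^bsub>D\<^esub> far k.H (far G f)"
  by (rule nat_isoE[OF HG]) (unfold ftor_simps, blast)
 \<comment> \<open>\<open>G\<close> is faithful, since \<open>H G\<close> is isomorphic to the
   identity.\<close>
 have Gf: "f = g" if f: "f : hom D X Y" "g : hom D X Y" and eq: "far G f = far G g" for X Y f g
 proof -
  have X: "X : Ob D" using d.hom_Ob[OF f(1)] by blast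
  have "f o\<^bsub>D\<^esub> s X = g o\<^bsub>D\<^esub> s X" using s(2) f eq by simp
  then show ?thesis using d.regular_epi_cancel[OF d.regular_epi_iso _ f] s(1) X by blast
 qed
 \<comment> \<open>The isomorphism \<open>t\<close> conjugates the image of \<open>f\<close> under
   \<open>G I\<close> to its image under \<open>J\<close>.\<close>
 have Jc: "far k.J f = (t Y o\<^bsub>k.K\<^esub> far G (far I f)) o\<^bsub>k.K\<^esub> j" "far G (far I f) o\<^bsub>k.K\<^esub> j = r o\<^bsub>k.K\<^esub> far k.J f"
  if f: "f : hom C X Y" and j: "j : hom k.K (fob k.J X) (fob G (fob I X))" "t X o\<^bsub>k.K\<^esub> j = idt k.K (fob k.J X)"
   and r: "r : hom k.K (fob k.J Y) (fob G (fob I Y))" "r o\<^bsub>k.K\<^esub> t Y = idt k.K (fob G (fob I Y))" for X Y f j r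
 proof -
  have O: "X : Ob C" "Y : Ob C" using c.hom_Ob[OF f] by auto
  note tX = bspec[OF t(1) O(1)] and tY = bspec[OF t(1) O(2)]
  have Jh: "far k.J f : hom k.K (fob k.J X) (fob k.J Y)" by (rule is_functorD(4)[OF fJ f])
  have Gh: "far G (far I f) : hom k.K (fob G (fob I X)) (fob G (fob I Y))" by (rule is_functorD(4)[OF fG is_functorD(4)[OF fI f]])
  have "far k.J f o\<^bsub>k.K\<^esub> t X o\<^bsub>k.K\<^esub> j = far k.J f" unfolding j(2) using Jh by (simp add: hom_iff del: k.fob_J)
  then show 1: "far k.J f = (t Y o\<^bsub>k.K\<^esub> far G (far I f)) o\<^bsub>k.K\<^esub> j"
   using t(2) f K.assoc[OF j(1) conjunct1[OF tX] Jh] by metis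
  have "r o\<^bsub>k.K\<^esub> t Y o\<^bsub>k.K\<^esub> far G (far I f) o\<^bsub>k.K\<^esub> j = far G (far I f) o\<^bsub>k.K\<^esub> j"
   by (rule K.retract_cmp[OF r(2) conjunct1[OF tY] r(1) K.cmp_hom[OF j(1) Gh]])
  then show "far G (far I f) o\<^bsub>k.K\<^esub> j = r o\<^bsub>k.K\<^esub> far k.J f" unfolding 1 using K.assoc[OF j(1) Gh conjunct1[OF tY]] by simp
 qed
 have inv: "EX j. j : hom k.K (fob k.J X) (fob G (fob I X)) & iso k.K j & t X o\<^bsub>k.K\<^esub> j = idt k.K (fob k.J X) &
   j o\<^bsub>k.K\<^esub> t X = idt k.K (fob G (fob I X))" if "X : Ob C" for X
  using bspec[OF t(1) that] K.isoE by metis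
 show ?thesis
 proof (intro covering.intro regular_fun.intro regular_fun_axioms.intro covering_axioms.intro regular.intro C rD rI Dx)
  show "f = g" if f: "f : hom C X Y" "g : hom C X Y" and eq: "far I f = far I g" for X Y f g
  proof -
   have O: "X : Ob C" "Y : Ob C" using c.hom_Ob[OF f(1)] by auto
   obtain j r where "j : hom k.K (fob k.J X) (fob G (fob I X))" "t X o\<^bsub>k.K\<^esub> j = idt k.K (fob k.J X)"
     "r : hom k.K (fob k.J Y) (fob G (fob I Y))" "r o\<^bsub>k.K\<^esub> t Y = idt k.K (fob G (fob I Y))" using inv O by blast
   then have "far k.J f = far k.J g" using Jc(1) f eq by simp
   then show ?thesis by (rule k.J_faithful[OF f])
  qed
  show "EX f:hom C X Y. far I f = u" if X: "X : Ob C" and Y: "Y : Ob C" and u: "u : hom D (fob I X) (fob I Y)" for X Y u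
  proof -
   obtain j where j: "j : hom k.K (fob k.J X) (fob G (fob I X))" "t X o\<^bsub>k.K\<^esub> j = idt k.K (fob k.J X)" "j o\<^bsub>k.K\<^esub> t X = idt k.K (fob G (fob I X))" "iso k.K j"
    using inv X by blast
   obtain r where r: "r : hom k.K (fob k.J Y) (fob G (fob I Y))" "r o\<^bsub>k.K\<^esub> t Y = idt k.K (fob G (fob I Y))" using inv Y by blast
   note tY = bspec[OF t(1) Y]
   have Gu: "far G u : hom k.K (fob G (fob I X)) (fob G (fob I Y))" by (rule is_functorD(4)[OF fG u])
   note Guj = K.cmp_hom[OF j(1) Gu]
   \<comment> \<open>Fullness of \<open>J\<close> is applied to the conjugate of
     \<open>far G u\<close>; faithfulness of \<open>G\<close> then shows that the arrow found lies
     over \<open>u\<close>.\<close>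
   obtain f where f: "f : hom C X Y" "far k.J f = t Y o\<^bsub>k.K\<^esub> far G u o\<^bsub>k.K\<^esub> j"
    by (rule k.J_full[OF K.cmp_hom[OF Guj conjunct1[OF tY]] X Y])
   have Gh: "far G (far I f) : hom k.K (fob G (fob I X)) (fob G (fob I Y))" by (rule is_functorD(4)[OF fG is_functorD(4)[OF fI f(1)]])
   have "far G (far I f) o\<^bsub>k.K\<^esub> j = far G u o\<^bsub>k.K\<^esub> j"
    unfolding Jc(2)[OF f(1) j(1,2) r] f(2) by (rule K.retract_cmp[OF r(2) conjunct1[OF tY] r(1) Guj])
   then have "far G (far I f) = far G u" by (rule K.regular_epi_cancel[OF K.regular_epi_iso[OF j(4)] j(1) Gh Gu])
   then have "far I f = u" by (rule Gf[OF is_functorD(4)[OF fI f(1)] u])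
   then show ?thesis using f(1) by blast
  qed
  show "EX X:Ob C. EX e:hom D (fob I X) a. regular_epi D e" if a: "a : Ob D" for a
  proof -
   \<comment> \<open>The image of \<open>a\<close> in \<open>K\<close> is covered by an object of
     \<open>C\<close>; applying \<open>H\<close> and composing with the isomorphisms at both ends
     gives a cover of \<open>a\<close>.\<close>
   obtain X e where e: "X : Ob C" "e : hom k.K (fob k.J X) (fob G a)" "regular_epi k.K e"
    by (rule k.J_covers[OF is_functorD(3)[OF fG a]])
   have He: "far k.H e : hom D (fob k.H (fob k.J X)) (fob k.H (fob G a))" "regular_epi D (far k.H e)"
    using is_functorD(4)[OF fH e(2)] k.H_regular_epi[OF e(3)] by auto
   obtain i where i: "i : hom D (fob I X) (fob k.H (fob k.J X))" "iso D i"
    using k.H_J e(1) unfolding nat_iso_def ftor_simps by blast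
   note sa = bspec[OF s(1) a]
   note c1 = d.regular_epi_cmp[OF d.regular_epi_iso[OF i(2)] i(1) He(2,1)] and h1 = d.cmp_hom[OF i(1) He(1)]
   have "regular_epi D (s a o\<^bsub>D\<^esub> far k.H e o\<^bsub>D\<^esub> i)" "s a o\<^bsub>D\<^esub> far k.H e o\<^bsub>D\<^esub> i : hom D (fob I X) a"
    using d.regular_epi_cmp_iso[OF c1 h1] d.cmp_hom[OF h1] sa by blast+
   then show ?thesis using e(1) by blast
  qed
  show "regular_epi C e" if e: "e : hom C X Y" and re: "regular_epi D (far I e)" for e X Y
  proof -
   have O: "X : Ob C" "Y : Ob C" using c.hom_Ob[OF e] by auto
   obtain j where j: "j : hom k.K (fob k.J X) (fob G (fob I X))" "t X o\<^bsub>k.K\<^esub> j = idt k.K (fob k.J X)" "iso k.K j"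
    using inv O by blast
   obtain r where r: "r : hom k.K (fob k.J Y) (fob G (fob I Y))" "r o\<^bsub>k.K\<^esub> t Y = idt k.K (fob G (fob I Y))" using inv O by blast
   note tY = bspec[OF t(1) O(2)]
   have Gh: "far G (far I e) : hom k.K (fob G (fob I X)) (fob G (fob I Y))" by (rule is_functorD(4)[OF fG is_functorD(4)[OF fI e]])
   have Gr: "regular_epi k.K (far G (far I e))" using G re unfolding regular_functor_def by blast
   note p = K.regular_epi_cmp[OF Gr Gh K.regular_epi_iso[OF conjunct2[OF tY]] conjunct1[OF tY]] K.cmp_hom[OF Gh conjunct1[OF tY]]
   have "regular_epi k.K (far k.J e)" unfolding Jc(1)[OF e j(1,2) r]
    by (rule K.regular_epi_cmp[OF K.regular_epi_iso[OF j(3)] j(1) p])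
   then show ?thesis by (rule k.J_reflects[OF e])
  qed
 qed
qed

section \<open>Internal posets\<close>

context regular begin

lemma posetD:
 assumes "internal_poset C P"
 shows "fst P : Ob C" "snd P : Rel (fst P) (fst P)" "x : hom C A (fst P) ==> mem (snd P) x x"
  "mem (snd P) x y ==> mem (snd P) y z ==> mem (snd P) x z"
  "mem (snd P) x y ==> mem (snd P) y x ==> x = y"
proof -
 have "fst P : Ob C & snd P : Rel (fst P) (fst P) & rel_refl C (fst P) (snd P) & rel_trans C (snd P) & rel_antisym C (snd P)"
  using assms by (cases P) (simp add: internal_poset_def)
 then show "fst P : Ob C" "snd P : Rel (fst P) (fst P)" "x : hom C A (fst P) ==> mem (snd P) x x"
  "mem (snd P) x y ==> mem (snd P) y z ==> mem (snd P) x z"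
  "mem (snd P) x y ==> mem (snd P) y x ==> x = y"
  unfolding rel_refl_def rel_trans_def rel_antisym_def by blast+
qed

lemma posetI:
 assumes "X : Ob C" "R : Rel X X" "!!A x. x : hom C A X ==> mem R x x"
  "!!x y z. mem R x y ==> mem R y z ==> mem R x z" "!!x y. mem R x y ==> mem R y x ==> x = y"
 shows "internal_poset C (X, R)"
 unfolding internal_poset_def rel_refl_def rel_trans_def rel_antisym_def prod.case using assms by blast

definition monot :: "'o \<times> 'm rel => 'o \<times> 'm rel => 'm => bool" where
 "monot P Q f \<longleftrightarrow> internal_poset C P & internal_poset C Q & f : hom C (fst P) (fst Q) &
   (ALL x y. mem (snd P) x y --> mem (snd Q) (f o x) (f o y))"

lemma monotD:
 assumes "monot P Q f"
 shows "internal_poset C P" "internal_poset C Q" "f : hom C (fst P) (fst Q)" "mem (snd P) x y ==> mem (snd Q) (f o x) (f o y)"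
 using assms unfolding monot_def by blast+

lemma Ord_arrows_iff: "(P, Q, f) : Ord_arrows C \<longleftrightarrow> monot P Q f"
proof -
 have "(ALL (r0, r1):snd P. mem (snd Q) (f o r0) (f o r1)) \<longleftrightarrow> (ALL x y. mem (snd P) x y --> mem (snd Q) (f o x) (f o y))"
  if P: "internal_poset C P" and Q: "internal_poset C Q" and f: "f : hom C (fst P) (fst Q)"
 proof (intro iffI allI impI)
  fix x y assume m: "ALL (r0, r1):snd P. mem (snd Q) (f o r0) (f o r1)" and xy: "mem (snd P) x y"
  obtain r0 r1 h where r: "(r0, r1) : snd P" "h : Ar C" "tgt C h = src C r0" "x = r0 o h" "y = r1 o h"
   using xy unfolding rel_mem_def by blast
  obtain T where T: "r0 : hom C T (fst P)" "r1 : hom C T (fst P)" by (rule rel.rels_span[OF posetD(2)[OF P] r(1)])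
  have h: "h : hom C (src C h) T" "f o r0 : hom C T (fst Q)" using r T f by (auto simp: hom_iff)
  have "mem (snd Q) ((f o r0) o h) ((f o r1) o h)" using rel.mem_stable[OF posetD(2)[OF Q] _ h] m r(1) by blast
  then show "mem (snd Q) (f o x) (f o y)" using r T f by (simp add: hom_iff)
 next
  assume m: "ALL x y. mem (snd P) x y --> mem (snd Q) (f o x) (f o y)"
  have "mem (snd P) r0 r1" if r: "(r0, r1) : snd P" for r0 r1
  proof -
   obtain T where T: "r0 : hom C T (fst P)" "r1 : hom C T (fst P)" "snd P = span_class C r0 r1" by (rule rel.rels_span[OF posetD(2)[OF P] r])
   have "idt C T : hom C T T" "r0 = r0 o idt C T" "r1 = r1 o idt C T" using T hom_Ob[OF T(1)] idt_hom by (auto simp: hom_iff)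
   then show ?thesis unfolding T(3) rel_mem_span_class[OF T(1,2)] by blast
  qed
  then show "ALL (r0, r1):snd P. mem (snd Q) (f o r0) (f o r1)" using m by blast
 qed
 then show ?thesis unfolding Ord_arrows_def monot_def by (cases P; cases Q) auto
qed

lemma Ord_simps: "Ob (Ord C) = Collect (internal_poset C)" "(P, Q, f) : Ar (Ord C) \<longleftrightarrow> monot P Q f"
 "src (Ord C) (P, Q, f) = P" "tgt (Ord C) (P, Q, f) = Q" "idt (Ord C) P = (P, P, idt C (fst P))"
 "cmp (Ord C) (Q', T, g) (P, Q, f) = (P, T, g o f)"
 by (simp_all add: Ord_def Ord_arrows_iff)

lemma Ord_leq: "(P, Q, f) \<preceq>\<^bsub>Ord C\<^esub> (P', Q', f') \<longleftrightarrow> monot P Q f & monot P' Q' f' & P = P' & Q = Q' & mem (snd Q) f f'"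
 by (simp add: Ord_def Ord_arrows_iff)

lemma hom_Ord: "f : hom (Ord C) P Q \<longleftrightarrow> (EX m. f = (P, Q, m) & monot P Q m)"
 by (cases f) (auto simp: hom_iff Ord_simps)

lemma monot_id: "internal_poset C P ==> monot P P (idt C (fst P))"
proof -
 assume P: "internal_poset C P"
 have "idt C (fst P) o x = x & idt C (fst P) o y = y" if m: "mem (snd P) x y" for x y
  using rel.mem_hom[OF posetD(2)[OF P] m] idt_left by blast
 then show ?thesis unfolding monot_def using P idt_hom[OF posetD(1)[OF P]] by auto
qed

lemma monot_comp:
 assumes f: "monot P Q f" and g: "monot Q T g" shows "monot P T (g o f)"
proof -
 note F = monotD[OF f] and G = monotD[OF g]
 have "mem (snd T) ((g o f) o x) ((g o f) o y)" if m: "mem (snd P) x y" for x y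
 proof -
  obtain A where A: "x : hom C A (fst P)" "y : hom C A (fst P)" using rel.mem_hom[OF posetD(2)[OF F(1)] m] by blast
  have "mem (snd T) (g o (f o x)) (g o (f o y))" by (rule G(4)[OF F(4)[OF m]])
  then show ?thesis using assoc[OF A(1) F(3) G(3)] assoc[OF A(2) F(3) G(3)] by simp
 qed
 then show ?thesis unfolding monot_def using F(1) G(2) cmp_hom[OF F(3) G(3)] by blast
qed

lemma pos_category_Ord: "pos_category (Ord C)"
proof (unfold_locales, goal_cases)
 case (1 f) then show ?case by (cases f) (auto simp: Ord_simps dest: monotD(1))
next
 case (2 f) then show ?case by (cases f) (auto simp: Ord_simps dest: monotD(2))
next
 case (3 P) then show ?case by (auto simp: Ord_simps hom_Ord intro: monot_id)
next
 case (4 f X Y g Z) then show ?case by (auto simp: Ord_simps hom_Ord intro: monot_comp)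
next
 case (5 f X Y) then show ?case by (auto simp: Ord_simps hom_Ord idt_left[OF monotD(3)])
next
 case (6 f X Y) then show ?case by (auto simp: Ord_simps hom_Ord idt_right[OF monotD(3)])
next
 case (7 f W X g Y h Z) then show ?case by (auto simp: Ord_simps hom_Ord assoc[OF monotD(3) monotD(3) monotD(3)])
next
 case (8 f g) then show ?case by (cases f; cases g) (auto simp: Ord_leq hom_Ord)
next
 case (9 f) then show ?case by (cases f) (auto simp: Ord_leq Ord_simps intro: posetD(3)[OF monotD(2,3)])
next
 case (10 f g h) then show ?case by (cases f; cases g; cases h) (auto simp: Ord_leq intro: posetD(4)[OF monotD(2)])
next
 case (11 f g) then show ?case by (cases f; cases g) (auto simp: Ord_leq intro: posetD(5)[OF monotD(2)])
next
 case (12 f X Y g Z f' g')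
 obtain m n where e: "f = (X, Y, m)" "g = (Y, Z, n)" and mn: "monot X Y m" "monot Y Z n" using 12(1,2) unfolding hom_Ord by blast
 obtain p q m' p' q' n' where e': "f' = (p, q, m')" "g' = (p', q', n')" by (cases f'; cases g')
 have le: "monot p q m'" "p = X" "q = Y" "mem (snd Y) m m'" "monot p' q' n'" "p' = Y" "q' = Z" "mem (snd Z) n n'"
  using 12(3,4) unfolding e e' Ord_leq by blast+
 note e' = e'[unfolded le(2,3,6,7)] and mn' = le(1)[unfolded le(2,3)] le(5)[unfolded le(6,7)] le(4,8)
 have "mem (snd Z) (n o m) (n o m')" by (rule monotD(4)[OF mn(2) mn'(3)])
 moreover have "mem (snd Z) (n o m') (n' o m')"
  by (rule rel.mem_stable[OF posetD(2)[OF monotD(2)[OF mn(2)]] mn'(4) monotD(3)[OF mn'(1)] monotD(3)[OF mn(2)]])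
 ultimately have "mem (snd Z) (n o m) (n' o m')" using posetD(4)[OF monotD(2)[OF mn(2)]] by blast
 then show ?case unfolding e e' Ord_simps Ord_leq using monot_comp mn mn' by blast
qed

end

section \<open>Posets in the exact completion\<close>

context covering begin

lemma coverE:
 assumes "A : Ob D"
 obtains B c where "c : hom D (IO B) A" "regular_epi D c" "B : Ob C"
 using covers[OF assms] that by blast

text \<open>After lifting along \<open>e\<close> the stage is covered by an object of
  \<open>C\<close>; fullness then turns the lifted element into an arrow of
  \<open>C\<close>.\<close>

lemma lift_pt:
 assumes e: "e : hom D (IO X) d" "regular_epi D e" and X: "X : Ob C" and u: "u : hom D A d"
 obtains B c x where "c : hom D (IO B) A" "regular_epi D c" "B : Ob C" "x : hom C B X" "e o IM x = u o c"
proof -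
 obtain A' a y where a: "a : hom D A' A" "regular_epi D a" "y : hom D A' (IO X)" "e o y = u o a"
  by (rule D.cover_lift[OF e(2,1) u])
 obtain B b where b: "b : hom D (IO B) A'" "regular_epi D b" "B : Ob C" by (rule coverE) (use D.hom_Ob[OF a(1)] in blast)
 have "y o b : hom D (IO B) (IO X)" using a b by (simp add: hom_iff)
 then obtain x where x: "x : hom C B X" "IM x = y o b" using full[OF b(3) X] by blast
 have "e o IM x = u o (a o b)" unfolding x(2) using D.assoc[OF b(1) a(3) e(1)] D.assoc[OF b(1) a(1) u] a(4) by simp
 then show thesis using that[OF D.cmp_hom[OF b(1) a(1)] D.regular_epi_cmp[OF b(2,1) a(2,1)] b(3) x(1)] by blast
qed

text \<open>If the stage comes from \<open>C\<close>, fullness brings the cover into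
  \<open>C\<close> as well, and there it is still a cover because \<open>I\<close> reflects regular
  epimorphisms.\<close>

lemma lift_pt_C:
 assumes e: "e : hom D (IO X) d" "regular_epi D e" and X: "X : Ob C" and A: "A : Ob C" and u: "u : hom D (IO A) d"
 obtains B a x where "a : hom C B A" "regular_epi C a" "x : hom C B X" "e o IM x = u o IM a"
proof -
 obtain B c x where b: "c : hom D (IO B) (IO A)" "regular_epi D c" "B : Ob C" "x : hom C B X" "e o IM x = u o c"
  by (rule lift_pt[OF e X u])
 obtain a where a: "a : hom C B A" "IM a = c" using full[OF b(3) A b(1)] by blast
 show thesis by (rule that[OF a(1) reflects[OF a(1)] b(4)]) (use a b in auto)
qed

text \<open>The apex of the inverse image of \<open>L\<close> need not come from \<open>C\<close>.
  It is covered by some \<open>IO Z\<close>, whose legs come from \<open>C\<close> by fullness, and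
  \<open>R\<close> is the image of this span in \<open>C\<close>.\<close>

lemma restrict_rel:
 assumes L: "L : D.Rel d d'" and e: "e : hom D (IO X) d" and e': "e' : hom D (IO Y) d'" and X: "X : Ob C" and Y: "Y : Ob C"
 obtains R where "R : C.Rel X Y" "ALL x y. C.mem R x y \<longleftrightarrow>
   (EX A. x : hom C A X & y : hom C A Y) & D.mem L (e o IM x) (e' o IM y)"
proof -
 obtain S where S: "S : D.Rel (IO X) (IO Y)"
  "ALL x y. D.mem S x y \<longleftrightarrow> (EX A. x : hom D A (IO X) & y : hom D A (IO Y)) & D.mem L (e o x) (e' o y)"
  by (rule D.rel_inv_image[OF L e e'])
 obtain T t0 t1 where t: "t0 : hom D T (IO X)" "t1 : hom D T (IO Y)" "S = span_class D t0 t1" by (rule D.rel.relsE[OF S(1)])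
 note Sm = D.rel_mem_span_class[OF t(1,2), folded t(3)]
 obtain Z c where c: "c : hom D (IO Z) T" "regular_epi D c" "Z : Ob C" by (rule coverE) (use D.hom_Ob[OF t(1)] in blast)
 obtain z0 z1 where z: "z0 : hom C Z X" "IM z0 = t0 o c" "z1 : hom C Z Y" "IM z1 = t1 o c"
  using full[OF c(3) X D.cmp_hom[OF c(1) t(1)]] full[OF c(3) Y D.cmp_hom[OF c(1) t(2)]] by blast
 obtain R where R: "R : C.Rel X Y" "ALL x y. C.mem R x y \<longleftrightarrow> (EX A B a h. x : hom C A X & y : hom C A Y & a : hom C B A & regular_epi C a &
    h : hom C B Z & x \<star> a = z0 \<star> h & y \<star> a = z1 \<star> h)"
  by (rule C.span_relation[OF z(1,3)])
 have "C.mem R x y \<longleftrightarrow> D.mem S (IM x) (IM y)" if x: "x : hom C A X" and y: "y : hom C A Y" for A x y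
 proof
  assume "C.mem R x y"
  then obtain A' B a h where h: "x : hom C A' X" "a : hom C B A'" "regular_epi C a" "h : hom C B Z" "x \<star> a = z0 \<star> h" "y \<star> a = z1 \<star> h"
   using R(2) by blast
  have "A' = A" using h(1) x by (simp add: hom_iff)
  note a = h(2)[unfolded this]
  have "IM x o IM a = t0 o (c o IM h)"
   using IM_cmp[OF a x] IM_cmp[OF h(4) z(1)] h(5) z(2) D.assoc[OF IM_hom[OF h(4)] c(1) t(1)] by metis
  moreover have "IM y o IM a = t1 o (c o IM h)"
   using IM_cmp[OF a y] IM_cmp[OF h(4) z(3)] h(6) z(4) D.assoc[OF IM_hom[OF h(4)] c(1) t(2)] by metis
  ultimately have "D.mem S (IM x o IM a) (IM y o IM a)" unfolding Sm using D.cmp_hom[OF IM_hom[OF h(4)] c(1)] by blast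
  then show "D.mem S (IM x) (IM y)" by (rule D.rel.mem_local[OF S(1) IM_regular_epi[OF h(3)] IM_hom[OF a] IM_hom[OF x] IM_hom[OF y]])
 next
  assume "D.mem S (IM x) (IM y)"
  then obtain A' k where k: "k : hom D A' T" "IM x = t0 o k" "IM y = t1 o k" unfolding Sm by blast
  have "A' = IO A" using k IM_hom[OF x] t(1) by (auto simp: hom_iff)
  note k1 = k(1)[unfolded this]
  have A: "A : Ob C" using C.hom_Ob[OF x] by blast
  obtain B a h where h: "a : hom C B A" "regular_epi C a" "h : hom C B Z" "c o IM h = k o IM a"
   by (rule lift_pt_C[OF c A k1])
  have "x \<star> a = z0 \<star> h"
  proof (rule faithful[OF C.cmp_hom[OF h(1) x] C.cmp_hom[OF h(3) z(1)]])
   show "IM (x \<star> a) = IM (z0 \<star> h)" unfolding IM_cmp[OF h(1) x] IM_cmp[OF h(3) z(1)] z(2) k(2)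
    using D.assoc[OF IM_hom[OF h(3)] c(1) t(1)] D.assoc[OF IM_hom[OF h(1)] k1 t(1)] h(4) by simp
  qed
  moreover have "y \<star> a = z1 \<star> h"
  proof (rule faithful[OF C.cmp_hom[OF h(1) y] C.cmp_hom[OF h(3) z(3)]])
   show "IM (y \<star> a) = IM (z1 \<star> h)" unfolding IM_cmp[OF h(1) y] IM_cmp[OF h(3) z(3)] z(4) k(3)
    using D.assoc[OF IM_hom[OF h(3)] c(1) t(2)] D.assoc[OF IM_hom[OF h(1)] k1 t(2)] h(4) by simp
  qed
  ultimately show "C.mem R x y" using R(2) x y h by blast
 qed
 note RS = this
 have "C.mem R x y \<longleftrightarrow> (EX A. x : hom C A X & y : hom C A Y) & D.mem L (e o IM x) (e' o IM y)" for x y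
 proof
  assume m: "C.mem R x y"
  obtain A where A: "x : hom C A X" "y : hom C A Y" using C.rel.mem_hom[OF R(1) m] by blast
  show "(EX A. x : hom C A X & y : hom C A Y) & D.mem L (e o IM x) (e' o IM y)" using RS[OF A] m S(2) A by blast
 next
  assume m: "(EX A. x : hom C A X & y : hom C A Y) & D.mem L (e o IM x) (e' o IM y)"
  then obtain A where A: "x : hom C A X" "y : hom C A Y" by blast
  show "C.mem R x y" using RS[OF A] m S(2) IM_hom[OF A(1)] IM_hom[OF A(2)] by blast
 qed
 then show thesis using that[OF R(1)] by blast
qed

end

section \<open>Monotone maps as left adjoints\<close>

context covering begin

text \<open>A cover of an internal poset of \<open>D\<close> by an object of \<open>C\<close>; the order pulled back along the
 cover is a congruence in \<open>C\<close>.\<close>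

definition pres :: "'a \<times> 'b rel => 'o => 'b => bool" where
 "pres P X e \<longleftrightarrow> internal_poset D P & X : Ob C & e : hom D (IO X) (fst P) & regular_epi D e"

text \<open>The relation \<open>e x \<le> e' y\<close> of \<open>D\<close>, restricted to elements \<open>x\<close>, \<open>y\<close> coming from \<open>C\<close>.\<close>

definition rl :: "'a \<times> 'b rel => 'o => 'b => 'o => 'b => 'm rel" where
 "rl P X e Y e' = (SOME R. R : C.Rel X Y & (ALL x y. C.mem R x y \<longleftrightarrow>
   (EX A. x : hom C A X & y : hom C A Y) & D.mem (snd P) (e o IM x) (e' o IM y)))"

lemma presD:
 assumes "pres P X e"
 shows "internal_poset D P" "X : Ob C" "e : hom D (IO X) (fst P)" "regular_epi D e"
 using assms unfolding pres_def by blast+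

lemma rl:
 assumes P: "internal_poset D P" and e: "X : Ob C" "e : hom D (IO X) (fst P)" "Y : Ob C" "e' : hom D (IO Y) (fst P)"
 shows "rl P X e Y e' : C.Rel X Y"
  "C.mem (rl P X e Y e') x y \<longleftrightarrow> (EX A. x : hom C A X & y : hom C A Y) & D.mem (snd P) (e o IM x) (e' o IM y)"
proof -
 obtain R where R: "R : C.Rel X Y" "ALL x y. C.mem R x y \<longleftrightarrow>
   (EX A. x : hom C A X & y : hom C A Y) & D.mem (snd P) (e o IM x) (e' o IM y)"
  by (rule restrict_rel[OF D.posetD(2)[OF P] e(2,4,1,3)])
 then have "EX R. R : C.Rel X Y & (ALL x y. C.mem R x y \<longleftrightarrow>
   (EX A. x : hom C A X & y : hom C A Y) & D.mem (snd P) (e o IM x) (e' o IM y))" by blast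
 from someI_ex[OF this, folded rl_def]
 show "rl P X e Y e' : C.Rel X Y"
  "C.mem (rl P X e Y e') x y \<longleftrightarrow> (EX A. x : hom C A X & y : hom C A Y) & D.mem (snd P) (e o IM x) (e' o IM y)"
  by blast+
qed

lemma rl_eqI:
 assumes P: "internal_poset D P" and e: "X : Ob C" "e : hom D (IO X) (fst P)" "Y : Ob C" "e' : hom D (IO Y) (fst P)"
  and R: "R : C.Rel X Y"
  and eq: "!!A x y. x : hom C A X ==> y : hom C A Y ==> C.mem R x y \<longleftrightarrow> D.mem (snd P) (e o IM x) (e' o IM y)"
 shows "rl P X e Y e' = R"
proof (rule C.rel.rels_eqI[OF rl(1)[OF P e] R])
 show "C.mem R x y" if "C.mem (rl P X e Y e') x y" for x y using that eq unfolding rl(2)[OF P e] by blast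
 show "C.mem (rl P X e Y e') x y" if m: "C.mem R x y" for x y
  using C.rel.mem_hom[OF R m] m eq unfolding rl(2)[OF P e] by blast
qed

lemma IM_val: "e : hom D (IO X) d ==> x : hom C A X ==> e o IM x : hom D (IO A) d"
 and IM_val_cmp: "e : hom D (IO X) d ==> x : hom C A X ==> a : hom C B A ==> e o IM (x \<star> a) = (e o IM x) o IM a"
 using D.cmp_hom[OF IM_hom] D.assoc[OF IM_hom IM_hom] by (auto simp: IM_cmp)

text \<open>If \<open>k x \<le> e' y\<close> and \<open>g (e' y) \<le> l z\<close> then
  \<open>g (k x) \<le> l z\<close>, by monotonicity. Conversely, since \<open>e'\<close> is a cover,
  a \<open>y\<close> with \<open>e' y = k x\<close> exists after a cover and lies in
  between.\<close>

lemma rl_comp: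
 assumes e': "pres Q Y e'" and g: "D.monot Q T g" and X: "X : Ob C" and k: "k : hom D (IO X) (fst Q)"
  and Z: "Z : Ob C" and l: "l : hom D (IO Z) (fst T)"
 shows "C.rcomp (rl T Y (g o e') Z l) (rl Q X k Y e') = rl T X (g o k) Z l"
proof -
 note E = presD[OF e'] and G = D.monotD[OF g]
 note k' = D.cmp_hom[OF k G(3)] and ge = D.cmp_hom[OF E(3) G(3)]
 note R = rl[OF E(1) X k E(2,3)] and S = rl[OF G(2) E(2) ge Z l] and RS = rl[OF G(2) X k' Z l]
 show ?thesis
 proof (rule C.rel.rels_eqI[OF C.rel.rel_comp_rels[OF R(1) S(1)] RS(1)])
  fix x z assume m: "C.mem (C.rcomp (rl T Y (g o e') Z l) (rl Q X k Y e')) x z"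
  show "C.mem (rl T X (g o k) Z l) x z"
  proof (rule C.rel.rel_comp_leI[OF R(1) S(1) RS(1) _ m])
   fix x y z assume m: "C.mem (rl Q X k Y e') x y" "C.mem (rl T Y (g o e') Z l) y z"
   then obtain A where A: "x : hom C A X" "y : hom C A Y" "z : hom C A Z" using C.mem_hom2(1)[OF S(1) m(2)] R(2) by blast
   have "D.mem (snd T) (g o (k o IM x)) (g o (e' o IM y))" by (rule G(4)) (use m(1) R(2) in blast)
   then have "D.mem (snd T) ((g o k) o IM x) ((g o e') o IM y)"
    using D.assoc[OF IM_hom[OF A(1)] k G(3)] D.assoc[OF IM_hom[OF A(2)] E(3) G(3)] by simp
   moreover have "D.mem (snd T) ((g o e') o IM y) (l o IM z)" using m(2) S(2) by blast
   ultimately have "D.mem (snd T) ((g o k) o IM x) (l o IM z)" by (rule D.posetD(4)[OF G(2)])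
   then show "C.mem (rl T X (g o k) Z l) x z" using RS(2) A by blast
  qed
 next
  fix x z assume m: "C.mem (rl T X (g o k) Z l) x z"
  then obtain A where A: "x : hom C A X" "z : hom C A Z" using RS(2) by blast
  obtain B a y where a: "a : hom C B A" "regular_epi C a" "y : hom C B Y" "e' o IM y = (k o IM x) o IM a"
   by (rule lift_pt_C[OF E(3,4,2) _ IM_val[OF k A(1)]]) (use C.hom_Ob[OF A(1)] in blast)
  have xa: "x \<star> a : hom C B X" "z \<star> a : hom C B Z" using A a(1) C.cmp_hom by blast+
  have eq: "e' o IM y = k o IM (x \<star> a)" using a(4) IM_val_cmp[OF k A(1) a(1)] by simp
  have "D.mem (snd Q) (k o IM (x \<star> a)) (e' o IM y)" unfolding eq by (rule D.posetD(3)[OF E(1) IM_val[OF k xa(1)]])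
  then have 1: "C.mem (rl Q X k Y e') (x \<star> a) y" using R(2) xa(1) a(3) by blast
  have "C.mem (rl T X (g o k) Z l) (x \<star> a) (z \<star> a)" by (rule C.rel.mem_stable[OF RS(1) m a(1) A(1)])
  then have "D.mem (snd T) ((g o k) o IM (x \<star> a)) (l o IM (z \<star> a))" using RS(2) by blast
  then have "D.mem (snd T) ((g o e') o IM y) (l o IM (z \<star> a))"
   using D.assoc[OF IM_hom[OF xa(1)] k G(3)] D.assoc[OF IM_hom[OF a(3)] E(3) G(3)] eq by simp
  then have 2: "C.mem (rl T Y (g o e') Z l) y (z \<star> a)" using S(2) a(3) xa(2) by blast
  show "C.mem (C.rcomp (rl T Y (g o e') Z l) (rl Q X k Y e')) x z"
   by (rule C.rel.mem_local[OF C.rel.rel_comp_rels[OF R(1) S(1)] a(2,1) A C.rel.mem_compI[OF R(1) S(1) 1 2]])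
 qed
qed

lemma rl_comp_id:
 assumes e': "pres Q Y e'" and X: "X : Ob C" and k: "k : hom D (IO X) (fst Q)" and Z: "Z : Ob C" and l: "l : hom D (IO Z) (fst Q)"
 shows "C.rcomp (rl Q Y e' Z l) (rl Q X k Y e') = rl Q X k Z l"
 using rl_comp[OF e' D.monot_id[OF presD(1)[OF e']] X k Z l] D.idt_left[OF k] D.idt_left[OF presD(3)[OF e']] by simp

lemma congruence_pres:
 assumes "pres P X e" shows "congruence (disc C) (X, rl P X e X e)"
proof -
 note E = presD[OF assms]
 note R = rl[OF E(1,2,3,2,3)]
 have "C.mem (rl P X e X e) x x" if x: "x : hom C A X" for A x
  using R(2) x D.posetD(3)[OF E(1) IM_val[OF E(3) x]] by blast
 moreover have "C.mem (rl P X e X e) x z" if m: "C.mem (rl P X e X e) x y" "C.mem (rl P X e X e) y z" for x y z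
  using m C.mem_hom2(1)[OF R(1) m(2)] D.posetD(4)[OF E(1)] unfolding R(2) by blast
 ultimately show ?thesis unfolding C.congruence_disc_iff rel_refl_def rel_trans_def fst_conv snd_conv using E(2) R(1) by blast
qed

text \<open>The right adjoint is the opposite relation \<open>e' y \<le> f (e x)\<close>. For the
  unit, \<open>y\<close> is chosen over \<open>f (e x)\<close> after a cover; the counit is
  transitivity.\<close>

lemma left_adjoint_pres:
 assumes p: "pres P X e" and q: "pres Q Y e'" and f: "D.monot P Q f"
 shows "C.rel.left_adjoint (X, rl P X e X e) (Y, rl Q Y e' Y e') (rl Q X (f o e) Y e')"
proof -
 note E = presD[OF p] and E' = presD[OF q] and F = D.monotD[OF f]
 note fe = D.cmp_hom[OF E(3) F(3)] and cp = congruence_pres[OF p] and cq = congruence_pres[OF q]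
 note R = rl[OF E(1,2,3,2,3)] and S = rl[OF E'(1,2,3,2,3)]
 note G = rl[OF E'(1) E(2) fe E'(2,3)] and H = rl[OF E'(1,2,3) E(2) fe]
 have mono: "D.mem (snd Q) ((f o e) o IM x) ((f o e) o IM y)" if m: "C.mem (rl P X e X e) x y" for x y
 proof -
  obtain A where A: "x : hom C A X" "y : hom C A X" using m R(2) by blast
  have "D.mem (snd Q) (f o (e o IM x)) (f o (e o IM y))" by (rule F(4)) (use m R(2) in blast)
  then show ?thesis using D.assoc[OF IM_hom[OF A(1)] E(3) F(3)] D.assoc[OF IM_hom[OF A(2)] E(3) F(3)] by simp
 qed
 note tr = D.posetD(4)[OF E'(1)]
 have 1: "lax_module (disc C) (X, rl P X e X e) (Y, rl Q Y e' Y e') (rl Q X (f o e) Y e')"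
 proof (rule C.rel.lax_moduleI[OF cp cq], unfold fst_conv snd_conv)
  show "C.mem (rl Q X (f o e) Y e') x' y" if m: "C.mem (rl P X e X e) x' x" "C.mem (rl Q X (f o e) Y e') x y" for x' x y
   using tr[OF mono[OF m(1)]] m(2) C.mem_hom2(2)[OF R(1) m(1)] unfolding G(2) by blast
  show "C.mem (rl Q X (f o e) Y e') x y'" if m: "C.mem (rl Q X (f o e) Y e') x y" "C.mem (rl Q Y e' Y e') y y'" for x y y'
   using m tr C.mem_hom2(1)[OF S(1) m(2)] unfolding G(2) S(2) by blast
 qed (rule G(1))
 have 2: "lax_module (disc C) (Y, rl Q Y e' Y e') (X, rl P X e X e) (rl Q Y e' X (f o e))"
 proof (rule C.rel.lax_moduleI[OF cq cp], unfold fst_conv snd_conv)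
  show "C.mem (rl Q Y e' X (f o e)) y x'" if m: "C.mem (rl Q Y e' X (f o e)) y x" "C.mem (rl P X e X e) x x'" for x' x y
   using tr[OF _ mono[OF m(2)]] m(1) C.mem_hom2(1)[OF R(1) m(2)] unfolding H(2) by blast
  show "C.mem (rl Q Y e' X (f o e)) y' x" if m: "C.mem (rl Q Y e' Y e') y' y" "C.mem (rl Q Y e' X (f o e)) y x" for x y y'
   using m tr C.mem_hom2(2)[OF S(1) m(1)] unfolding H(2) S(2) by blast
 qed (rule H(1))
 have 3: "EX B. EX a:hom C B A. EX y. regular_epi C a & C.mem (rl Q X (f o e) Y e') (x \<star> a) y & C.mem (rl Q Y e' X (f o e)) y (x \<star> a)"
  if x: "x : hom C A X" for A x
 proof -
  obtain B a y where a: "a : hom C B A" "regular_epi C a" "y : hom C B Y" "e' o IM y = ((f o e) o IM x) o IM a"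
   by (rule lift_pt_C[OF E'(3,4,2) _ IM_val[OF fe x]]) (use C.hom_Ob[OF x] in blast)
  have xa: "x \<star> a : hom C B X" by (rule C.cmp_hom[OF a(1) x])
  have "e' o IM y = (f o e) o IM (x \<star> a)" using a(4) IM_val_cmp[OF fe x a(1)] by simp
  then have "D.mem (snd Q) ((f o e) o IM (x \<star> a)) (e' o IM y)" "D.mem (snd Q) (e' o IM y) ((f o e) o IM (x \<star> a))"
   using D.posetD(3)[OF E'(1) IM_val[OF E'(3) a(3)]] by simp_all
  then show ?thesis using a(1,2,3) xa G(2) H(2) by blast
 qed
 have 4: "C.mem (rl Q Y e' Y e') y y'" if m: "C.mem (rl Q Y e' X (f o e)) y x" "C.mem (rl Q X (f o e) Y e') x y'" for y x y'
  using m tr C.mem_hom2(1)[OF G(1) m(2)] unfolding S(2) G(2) H(2) by blast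
 show ?thesis unfolding C.rel.left_adjoint_def adjoint_modules_def disc_defs disc_simps fst_conv snd_conv using cp cq 1 2 3 4 by blast
qed

text \<open>An arrow \<open>f\<close> is coded by \<open>f (e x) \<le> e' y\<close>, so larger
  arrows give smaller relations; this explains the reversal in the order of \<open>ex_reg\<close>.
  The converse is tested at a \<open>y\<close> lying over \<open>g (e c)\<close>.\<close>

lemma rl_le_iff:
 assumes p: "pres P X e" and q: "pres Q Y e'" and f: "D.monot P Q f" and g: "D.monot P Q g"
 shows "D.mem (snd Q) f g \<longleftrightarrow> (ALL x y. C.mem (rl Q X (g o e) Y e') x y --> C.mem (rl Q X (f o e) Y e') x y)"
proof -
 note E = presD[OF p] and E' = presD[OF q] and F = D.monotD[OF f] and G = D.monotD[OF g]
 note fe = D.cmp_hom[OF E(3) F(3)] and ge = D.cmp_hom[OF E(3) G(3)]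
 note RF = rl[OF E'(1) E(2) fe E'(2,3)] and RG = rl[OF E'(1) E(2) ge E'(2,3)]
 note L = D.posetD(2)[OF E'(1)]
 show ?thesis
 proof (intro iffI allI impI)
  fix x y assume fg: "D.mem (snd Q) f g" and m: "C.mem (rl Q X (g o e) Y e') x y"
  obtain A where A: "x : hom C A X" using m RG(2) by blast
  have "D.mem (snd Q) ((f o e) o IM x) ((g o e) o IM x)"
   by (rule D.rel.mem_stable[OF L D.rel.mem_stable[OF L fg E(3) F(3)] IM_hom[OF A] fe])
  then show "C.mem (rl Q X (f o e) Y e') x y" using m D.posetD(4)[OF E'(1)] unfolding RF(2) RG(2) by blast
 next
  assume le: "ALL x y. C.mem (rl Q X (g o e) Y e') x y --> C.mem (rl Q X (f o e) Y e') x y"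
  obtain B c y where c: "c : hom C B X" "regular_epi C c" "y : hom C B Y" "e' o IM y = (g o e) o IM c"
   by (rule lift_pt_C[OF E'(3,4,2) E(2) ge])
  have "D.mem (snd Q) ((g o e) o IM c) (e' o IM y)" using D.posetD(3)[OF E'(1) IM_val[OF E'(3) c(3)]] c(4) by simp
  then have "C.mem (rl Q X (f o e) Y e') c y" using le RG(2) c(1,3) by blast
  then have "D.mem (snd Q) ((f o e) o IM c) ((g o e) o IM c)" unfolding RF(2) c(4) by blast
  then have "D.mem (snd Q) (f o e) (g o e)" by (rule D.rel.mem_local[OF L IM_regular_epi[OF c(2)] IM_hom[OF c(1)] fe ge])
  then show "D.mem (snd Q) f g" by (rule D.rel.mem_local[OF L E(4,3) F(3) G(3)])
 qed
qed

text \<open>With \<open>\<Psi>\<close> the right adjoint, the elements of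
  \<open>\<Phi> \<inter> \<Psi>\<inverse>\<close> are the pairs \<open>(x, y)\<close> at which
  \<open>e' y\<close> has to be the value of \<open>f\<close> at \<open>e x\<close>. The unit makes
  the first leg \<open>t0\<close> a cover, the counit makes the assignment monotone, and
  antisymmetry of \<open>Q\<close> makes it descend to \<open>fst P\<close>.\<close>

lemma left_adjoint_pres_full:
 assumes p: "pres P X e" and q: "pres Q Y e'" and m: "C.rel.left_adjoint (X, rl P X e X e) (Y, rl Q Y e' Y e') \<Phi>"
 obtains f where "D.monot P Q f" "rl Q X (f o e) Y e' = \<Phi>"
proof -
 note E = presD[OF p] and E' = presD[OF q]
 note R = rl[OF E(1,2,3,2,3)] and S = rl[OF E'(1,2,3,2,3)]
 note L = D.posetD(2)[OF E(1)] and L' = D.posetD(2)[OF E'(1)]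
 note cp = congruence_pres[OF p] and cq = congruence_pres[OF q]
 obtain \<Psi> where a: "adjoint_modules (disc C) (regular_epi C) (X, rl P X e X e) (Y, rl Q Y e' Y e') \<Phi> \<Psi>"
  using m unfolding C.rel.left_adjoint_def by blast
 have lF: "lax_module (disc C) (X, rl P X e X e) (Y, rl Q Y e' Y e') \<Phi>" and lP: "lax_module (disc C) (Y, rl Q Y e' Y e') (X, rl P X e X e) \<Psi>"
  and tot: "ALL A. ALL x:hom C A X. EX B. EX a:hom C B A. EX y. regular_epi C a & C.mem \<Phi> (x \<star> a) y & C.mem \<Psi> y (x \<star> a)"
  and sng: "ALL y x y'. C.mem \<Psi> y x --> C.mem \<Phi> x y' --> C.mem (rl Q Y e' Y e') y y'"
  using a unfolding adjoint_modules_def disc_defs disc_simps fst_conv snd_conv by blast+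
 note F = C.rel.lax_moduleD(1)[OF lF, unfolded fst_conv] and G = C.rel.lax_moduleD(1)[OF lP, unfolded fst_conv]
 have Fr: "C.mem \<Phi> x y'" if "C.mem \<Phi> x y" "C.mem (rl Q Y e' Y e') y y'" for y' x y
  using C.rel.lax_module_right[OF cp lF, unfolded snd_conv] that .
 have Gr: "C.mem \<Psi> y x'" if "C.mem \<Psi> y x" "C.mem (rl P X e X e) x x'" for y x x'
  using C.rel.lax_module_right[OF cq lP, unfolded snd_conv] that .
 obtain N where N: "N : C.Rel X Y" "ALL x y. C.mem N x y \<longleftrightarrow> C.mem \<Phi> x y & C.mem (\<Psi>\<inverse>) x y"
  by (rule C.rel_inter[OF F C.rel_converse(1)[OF G]])
 obtain T t0 t1 where t: "t0 : hom C T X" "t1 : hom C T Y" "N = span_class C t0 t1" by (rule C.rel.relsE[OF N(1)])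
 note Nm = C.rel_mem_span_class[OF t(1,2), folded t(3)]
 have FG: "C.mem \<Phi> (t0 \<star> w) (t1 \<star> w)" "C.mem \<Psi> (t1 \<star> w) (t0 \<star> w)" if "w : hom C B T" for B w
  using N(2) Nm that C.rel_converse(2)[OF G] by blast+
 \<comment> \<open>The right action moves the second argument of \<open>\<Psi>\<close> from
   \<open>t0 v\<close> to \<open>t0 w\<close>; the counit then compares \<open>t1 v\<close> with
   \<open>t1 w\<close>.\<close>
 have step: "C.mem (rl Q Y e' Y e') (t1 \<star> v) (t1 \<star> w)"
  if v: "v : hom C B T" and w: "w : hom C B T" and m: "C.mem (rl P X e X e) (t0 \<star> v) (t0 \<star> w)" for B v w
  using sng Gr[OF FG(2)[OF v] m] FG(1)[OF w] by blast
 have X: "X : Ob C" and T: "T : Ob C" using C.hom_Ob[OF t(1)] by auto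
 obtain B b y where b: "b : hom C B X" "regular_epi C b" "C.mem \<Phi> (idt C X \<star> b) y" "C.mem \<Psi> y (idt C X \<star> b)"
  using tot C.idt_hom[OF X] by blast
 have "C.mem N b y" using b N(2) C.rel_converse(2)[OF G] C.idt_left[OF b(1)] by simp
 then obtain B' k where k: "k : hom C B' T" "b = t0 \<star> k" unfolding Nm by blast
 have r0: "regular_epi C t0" by (rule C.regular_epi_right[OF b(2)[unfolded k(2)] k(1) t(1)])
 define c where "c = e o IM t0"
 have c: "c : hom D (IO T) (fst P)" "regular_epi D c" unfolding c_def
  using IM_val[OF E(3) t(1)] D.regular_epi_cmp[OF IM_regular_epi[OF r0] IM_hom[OF t(1)] E(4,3)] by auto
 define c' where "c' = e' o IM t1"
 have c': "c' : hom D (IO T) (fst Q)" unfolding c'_def by (rule IM_val[OF E'(3) t(2)])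
 have cw: "c o IM w = e o IM (t0 \<star> w)" "c' o IM w = e' o IM (t1 \<star> w)" if w: "w : hom C B T" for B w
  unfolding c_def c'_def using IM_val_cmp[OF E(3) t(1) w] IM_val_cmp[OF E'(3) t(2) w] by auto
 have mono: "D.mem (snd Q) (c' o IM v) (c' o IM w)"
  if v: "v : hom C B T" and w: "w : hom C B T" and m: "D.mem (snd P) (c o IM v) (c o IM w)" for B v w
 proof -
  have "C.mem (rl P X e X e) (t0 \<star> v) (t0 \<star> w)"
   using m C.cmp_hom[OF v t(1)] C.cmp_hom[OF w t(1)] unfolding R(2) cw[OF v] cw[OF w] by blast
  from step[OF v w this] show ?thesis unfolding S(2) cw[OF v] cw[OF w] by blast
 qed
 have desc: "c' o u = c' o v" if u: "u : hom D A (IO T)" and v: "v : hom D A (IO T)" and eq: "c o u = c o v" for A u v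
 proof -
  \<comment> \<open>The stage \<open>A\<close> is arbitrary in \<open>D\<close>. Covering it by an
    object of \<open>C\<close> turns \<open>u\<close> and \<open>v\<close> into arrows of
    \<open>C\<close>, to which the statements about \<open>\<Phi>\<close> and \<open>\<Psi>\<close>
    apply.\<close>
  obtain B b where b: "b : hom D (IO B) A" "regular_epi D b" "B : Ob C" by (rule coverE) (use D.hom_Ob[OF u] in blast)
  obtain u' v' where uv: "u' : hom C B T" "IM u' = u o b" "v' : hom C B T" "IM v' = v o b"
   using full[OF b(3) T D.cmp_hom[OF b(1) u]] full[OF b(3) T D.cmp_hom[OF b(1) v]] by blast
  have e: "c o IM u' = c o IM v'" unfolding uv using D.assoc[OF b(1) u c(1)] D.assoc[OF b(1) v c(1)] eq by simp
  have r: "D.mem (snd P) (c o IM v') (c o IM v')" by (rule D.posetD(3)[OF E(1) IM_val[OF c(1) uv(3)]])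
  have "c' o IM u' = c' o IM v'"
   by (rule D.posetD(5)[OF E'(1) mono[OF uv(1,3)] mono[OF uv(3,1)]]) (simp_all add: e r)
  then have "(c' o u) o b = (c' o v) o b" unfolding uv using D.assoc[OF b(1) u c'] D.assoc[OF b(1) v c'] by simp
  then show ?thesis by (rule D.regular_epi_cancel[OF b(2,1) D.cmp_hom[OF u c'] D.cmp_hom[OF v c']])
 qed
 obtain f where f: "f : hom D (fst P) (fst Q)" "f o c = c'" by (rule D.regular_epi_desc[OF c(2,1) c' desc])
 have fc: "f o (c o u) = c' o u" if "u : hom D A (IO T)" for A u
  using D.assoc[OF that c(1) f(1)] f(2) by simp
 have fm: "D.mem (snd Q) (f o z) (f o z')" if m: "D.mem (snd P) z z'" for z z'
 proof -
  obtain A where z: "z : hom D A (fst P)" "z' : hom D A (fst P)" using D.rel.mem_hom[OF L m] by blast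
  obtain B1 a v where a: "a : hom D (IO B1) A" "regular_epi D a" "B1 : Ob C" "v : hom C B1 T" "c o IM v = z o a"
   by (rule lift_pt[OF c T z(1)])
  obtain B2 b w where b: "b : hom C B2 B1" "regular_epi C b" "w : hom C B2 T" "c o IM w = (z' o a) o IM b"
   by (rule lift_pt_C[OF c T a(3) D.cmp_hom[OF a(1) z(2)]])
  have vb: "v \<star> b : hom C B2 T" by (rule C.cmp_hom[OF b(1) a(4)])
  have e1: "c o IM (v \<star> b) = (z o a) o IM b" using IM_val_cmp[OF c(1) a(4) b(1)] a(5) by simp
  note za = D.cmp_hom[OF a(1) z(1)] D.cmp_hom[OF a(1) z(2)] and ib = IM_hom[OF b(1)]
  have "D.mem (snd P) ((z o a) o IM b) ((z' o a) o IM b)"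
   by (rule D.rel.mem_stable[OF L D.rel.mem_stable[OF L m a(1) z(1)] ib za(1)])
  then have "D.mem (snd Q) (c' o IM (v \<star> b)) (c' o IM w)" by (intro mono[OF vb b(3)]) (simp only: e1 b(4))
  then have "D.mem (snd Q) (f o ((z o a) o IM b)) (f o ((z' o a) o IM b))"
   using fc[OF IM_hom[OF vb]] fc[OF IM_hom[OF b(3)]] e1 b(4) by simp
  then have "D.mem (snd Q) (((f o z) o a) o IM b) (((f o z') o a) o IM b)"
   using f(1) z a(1) ib by (simp add: hom_iff)
  then have "D.mem (snd Q) ((f o z) o a) ((f o z') o a)"
   by (rule D.rel.mem_local[OF L' IM_regular_epi[OF b(2)] ib D.cmp_hom[OF a(1) D.cmp_hom[OF z(1) f(1)]] D.cmp_hom[OF a(1) D.cmp_hom[OF z(2) f(1)]]])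
  then show ?thesis by (rule D.rel.mem_local[OF L' a(2,1) D.cmp_hom[OF z(1) f(1)] D.cmp_hom[OF z(2) f(1)]])
 qed
 have fmon: "D.monot P Q f" unfolding D.monot_def using E(1) E'(1) f(1) fm by blast
 have fe: "f o e : hom D (IO X) (fst Q)" by (rule D.cmp_hom[OF E(3) f(1)])
 note RF = rl[OF E'(1) X fe E'(2,3)]
 have "rl Q X (f o e) Y e' = \<Phi>"
 proof (rule rl_eqI[OF E'(1) X fe E'(2,3) F])
  fix A x y assume x: "x : hom C A X" and y: "y : hom C A Y"
  obtain B b w where b: "b : hom C B A" "regular_epi C b" "w : hom C B T" "t0 \<star> w = x \<star> b" by (rule C.cover_lift[OF r0 t(1) x])
  have yb: "x \<star> b : hom C B X" "y \<star> b : hom C B Y" "t1 \<star> w : hom C B Y" using C.cmp_hom b x y t(2) by blast+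
  have eq: "(f o e) o IM (x \<star> b) = e' o IM (t1 \<star> w)"
   using cw[OF b(3)] fc[OF IM_hom[OF b(3)]] b(4) D.assoc[OF IM_hom[OF yb(1)] E(3) f(1)] by simp
  have "C.mem \<Phi> x y \<longleftrightarrow> C.mem \<Phi> (x \<star> b) (y \<star> b)"
   using C.rel.mem_stable[OF F _ b(1) x] C.rel.mem_local[OF F b(2,1) x y] by blast
  \<comment> \<open>At \<open>t0 w\<close> the relation \<open>\<Phi>\<close> is the up-set
    generated by \<open>t1 w\<close>: one direction is the counit, the other the right
    action.\<close>
  also have "\<dots> \<longleftrightarrow> C.mem (rl Q Y e' Y e') (t1 \<star> w) (y \<star> b)"
   using FG[OF b(3)] sng Fr unfolding b(4) by blast
  also have "\<dots> \<longleftrightarrow> C.mem (rl Q X (f o e) Y e') (x \<star> b) (y \<star> b)" unfolding RF(2) S(2) eq using yb by blast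
  also have "\<dots> \<longleftrightarrow> C.mem (rl Q X (f o e) Y e') x y"
   using C.rel.mem_stable[OF RF(1) _ b(1) x] C.rel.mem_local[OF RF(1) b(2,1) x y] by blast
  finally show "C.mem \<Phi> x y \<longleftrightarrow> D.mem (snd Q) ((f o e) o IM x) (e' o IM y)" unfolding RF(2) using x y by blast
 qed
 then show thesis by (rule that[OF fmon])
qed

end

section \<open>The functor from internal posets to congruences and its essential
  surjectivity\<close>

context covering begin

definition ch :: "'a \<times> 'b rel => 'o \<times> 'b" where
 "ch P = (SOME r. pres P (fst r) (snd r))"

abbreviation "CX P == fst (ch P)"
abbreviation "ce P == snd (ch P)"
abbreviation "Fo P == (CX P, rl P (CX P) (ce P) (CX P) (ce P))"
abbreviation "Fm P Q f == rl Q (CX P) (f o ce P) (CX Q) (ce Q)"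

lemma ch: "pres P (CX P) (ce P)" if P: "internal_poset D P"
proof -
 obtain X e where "X : Ob C" "e : hom D (IO X) (fst P)" "regular_epi D e" using covers[OF D.posetD(1)[OF P]] by blast
 then have "pres P (fst (X, e)) (snd (X, e))" using P unfolding pres_def by simp
 then show ?thesis unfolding ch_def by (rule someI[where x = "(X, e)"])
qed

definition F :: "('a \<times> 'b rel, ('a \<times> 'b rel) \<times> ('a \<times> 'b rel) \<times> 'b, 'o \<times> 'm rel, ('o \<times> 'm rel) \<times> ('o \<times> 'm rel) \<times> 'm rel) ftor" where
 "F = \<lparr>fob = (%P. Fo P), far = (%(P, Q, f). (Fo P, Fo Q, Fm P Q f))\<rparr>"

lemma F_simps: "fob F P = Fo P" "far F (P, Q, f) = (Fo P, Fo Q, Fm P Q f)"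
 by (simp_all add: F_def)

lemma left_adjoint_F: "D.monot P Q f ==> C.rel.left_adjoint (Fo P) (Fo Q) (Fm P Q f)"
 by (rule left_adjoint_pres[OF ch ch]) (auto dest: D.monotD(1,2))

lemma F_le_iff:
 assumes f: "D.monot P Q f" and g: "D.monot P Q g"
 shows "far F (P, Q, f) \<preceq>\<^bsub>ex_reg (disc C)\<^esub> far F (P, Q, g) \<longleftrightarrow> D.mem (snd Q) f g"
 unfolding F_simps C.rel.ex_reg_leq using left_adjoint_F[OF f] left_adjoint_F[OF g]
  rl_le_iff[OF ch[OF D.monotD(1)[OF f]] ch[OF D.monotD(2)[OF f]] f g] by blast

lemma pos_functor_F: "pos_functor (Ord D) (ex_reg (disc C)) F"
 unfolding pos_functor_def is_functor_def
proof (intro conjI allI ballI impI)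
 show "pos_category (Ord D)" "pos_category (ex_reg (disc C))" by (rule D.pos_category_Ord C.rel.pos_category_ex_reg)+
 then show "category (Ord D)" "category (ex_reg (disc C))" by (simp_all add: pos_category_def)
 show "fob F P : Ob (ex_reg (disc C))" if "P : Ob (Ord D)" for P
  using congruence_pres[OF ch] that unfolding D.Ord_simps C.rel.ex_reg_simps F_simps by blast
 show "far F f : hom (ex_reg (disc C)) (fob F P) (fob F Q)" if fh: "f : hom (Ord D) P Q" for P Q f
 proof -
  obtain m where m: "f = (P, Q, m)" "D.monot P Q m" using fh unfolding D.hom_Ord by blast
  show ?thesis using left_adjoint_F[OF m(2)] unfolding m(1) C.rel.hom_ex_reg F_simps by blast
 qed
 show "far F (idt (Ord D) P) = idt (ex_reg (disc C)) (fob F P)" if "P : Ob (Ord D)" for P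
  using D.idt_left[OF presD(3)[OF ch]] that unfolding D.Ord_simps C.rel.ex_reg_simps F_simps by simp
 show "far F (g o\<^bsub>Ord D\<^esub> f) = far F g o\<^bsub>ex_reg (disc C)\<^esub> far F f" if f: "f : hom (Ord D) P Q" and g: "g : hom (Ord D) Q T" for P Q T f g
 proof -
  obtain m n where mn: "f = (P, Q, m)" "D.monot P Q m" "g = (Q, T, n)" "D.monot Q T n" using f g unfolding D.hom_Ord by blast
  note M = D.monotD[OF mn(2)] and N = D.monotD[OF mn(4)]
  note cP = presD[OF ch[OF M(1)]] and cT = presD[OF ch[OF N(2)]]
  have "(n o m) o ce P = n o m o ce P" by (rule D.assoc[OF cP(3) M(3) N(3)])
  then show ?thesis unfolding mn(1,3) D.Ord_simps F_simps C.rel.ex_reg_simps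
   using rl_comp[OF ch[OF M(2)] mn(4) cP(2) D.cmp_hom[OF cP(3) M(3)] cT(2,3)] by simp
 qed
 show "far F f \<preceq>\<^bsub>ex_reg (disc C)\<^esub> far F g" if le: "f \<preceq>\<^bsub>Ord D\<^esub> g" for f g
 proof -
  obtain P Q m P' Q' n where e: "f = (P, Q, m)" "g = (P', Q', n)" by (cases f; cases g)
  show ?thesis using le F_le_iff unfolding e D.Ord_leq by blast
 qed
qed

lemma lift_pair:
 assumes q: "q : hom D (IO X) d" "regular_epi D q" and u: "u : hom D A d" and v: "v : hom D A d"
 obtains B b z z' where "b : hom D B A" "regular_epi D b" "z : hom D B (IO X)" "z' : hom D B (IO X)"
  "q o z = u o b" "q o z' = v o b"
proof -
 obtain B a z where a: "a : hom D B A" "regular_epi D a" "z : hom D B (IO X)" "q o z = u o a" by (rule D.cover_lift[OF q(2,1) u])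
 obtain B' b z' where b: "b : hom D B' B" "regular_epi D b" "z' : hom D B' (IO X)" "q o z' = (v o a) o b"
  by (rule D.cover_lift[OF q(2,1) D.cmp_hom[OF a(1) v]])
 have "q o (z o b) = u o (a o b)" using a(4) D.assoc[OF b(1) a(3) q(1)] D.assoc[OF b(1) a(1) u] by simp
 moreover have "q o z' = v o (a o b)" using b(4) D.assoc[OF b(1) a(1) v] by simp
 ultimately show thesis
  using that D.cmp_hom[OF b(1) a(1)] D.regular_epi_cmp[OF b(2,1) a(2,1)] D.cmp_hom[OF b(1) a(3)] b(3) by blast
qed

text \<open>Fullness brings the factorization back from \<open>D\<close> to \<open>C\<close>, and
  faithfulness makes its equations hold there.\<close>

lemma imem_IM_iff:
 assumes R: "R : C.Rel X Y" and x: "x : hom C A X" and y: "y : hom C A Y"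
 shows "imem R (IM x) (IM y) \<longleftrightarrow> C.mem R x y"
proof
 show "imem R (IM x) (IM y)" if "C.mem R x y" by (rule imem_IM[OF R that])
 assume m: "imem R (IM x) (IM y)"
 obtain T r0 r1 where "ispan R X Y T r0 r1" by (rule IRelE[OF R])
 note r = ispanD[OF this]
 obtain A' h where h: "h : hom D A' (IO T)" "IM x = IM r0 o h" "IM y = IM r1 o h" using m r(6) by blast
 have "A' = IO A" using h(1,2) r(3) IM_hom[OF x] by (auto simp: hom_iff)
 then obtain k where k: "k : hom C A T" "IM k = h" using full h(1) C.hom_Ob[OF x] C.hom_Ob[OF r(1)] by blast
 have "x = r0 \<star> k" by (rule faithful[OF x C.cmp_hom[OF k(1) r(1)]]) (simp add: IM_cmp[OF k(1) r(1)] k(2) h(2))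
 moreover have "y = r1 \<star> k" by (rule faithful[OF y C.cmp_hom[OF k(1) r(2)]]) (simp add: IM_cmp[OF k(1) r(2)] k(2) h(3))
 ultimately show "C.mem R x y" using r(8) k(1) by blast
qed

text \<open>\<open>E\<close> is the symmetric part of the preorder \<open>R\<close>. Exactness of
  \<open>D\<close> supplies the quotient \<open>q\<close> of \<open>IO X\<close> by the image of
  \<open>E\<close>, and the order \<open>L\<close> is the image of \<open>R\<close> along
  \<open>q\<close>.\<close>

lemma congruence_quotient:
 assumes cg: "congruence (disc C) (X, R)"
 obtains P q where "pres P X q" "rl P X q X q = R"
proof -
 have X: "X : Ob C" and R: "R : C.Rel X X" and refl: "!!A x. x : hom C A X ==> C.mem R x x"
  and trans: "!!x y z. C.mem R x y ==> C.mem R y z ==> C.mem R x z"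
  using cg unfolding C.congruence_disc_iff rel_refl_def rel_trans_def fst_conv snd_conv by blast+
 note cv = C.rel_converse[OF R]
 obtain E where E: "E : C.Rel X X" "ALL x y. C.mem E x y \<longleftrightarrow> C.mem R x y & C.mem (R\<inverse>) x y" by (rule C.rel_inter[OF R cv(1)])
 have Em: "C.mem E x y \<longleftrightarrow> C.mem R x y & C.mem R y x" for x y using E(2) cv(2) by blast
 have eq: "C.eqv (X, E)" by (rule C.eqvI[OF X E(1)]) (use Em refl trans in blast)+
 obtain d q where q: "q : hom D (IO X) d" "regular_epi D q"
  "!!A x x'. x : hom D A (IO X) ==> x' : hom D A (IO X) ==> q o x = q o x' \<longleftrightarrow> imem E x x'"
  by (rule D.exact_quotient[OF D_exact IO_Ob[OF X] IRel_equivalence[OF eq, unfolded fst_conv snd_conv]]) blast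
 obtain T r0 r1 where "ispan R X X T r0 r1" by (rule IRelE[OF R])
 note r = ispanD[OF this]
 note s = D.cmp_hom[OF r(3) q(1)] D.cmp_hom[OF r(4) q(1)]
 obtain L where L: "L : D.Rel d d"
  "ALL x y. D.mem L x y \<longleftrightarrow> (EX A B a h. x : hom D A d & y : hom D A d & a : hom D B A & regular_epi D a &
    h : hom D B (IO T) & x o a = (q o IM r0) o h & y o a = (q o IM r1) o h)"
  by (rule D.span_relation[OF s])
 have ER: "imem R x y" if "imem E x y" for x y by (rule transfer_incl[OF E(1) R _ that]) (use Em in blast)
 have ER': "imem R y x" if "imem E x y" for x y by (rule transfer_sym[OF E(1) R _ that]) (use Em in blast)
 have iE: "imem E x y" if "imem R x y" "imem R y x" for x y
  by (rule transfer_inter[OF R cv(1) E(1) _ that(1) imem_converse[OF R, THEN iffD2, OF that(2)]]) (use E(2) in blast)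
 have itr: "imem R x z" if "imem R x y" "imem R y z" for x y z by (rule transfer_comp[OF R R R trans that])
 \<comment> \<open>Pulled back along \<open>q\<close>, the order \<open>L\<close> is no larger than
   the image of \<open>R\<close>: elements identified by \<open>q\<close> are related by
   \<open>E\<close>, and \<open>R\<close> absorbs \<open>E\<close> on both sides.\<close>
 have key: "D.mem L (q o z) (q o z') \<longleftrightarrow> imem R z z'" if z: "z : hom D A (IO X)" "z' : hom D A (IO X)" for A z z'
 proof
  assume "D.mem L (q o z) (q o z')"
  then obtain A' B a h where h: "q o z : hom D A' d" "a : hom D B A'" "regular_epi D a" "h : hom D B (IO T)"
   "(q o z) o a = (q o IM r0) o h" "(q o z') o a = (q o IM r1) o h" using L(2) by blast
  have "A' = A" using h(1) D.cmp_hom[OF z(1) q(1)] by (simp add: hom_iff)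
  note a = h(2)[unfolded this]
  note za = D.cmp_hom[OF a z(1)] D.cmp_hom[OF a z(2)] and rh = D.cmp_hom[OF h(4) r(3)] D.cmp_hom[OF h(4) r(4)]
  have "q o (z o a) = q o (IM r0 o h)" using h(5) D.assoc[OF a z(1) q(1)] D.assoc[OF h(4) r(3) q(1)] by simp
  then have 1: "imem R (z o a) (IM r0 o h)" using q(3)[OF za(1) rh(1)] ER by blast
  have "q o (z' o a) = q o (IM r1 o h)" using h(6) D.assoc[OF a z(2) q(1)] D.assoc[OF h(4) r(4) q(1)] by simp
  then have 2: "imem R (IM r1 o h) (z' o a)" using q(3)[OF za(2) rh(2)] ER' by blast
  have "imem R (IM r0 o h) (IM r1 o h)" using r(6) h(4) by blast
  from itr[OF 1 itr[OF this 2]] show "imem R z z'" by (rule imem_local[OF R h(3) a z])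
 next
  assume "imem R z z'"
  then obtain A' h where h: "h : hom D A' (IO T)" "z = IM r0 o h" "z' = IM r1 o h" using r(6) by blast
  have "A' = A" using h(1,2) z(1) r(3) by (auto simp: hom_iff)
  note h1 = h(1)[unfolded this]
  note qz = D.cmp_hom[OF z(1) q(1)] D.cmp_hom[OF z(2) q(1)]
  have A: "A : Ob D" using D.hom_Ob[OF z(1)] by blast
  have "(q o z) o idt D A = (q o IM r0) o h" "(q o z') o idt D A = (q o IM r1) o h"
   using D.idt_right[OF qz(1)] D.idt_right[OF qz(2)] D.assoc[OF h1 r(3) q(1)] D.assoc[OF h1 r(4) q(1)] h(2,3) by simp_all
  then show "D.mem L (q o z) (q o z')" using L(2) qz D.idt_hom[OF A] D.rel.cv_idt[OF A] h1 by blast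
 qed
 have P: "internal_poset D (d, L)"
 proof (rule D.posetI[OF _ L(1)])
  show "d : Ob D" using D.hom_Ob[OF q(1)] by blast
  show "D.mem L u u" if u: "u : hom D A d" for A u
  proof -
   obtain B a z where a: "a : hom D B A" "regular_epi D a" "z : hom D B (IO X)" "q o z = u o a" by (rule D.cover_lift[OF q(2,1) u])
   have "D.mem L (u o a) (u o a)" using key[OF a(3,3)] transfer_refl[OF R X refl a(3)] a(4) by simp
   then show ?thesis by (rule D.rel.mem_local[OF L(1) a(2,1) u u])
  qed
  show "u = v" if m: "D.mem L u v" "D.mem L v u" for u v
  proof -
   obtain A where uv: "u : hom D A d" "v : hom D A d" using D.rel.mem_hom[OF L(1) m(1)] by blast
   obtain B b z z' where b: "b : hom D B A" "regular_epi D b" "z : hom D B (IO X)" "z' : hom D B (IO X)"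
    "q o z = u o b" "q o z' = v o b" by (rule lift_pair[OF q(1,2) uv])
   have "imem R z z'" "imem R z' z" using key[OF b(3,4)] key[OF b(4,3)] D.rel.mem_stable[OF L(1) m(1) b(1) uv(1)]
     D.rel.mem_stable[OF L(1) m(2) b(1) uv(2)] b(5,6) by simp_all
   then have "q o z = q o z'" using q(3)[OF b(3,4)] iE by blast
   then show ?thesis using D.regular_epi_cancel[OF b(2,1) uv] b(5,6) by simp
  qed
  show "D.mem L u w" if m: "D.mem L u v" "D.mem L v w" for u v w
  proof -
   obtain A where uv: "u : hom D A d" "v : hom D A d" using D.rel.mem_hom[OF L(1) m(1)] by blast
   have w: "w : hom D A d" by (rule D.mem_hom2(1)[OF L(1) m(2) uv(2)])
   obtain B b z z' where b: "b : hom D B A" "regular_epi D b" "z : hom D B (IO X)" "z' : hom D B (IO X)"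
    "q o z = u o b" "q o z' = v o b" by (rule lift_pair[OF q(1,2) uv])
   note wb = D.cmp_hom[OF b(1) w] and ub = D.cmp_hom[OF b(1) uv(1)] and vb = D.cmp_hom[OF b(1) uv(2)]
   obtain B' c z'' where c: "c : hom D B' B" "regular_epi D c" "z'' : hom D B' (IO X)" "q o z'' = (w o b) o c"
    by (rule D.cover_lift[OF q(2,1) wb])
   note zc = D.cmp_hom[OF c(1) b(3)] D.cmp_hom[OF c(1) b(4)]
   have e: "q o (z o c) = (u o b) o c" "q o (z' o c) = (v o b) o c"
    using D.assoc[OF c(1) b(3) q(1)] D.assoc[OF c(1) b(4) q(1)] b(5,6) by simp_all
   have "imem R (z o c) (z' o c)" using key[OF zc] e
     D.rel.mem_stable[OF L(1) D.rel.mem_stable[OF L(1) m(1) b(1) uv(1)] c(1) ub] by simp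
   moreover have "imem R (z' o c) z''" using key[OF zc(2) c(3)] e c(4)
     D.rel.mem_stable[OF L(1) D.rel.mem_stable[OF L(1) m(2) b(1) uv(2)] c(1) vb] by simp
   ultimately have "D.mem L ((u o b) o c) ((w o b) o c)" using key[OF zc(1) c(3)] itr e(1) c(4) by metis
   then have "D.mem L (u o b) (w o b)" by (rule D.rel.mem_local[OF L(1) c(2,1) ub wb])
   then show ?thesis by (rule D.rel.mem_local[OF L(1) b(2,1) uv(1) w])
  qed
 qed
 have p: "pres (d, L) X q" unfolding pres_def using P X q(1,2) by simp
 have "rl (d, L) X q X q = R"
  by (rule rl_eqI[OF P X _ X _ R]) (use q(1) key[OF IM_hom IM_hom] imem_IM_iff[OF R] in simp_all)
 then show thesis by (rule that[OF p])
qed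

text \<open>The congruence is presented by some cover \<open>q\<close> of a poset \<open>P\<close>,
  while \<open>F\<close> uses the chosen cover \<open>ce P\<close>. Comparing the two covers in the
  order of \<open>P\<close> gives mutually inverse arrows, by \<open>rl_comp_id\<close>.\<close>

lemma F_essentially_surjective:
 assumes Z: "Z : Ob (ex_reg (disc C))"
 shows "EX P:Ob (Ord D). EX i:hom (ex_reg (disc C)) (fob F P) Z. iso (ex_reg (disc C)) i"
proof -
 interpret E: pos_category "ex_reg (disc C)" by (rule C.rel.pos_category_ex_reg)
 obtain X R where e: "Z = (X, R)" and cg: "congruence (disc C) (X, R)" using Z unfolding C.rel.ex_reg_simps by (cases Z) auto
 obtain P q where q: "pres P X q" "rl P X q X q = R" by (rule congruence_quotient[OF cg])
 note Q = presD[OF q(1)] and p = ch[OF presD(1)[OF q(1)]]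
 note c = presD[OF p] and i = D.monot_id[OF Q(1)]
 have 1: "(Fo P, Z, rl P (CX P) (ce P) X q) : hom (ex_reg (disc C)) (Fo P) Z"
  "(Z, Fo P, rl P X q (CX P) (ce P)) : hom (ex_reg (disc C)) Z (Fo P)"
  using left_adjoint_pres[OF p q(1) i] left_adjoint_pres[OF q(1) p i] D.idt_left[OF Q(3)] D.idt_left[OF c(3)]
  unfolding C.rel.hom_ex_reg e q(2) by simp_all
 have "iso (ex_reg (disc C)) (Fo P, Z, rl P (CX P) (ce P) X q)"
  by (rule E.isoI[OF 1]) (simp_all add: C.rel.ex_reg_simps e rl_comp_id[OF q(1) c(2,3,2,3)] rl_comp_id[OF p Q(2,3,2,3)] q(2))
 then show ?thesis unfolding D.Ord_simps F_simps using 1(1) Q(1) by blast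
qed

lemma Ord_equivalent: "pos_equivalent (Ord D) (ex_reg (disc C))"
proof (rule pos_equivalentI[OF pos_functor_F _ _ F_essentially_surjective])
 fix P Q f g assume fg: "f : hom (Ord D) P Q" "g : hom (Ord D) P Q" and le: "far F f \<preceq>\<^bsub>ex_reg (disc C)\<^esub> far F g"
 obtain m n where mn: "f = (P, Q, m)" "D.monot P Q m" "g = (P, Q, n)" "D.monot P Q n" using fg unfolding D.hom_Ord by blast
 show "f \<preceq>\<^bsub>Ord D\<^esub> g" using le F_le_iff[OF mn(2,4)] mn(2,4) unfolding mn(1,3) D.Ord_leq by blast
next
 fix P Q h assume P: "P : Ob (Ord D)" and Q: "Q : Ob (Ord D)" and h: "h : hom (ex_reg (disc C)) (fob F P) (fob F Q)"
 then have p: "pres P (CX P) (ce P)" and q: "pres Q (CX Q) (ce Q)" using ch unfolding D.Ord_simps by blast+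
 obtain \<Phi> where \<Phi>: "h = (Fo P, Fo Q, \<Phi>)" "C.rel.left_adjoint (Fo P) (Fo Q) \<Phi>" using h unfolding C.rel.hom_ex_reg F_simps by blast
 obtain f where f: "D.monot P Q f" "Fm P Q f = \<Phi>" by (rule left_adjoint_pres_full[OF p q \<Phi>(2)])
 have "far F (P, Q, f) = h" unfolding F_simps \<Phi>(1) f(2) ..
 then show "EX f:hom (Ord D) P Q. far F f = h" using f(1) D.hom_Ord by (intro bexI[of _ "(P, Q, f)"]) auto
qed

end

section \<open>Internal posets form a regular category\<close>

context regular begin

abbreviation ocmp (infixr "\<bullet>" 70) where "g \<bullet> f == g o\<^bsub>Ord C\<^esub> f"

lemma poset_jo: "internal_poset C (jo X)" if X: "X : Ob C"
proof -
 have "graph (idt C X) : Rel X X" using eqvD(2)[OF eqv_jo[OF X]] by (simp add: jo_def)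
 moreover note m = mem_jo[OF X, unfolded jo_def snd_conv]
 ultimately show ?thesis unfolding jo_def by (intro posetI[OF X]) (auto simp: m)
qed

text \<open>This makes each element of \<open>C\<close> available as an arrow of
  \<open>Ord C\<close> out of a discrete poset.\<close>

lemma monot_jo: "internal_poset C P ==> f : hom C A (fst P) ==> monot (jo A) P f"
 unfolding monot_def using poset_jo mem_jo hom_Ob posetD(3) by (metis cmp_hom fst_jo)

text \<open>The order induced on \<open>W\<close> by a jointly monic span into two posets; it makes the span jointly
 order-reflecting.\<close>

lemma induced_poset:
 assumes P: "internal_poset C P" and Q: "internal_poset C Q" and p: "p0 : hom C W (fst P)" "p1 : hom C W (fst Q)"
  and j: "!!A u v. u : hom C A W ==> v : hom C A W ==> p0 o u = p0 o v ==> p1 o u = p1 o v ==> u = v"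
 obtains M where "internal_poset C (W, M)" "monot (W, M) P p0" "monot (W, M) Q p1"
  "ALL x y. mem M x y \<longleftrightarrow> (EX A. x : hom C A W & y : hom C A W) & mem (snd P) (p0 o x) (p0 o y) & mem (snd Q) (p1 o x) (p1 o y)"
proof -
 obtain R where R: "R : Rel W W" "ALL x y. mem R x y \<longleftrightarrow> (EX A. x : hom C A W & y : hom C A W) & mem (snd P) (p0 o x) (p0 o y)"
  by (rule rel_inv_image[OF posetD(2)[OF P] p(1,1)])
 obtain S where S: "S : Rel W W" "ALL x y. mem S x y \<longleftrightarrow> (EX A. x : hom C A W & y : hom C A W) & mem (snd Q) (p1 o x) (p1 o y)"
  by (rule rel_inv_image[OF posetD(2)[OF Q] p(2,2)])
 obtain M where M: "M : Rel W W" "ALL x y. mem M x y \<longleftrightarrow> mem R x y & mem S x y" by (rule rel_inter[OF R(1) S(1)])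
 have m: "mem M x y \<longleftrightarrow> (EX A. x : hom C A W & y : hom C A W) & mem (snd P) (p0 o x) (p0 o y) & mem (snd Q) (p1 o x) (p1 o y)" for x y
  using M(2) R(2) S(2) by blast
 have W: "internal_poset C (W, M)"
 proof (rule posetI[OF _ M(1)])
  show "W : Ob C" using hom_Ob[OF p(1)] by blast
  show "mem M x x" if x: "x : hom C A W" for A x
   using m x posetD(3)[OF P cmp_hom[OF x p(1)]] posetD(3)[OF Q cmp_hom[OF x p(2)]] by blast
  show "mem M x z" if xy: "mem M x y" and yz: "mem M y z" for x y z
   using xy yz mem_hom2(1)[OF M(1) yz] posetD(4)[OF P] posetD(4)[OF Q] unfolding m by blast
  show "x = y" if "mem M x y" "mem M y x" for x y
   using that j posetD(5)[OF P] posetD(5)[OF Q] unfolding m by blast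
 qed
 have "monot (W, M) P p0" "monot (W, M) Q p1" unfolding monot_def using W P Q p m by simp_all
 then show thesis using that[OF W] m by blast
qed

lemma jointly_ff_Ord:
 assumes p0: "monot (W, M) P p0" and p1: "monot (W, M) Q p1"
  and m: "ALL x y. mem M x y \<longleftrightarrow> (EX A. x : hom C A W & y : hom C A W) & mem (snd P) (p0 o x) (p0 o y) & mem (snd Q) (p1 o x) (p1 o y)"
 shows "jointly_ff (Ord C) (W, M) P Q ((W, M), P, p0) ((W, M), Q, p1)"
 unfolding jointly_ff_def
proof (intro conjI allI ballI impI)
 fix A u v assume u: "u : hom (Ord C) A (W, M)" and v: "v : hom (Ord C) A (W, M)"
  and le: "((W, M), P, p0) \<bullet> u \<preceq>\<^bsub>Ord C\<^esub> ((W, M), P, p0) \<bullet> v" "((W, M), Q, p1) \<bullet> u \<preceq>\<^bsub>Ord C\<^esub> ((W, M), Q, p1) \<bullet> v"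
 obtain a b where ab: "u = (A, (W, M), a)" "monot A (W, M) a" "v = (A, (W, M), b)" "monot A (W, M) b" using u v unfolding hom_Ord by blast
 have "mem M a b" using le m monotD(3)[OF ab(2), unfolded fst_conv] monotD(3)[OF ab(4), unfolded fst_conv]
  unfolding ab(1,3) Ord_simps Ord_leq by blast
 then show "u \<preceq>\<^bsub>Ord C\<^esub> v" unfolding ab(1,3) Ord_leq snd_conv using ab(2,4) by blast
qed (use p0 p1 in \<open>simp_all add: hom_Ord\<close>)

text \<open>Joint order reflection in \<open>Ord C\<close> is tested on discrete posets, where all
  elements of \<open>C\<close> are monotone.\<close>

lemma jointly_ff_OrdD:
 assumes j: "jointly_ff (Ord C) W P Q (W, P, p0) (W, Q, p1)" and x: "x : hom C A (fst W)" and y: "y : hom C A (fst W)"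
  and m: "mem (snd P) (p0 o x) (p0 o y)" "mem (snd Q) (p1 o x) (p1 o y)"
 shows "mem (snd W) x y"
proof -
 have p: "monot W P p0" "monot W Q p1" using j unfolding jointly_ff_def hom_Ord by blast+
 note xy = monot_jo[OF monotD(1)[OF p(1)] x] monot_jo[OF monotD(1)[OF p(1)] y]
 have h: "(jo A, W, x) : hom (Ord C) (jo A) W" "(jo A, W, y) : hom (Ord C) (jo A) W" using xy unfolding hom_Ord by blast+
 have "(W, P, p0) \<bullet> (jo A, W, x) \<preceq>\<^bsub>Ord C\<^esub> (W, P, p0) \<bullet> (jo A, W, y)"
  "(W, Q, p1) \<bullet> (jo A, W, x) \<preceq>\<^bsub>Ord C\<^esub> (W, Q, p1) \<bullet> (jo A, W, y)"
  unfolding Ord_simps Ord_leq using m monot_comp[OF xy(1) p(1)] monot_comp[OF xy(2) p(1)] monot_comp[OF xy(1) p(2)] monot_comp[OF xy(2) p(2)] by blast+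
 then have "(jo A, W, x) \<preceq>\<^bsub>Ord C\<^esub> (jo A, W, y)" using j h unfolding jointly_ff_def by blast
 then show ?thesis unfolding Ord_leq by blast
qed

lemma ff_mor_OrdD:
 assumes m: "ff_mor (Ord C) (P, Q, m)" and x: "x : hom C A (fst P)" and y: "y : hom C A (fst P)" and le: "mem (snd Q) (m o x) (m o y)"
 shows "mem (snd P) x y"
proof -
 have mm: "monot P Q m" using m by (simp add: ff_mor_def Ord_simps)
 have "jointly_ff (Ord C) P Q Q (P, Q, m) (P, Q, m)"
  using m mm unfolding jointly_ff_def ff_mor_def by (auto simp: Ord_simps hom_Ord)
 from jointly_ff_OrdD[OF this x y le le] show ?thesis .
qed

lemma monot_reflect:
 assumes j: "internal_poset C W" "internal_poset C A" and w: "w : hom C (fst A) (fst W)"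
  and ref: "!!B x y. x : hom C B (fst W) ==> y : hom C B (fst W) ==> mem (snd P) (p0 o x) (p0 o y) ==>
    mem (snd Q) (p1 o x) (p1 o y) ==> mem (snd W) x y"
  and p: "p0 : hom C (fst W) (fst P)" "p1 : hom C (fst W) (fst Q)" and m: "monot A P (p0 o w)" "monot A Q (p1 o w)"
 shows "monot A W w"
proof -
 have "mem (snd W) (w o x) (w o y)" if xy: "mem (snd A) x y" for x y
 proof -
  obtain B where B: "x : hom C B (fst A)" "y : hom C B (fst A)" using rel.mem_hom[OF posetD(2)[OF j(2)] xy] by blast
  show ?thesis
   by (rule ref[OF cmp_hom[OF B(1) w] cmp_hom[OF B(2) w]])
    (use monotD(4)[OF m(1) xy] monotD(4)[OF m(2) xy] assoc[OF B(1) w p(1)] assoc[OF B(2) w p(1)] assoc[OF B(1) w p(2)] assoc[OF B(2) w p(2)] in simp_all)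
 qed
 then show ?thesis unfolding monot_def using j w by blast
qed

text \<open>The final clause is what makes mediating arrows monotone when limits and factorizations
  are lifted from \<open>C\<close>.\<close>

lemma induced_span:
 assumes P: "internal_poset C P" and Q: "internal_poset C Q" and p: "p0 : hom C W (fst P)" "p1 : hom C W (fst Q)"
  and j: "ALL A. ALL u:hom C A W. ALL v:hom C A W. p0 o u = p0 o v --> p1 o u = p1 o v --> u = v"
 obtains V where "fst V = W" "monot V P p0" "monot V Q p1" "jointly_ff (Ord C) V P Q (V, P, p0) (V, Q, p1)"
  "ALL A u. internal_poset C A --> u : hom C (fst A) W --> monot A P (p0 o u) --> monot A Q (p1 o u) --> monot A V u"
proof -
 obtain M where M: "internal_poset C (W, M)" "monot (W, M) P p0" "monot (W, M) Q p1"
  "ALL x y. mem M x y \<longleftrightarrow> (EX A. x : hom C A W & y : hom C A W) & mem (snd P) (p0 o x) (p0 o y) & mem (snd Q) (p1 o x) (p1 o y)"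
  by (rule induced_poset[OF P Q p]) (use j in blast)+
 have "monot A (W, M) u" if "internal_poset C A" "u : hom C (fst A) W" "monot A P (p0 o u)" "monot A Q (p1 o u)" for A u
  by (rule monot_reflect[OF M(1) that(1), where P = P and Q = Q, unfolded fst_conv snd_conv, OF that(2) _ p that(3,4)]) (use M(4) in blast)
 then show thesis using that[of "(W, M)"] M(2,3) jointly_ff_Ord[OF M(2,3,4)] by simp
qed

section \<open>Covers and limits of internal posets\<close>

definition ocv :: "('o \<times> 'm rel) \<times> ('o \<times> 'm rel) \<times> 'm => bool" where
 "ocv f \<longleftrightarrow> f : Ar (Ord C) & regular_epi C (snd (snd f))"

lemma ocv_iff: "ocv (P, Q, f) \<longleftrightarrow> monot P Q f & regular_epi C f"
 by (simp add: ocv_def Ord_simps)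

text \<open>The fill-in found in \<open>C\<close> is monotone because \<open>ff\<close>-morphisms
  reflect the order. Conversely, the mono part of \<open>e\<close> with the order induced from
  \<open>Q\<close> is an \<open>ff\<close>-morphism, and orthogonality gives it a section.\<close>

lemma so_mor_Ord: "ocv f \<longleftrightarrow> so_mor (Ord C) f"
proof -
 interpret O: pcategory "Ord C" by (intro pcategory.intro pos_category_Ord)
 obtain P Q e where f: "f = (P, Q, e)" by (cases f)
 have "monot P Q e & regular_epi C e \<longleftrightarrow> so_mor (Ord C) (P, Q, e)"
 proof
  assume e: "monot P Q e & regular_epi C e"
  then have eh: "e : hom C (fst P) (fst Q)" and em: "monot P Q e" and er: "regular_epi C e" by (auto dest: monotD(3))
  show "so_mor (Ord C) (P, Q, e)"
  proof (rule O.so_morI)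
   show "(P, Q, e) : hom (Ord C) P Q" unfolding hom_Ord using em by blast
   fix m X Y u v assume m: "ff_mor (Ord C) m" "m : hom (Ord C) X Y" and u: "u : hom (Ord C) P X" and v: "v : hom (Ord C) Q Y"
    and eq: "m \<bullet> u = v \<bullet> (P, Q, e)"
   obtain m' u' v' where d: "m = (X, Y, m')" "monot X Y m'" "u = (P, X, u')" "monot P X u'" "v = (Q, Y, v')" "monot Q Y v'"
    using m(2) u v unfolding hom_Ord by blast
   have eq': "m' o u' = v' o e" using eq unfolding d Ord_simps by simp
   note h = monotD(3)[OF d(2)] monotD(3)[OF d(4)] monotD(3)[OF d(6)] and X = monotD(1)[OF d(2)] and Y = monotD(2)[OF d(2)]
   note ref = ff_mor_OrdD[OF m(1)[unfolded d(1)]]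
   have "mono_ar C m'" unfolding mono_ar_def
   proof (intro conjI allI ballI impI)
    fix A a b assume a: "a : hom C A (src C m')" "b : hom C A (src C m')" "m' o a = m' o b"
    then have ab: "a : hom C A (fst X)" "b : hom C A (fst X)" using h(1) by (auto simp: hom_iff)
    have "mem (snd Y) (m' o a) (m' o b)" "mem (snd Y) (m' o b) (m' o a)" using a(3) posetD(3)[OF Y cmp_hom[OF ab(2) h(1)]] by auto
    then show "a = b" using ref ab posetD(5)[OF X] by blast
   qed (use h(1) in \<open>simp add: hom_iff\<close>)
   then obtain w where w: "w : hom C (fst Q) (fst X)" "w o e = u'" "m' o w = v'"
    by (rule regular_epi_mono_orth[OF er eh _ h(1,2,3) eq'])
   have "monot Q X w"
    by (rule monot_reflect[OF X monotD(2)[OF em] w(1), where P = Y and Q = Y]) (use ref h(1) w(3) d(6) in auto)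
   then show "EX w:hom (Ord C) Q X. w \<bullet> (P, Q, e) = u & m \<bullet> w = v"
    by (intro bexI[of _ "(Q, X, w)"]) (simp_all add: d Ord_simps hom_Ord w)
  next
   fix m X Y w w' assume w: "w : hom (Ord C) Q X" "w' : hom (Ord C) Q X" and le: "w \<bullet> (P, Q, e) \<preceq>\<^bsub>Ord C\<^esub> w' \<bullet> (P, Q, e)"
   obtain a b where d: "w = (Q, X, a)" "monot Q X a" "w' = (Q, X, b)" "monot Q X b" using w unfolding hom_Ord by blast
   have "mem (snd X) (a o e) (b o e)" using le unfolding d Ord_simps Ord_leq by blast
   then have "mem (snd X) a b" by (rule rel.mem_local[OF posetD(2)[OF monotD(2)[OF d(2)]] er eh monotD(3)[OF d(2)] monotD(3)[OF d(4)]])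
   then show "w \<preceq>\<^bsub>Ord C\<^esub> w'" unfolding d Ord_leq using d by blast
  qed
 next
  assume so: "so_mor (Ord C) (P, Q, e)"
  then have e: "monot P Q e" by (simp add: so_mor_def Ord_simps)
  note E = monotD[OF e]
  obtain W q m where m: "q : hom C (fst P) W" "regular_epi C q" "m : hom C W (fst Q)" "mono_ar C m" "e = m o q" by (rule factorization[OF E(3)])
  obtain V where V: "fst V = W" "monot V Q m" "monot V Q m" "jointly_ff (Ord C) V Q Q (V, Q, m) (V, Q, m)"
   "ALL A u. internal_poset C A --> u : hom C (fst A) W --> monot A Q (m o u) --> monot A Q (m o u) --> monot A V u"
   by (rule induced_span[OF E(2,2) m(3,3)]) (use mono_ar_cancel[OF m(4,3)] in blast)+
  have ff: "ff_mor (Ord C) (V, Q, m)" using V(4) unfolding ff_mor_def jointly_ff_def by (auto simp: Ord_simps hom_Ord)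
  have qm: "monot P V q" using V(5) E(1) m(1,5) e by blast
  obtain w where w: "w : hom (Ord C) Q V" "(V, Q, m) \<bullet> w = (Q, Q, idt C (fst Q))"
  proof (rule O.so_mor_lift[OF so _ ff])
   show "(P, Q, e) : hom (Ord C) P Q" "(V, Q, m) : hom (Ord C) V Q" "(P, V, q) : hom (Ord C) P V"
    "(Q, Q, idt C (fst Q)) : hom (Ord C) Q Q" unfolding hom_Ord using e V(2) qm monot_id[OF E(2)] by blast+
   show "(V, Q, m) \<bullet> (P, V, q) = (Q, Q, idt C (fst Q)) \<bullet> (P, Q, e)"
    unfolding Ord_simps idt_left[OF E(3)] using m(5) by simp
  qed
  obtain w' where w': "w = (Q, V, w')" "monot Q V w'" using w(1) unfolding hom_Ord by blast
  then have "w' : hom C (fst Q) W" "m o w' = idt C (fst Q)" using w(2) monotD(3)[OF w'(2)] V(1) by (simp_all add: Ord_simps)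
  then have "iso C m" by (rule mono_section_iso[OF m(4,3)])
  then show "monot P Q e & regular_epi C e" using e regular_epi_cmp_iso[OF m(2,1) _ m(3)] m(5) by simp
 qed
 then show ?thesis unfolding f ocv_iff .
qed

lemma pos_pullback_Ord_ex:
 assumes f: "monot P T f" and g: "monot Q T g"
 shows "EX p0 p1. pos_pullback (Ord C) (P, T, f) (Q, T, g) p0 p1"
proof -
 note F = monotD[OF f] and G = monotD[OF g]
 obtain W p0 p1 where p: "p0 : hom C W (fst P)" "p1 : hom C W (fst Q)" "f o p0 = g o p1"
  and pe: "!!A x y. x : hom C A (fst P) ==> y : hom C A (fst Q) ==> f o x = g o y ==> EX u:hom C A W. p0 o u = x & p1 o u = y"
  and pu: "!!A u v. u : hom C A W ==> v : hom C A W ==> p0 o u = p0 o v ==> p1 o u = p1 o v ==> u = v"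
  by (rule pullback_ex[OF F(3) G(3)]) blast
 obtain V where V: "fst V = W" "monot V P p0" "monot V Q p1" "jointly_ff (Ord C) V P Q (V, P, p0) (V, Q, p1)"
  "ALL A u. internal_poset C A --> u : hom C (fst A) W --> monot A P (p0 o u) --> monot A Q (p1 o u) --> monot A V u"
  by (rule induced_span[OF F(1) G(1) p(1,2)]) (use pu in blast)+
 have ex: "EX u:hom (Ord C) A V. (V, P, p0) \<bullet> u = x & (V, Q, p1) \<bullet> u = y"
  if x: "x : hom (Ord C) A P" and y: "y : hom (Ord C) A Q" and eq: "(P, T, f) \<bullet> x = (Q, T, g) \<bullet> y" for A x y
 proof -
  obtain a b where d: "x = (A, P, a)" "monot A P a" "y = (A, Q, b)" "monot A Q b" using x y unfolding hom_Ord by blast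
  obtain u where u: "u : hom C (fst A) W" "p0 o u = a" "p1 o u = b"
   using pe[OF monotD(3)[OF d(2)] monotD(3)[OF d(4)]] eq unfolding d Ord_simps by blast
  have "monot A V u" using V(5) monotD(1)[OF d(2)] u d(2,4) by blast
  then show ?thesis by (intro bexI[of _ "(A, V, u)"]) (simp_all add: Ord_simps hom_Ord d u)
 qed
 interpret O: pcategory "Ord C" by (intro pcategory.intro pos_category_Ord)
 have "is_pullback (Ord C) (P, T, f) (Q, T, g) (V, P, p0) (V, Q, p1)"
  unfolding O.is_pullback_iff
 proof (intro exI conjI allI ballI impI)
  show "(P, T, f) : hom (Ord C) P T" "(Q, T, g) : hom (Ord C) Q T" "(V, P, p0) : hom (Ord C) V P" "(V, Q, p1) : hom (Ord C) V Q"
   unfolding hom_Ord using f g V by blast+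
  show "(P, T, f) \<bullet> (V, P, p0) = (Q, T, g) \<bullet> (V, Q, p1)" using p(3) by (simp add: Ord_simps)
 qed (rule ex O.jointly_ff_cancel[OF V(4)]; assumption)+
 moreover have "jointly_order_mono (Ord C) (V, P, p0) (V, Q, p1)"
  unfolding jointly_order_mono_def using V(2,3,4) unfolding jointly_ff_def by (auto simp: Ord_simps)
 ultimately show ?thesis unfolding pos_pullback_def by blast
qed

lemma pos_product_Ord_ex:
 assumes P: "internal_poset C P" and Q: "internal_poset C Q"
 shows "EX p0 p1. pos_product (Ord C) P Q p0 p1"
proof -
 obtain W p0 p1 where p: "p0 : hom C W (fst P)" "p1 : hom C W (fst Q)"
  and pe: "!!A x y. x : hom C A (fst P) ==> y : hom C A (fst Q) ==> EX u:hom C A W. p0 o u = x & p1 o u = y"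
  and pu: "!!A u v. u : hom C A W ==> v : hom C A W ==> p0 o u = p0 o v ==> p1 o u = p1 o v ==> u = v"
  by (rule product_ex[OF posetD(1)[OF P] posetD(1)[OF Q]]) blast
 obtain V where V: "fst V = W" "monot V P p0" "monot V Q p1" "jointly_ff (Ord C) V P Q (V, P, p0) (V, Q, p1)"
  "ALL A u. internal_poset C A --> u : hom C (fst A) W --> monot A P (p0 o u) --> monot A Q (p1 o u) --> monot A V u"
  by (rule induced_span[OF P Q p]) (use pu in blast)+
 have ex: "EX u:hom (Ord C) A V. (V, P, p0) \<bullet> u = x & (V, Q, p1) \<bullet> u = y"
  if x: "x : hom (Ord C) A P" and y: "y : hom (Ord C) A Q" for A x y
 proof -
  obtain a b where d: "x = (A, P, a)" "monot A P a" "y = (A, Q, b)" "monot A Q b" using x y unfolding hom_Ord by blast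
  obtain u where u: "u : hom C (fst A) W" "p0 o u = a" "p1 o u = b"
   using pe[OF monotD(3)[OF d(2)] monotD(3)[OF d(4)]] by blast
  have "monot A V u" using V(5) monotD(1)[OF d(2)] u d(2,4) by blast
  then show ?thesis by (intro bexI[of _ "(A, V, u)"]) (simp_all add: Ord_simps hom_Ord d u)
 qed
 interpret O: pcategory "Ord C" by (intro pcategory.intro pos_category_Ord)
 have "is_product (Ord C) P Q (V, P, p0) (V, Q, p1)"
  unfolding O.is_product_iff
 proof (intro exI conjI allI ballI impI)
  show "(V, P, p0) : hom (Ord C) V P" "(V, Q, p1) : hom (Ord C) V Q"
   unfolding hom_Ord using V by blast+
 qed (rule ex O.jointly_ff_cancel[OF V(4)]; assumption)+
 moreover have "jointly_order_mono (Ord C) (V, P, p0) (V, Q, p1)"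
  unfolding jointly_order_mono_def using V(2,3,4) unfolding jointly_ff_def by (auto simp: Ord_simps)
 ultimately show ?thesis unfolding pos_product_def by blast
qed

lemma posreg_Ord: "posreg (Ord C) ocv"
proof (intro posreg.intro posreg_axioms.intro pcategory.intro pos_category_Ord so_mor_Ord, goal_cases)
 case (1 X Y) then show ?case unfolding Ord_simps mem_Collect_eq by (rule pos_product_Ord_ex)
next
 case (2 f X Z g Y)
 obtain m n where "f = (X, Z, m)" "monot X Z m" "g = (Y, Z, n)" "monot Y Z n" using 2 unfolding hom_Ord by blast
 then show ?case using pos_pullback_Ord_ex by blast
next
 case (3 t0 T X t1 Y)
 obtain a b where d: "t0 = (T, X, a)" "monot T X a" "t1 = (T, Y, b)" "monot T Y b" using 3 unfolding hom_Ord by blast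
 note A = monotD[OF d(2)] and B = monotD[OF d(4)]
 obtain W q0 q1 e where q: "jointly_ff (disc C) W (fst X) (fst Y) q0 q1" "regular_epi C e" "e : hom C (fst T) W" "a = q0 o e" "b = q1 o e"
  by (rule span_image[OF A(3) B(3)])
 note j = q(1)[unfolded jointly_ff_disc[OF category_axioms]]
 obtain V where V: "fst V = W" "monot V X q0" "monot V Y q1" "jointly_ff (Ord C) V X Y (V, X, q0) (V, Y, q1)"
  "ALL A u. internal_poset C A --> u : hom C (fst A) W --> monot A X (q0 o u) --> monot A Y (q1 o u) --> monot A V u"
  by (rule induced_span[OF A(2) B(2)]) (use j in blast)+
 have em: "monot T V e" using V(5) A(1) q(3,4,5) d(2,4) by blast
 note V(4)
 moreover have "ocv (T, V, e)" "(T, V, e) : hom (Ord C) T V" using em q(2) by (simp_all add: ocv_iff hom_Ord)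
 moreover have "t0 = (V, X, q0) \<bullet> (T, V, e)" "t1 = (V, Y, q1) \<bullet> (T, V, e)" using d q by (simp_all add: Ord_simps)
 ultimately show ?case by blast
next
 case (4 e g p0 p1)
 interpret O: pcategory "Ord C" by (intro pcategory.intro pos_category_Ord)
 obtain X Y Z P where p: "e : hom (Ord C) X Z" "g : hom (Ord C) Y Z" "p0 : hom (Ord C) P X" "p1 : hom (Ord C) P Y"
  and ex: "ALL A. ALL x:hom (Ord C) A X. ALL y:hom (Ord C) A Y. e \<bullet> x = g \<bullet> y -->
    (EX u:hom (Ord C) A P. p0 \<bullet> u = x & p1 \<bullet> u = y)"
  using 4(1) unfolding pos_pullback_def O.is_pullback_iff by blast
 obtain m n k l where d: "e = (X, Z, m)" "monot X Z m" "g = (Y, Z, n)" "monot Y Z n" "p0 = (P, X, k)" "monot P X k" "p1 = (P, Y, l)" "monot P Y l"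
  using p unfolding hom_Ord by blast
 have r: "regular_epi C m" using 4(2) unfolding d ocv_iff by blast
 \<comment> \<open>The pullback is probed with a discrete poset \<open>jo B\<close>: the cover
   \<open>a\<close> factors through \<open>p1\<close>, so \<open>l\<close> is the last factor of a
   regular epimorphism.\<close>
 obtain B a x where a: "a : hom C B (fst Y)" "regular_epi C a" "x : hom C B (fst X)" "m o x = n o a"
  by (rule cover_lift[OF r monotD(3)[OF d(2)] monotD(3)[OF d(4)]])
 have ax: "monot (jo B) X x" "monot (jo B) Y a" using monot_jo[OF monotD(1)[OF d(2)] a(3)] monot_jo[OF monotD(1)[OF d(4)] a(1)] by auto
 have "e \<bullet> (jo B, X, x) = g \<bullet> (jo B, Y, a)" using a(4) by (simp add: d Ord_simps)
 moreover have "(jo B, X, x) : hom (Ord C) (jo B) X" "(jo B, Y, a) : hom (Ord C) (jo B) Y" using ax by (simp_all add: hom_Ord)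
 ultimately obtain u where u: "u : hom (Ord C) (jo B) P" "p1 \<bullet> u = (jo B, Y, a)" using ex by blast
 obtain v where v: "u = (jo B, P, v)" "monot (jo B) P v" using u(1) unfolding hom_Ord by blast
 have "l o v = a" using u(2) unfolding v d Ord_simps by simp
 then have "regular_epi C l" using regular_epi_right[OF _ monotD(3)[OF v(2)] monotD(3)[OF d(8)]] a(2) by simp
 then show ?case using d(8) unfolding d(7) ocv_iff by blast
qed

end

sublocale regular \<subseteq> ord: posreg "Ord C" ocv
 by (rule posreg_Ord)

section \<open>Relations between internal posets\<close>

text \<open>Each one-sided action is an entailment from two memberships to one, the shape that
  \<open>ul_entail\<close> translates.\<close>

lemma (in posreg) lax_module_split:
 assumes p: "congruence E p" and q: "congruence E q" and \<Phi>: "\<Phi> : rels E (fst p) (fst q)"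
 shows "lax_module E p q \<Phi> \<longleftrightarrow> (ALL x' x y. rel_mem E (snd p) x' x --> rel_mem E \<Phi> x y --> rel_mem E \<Phi> x' y) &
  (ALL x y y'. rel_mem E \<Phi> x y --> rel_mem E (snd q) y y' --> rel_mem E \<Phi> x y')"
proof (intro iffI conjI allI impI)
 show "rel_mem E \<Phi> x' y" if "lax_module E p q \<Phi>" "rel_mem E (snd p) x' x" "rel_mem E \<Phi> x y" for x' x y
  by (rule lax_module_left[OF q that])
 show "rel_mem E \<Phi> x y'" if "lax_module E p q \<Phi>" "rel_mem E \<Phi> x y" "rel_mem E (snd q) y y'" for x y y'
  by (rule lax_module_right[OF p that])
qed (rule lax_moduleI[OF p q \<Phi>]; blast)

context regular begin

abbreviation "omem == rel_mem (Ord C)"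

text \<open>The span of underlying arrows. Since every element of \<open>P\<close> in \<open>C\<close> is monotone on a discrete poset, it
 determines \<open>\<Phi>\<close> when \<open>\<Phi>\<close> is weakening-closed.\<close>

definition ul :: "'o \<times> 'm rel => 'o \<times> 'm rel => (('o \<times> 'm rel) \<times> ('o \<times> 'm rel) \<times> 'm) rel => 'm rel" where
 "ul P Q \<Phi> = (SOME R. R : Rel (fst P) (fst Q) &
   (ALL B x y. monot B P x --> monot B Q y --> (omem \<Phi> (B, P, x) (B, Q, y) \<longleftrightarrow> mem R x y)))"

lemma ul:
 assumes \<Phi>: "\<Phi> : rels (Ord C) P Q"
 shows "ul P Q \<Phi> : Rel (fst P) (fst Q)"
  "monot B P x ==> monot B Q y ==> omem \<Phi> (B, P, x) (B, Q, y) \<longleftrightarrow> mem (ul P Q \<Phi>) x y"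
proof -
 obtain T r0 r1 where r: "jointly_ff (Ord C) T P Q r0 r1" "r0 : hom (Ord C) T P" "r1 : hom (Ord C) T Q" "\<Phi> = span_class (Ord C) r0 r1"
  by (rule ord.relsE[OF \<Phi>])
 obtain m n where d: "r0 = (T, P, m)" "monot T P m" "r1 = (T, Q, n)" "monot T Q n" using r(2,3) unfolding hom_Ord by blast
 note M = monotD[OF d(2)] and N = monotD[OF d(4)] and j = r(1)[unfolded d(1,3)]
 have inj: "u = v" if u: "u : hom C A (fst T)" "v : hom C A (fst T)" and eq: "m o u = m o v" "n o u = n o v" for A u v
 proof -
  note r = posetD(3)[OF M(2) cmp_hom[OF u(2) M(3)]] posetD(3)[OF N(2) cmp_hom[OF u(2) N(3)]]
  have "mem (snd T) u v" "mem (snd T) v u" by (rule jointly_ff_OrdD[OF j]; use u eq r in simp)+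
  then show ?thesis by (rule posetD(5)[OF M(1)])
 qed
 have "jointly_ff (disc C) (fst T) (fst P) (fst Q) m n" unfolding jointly_ff_disc[OF category_axioms] using M(3) N(3) inj by blast
 then have 1: "span_class C m n : Rel (fst P) (fst Q)" by (rule rel.rels_spanI)
 have 2: "omem \<Phi> (B, P, x) (B, Q, y) \<longleftrightarrow> mem (span_class C m n) x y" if x: "monot B P x" and y: "monot B Q y" for B x y
  unfolding r(4) rel_mem_span_class[OF M(3) N(3)] ord.rel_mem_span_class[OF r(2,3)]
 proof
  assume "EX A. EX h:hom (Ord C) A T. (B, P, x) = r0 \<bullet> h & (B, Q, y) = r1 \<bullet> h"
  then obtain A k where k: "k : hom (Ord C) A T" "(B, P, x) = r0 \<bullet> k" "(B, Q, y) = r1 \<bullet> k" by blast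
  then obtain h where h: "monot A T h" "k = (A, T, h)" unfolding hom_Ord by blast
  then show "EX A. EX h:hom C A (fst T). x = m o h & y = n o h" using monotD(3)[OF h(1)] k(2,3) unfolding h(2) d Ord_simps by blast
 next
  assume "EX A. EX h:hom C A (fst T). x = m o h & y = n o h"
  then obtain A h where h: "h : hom C A (fst T)" "x = m o h" "y = n o h" by blast
  \<comment> \<open>The factorization \<open>h\<close> in \<open>C\<close> is automatically
    monotone, since the legs jointly reflect the order of \<open>T\<close>.\<close>
  have "fst B = A" using h(1,2) M(3) monotD(3)[OF x] by (auto simp: hom_iff)
  then have "monot B T h"
   by (intro monot_reflect[OF M(1) monotD(1)[OF x] _ jointly_ff_OrdD[OF j] M(3) N(3)]) (use h x y in auto)
  then show "EX A. EX h:hom (Ord C) A T. (B, P, x) = r0 \<bullet> h & (B, Q, y) = r1 \<bullet> h"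
   by (intro exI[of _ B] bexI[of _ "(B, T, h)"]) (simp_all add: d hom_Ord Ord_simps h)
 qed
 have "EX R. R : Rel (fst P) (fst Q) &
   (ALL B x y. monot B P x --> monot B Q y --> (omem \<Phi> (B, P, x) (B, Q, y) \<longleftrightarrow> mem R x y))" using 1 2 by blast
 from someI_ex[OF this, folded ul_def]
 show "ul P Q \<Phi> : Rel (fst P) (fst Q)"
  "monot B P x ==> monot B Q y ==> omem \<Phi> (B, P, x) (B, Q, y) \<longleftrightarrow> mem (ul P Q \<Phi>) x y" by blast+
qed

lemma rels_OrdD: "\<Phi> : rels (Ord C) P Q ==> internal_poset C P & internal_poset C Q"
 by (erule ord.relsE) (auto simp: hom_Ord dest: monotD(2))

lemma omemE:
 assumes \<Phi>: "\<Phi> : rels (Ord C) P Q" and m: "omem \<Phi> f g"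
 obtains B x y where "f = (B, P, x)" "g = (B, Q, y)" "monot B P x" "monot B Q y" "mem (ul P Q \<Phi>) x y"
proof -
 obtain B x y where xy: "f = (B, P, x)" "monot B P x" "g = (B, Q, y)" "monot B Q y" using ord.mem_hom[OF \<Phi> m] unfolding hom_Ord by blast
 show thesis using that[OF xy(1,3,2,4)] m ul(2)[OF \<Phi> xy(2,4)] unfolding xy(1,3) by blast
qed

lemma ul_jo:
 assumes \<Phi>: "\<Phi> : rels (Ord C) P Q" and x: "x : hom C A (fst P)" and y: "y : hom C A (fst Q)"
 shows "mem (ul P Q \<Phi>) x y \<longleftrightarrow> omem \<Phi> (jo A, P, x) (jo A, Q, y)"
 using ul(2)[OF \<Phi> monot_jo[OF _ x] monot_jo[OF _ y]] rels_OrdD[OF \<Phi>] by blast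

text \<open>The apex receives the order induced by its two legs, which turns a jointly monic span
  into a jointly order-reflecting one.\<close>

lemma ul_surj:
 assumes P: "internal_poset C P" and Q: "internal_poset C Q" and R: "R : Rel (fst P) (fst Q)"
 obtains \<Phi> where "\<Phi> : rels (Ord C) P Q" "ul P Q \<Phi> = R"
proof -
 obtain T r0 r1 where r: "jointly_ff (disc C) T (fst P) (fst Q) r0 r1" "r0 : hom C T (fst P)" "r1 : hom C T (fst Q)" "R = span_class C r0 r1"
  by (rule rel.relsE[OF R])
 obtain V where V: "fst V = T" "monot V P r0" "monot V Q r1" "jointly_ff (Ord C) V P Q (V, P, r0) (V, Q, r1)"
  by (rule induced_span[OF P Q r(2,3)]) (use r(1)[unfolded jointly_ff_disc[OF category_axioms]] in blast)+
 define \<Phi> where "\<Phi> = span_class (Ord C) (V, P, r0) (V, Q, r1)"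
 have \<Phi>: "\<Phi> : rels (Ord C) P Q" unfolding \<Phi>_def by (rule ord.rels_spanI[OF V(4)])
 have h: "(V, P, r0) : hom (Ord C) V P" "(V, Q, r1) : hom (Ord C) V Q" using V by (simp_all add: hom_Ord)
 note om = ord.rel_mem_span_class[OF h, folded \<Phi>_def] and cm = rel_mem_span_class[OF r(2,3), folded r(4)]
 have "ul P Q \<Phi> = R"
 proof (rule rel.rels_eqI[OF ul(1)[OF \<Phi>] R])
  fix x y assume m: "mem (ul P Q \<Phi>) x y"
  obtain A where A: "x : hom C A (fst P)" "y : hom C A (fst Q)" using rel.mem_hom[OF ul(1)[OF \<Phi>] m] by blast
  obtain B k where k: "k : hom (Ord C) B V" "(jo A, P, x) = (V, P, r0) \<bullet> k" "(jo A, Q, y) = (V, Q, r1) \<bullet> k"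
   using m unfolding ul_jo[OF \<Phi> A] om by blast
  obtain h where h: "monot B V h" "k = (B, V, h)" using k(1) unfolding hom_Ord by blast
  show "mem R x y" using monotD(3)[OF h(1), unfolded V(1)] k(2,3) unfolding cm h(2) Ord_simps by blast
 next
  fix x y assume m: "mem R x y"
  then obtain A k where k: "k : hom C A T" "x = r0 o k" "y = r1 o k" unfolding cm by blast
  have xy: "x : hom C A (fst P)" "y : hom C A (fst Q)" using cmp_hom k r(2,3) by blast+
  have "monot (jo A) V k" by (rule monot_jo[OF monotD(1)[OF V(2)]]) (simp add: V k)
  then show "mem (ul P Q \<Phi>) x y" unfolding ul_jo[OF \<Phi> xy] om
   by (intro exI[of _ "jo A"] bexI[of _ "(jo A, V, k)"]) (simp_all add: hom_Ord Ord_simps k)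
 qed
 then show thesis by (rule that[OF \<Phi>])
qed

text \<open>Elements of \<open>C\<close> enter \<open>Ord C\<close> as arrows out of discrete
  posets, and monotone elements have underlying elements, so an entailment may be tested on either
  side.\<close>

lemma ul_entail:
 assumes \<Phi>: "\<Phi> : rels (Ord C) P Q" and \<Psi>: "\<Psi> : rels (Ord C) Q T" and \<Theta>: "\<Theta> : rels (Ord C) P T"
 shows "(ALL x y z. omem \<Phi> x y --> omem \<Psi> y z --> omem \<Theta> x z) \<longleftrightarrow>
  (ALL x y z. mem (ul P Q \<Phi>) x y --> mem (ul Q T \<Psi>) y z --> mem (ul P T \<Theta>) x z)"
proof (intro iffI allI impI)
 fix x y z assume e: "ALL x y z. omem \<Phi> x y --> omem \<Psi> y z --> omem \<Theta> x z" and m: "mem (ul P Q \<Phi>) x y" "mem (ul Q T \<Psi>) y z"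
 obtain A where A: "x : hom C A (fst P)" "y : hom C A (fst Q)" using rel.mem_hom[OF ul(1)[OF \<Phi>] m(1)] by blast
 note z = mem_hom2(1)[OF ul(1)[OF \<Psi>] m(2) A(2)]
 show "mem (ul P T \<Theta>) x z" using m e unfolding ul_jo[OF \<Phi> A] ul_jo[OF \<Psi> A(2) z] ul_jo[OF \<Theta> A(1) z] by blast
next
 fix f g h assume e: "ALL x y z. mem (ul P Q \<Phi>) x y --> mem (ul Q T \<Psi>) y z --> mem (ul P T \<Theta>) x z" and m: "omem \<Phi> f g" "omem \<Psi> g h"
 obtain B x y where a: "f = (B, P, x)" "g = (B, Q, y)" "monot B P x" "monot B Q y" "mem (ul P Q \<Phi>) x y" by (rule omemE[OF \<Phi> m(1)])
 obtain B' y' z where b: "g = (B', Q, y')" "h = (B', T, z)" "monot B' Q y'" "monot B' T z" "mem (ul Q T \<Psi>) y' z" by (rule omemE[OF \<Psi> m(2)])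
 have eq: "B' = B" "y' = y" using a(2) b(1) by auto
 show "omem \<Theta> f h" using e a(5) b(5) ul(2)[OF \<Theta> a(3) b(4)[unfolded eq]] unfolding a(1) b(2) eq by blast
qed

lemma ul_incl:
 assumes \<Phi>: "\<Phi> : rels (Ord C) P Q" and \<Psi>: "\<Psi> : rels (Ord C) P Q"
 shows "(ALL x y. omem \<Phi> x y --> omem \<Psi> x y) \<longleftrightarrow> (ALL x y. mem (ul P Q \<Phi>) x y --> mem (ul P Q \<Psi>) x y)"
proof (intro iffI allI impI)
 fix x y assume e: "ALL x y. omem \<Phi> x y --> omem \<Psi> x y" and m: "mem (ul P Q \<Phi>) x y"
 obtain A where A: "x : hom C A (fst P)" "y : hom C A (fst Q)" using rel.mem_hom[OF ul(1)[OF \<Phi>] m(1)] by blast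
 show "mem (ul P Q \<Psi>) x y" using m e unfolding ul_jo[OF \<Phi> A] ul_jo[OF \<Psi> A] by blast
next
 fix f g assume e: "ALL x y. mem (ul P Q \<Phi>) x y --> mem (ul P Q \<Psi>) x y" and m: "omem \<Phi> f g"
 obtain B x y where a: "f = (B, P, x)" "g = (B, Q, y)" "monot B P x" "monot B Q y" "mem (ul P Q \<Phi>) x y" by (rule omemE[OF \<Phi> m(1)])
 show "omem \<Psi> f g" using e a(5) ul(2)[OF \<Psi> a(3,4)] unfolding a(1,2) by blast
qed

text \<open>A cover in \<open>C\<close> of the underlying object of \<open>A\<close> is also a cover
  of the poset \<open>A\<close>, by the discrete poset \<open>jo B\<close>.\<close>

lemma ul_total:
 assumes \<Phi>: "\<Phi> : rels (Ord C) P Q" and \<Psi>: "\<Psi> : rels (Ord C) Q P"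
 shows "(ALL A. ALL x:hom (Ord C) A P. EX B. EX a:hom (Ord C) B A. EX y. ocv a & omem \<Phi> (x \<bullet> a) y & omem \<Psi> y (x \<bullet> a)) \<longleftrightarrow>
  (ALL A. ALL x:hom C A (fst P). EX B. EX a:hom C B A. EX y. regular_epi C a & mem (ul P Q \<Phi>) (x o a) y & mem (ul Q P \<Psi>) y (x o a))"
proof (intro iffI allI ballI)
 fix A x assume t: "ALL A. ALL x:hom (Ord C) A P. EX B. EX a:hom (Ord C) B A. EX y. ocv a & omem \<Phi> (x \<bullet> a) y & omem \<Psi> y (x \<bullet> a)"
  and x: "x : hom C A (fst P)"
 have "(jo A, P, x) : hom (Ord C) (jo A) P" using monot_jo[OF _ x] rels_OrdD[OF \<Phi>] unfolding hom_Ord by blast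
 then obtain B b y where b: "b : hom (Ord C) B (jo A)" "ocv b" "omem \<Phi> ((jo A, P, x) \<bullet> b) y" "omem \<Psi> y ((jo A, P, x) \<bullet> b)"
  using t by blast
 obtain a where ba: "b = (B, jo A, a)" and "monot B (jo A) a" using b(1) unfolding hom_Ord by blast
 note a = this(2) b(2-4)[unfolded ba]
 obtain y' where y: "y = (B, Q, y')" "mem (ul P Q \<Phi>) (x o a) y'"
  by (rule omemE[OF \<Phi> a(3)]) (auto simp: Ord_simps)
 have "mem (ul Q P \<Psi>) y' (x o a)" by (rule omemE[OF \<Psi> a(4)]) (auto simp: Ord_simps y)
 then show "EX B. EX a:hom C B A. EX y. regular_epi C a & mem (ul P Q \<Phi>) (x o a) y & mem (ul Q P \<Psi>) y (x o a)"
  using y(2) monotD(3)[OF a(1), unfolded fst_jo] a(2) unfolding ocv_iff by blast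
next
 fix A f assume t: "ALL A. ALL x:hom C A (fst P). EX B. EX a:hom C B A. EX y. regular_epi C a & mem (ul P Q \<Phi>) (x o a) y & mem (ul Q P \<Psi>) y (x o a)"
  and f: "f : hom (Ord C) A P"
 obtain x where x: "f = (A, P, x)" "monot A P x" using f unfolding hom_Ord by blast
 note X = monotD[OF x(2)]
 obtain B a y where a: "a : hom C B (fst A)" "regular_epi C a" "mem (ul P Q \<Phi>) (x o a) y" "mem (ul Q P \<Psi>) y (x o a)" using t X(3) by blast
 note xa = cmp_hom[OF a(1) X(3)]
 note y = mem_hom2(1)[OF ul(1)[OF \<Phi>] a(3) xa]
 have "omem \<Phi> (f \<bullet> (jo B, A, a)) (jo B, Q, y)" "omem \<Psi> (jo B, Q, y) (f \<bullet> (jo B, A, a))"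
  using a(3,4) unfolding x Ord_simps ul_jo[OF \<Phi> xa y] ul_jo[OF \<Psi> y xa] .
 moreover have "monot (jo B) A a" by (rule monot_jo[OF X(1) a(1)])
 ultimately show "EX B. EX a:hom (Ord C) B A. EX y. ocv a & omem \<Phi> (f \<bullet> a) y & omem \<Psi> y (f \<bullet> a)"
  by (intro exI[of _ "jo B"] bexI[of _ "(jo B, A, a)"] exI[of _ "(jo B, Q, y)"]) (simp_all add: hom_Ord ocv_iff a(2))
qed

lemma ul_comp:
 assumes \<Phi>: "\<Phi> : rels (Ord C) P Q" and \<Psi>: "\<Psi> : rels (Ord C) Q T"
 shows "ul P T (rel_comp (Ord C) \<Psi> \<Phi>) = rcomp (ul Q T \<Psi>) (ul P Q \<Phi>)"
proof -
 note c = ord.rel_comp_rels[OF \<Phi> \<Psi>]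
 note R = ul(1)[OF \<Phi>] and S = ul(1)[OF \<Psi>]
 show ?thesis
 proof (rule rel.rels_eqI[OF ul(1)[OF c] rel.rel_comp_rels[OF R S]])
  fix x z assume m: "mem (ul P T (rel_comp (Ord C) \<Psi> \<Phi>)) x z"
  obtain A where A: "x : hom C A (fst P)" "z : hom C A (fst T)" using rel.mem_hom[OF ul(1)[OF c] m] by blast
  obtain A' B a y where a: "(jo A, P, x) : hom (Ord C) A' P" "a : hom (Ord C) B A'" "ocv a"
   "omem \<Phi> ((jo A, P, x) \<bullet> a) y" "omem \<Psi> y ((jo A, T, z) \<bullet> a)"
   by (rule ord.mem_compE[OF \<Phi> \<Psi> m[unfolded ul_jo[OF c A]]])
  have "A' = jo A" using a(1) by (auto simp: hom_Ord)
  then obtain a' where a': "a = (B, jo A, a')" "monot B (jo A) a'" using a(2) unfolding hom_Ord by blast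
  obtain y' where y: "y = (B, Q, y')" "mem (ul P Q \<Phi>) (x o a') y'"
   by (rule omemE[OF \<Phi> a(4)]) (auto simp: Ord_simps a')
  have "mem (ul Q T \<Psi>) y' (z o a')" by (rule omemE[OF \<Psi> a(5)]) (auto simp: Ord_simps y a')
  then have "mem (rcomp (ul Q T \<Psi>) (ul P Q \<Phi>)) (x o a') (z o a')" by (rule rel.mem_compI[OF R S y(2)])
  then show "mem (rcomp (ul Q T \<Psi>) (ul P Q \<Phi>)) x z"
   using rel.mem_local[OF rel.rel_comp_rels[OF R S] _ monotD(3)[OF a'(2), unfolded fst_jo] A] a(3) unfolding a'(1) ocv_iff by blast
 next
  fix x z assume m: "mem (rcomp (ul Q T \<Psi>) (ul P Q \<Phi>)) x z"
  obtain A B a y where a: "x : hom C A (fst P)" "z : hom C A (fst T)" "a : hom C B A" "regular_epi C a"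
   "y : hom C B (fst Q)" "mem (ul P Q \<Phi>) (x o a) y" "mem (ul Q T \<Psi>) y (z o a)" by (rule rel.mem_compE[OF R S m])
  note xa = cmp_hom[OF a(3,1)] and za = cmp_hom[OF a(3,2)]
  have "mem (ul P T (rel_comp (Ord C) \<Psi> \<Phi>)) (x o a) (z o a)" unfolding ul_jo[OF c xa za]
   by (rule ord.mem_compI[OF \<Phi> \<Psi> a(6)[unfolded ul_jo[OF \<Phi> xa a(5)]] a(7)[unfolded ul_jo[OF \<Psi> a(5) za]]])
  then show "mem (ul P T (rel_comp (Ord C) \<Psi> \<Phi>)) x z" by (rule rel.mem_local[OF ul(1)[OF c] a(4,3,1,2)])
 qed
qed

section \<open>Congruences on internal posets against congruences in \<open>C\<close>\<close>

abbreviation "uo p == (fst (fst p), ul (fst p) (fst p) (snd p))"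

lemma uo_congruence:
 assumes p: "congruence (Ord C) p" shows "congruence (disc C) (uo p)"
proof -
 note c = ord.congruenceD[OF p]
 have P: "internal_poset C (fst p)" using c(1) unfolding Ord_simps by blast
 have "mem (ul (fst p) (fst p) (snd p)) x x" if x: "x : hom C A (fst (fst p))" for A x
  unfolding ul_jo[OF c(2) x x] by (rule c(3)) (use monot_jo[OF P x] in \<open>auto simp: hom_Ord\<close>)
 moreover have "ALL x y z. mem (ul (fst p) (fst p) (snd p)) x y --> mem (ul (fst p) (fst p) (snd p)) y z --> mem (ul (fst p) (fst p) (snd p)) x z"
  unfolding ul_entail[OF c(2,2,2), symmetric] using c(4) by blast
 ultimately show ?thesis unfolding congruence_disc_iff rel_refl_def rel_trans_def fst_conv snd_conv
  using posetD(1)[OF P] ul(1)[OF c(2)] by blast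
qed

text \<open>On the discrete poset \<open>jo X\<close> weakening is vacuous, so a preorder on
  \<open>X\<close> is the same as a congruence on \<open>jo X\<close>.\<close>

lemma uo_surj:
 assumes p: "congruence (disc C) (X, R)"
 obtains p where "congruence (Ord C) p" "uo p = (X, R)"
proof -
 have X: "X : Ob C" and R: "R : Rel X X" and refl: "!!A x. x : hom C A X ==> mem R x x"
  and trans: "ALL x y z. mem R x y --> mem R y z --> mem R x z"
  using p unfolding congruence_disc_iff rel_refl_def rel_trans_def fst_conv snd_conv by blast+
 obtain \<Phi> where \<Phi>: "\<Phi> : rels (Ord C) (jo X) (jo X)" "ul (jo X) (jo X) \<Phi> = R"
  by (rule ul_surj[OF poset_jo[OF X] poset_jo[OF X]]) (use R in \<open>auto simp: fst_jo\<close>)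
 have eq: "f = g" if le: "f \<preceq>\<^bsub>Ord C\<^esub> g" and h: "f : hom (Ord C) B (jo X) \<or> g : hom (Ord C) B (jo X)" for f g B
 proof -
  obtain P Q m P' Q' n where d: "f = (P, Q, m)" "g = (P', Q', n)" by (cases f; cases g)
  have l: "P = P'" "Q = Q'" "mem (snd Q) m n" using le unfolding d Ord_leq by auto
  have "Q = jo X" using h l unfolding d hom_Ord by blast
  then show ?thesis using l mem_jo[OF X] unfolding d by blast
 qed
 have w: "weakening_closed (Ord C) \<Phi>" unfolding weakening_closed_def
 proof (intro allI impI)
  fix x' x y y' assume a: "x' \<preceq>\<^bsub>Ord C\<^esub> x & omem \<Phi> x y & y \<preceq>\<^bsub>Ord C\<^esub> y'"
  obtain B where B: "x : hom (Ord C) B (jo X)" "y : hom (Ord C) B (jo X)" using ord.mem_hom[OF \<Phi>(1)] a by blast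
  have "x' = x" "y = y'" using eq a B by blast+
  then show "omem \<Phi> x' y'" using a by simp
 qed
 have r: "rel_refl (Ord C) (jo X) \<Phi>" unfolding rel_refl_def
 proof (intro allI ballI)
  fix A f assume "f : hom (Ord C) A (jo X)"
  then obtain x where x: "f = (A, jo X, x)" "monot A (jo X) x" unfolding hom_Ord by blast
  have "mem R x x" by (rule refl) (use monotD(3)[OF x(2)] in simp)
  then show "omem \<Phi> f f" unfolding x(1) ul(2)[OF \<Phi>(1) x(2,2)] \<Phi>(2) .
 qed
 have t: "rel_trans (Ord C) \<Phi>" using trans ul_entail[OF \<Phi>(1,1,1)] unfolding \<Phi>(2) rel_trans_def by blast
 have "congruence (Ord C) (jo X, \<Phi>)" unfolding congruence_def prod.case Ord_simps mem_Collect_eq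
  using poset_jo[OF X] \<Phi>(1) w r t by blast
 then show thesis by (rule that) (simp add: \<Phi>(2))
qed

lemma adjoint_modules_ul:
 assumes p: "congruence (Ord C) p" and q: "congruence (Ord C) q" and \<Phi>: "\<Phi> : rels (Ord C) (fst p) (fst q)" and \<Psi>: "\<Psi> : rels (Ord C) (fst q) (fst p)"
 shows "adjoint_modules (Ord C) ocv p q \<Phi> \<Psi> \<longleftrightarrow>
  adjoint_modules (disc C) (regular_epi C) (uo p) (uo q) (ul (fst p) (fst q) \<Phi>) (ul (fst q) (fst p) \<Psi>)"
proof -
 note cp = ord.congruenceD(2)[OF p] and cq = ord.congruenceD(2)[OF q] and up = uo_congruence[OF p] and uq = uo_congruence[OF q]
 have 1: "lax_module (Ord C) p q \<Phi> \<longleftrightarrow> lax_module (disc C) (uo p) (uo q) (ul (fst p) (fst q) \<Phi>)"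
  unfolding ord.lax_module_split[OF p q \<Phi>] rel.lax_module_split[OF up uq, unfolded fst_conv snd_conv, OF ul(1)[OF \<Phi>]]
   ul_entail[OF cp \<Phi> \<Phi>] ul_entail[OF \<Phi> cq \<Phi>] ..
 have 2: "lax_module (Ord C) q p \<Psi> \<longleftrightarrow> lax_module (disc C) (uo q) (uo p) (ul (fst q) (fst p) \<Psi>)"
  unfolding ord.lax_module_split[OF q p \<Psi>] rel.lax_module_split[OF uq up, unfolded fst_conv snd_conv, OF ul(1)[OF \<Psi>]]
   ul_entail[OF cq \<Psi> \<Psi>] ul_entail[OF \<Psi> cp \<Psi>] ..
 show ?thesis unfolding adjoint_modules_def disc_defs disc_simps fst_conv snd_conv 1 2 ul_total[OF \<Phi> \<Psi>] ul_entail[OF \<Psi> \<Phi> cq] ..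
qed

definition U :: "(('o \<times> 'm rel) \<times> (('o \<times> 'm rel) \<times> ('o \<times> 'm rel) \<times> 'm) rel,
  (('o \<times> 'm rel) \<times> (('o \<times> 'm rel) \<times> ('o \<times> 'm rel) \<times> 'm) rel) \<times> (('o \<times> 'm rel) \<times> (('o \<times> 'm rel) \<times> ('o \<times> 'm rel) \<times> 'm) rel) \<times>
   (('o \<times> 'm rel) \<times> ('o \<times> 'm rel) \<times> 'm) rel, 'o \<times> 'm rel, ('o \<times> 'm rel) \<times> ('o \<times> 'm rel) \<times> 'm rel) ftor" where
 "U = \<lparr>fob = (%p. uo p), far = (%(p, q, \<Phi>). (uo p, uo q, ul (fst p) (fst q) \<Phi>))\<rparr>"

lemma U_simps: "fob U p = uo p" "far U (p, q, \<Phi>) = (uo p, uo q, ul (fst p) (fst q) \<Phi>)"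
 by (simp_all add: U_def)

lemma left_adjoint_U:
 assumes l: "ord.left_adjoint p q \<Phi>" shows "rel.left_adjoint (uo p) (uo q) (ul (fst p) (fst q) \<Phi>)"
proof -
 note d = ord.left_adjointD[OF l]
 obtain \<Psi> where a: "adjoint_modules (Ord C) ocv p q \<Phi> \<Psi>" using l unfolding ord.left_adjoint_def by blast
 have "\<Psi> : rels (Ord C) (fst q) (fst p)" using a ord.lax_moduleD(1) unfolding adjoint_modules_def by blast
 from adjoint_modules_ul[OF d(1,2,4) this] show ?thesis
  unfolding rel.left_adjoint_def using uo_congruence[OF d(1)] uo_congruence[OF d(2)] a by blast
qed

lemma U_leq_iff:
 assumes f: "ord.left_adjoint p q \<Phi>" and g: "ord.left_adjoint p q \<Psi>"
 shows "far U (p, q, \<Phi>) \<preceq>\<^bsub>ex_reg (disc C)\<^esub> far U (p, q, \<Psi>) \<longleftrightarrow> (p, q, \<Phi>) \<preceq>\<^bsub>ex_reg (Ord C)\<^esub> (p, q, \<Psi>)"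
 unfolding U_simps rel.ex_reg_leq ord.ex_reg_leq ul_incl[OF ord.left_adjointD(4)[OF g] ord.left_adjointD(4)[OF f]]
 using left_adjoint_U[OF f] left_adjoint_U[OF g] f g by blast

lemma pos_functor_U: "pos_functor (ex_reg (Ord C)) (ex_reg (disc C)) U"
 unfolding pos_functor_def is_functor_def
proof (intro conjI allI ballI impI)
 show "pos_category (ex_reg (Ord C))" "pos_category (ex_reg (disc C))" by (rule ord.pos_category_ex_reg rel.pos_category_ex_reg)+
 then show "category (ex_reg (Ord C))" "category (ex_reg (disc C))" by (simp_all add: pos_category_def)
 show "fob U p : Ob (ex_reg (disc C))" if "p : Ob (ex_reg (Ord C))" for p
  using that uo_congruence unfolding ord.ex_reg_simps rel.ex_reg_simps U_simps by blast
 show "far U (idt (ex_reg (Ord C)) p) = idt (ex_reg (disc C)) (fob U p)" for p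
  unfolding ord.ex_reg_simps rel.ex_reg_simps U_simps by simp
 show "far U f : hom (ex_reg (disc C)) (fob U p) (fob U q)" if f: "f : hom (ex_reg (Ord C)) p q" for p q f
 proof -
  obtain \<Phi> where "f = (p, q, \<Phi>)" "ord.left_adjoint p q \<Phi>" using f unfolding ord.hom_ex_reg by blast
  then show ?thesis using left_adjoint_U unfolding rel.hom_ex_reg by (simp add: U_simps)
 qed
 show "far U (g o\<^bsub>ex_reg (Ord C)\<^esub> f) = far U g o\<^bsub>ex_reg (disc C)\<^esub> far U f"
  if f: "f : hom (ex_reg (Ord C)) p q" and g: "g : hom (ex_reg (Ord C)) q r" for p q r f g
 proof -
  obtain \<Phi> \<Psi> where "f = (p, q, \<Phi>)" "ord.left_adjoint p q \<Phi>" "g = (q, r, \<Psi>)" "ord.left_adjoint q r \<Psi>"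
   using f g unfolding ord.hom_ex_reg by blast
  then show ?thesis using ul_comp[OF ord.left_adjointD(4) ord.left_adjointD(4)] by (simp add: ord.ex_reg_simps rel.ex_reg_simps U_simps)
 qed
 show "far U f \<preceq>\<^bsub>ex_reg (disc C)\<^esub> far U g" if le: "f \<preceq>\<^bsub>ex_reg (Ord C)\<^esub> g" for f g
 proof -
  obtain p q \<Phi> p' q' \<Psi> where d: "f = (p, q, \<Phi>)" "g = (p', q', \<Psi>)" by (cases f; cases g)
  have "ord.left_adjoint p q \<Phi>" "ord.left_adjoint p' q' \<Psi>" "p' = p" "q' = q" using le unfolding d ord.ex_reg_leq by blast+
  then show ?thesis using U_leq_iff le unfolding d by blast
 qed
qed

lemma ex_reg_Ord_equivalent: "pos_equivalent (ex_reg (Ord C)) (ex_reg (disc C))"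
proof (rule pos_equivalentI[OF pos_functor_U])
 fix p q f g assume fg: "f : hom (ex_reg (Ord C)) p q" "g : hom (ex_reg (Ord C)) p q" and le: "far U f \<preceq>\<^bsub>ex_reg (disc C)\<^esub> far U g"
 obtain \<Phi> \<Psi> where d: "f = (p, q, \<Phi>)" "ord.left_adjoint p q \<Phi>" "g = (p, q, \<Psi>)" "ord.left_adjoint p q \<Psi>"
  using fg unfolding ord.hom_ex_reg by blast
 show "f \<preceq>\<^bsub>ex_reg (Ord C)\<^esub> g" using le U_leq_iff[OF d(2,4)] unfolding d(1,3) by blast
next
 fix p q h assume pO: "p : Ob (ex_reg (Ord C))" and qO: "q : Ob (ex_reg (Ord C))" and h: "h : hom (ex_reg (disc C)) (fob U p) (fob U q)"
 have p: "congruence (Ord C) p" and q: "congruence (Ord C) q" using pO qO unfolding ord.ex_reg_simps by blast+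
 have P: "internal_poset C (fst p)" "internal_poset C (fst q)"
  using ord.congruenceD(1)[OF p] ord.congruenceD(1)[OF q] unfolding Ord_simps by blast+
 obtain F where F: "h = (uo p, uo q, F)" "rel.left_adjoint (uo p) (uo q) F" using h unfolding rel.hom_ex_reg U_simps by blast
 \<comment> \<open>Being a left adjoint is an existential statement, so the right adjoint is lifted
   to \<open>Ord C\<close> together with \<open>F\<close>.\<close>
 obtain G where G: "adjoint_modules (disc C) (regular_epi C) (uo p) (uo q) F G" using F(2) unfolding rel.left_adjoint_def by blast
 have "F : Rel (fst (fst p)) (fst (fst q))" "G : Rel (fst (fst q)) (fst (fst p))"
  using G unfolding adjoint_modules_def lax_module_def fst_conv by blast+
 then obtain \<Phi> \<Psi> where \<Phi>: "\<Phi> : rels (Ord C) (fst p) (fst q)" "ul (fst p) (fst q) \<Phi> = F"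
  and \<Psi>: "\<Psi> : rels (Ord C) (fst q) (fst p)" "ul (fst q) (fst p) \<Psi> = G"
  using ul_surj[OF P(1,2)] ul_surj[OF P(2,1)] by metis
 have "ord.left_adjoint p q \<Phi>" unfolding ord.left_adjoint_def
  using p q adjoint_modules_ul[OF p q \<Phi>(1) \<Psi>(1)] G unfolding \<Phi>(2) \<Psi>(2) by blast
 then have "(p, q, \<Phi>) : hom (ex_reg (Ord C)) p q" unfolding ord.hom_ex_reg by blast
 moreover have "far U (p, q, \<Phi>) = h" unfolding U_simps F(1) \<Phi>(2) ..
 ultimately show "EX f:hom (ex_reg (Ord C)) p q. far U f = h" by blast
next
 fix Z assume Z: "Z : Ob (ex_reg (disc C))"
 interpret E: pos_category "ex_reg (disc C)" by (rule rel.pos_category_ex_reg)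
 obtain X R where e: "Z = (X, R)" by (cases Z)
 have "congruence (disc C) (X, R)" using Z unfolding e rel.ex_reg_simps by blast
 \<comment> \<open>Here \<open>uo p\<close> equals \<open>Z\<close> on the nose, and the required
   isomorphism is an identity.\<close>
 then obtain p where p: "congruence (Ord C) p" "uo p = Z" unfolding e by (rule uo_surj)
 then show "EX p:Ob (ex_reg (Ord C)). EX i:hom (ex_reg (disc C)) (fob U p) Z. iso (ex_reg (disc C)) i"
  using E.idt_hom[OF Z] E.iso_idt[OF Z] unfolding U_simps ord.ex_reg_simps by (intro bexI[of _ p]) auto
qed

end

theorem proposition6p7:
 fixes C D :: "('u :: infinite, 'u) cat"
  and I :: "('u, 'u, 'u, 'u) ftor"
 assumes "regular_category C"
  and "exact_completion C D I"
 shows "pos_equivalent (Ord D) (ex_reg (Ord C)) \<and>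
     pos_equivalent (ex_reg (Ord C)) (ex_reg (disc C))"
proof -
 interpret covering C D I by (rule exact_completion_covering[OF assms])
 show ?thesis using pos_equivalent_trans[OF Ord_equivalent pos_equivalent_sym[OF C.ex_reg_Ord_equivalent]] C.ex_reg_Ord_equivalent by blast
qed

end
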